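(* Let $\mathcal T_h$ be quasi-uniform. There exists a map $\tilde\Pi_h:H^1_{\mathrm D}(\Omega)\to\mathbb P_1(\mathcal T_h)\cap H^1_{\mathrm D}(\Omega)$ such that $$\int_{\Gamma_{\mathrm T}}\tilde\Pi_hv\,w_h\,ds=\int_{\Gamma_{\mathrm T}}v\,w_h\,ds\quad\text{for all }w_h\in W_h$$ (for every $v\in H^1_{\mathrm D}(\Omega)$). In addition, the operator $\Pi_h:H^1_{\mathrm D}(\Omega)^2\to V_h$ given by $\Pi_hw=(\tilde\Pi_hw_n)\,n+(\mathcal{SZ}_hw_\tau)\,\tau$ is a Fortin operator, i.e. $$\int_{\Gamma_{\mathrm T}}(v-\Pi_hv)\cdot n\,w_h\,ds=0\quad\text{for all }v\in H^1_{\mathrm D}(\Omega)^2,\ w_h\in W_h,$$ and satisfies, for all $v\in H^1_{\mathrm D}(\Omega)^2$, $$\|\Pi_hv\|_{L^2(\Omega)}\lesssim\|v\|_{L^2(\Omega)}+h\|\nabla v\|_{L^2(\Omega)},\qquad\|\nabla(\Pi_hv)\|_{L^2(\Omega)}\lesssim\|\nabla v\|_{L^2(\Omega)},$$ and, for $0\le s\le1$ and $w\in H^{1+s}(\Omega)^2\cap H^1_{\mathrm D}(\Omega)^2$, $$\|w-\Pi_hw\|_{L^2(\Omega)}+h\|\nabla(w-\Pi_hw)\|_{L^2(\Omega)}\lesssim h^{1+s}|w|_{H^{1+s}(\Omega)}.$$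
   Context: $\Omega\subset\mathbb R^2$ is an open bounded polygonal domain, $\partial\Omega=\overline{\Gamma_{\mathrm D}\cup\Gamma_{\mathrm T}}$ with $\Gamma_{\mathrm D},\Gamma_{\mathrm T}$ disjoint, relatively open, of positive length, and $\Gamma_{\mathrm T}$ an open straight line segment. $n$ and $\tau$ are the (constant) unit outward normal and unit tangent vectors of $\Gamma_{\mathrm T}$; $w_n=w\cdot n$ and $w_\tau=w\cdot\tau$ are the normal and tangential components of a vector field $w\in H^1(\Omega)^2$. $H^1_{\mathrm D}(\Omega)=\{v\in H^1(\Omega):v|_{\Gamma_{\mathrm D}}=0\}$. $\mathcal T_h$ is a conforming affine shape-regular simplicial mesh of size $h$ (respecting $\Gamma_{\mathrm D},\Gamma_{\mathrm T}$); $\mathbb P_1(\mathcal T_h)$ is the space of elementwise affine functions. $V_h=(\mathbb P_1(\mathcal T_h)\cap H^1_{\mathrm D}(\Omega))^2$ and $W_h=\{w_h\in C(\overline{\Gamma_{\mathrm T}}):w_h|_E\in\mathbb P_1(E)\ \forall\text{ mesh edges }E\subset\Gamma_{\mathrm T},\ w_h=0\text{ on }\partial\Gamma_{\mathrm T}\}$, where $\partial\Gamma_{\mathrm T}$ is the set of endpoints of $\Gamma_{\mathrm T}$. $\mathcal{SZ}_h$ is the Scott–Zhang interpolant onto continuous piecewise affine functions (nodal value at $z$ equal to $\int_{\sigma_z}\theta_zv\,ds$ with a chosen mesh edge $\sigma_z\ni z$, $\sigma_z\subset\partial\Omega$ if $z\in\partial\Omega$, and $\sigma_z\subset\overline{\Gamma_{\mathrm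 D}}$ if $z\in\overline{\Gamma_{\mathrm D}}$, and $\theta_z\in\mathbb P_1(\sigma_z)$ the $L^2(\sigma_z)$-dual basis function of the nodal basis function at $z$), so that it preserves the homogeneous condition on $\Gamma_{\mathrm D}$. $a\lesssim b$ means $a\le cb$ with $c$ independent of $h$. *)

theory Defs
  imports "HOL-Analysis.Analysis"
begin

type_synonym plane = "real^2"

section \<open>Polygonal domains\<close>

definition lipschitz_boundary :: "plane set \<Rightarrow> bool" where
  "lipschitz_boundary \<Omega> \<longleftrightarrow>
    (\<forall>x\<in>frontier \<Omega>. \<exists>r>0. \<exists>e1 e2 :: plane. \<exists>f :: real \<Rightarrow> real. \<exists>L.
       norm e1 = 1 \<and> norm e2 = 1 \<and> e1 \<bullet> e2 = 0 \<and> L-lipschitz_on UNIV f \<and>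
       \<Omega> \<inter> ball x r = {y \<in> ball x r. f (y \<bullet> e1) < y \<bullet> e2})"

text \<open>As usual in finite element analysis, a polygonal domain is a Lipschitz domain: slits and
  points where the boundary touches itself are excluded, holes are not.\<close>

definition polygonal_domain :: "plane set \<Rightarrow> bool" where
  "polygonal_domain \<Omega> \<longleftrightarrow>
    open \<Omega> \<and> bounded \<Omega> \<and> connected \<Omega> \<and> \<Omega> \<noteq> {} \<and> lipschitz_boundary \<Omega> \<and>
    (\<exists>S. finite S \<and> (\<forall>E\<in>S. \<exists>p q. E = closed_segment p q) \<and> frontier \<Omega> = \<Union>S)"

text \<open>For subsets of a finite union of segments this is positivity of the arc length.\<close>

definition positive_length :: "plane set \<Rightarrow> bool" where
  "positive_length S \<longleftrightarrow>
    (\<exists>p q. p \<noteq> q \<and> 0 < emeasure lebesgue {t \<in> {0..1}. linepath p q t \<in> S})"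

definition outward_unit_normal :: "plane set \<Rightarrow> plane \<Rightarrow> plane \<Rightarrow> plane \<Rightarrow> bool" where
  "outward_unit_normal \<Omega> a b n \<longleftrightarrow>
    norm n = 1 \<and> n \<bullet> (b - a) = 0 \<and>
    (\<forall>x\<in>open_segment a b. \<exists>\<epsilon>>0. \<forall>t\<in>{0<..<\<epsilon>}. x - t *\<^sub>R n \<in> \<Omega> \<and> x + t *\<^sub>R n \<notin> \<Omega>)"

definition unit_tangent :: "plane \<Rightarrow> plane \<Rightarrow> plane \<Rightarrow> bool" where
  "unit_tangent a b \<tau> \<longleftrightarrow> norm \<tau> = 1 \<and> (\<exists>k. b - a = k *\<^sub>R \<tau>)"

text \<open>The integral over the segment from \<open>p\<close> to \<open>q\<close> with respect to arc length.\<close>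

definition seg_integral :: "plane \<Rightarrow> plane \<Rightarrow> (plane \<Rightarrow> real) \<Rightarrow> real" where
  "seg_integral p q f = dist p q * (LINT t:{0..1}|lebesgue. f (linepath p q t))"

definition seg_L2 :: "plane \<Rightarrow> plane \<Rightarrow> (plane \<Rightarrow> real) set" where
  "seg_L2 p q = {g. (\<lambda>t. g (linepath p q t)) \<in> borel_measurable (lebesgue_on {0..1}) \<and>
                    integrable (lebesgue_on {0..1}) (\<lambda>t. (g (linepath p q t))\<^sup>2)}"


section \<open>Sobolev spaces\<close>

text \<open>Functions are representatives of their classes modulo equality almost everywhere in \<open>\<Omega>\<close>;
  values outside \<open>\<Omega>\<close> are irrelevant.\<close>

definition partial :: "2 \<Rightarrow> (plane \<Rightarrow> real) \<Rightarrow> plane \<Rightarrow> real" where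
  "partial i f x = frechet_derivative f (at x) (axis i 1)"

primrec C_k :: "nat \<Rightarrow> (plane \<Rightarrow> real) \<Rightarrow> bool" where
  "C_k 0 f \<longleftrightarrow> continuous_on UNIV f"
| "C_k (Suc k) f \<longleftrightarrow> f differentiable_on UNIV \<and> (\<forall>i. C_k k (partial i f))"

definition smooth :: "(plane \<Rightarrow> real) \<Rightarrow> bool" where
  "smooth f \<longleftrightarrow> (\<forall>k. C_k k f)"

definition test_functions :: "plane set \<Rightarrow> (plane \<Rightarrow> real) set" where
  "test_functions \<Omega> =
    {\<phi>. smooth \<phi> \<and> compact (closure {x. \<phi> x \<noteq> 0}) \<and> closure {x. \<phi> x \<noteq> 0} \<subseteq> \<Omega>}"

definition L2 :: "plane set \<Rightarrow> (plane \<Rightarrow> real) set" where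
  "L2 \<Omega> = {f. f \<in> borel_measurable (lebesgue_on \<Omega>) \<and> integrable (lebesgue_on \<Omega>) (\<lambda>x. (f x)\<^sup>2)}"

definition L2_norm :: "plane set \<Rightarrow> (plane \<Rightarrow> 'b::real_normed_vector) \<Rightarrow> real" where
  "L2_norm \<Omega> f = sqrt (LINT x|lebesgue_on \<Omega>. (norm (f x))\<^sup>2)"

definition has_weak_partial :: "plane set \<Rightarrow> 2 \<Rightarrow> (plane \<Rightarrow> real) \<Rightarrow> (plane \<Rightarrow> real) \<Rightarrow> bool" where
  "has_weak_partial \<Omega> i v g \<longleftrightarrow>
    (\<forall>\<phi>\<in>test_functions \<Omega>.
       (LINT x|lebesgue_on \<Omega>. v x * partial i \<phi> x) = - (LINT x|lebesgue_on \<Omega>. g x * \<phi> x))"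

definition weak_partial :: "plane set \<Rightarrow> 2 \<Rightarrow> (plane \<Rightarrow> real) \<Rightarrow> plane \<Rightarrow> real" where
  "weak_partial \<Omega> i v = (SOME g. g \<in> L2 \<Omega> \<and> has_weak_partial \<Omega> i v g)"

definition H1 :: "plane set \<Rightarrow> (plane \<Rightarrow> real) set" where
  "H1 \<Omega> = {v \<in> L2 \<Omega>. \<forall>i. \<exists>g\<in>L2 \<Omega>. has_weak_partial \<Omega> i v g}"

definition weak_grad :: "plane set \<Rightarrow> (plane \<Rightarrow> real) \<Rightarrow> plane \<Rightarrow> real^2" where
  "weak_grad \<Omega> v x = (\<chi> i. weak_partial \<Omega> i v x)"

definition weak_jacobian :: "plane set \<Rightarrow> (plane \<Rightarrow> real^2) \<Rightarrow> plane \<Rightarrow> real^2^2" where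
  "weak_jacobian \<Omega> w x = (\<chi> j. weak_grad \<Omega> (\<lambda>y. w y $ j) x)"

definition H1_norm :: "plane set \<Rightarrow> (plane \<Rightarrow> real) \<Rightarrow> real" where
  "H1_norm \<Omega> v = sqrt ((L2_norm \<Omega> v)\<^sup>2 + (L2_norm \<Omega> (weak_grad \<Omega> v))\<^sup>2)"

text \<open>The Sobolev--Slobodeckij scale for \<open>0 \<le> s \<le> 1\<close>, in dimension two.\<close>

definition slobodeckij_integrand :: "real \<Rightarrow> (plane \<Rightarrow> real) \<Rightarrow> plane \<times> plane \<Rightarrow> real" where
  "slobodeckij_integrand s g = (\<lambda>(x, y). (g x - g y)\<^sup>2 / norm (x - y) powr (2 + 2 * s))"

definition Hs :: "plane set \<Rightarrow> real \<Rightarrow> (plane \<Rightarrow> real) set" where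
  "Hs \<Omega> s =
    (if s = 0 then L2 \<Omega> else if s = 1 then H1 \<Omega>
     else {g \<in> L2 \<Omega>. integrable (lebesgue_on \<Omega> \<Otimes>\<^sub>M lebesgue_on \<Omega>) (slobodeckij_integrand s g)})"

definition Hs_seminorm :: "plane set \<Rightarrow> real \<Rightarrow> (plane \<Rightarrow> real) \<Rightarrow> real" where
  "Hs_seminorm \<Omega> s g =
    (if s = 0 then L2_norm \<Omega> g else if s = 1 then L2_norm \<Omega> (weak_grad \<Omega> g)
     else sqrt (integral\<^sup>L (lebesgue_on \<Omega> \<Otimes>\<^sub>M lebesgue_on \<Omega>) (slobodeckij_integrand s g)))"

definition H1s_vec :: "plane set \<Rightarrow> real \<Rightarrow> (plane \<Rightarrow> real^2) set" where
  "H1s_vec \<Omega> s = {w. \<forall>j. (\<lambda>x. w x $ j) \<in> H1 \<Omega> \<and>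
                        (\<forall>i. weak_partial \<Omega> i (\<lambda>x. w x $ j) \<in> Hs \<Omega> s)}"

definition H1s_vec_seminorm :: "plane set \<Rightarrow> real \<Rightarrow> (plane \<Rightarrow> real^2) \<Rightarrow> real" where
  "H1s_vec_seminorm \<Omega> s w =
    sqrt (\<Sum>j\<in>UNIV. \<Sum>i\<in>UNIV. (Hs_seminorm \<Omega> s (weak_partial \<Omega> i (\<lambda>x. w x $ j)))\<^sup>2)"

text \<open>Trace of \<open>v \<in> H\<^sup>1(\<Omega>)\<close> on a segment in the closure of \<open>\<Omega>\<close>, possibly in its boundary: the
  continuous extension of the restriction of smooth functions. It is determined almost everywhere
  on the segment.\<close>

definition has_trace ::
  "plane set \<Rightarrow> plane \<Rightarrow> plane \<Rightarrow> (plane \<Rightarrow> real) \<Rightarrow> (plane \<Rightarrow> real) \<Rightarrow> bool" where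
  "has_trace \<Omega> p q v g \<longleftrightarrow>
    g \<in> seg_L2 p q \<and>
    (\<exists>\<phi> :: nat \<Rightarrow> plane \<Rightarrow> real.
       (\<forall>k. smooth (\<phi> k)) \<and>
       (\<lambda>k. H1_norm \<Omega> (\<lambda>x. \<phi> k x - v x)) \<longlonglongrightarrow> 0 \<and>
       (\<lambda>k. seg_integral p q (\<lambda>x. (\<phi> k x - g x)\<^sup>2)) \<longlonglongrightarrow> 0)"

definition trace_on :: "plane set \<Rightarrow> plane \<Rightarrow> plane \<Rightarrow> (plane \<Rightarrow> real) \<Rightarrow> plane \<Rightarrow> real" where
  "trace_on \<Omega> p q v = (SOME g. has_trace \<Omega> p q v g)"

definition H1_D :: "plane set \<Rightarrow> plane set \<Rightarrow> (plane \<Rightarrow> real) set" where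
  "H1_D \<Omega> \<Gamma>D =
    {v \<in> H1 \<Omega>. \<forall>p q. p \<noteq> q \<and> closed_segment p q \<subseteq> frontier \<Omega> \<longrightarrow>
       (AE t in lebesgue_on {0..1}.
          linepath p q t \<in> \<Gamma>D \<longrightarrow> trace_on \<Omega> p q v (linepath p q t) = 0)}"

definition H1_D_vec :: "plane set \<Rightarrow> plane set \<Rightarrow> (plane \<Rightarrow> real^2) set" where
  "H1_D_vec \<Omega> \<Gamma>D = {w. \<forall>j. (\<lambda>x. w x $ j) \<in> H1_D \<Omega> \<Gamma>D}"


section \<open>Meshes\<close>

text \<open>A mesh is a set of closed triangles; \<^const>\<open>triangulation\<close> is finiteness together with the
  conformity condition that two triangles meet in a common face.\<close>

definition mesh_vertices :: "plane set set \<Rightarrow> plane set" where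
  "mesh_vertices T = {z. \<exists>K\<in>T. z extreme_point_of K}"

definition mesh_edges :: "plane set set \<Rightarrow> plane set set" where
  "mesh_edges T = {E. \<exists>K\<in>T. E face_of K \<and> aff_dim E = 1}"

definition mesh_size :: "plane set set \<Rightarrow> real" where
  "mesh_size T = Max (diameter ` T)"

definition conforming_mesh ::
  "plane set \<Rightarrow> plane set \<Rightarrow> plane set \<Rightarrow> plane set set \<Rightarrow> bool" where
  "conforming_mesh \<Omega> \<Gamma>D \<Gamma>T T \<longleftrightarrow>
    triangulation T \<and> (\<forall>K\<in>T. 2 simplex K) \<and> \<Union>T = closure \<Omega> \<and>
    (\<forall>E\<in>mesh_edges T. E \<subseteq> frontier \<Omega> \<longrightarrow> rel_interior E \<subseteq> \<Gamma>D \<or> rel_interior E \<subseteq> \<Gamma>T)"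

definition inradius :: "plane set \<Rightarrow> real" where
  "inradius K = Sup {r. 0 \<le> r \<and> (\<exists>x. cball x r \<subseteq> K)}"

definition shape_regular :: "plane set set set \<Rightarrow> bool" where
  "shape_regular \<M> \<longleftrightarrow> (\<exists>\<kappa>. \<forall>T\<in>\<M>. \<forall>K\<in>T. diameter K \<le> \<kappa> * inradius K)"

definition quasi_uniform :: "plane set set set \<Rightarrow> bool" where
  "quasi_uniform \<M> \<longleftrightarrow> (\<exists>q. \<forall>T\<in>\<M>. \<forall>K\<in>T. mesh_size T \<le> q * diameter K)"


section \<open>Finite element spaces\<close>

definition affine_fun_on :: "plane set \<Rightarrow> (plane \<Rightarrow> real) \<Rightarrow> bool" where
  "affine_fun_on S f \<longleftrightarrow> (\<exists>c d. \<forall>x\<in>S. f x = c + d \<bullet> x)"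

definition P1 :: "plane set set \<Rightarrow> (plane \<Rightarrow> real) set" where
  "P1 T = {v. \<forall>K\<in>T. affine_fun_on (interior K) v}"

definition V_h :: "plane set \<Rightarrow> plane set \<Rightarrow> plane set set \<Rightarrow> (plane \<Rightarrow> real^2) set" where
  "V_h \<Omega> \<Gamma>D T = {w. \<forall>j. (\<lambda>x. w x $ j) \<in> P1 T \<inter> H1_D \<Omega> \<Gamma>D}"

definition W_h :: "plane \<Rightarrow> plane \<Rightarrow> plane set set \<Rightarrow> (plane \<Rightarrow> real) set" where
  "W_h a b T =
    {w. continuous_on (closed_segment a b) w \<and>
        (\<forall>E\<in>mesh_edges T. E \<subseteq> closed_segment a b \<longrightarrow> affine_fun_on E w) \<and>
        w a = 0 \<and> w b = 0}"

text \<open>The continuous piecewise affine function with nodal values \<open>c\<close>.\<close>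

definition nodal_function :: "plane set set \<Rightarrow> (plane \<Rightarrow> real) \<Rightarrow> plane \<Rightarrow> real" where
  "nodal_function T c =
    (THE u. (\<forall>K\<in>T. affine_fun_on K u) \<and> (\<forall>z\<in>mesh_vertices T. u z = c z) \<and>
            (\<forall>x. x \<notin> \<Union>T \<longrightarrow> u x = 0))"

definition nodal_basis :: "plane set set \<Rightarrow> plane \<Rightarrow> plane \<Rightarrow> real" where
  "nodal_basis T z = nodal_function T (\<lambda>y. if y = z then 1 else 0)"


section \<open>The Scott--Zhang interpolant\<close>

text \<open>The chosen edge of the vertex \<open>z\<close> is the segment from \<open>z\<close> to \<open>\<sigma> z\<close>.\<close>

definition sz_choice ::
  "plane set \<Rightarrow> plane set \<Rightarrow> plane set set \<Rightarrow> (plane \<Rightarrow> plane) \<Rightarrow> bool" where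
  "sz_choice \<Omega> \<Gamma>D T \<sigma> \<longleftrightarrow>
    (\<forall>z\<in>mesh_vertices T.
       closed_segment z (\<sigma> z) \<in> mesh_edges T \<and>
       (z \<in> frontier \<Omega> \<longrightarrow> closed_segment z (\<sigma> z) \<subseteq> frontier \<Omega>) \<and>
       (z \<in> closure \<Gamma>D \<longrightarrow> closed_segment z (\<sigma> z) \<subseteq> closure \<Gamma>D))"

definition sz_dual :: "plane set set \<Rightarrow> plane \<Rightarrow> plane \<Rightarrow> plane \<Rightarrow> real" where
  "sz_dual T z y =
    (SOME \<theta>. affine_fun_on (closed_segment z y) \<theta> \<and>
             seg_integral z y (\<lambda>x. \<theta> x * nodal_basis T z x) = 1 \<and>
             seg_integral z y (\<lambda>x. \<theta> x * nodal_basis T y x) = 0)"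

definition scott_zhang ::
  "plane set \<Rightarrow> plane set set \<Rightarrow> (plane \<Rightarrow> plane) \<Rightarrow> (plane \<Rightarrow> real) \<Rightarrow> plane \<Rightarrow> real" where
  "scott_zhang \<Omega> T \<sigma> v =
    nodal_function T
      (\<lambda>z. seg_integral z (\<sigma> z) (\<lambda>x. sz_dual T z (\<sigma> z) x * trace_on \<Omega> z (\<sigma> z) v x))"

definition fortin_op ::
  "plane set \<Rightarrow> plane set set \<Rightarrow> (plane \<Rightarrow> plane) \<Rightarrow> plane \<Rightarrow> plane \<Rightarrow>
   ((plane \<Rightarrow> real) \<Rightarrow> plane \<Rightarrow> real) \<Rightarrow> (plane \<Rightarrow> real^2) \<Rightarrow> plane \<Rightarrow> real^2" where
  "fortin_op \<Omega> T \<sigma> n \<tau> \<Pi>t w x =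
    \<Pi>t (\<lambda>y. w y \<bullet> n) x *\<^sub>R n + scott_zhang \<Omega> T \<sigma> (\<lambda>y. w y \<bullet> \<tau>) x *\<^sub>R \<tau>"

end

theory Submission
  imports Defs
begin

text \<open>The operator $\tilde\Pi_h$ is the Scott--Zhang interpolant corrected on $\Gamma_T$ by the
  $L^2(\Gamma_T)$ projection of the trace error onto the hat functions of the vertices in $\Gamma_T$.
  Quasi-uniformity turns the trace inequality and an inverse estimate into a bound of the correction by
  the error of the Scott--Zhang interpolant in the norm $\|v\| + h \|\nabla v\|$. That error is estimated
  for smooth functions by comparison with affine functions on each triangle, chaining through shared
  edges around a vertex, in terms of the distance of $\nabla v$ to its mean on each triangle; density of
  smooth functions in $H^1$ of a Lipschitz domain gives the general case. The Poincar\'e inequality, or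
  the double integral representation of the variance, bounds these distances by $h^s |v|_{1+s}$ for
  every $0 \le s \le 1$; stability is the case $s = 0$.\<close>

section \<open>Smooth functions\<close>

text \<open>The constant is fixed before the mesh and the choice of edges, so every surviving bound
  may depend on \<open>gamma\<close> only, where all triangles have diameter at most h and contain a
  disc of radius \<open>gamma * h\<close>. Hence there is no reference triangle: areas, numbers of
  neighbours and gradients of hat functions are read off from that disc. Mesh-dependent constants do
  occur (existence of traces, continuity of nodal functionals), but only as factors of an epsilon in
  density arguments. The correction is stable because powers of h cancel: a trace costs h^(-1/2) in
  the scaled norm, while a nodal function with coefficients c has scaled norm of order h |c| and
  trace norm of order h^(1/2) |c|. Corrections sit at vertices inside the open segment only; their
  hat functions vanish on \<Gamma>D, and the members of \<open>W_h\<close> have no other degrees of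
  freedom. The Lipschitz boundary gives the direction in which to mollify, excludes slits, and keeps
  the triangles around a vertex connected through edges. Traces and weak derivatives are chosen
  representatives, so even their linearity has to be derived from approximation.\<close>

lemma partial_eq: "(f has_derivative f') (at x) ==> partial i f x = f' (axis i 1)"
 unfolding partial_def using frechet_derivative_at by metis

lemma has_derivative_partial:
 assumes "f differentiable (at x)"
 shows "(f has_derivative (%k. SUM i:UNIV. partial i f x * k $ i)) (at x)"
proof -
 let ?D = "frechet_derivative f (at x)"
 have D: "(f has_derivative ?D) (at x)" using assms frechet_derivative_works by blast
 then have lin: "linear ?D" by (rule has_derivative_linear)
 have "?D k = (SUM i:UNIV. partial i f x * k $ i)" for k
 proof -
  have "?D k = ?D (SUM i:UNIV. (k $ i) *\<^sub>R axis i 1)"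
   by (metis basis_expansion scalar_mult_eq_scaleR)
  also have "... = (SUM i:UNIV. (k $ i) * ?D (axis i 1))"
   by (simp add: linear_sum[OF lin] linear_cmul[OF lin])
  finally show ?thesis by (simp add: partial_def mult.commute)
 qed
 then have "?D = (%k. SUM i:UNIV. partial i f x * k $ i)" by auto
 with D show ?thesis by simp
qed

lemma C_k_Suc_differentiable: "C_k (Suc k) f ==> f differentiable (at x)"
 by (simp add: differentiable_on_def)

lemma C_k_SucD: "C_k (Suc k) f ==> C_k k f"
proof (induction k arbitrary: f)
 case 0 then show ?case by (simp add: differentiable_imp_continuous_on)
next
 case (Suc k) then show ?case by (metis C_k.simps(2))
qed

text \<open>\<open>C_k\<close> refers to \<open>partial\<close>, which rests on
  \<open>frechet_derivative\<close>; this rule trades it for any explicit derivative, so that the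
  closure properties become inductions on \<open>k\<close> whose step is the usual differentiation
  rule.\<close>

lemma C_k_SucI:
 assumes "!!x. (f has_derivative f' x) (at x)" and "!!i. C_k k (%x. f' x (axis i 1))"
 shows "C_k (Suc k) f"
proof -
 have "partial i f = (%x. f' x (axis i 1))" for i using partial_eq[OF assms(1)] by auto
 moreover have "f differentiable_on UNIV"
  using assms(1) by (auto simp: differentiable_on_def differentiable_def)
 ultimately show ?thesis using assms(2) by simp
qed

lemma C_k_const: "C_k k (%x. c)"
proof (induction k arbitrary: c)
 case (Suc k)
 show ?case by (rule C_k_SucI[where f'="%_ _. 0"]) (auto intro: Suc)
qed simp

lemma C_k_add: "C_k k f ==> C_k k g ==> C_k k (%x. f x + g x)"
proof (induction k arbitrary: f g)
 case 0 then show ?case by (auto intro: continuous_intros)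
next
 case (Suc k)
 let ?D = "%f x. frechet_derivative f (at x)"
 show ?case
 proof (rule C_k_SucI[where f'="%x k. ?D f x k + ?D g x k"])
  show "((%x. f x + g x) has_derivative (%k. ?D f x k + ?D g x k)) (at x)" for x
   using Suc.prems by (intro has_derivative_add) (auto simp: C_k_Suc_differentiable frechet_derivative_works[symmetric])
  show "C_k k (%x. ?D f x (axis i 1) + ?D g x (axis i 1))" for i
   using Suc by (auto simp: partial_def[abs_def])
 qed
qed

lemma C_k_mult: "C_k k f ==> C_k k g ==> C_k k (%x. f x * g x)"
proof (induction k arbitrary: f g)
 case 0 then show ?case by (auto intro: continuous_intros)
next
 case (Suc k)
 let ?D = "%f x. frechet_derivative f (at x)"
 show ?case
 proof (rule C_k_SucI[where f'="%x k. f x * ?D g x k + ?D f x k * g x"])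
  show "((%x. f x * g x) has_derivative (%k. f x * ?D g x k + ?D f x k * g x)) (at x)" for x
   using Suc.prems by (intro has_derivative_mult) (auto simp: C_k_Suc_differentiable frechet_derivative_works[symmetric])
  show "C_k k (%x. f x * ?D g x (axis i 1) + ?D f x (axis i 1) * g x)" for i
   using Suc C_k_SucD[OF Suc.prems(1)] C_k_SucD[OF Suc.prems(2)]
   by (intro C_k_add) (auto simp: partial_def[abs_def])
 qed
qed

lemma C_k_inverse: "C_k k f ==> (!!x. f x ~= 0) ==> C_k k (%x. inverse (f x))"
proof (induction k arbitrary: f)
 case 0 then show ?case by (auto intro: continuous_intros)
next
 case (Suc k)
 let ?D = "%f x. frechet_derivative f (at x)"
 show ?case
 proof (rule C_k_SucI[where f'="%x k. - (inverse (f x) * ?D f x k * inverse (f x))"])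
  show "((%x. inverse (f x)) has_derivative (%k. - (inverse (f x) * ?D f x k * inverse (f x)))) (at x)" for x
   using Suc.prems by (intro Deriv.has_derivative_inverse) (auto simp: C_k_Suc_differentiable frechet_derivative_works[symmetric])
  have I: "C_k k (%x. inverse (f x))" by (rule Suc.IH[OF C_k_SucD[OF Suc.prems(1)] Suc.prems(2)])
  have "C_k k (%x. (-1) * (inverse (f x) * ?D f x (axis i 1) * inverse (f x)))" for i
   using Suc.prems by (intro C_k_mult C_k_const I) (auto simp: partial_def[abs_def])
  then show "C_k k (%x. - (inverse (f x) * ?D f x (axis i 1) * inverse (f x)))" for i by simp
 qed
qed

lemma C_k_linear: assumes "bounded_linear f" shows "C_k k f"
proof (cases k)
 case 0 then show ?thesis using assms by (simp add: linear_continuous_on)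
next
 case (Suc m)
 then show ?thesis
  using C_k_SucI[of f "%_. f" m] bounded_linear_imp_has_derivative[OF assms] C_k_const by auto
qed

lemma smooth_const: "smooth (%x. c)" and
 smooth_add: "smooth f ==> smooth g ==> smooth (%x. f x + g x)" and
 smooth_mult: "smooth f ==> smooth g ==> smooth (%x. f x * g x)" and
 smooth_inverse: "smooth f ==> (!!x. f x ~= 0) ==> smooth (%x. inverse (f x))" and
 smooth_linear: "bounded_linear f ==> smooth f"
 by (simp_all add: smooth_def C_k_const C_k_add C_k_mult C_k_inverse C_k_linear)

lemma smooth_uminus: "smooth f ==> smooth (%x. - f x)"
 using smooth_mult[OF smooth_const[of "-1"]] by force

lemma smooth_diff: "smooth f ==> smooth g ==> smooth (%x. f x - g x)"
 using smooth_add[OF _ smooth_uminus] by force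

lemma smooth_cmult: "smooth f ==> smooth (%x. c * f x)"
 by (rule smooth_mult[OF smooth_const])

lemma smooth_sum: "(!!i. i : I ==> smooth (f i)) ==> smooth (%x. SUM i:I. f i x)"
 by (induction I rule: infinite_finite_induct) (auto simp: smooth_const smooth_add)

lemma smooth_affine: "smooth (%x. c + d \<bullet> x)"
 by (intro smooth_add smooth_const smooth_linear bounded_linear_inner_right)

lemma smooth_affine_left: "smooth (%x. c + x \<bullet> d)"
 using smooth_affine[of c d] by (simp add: inner_commute)

lemma smooth_differentiable: "smooth f ==> f differentiable (at x)"
 unfolding smooth_def using C_k_Suc_differentiable by blast

lemma smooth_partial: "smooth f ==> smooth (partial i f)"
 unfolding smooth_def using C_k.simps(2) by blast

lemma smooth_continuous_on: "smooth f ==> continuous_on S f"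
 by (metis C_k.simps(1) continuous_on_subset smooth_def subset_UNIV)

lemma smooth_borel_measurable: "smooth f ==> f : borel_measurable borel"
 by (simp add: borel_measurable_continuous_onI smooth_continuous_on)

lemma smooth_has_derivative:
 "smooth f ==> (f has_derivative (%k. SUM i:UNIV. partial i f x * k $ i)) (at x)"
 by (simp add: has_derivative_partial smooth_differentiable)

lemma partial_add: "smooth f ==> smooth g ==> partial i (%x. f x + g x) x = partial i f x + partial i g x"
 using partial_eq[OF has_derivative_add[OF smooth_has_derivative smooth_has_derivative], of f g]
 by (simp add: axis_def if_distrib[of "(*) _"] cong: if_cong)

lemma partial_mult: "smooth f ==> smooth g ==> partial i (%x. f x * g x) x = f x * partial i g x + partial i f x * g x"
 using partial_eq[OF has_derivative_mult[OF smooth_has_derivative smooth_has_derivative], of f g]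
 by (simp add: axis_def if_distrib[of "(*) _"] cong: if_cong)

lemma partial_const: "partial i (%x. c) x = 0"
 by (rule partial_eq) simp

lemma partial_cmult: "smooth f ==> partial i (%x. c * f x) x = c * partial i f x"
 using partial_mult[OF smooth_const, of f] by (simp add: partial_const)

lemma partial_diff: "smooth f ==> smooth g ==> partial i (%x. f x - g x) x = partial i f x - partial i g x"
 using partial_add[of f "%x. -1 * g x"] smooth_cmult[of g "-1"] partial_cmult[of g i "-1"] by simp

lemma partial_sum: "(!!j. j : I ==> smooth (f j)) ==> partial i (%x. SUM j:I. f j x) x = (SUM j:I. partial i (f j) x)"
 by (induction I rule: infinite_finite_induct) (auto simp: partial_const partial_add smooth_sum)

lemma partial_affine: "partial i (%x. c + d \<bullet> x) x = d $ i"
 by (rule partial_eq[where f'="%k. d \<bullet> k", THEN trans]) (auto intro!: derivative_eq_intros simp: inner_axis)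

lemma smooth_compose_shift:
 assumes "smooth f" shows "smooth (%x. f (a + s *\<^sub>R x))"
proof -
 have "C_k k f ==> C_k k (%x. f (a + s *\<^sub>R x))" for k f
 proof (induction k arbitrary: f)
  case 0
  then show ?case by (auto intro!: continuous_intros elim: continuous_on_compose2)
 next
  case (Suc k)
  let ?D = "%x. frechet_derivative f (at x)"
  have lin: "linear (?D x)" for x
   using Suc.prems C_k_Suc_differentiable has_derivative_linear frechet_derivative_works by blast
  show ?case
  proof (rule C_k_SucI[where f'="%x k. ?D (a + s *\<^sub>R x) (s *\<^sub>R k)"])
   show "((%x. f (a + s *\<^sub>R x)) has_derivative (%k. ?D (a + s *\<^sub>R x) (s *\<^sub>R k))) (at x)" for x
    using Suc.prems
    by (intro has_derivative_compose[where f="%x. a + s *\<^sub>R x" and g=f])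
     (auto intro!: derivative_eq_intros simp: C_k_Suc_differentiable frechet_derivative_works[symmetric])
   have "C_k k (%x. s * partial i f (a + s *\<^sub>R x))" for i
    using Suc by (intro C_k_mult C_k_const Suc.IH) simp
   then show "C_k k (%x. ?D (a + s *\<^sub>R x) (s *\<^sub>R axis i 1))" for i
    by (simp add: partial_def linear_cmul[OF lin])
  qed
 qed
 then show ?thesis using assms by (auto simp: smooth_def)
qed

lemma partial_compose_shift:
 assumes "smooth f" shows "partial i (%x. f (a + s *\<^sub>R x)) x = s * partial i f (a + s *\<^sub>R x)"
proof -
 have "((%x. f (a + s *\<^sub>R x)) has_derivative (%k. SUM i:UNIV. partial i f (a + s *\<^sub>R x) * (s *\<^sub>R k) $ i)) (at x)"
  by (intro has_derivative_compose[where f="%x. a + s *\<^sub>R x" and g=f] smooth_has_derivative assms)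
   (auto intro!: derivative_eq_intros)
 from partial_eq[OF this] show ?thesis
  by (simp add: axis_def if_distrib[of "(*) _"] cong: if_cong)
qed

subsection \<open>Bump functions\<close>

text \<open>The functions exp(-1/t)/t^n, extended by 0, form a family whose derivatives are linear
  combinations of members. Smoothness then follows by one induction over all n at once.\<close>

definition flat :: "nat => real => real" where
 "flat n t = (if t > 0 then exp (- (1 / t)) / t ^ n else 0)"

lemma flat_nonneg: "flat n t >= 0" by (simp add: flat_def)

lemma flat_pos_iff: "flat n t > 0 \<longleftrightarrow> t > 0" by (simp add: flat_def)

text \<open>Keep only the term of order n + 2 in the exponential series at u = 1/t. The quadratic
  bound is what sends the difference quotient at t = 0 to 0.\<close>

lemma flat_le: "flat n t <= fact (Suc (Suc n)) * t^2"
proof (cases "t > 0")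
 case True
 define u where "u = 1 / t"
 have u: "u > 0" "t = 1 / u" using True by (auto simp: u_def)
 have "sum (%n. u ^ n /\<^sub>R fact n) {n + 2} <= (\<Sum>n. u ^ n /\<^sub>R fact n)"
  using u by (intro sum_le_suminf summable_exp_generic) auto
 then have "u ^ (n + 2) / fact (n + 2) <= exp u"
  by (simp add: exp_def divide_inverse mult.commute del: fact_Suc)
 then have "u ^ (n + 2) <= exp u * fact (n + 2)"
  by (simp add: pos_divide_le_eq del: fact_Suc power_add power_Suc)
 then have "u ^ n * exp (- u) <= fact (n + 2) * (1 / u)^2"
  using u by (simp add: exp_minus field_simps power2_eq_square power_add)
 moreover have "flat n t = u ^ n * exp (- u)" "1 / u = t"
  using True by (simp_all add: flat_def u_def power_one_over field_simps)
 ultimately show ?thesis by (simp del: fact_Suc)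
qed (simp add: flat_def)

lemma flat_has_derivative:
 "(flat n has_real_derivative (flat (n + 2) t - real n * flat (n + 1) t)) (at t)"
proof -
 consider "t > 0" | "t < 0" | "t = 0" by linarith
 then show ?thesis
 proof cases
  case 1
  have "((%t. exp (- (1 / t)) / t ^ n) has_real_derivative (flat (n + 2) t - real n * flat (n + 1) t)) (at t)"
  proof (cases n)
   case (Suc m)
   have "((%t. exp (- (1 / t)) / t ^ n) has_real_derivative
    ((exp (- (1 / t)) * (1 / t^2)) * t ^ n - exp (- (1 / t)) * (real n * t ^ m)) / (t ^ n * t ^ n)) (at t)"
   proof -
    have A: "((%t. exp (- (1 / t))) has_real_derivative exp (- (1 / t)) * (1 / t^2)) (at t)"
     using 1 by (auto intro!: derivative_eq_intros simp: power2_eq_square)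
    have "m = n - Suc 0" using Suc by simp
    then show ?thesis using DERIV_divide[OF A DERIV_pow[of n t]] 1 by simp
   qed
   moreover have "((exp (- (1 / t)) * (1 / t^2)) * t ^ n - exp (- (1 / t)) * (real n * t ^ m)) / (t ^ n * t ^ n)
    = flat (n + 2) t - real n * flat (n + 1) t"
    using 1 unfolding Suc by (simp add: flat_def field_simps power2_eq_square)
   ultimately show ?thesis by simp
  qed (use 1 in \<open>auto intro!: derivative_eq_intros simp: flat_def field_simps power2_eq_square\<close>)
  then show ?thesis
   by (rule has_field_derivative_transform_within_open[where S="{0<..}"]) (use 1 in \<open>auto simp: flat_def\<close>)
 next
  case 2
  have "((%t. 0) has_real_derivative 0) (at t)" by simp
  then have "(flat n has_real_derivative 0) (at t)"
   by (rule has_field_derivative_transform_within_open[where S="{..<0}"]) (use 2 in \<open>auto simp: flat_def\<close>)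
  then show ?thesis using 2 by (simp add: flat_def)
 next
  case 3
  have "((%h. (flat n (0 + h) - flat n 0) / h) \<longlongrightarrow> 0) (at 0)"
  proof (rule Lim_null_comparison)
   show "\<forall>\<^sub>F h in at 0. norm ((flat n (0 + h) - flat n 0) / h) <= fact (Suc (Suc n)) * \<bar>h\<bar>"
   proof (intro always_eventually allI)
    fix h :: real
    show "norm ((flat n (0 + h) - flat n 0) / h) <= fact (Suc (Suc n)) * \<bar>h\<bar>"
    proof (cases "h = 0")
     case False
     have "\<bar>flat n h\<bar> <= (fact (Suc (Suc n)) * \<bar>h\<bar>) * \<bar>h\<bar>"
      using flat_le[of n h] flat_nonneg[of n h] by (simp add: power2_eq_square mult.assoc del: fact_Suc)
     then show ?thesis using False by (simp add: flat_def[of _ 0] pos_divide_le_eq del: fact_Suc)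
    qed simp
   qed
   show "((%h. fact (Suc (Suc n)) * \<bar>h\<bar>) \<longlongrightarrow> 0) (at (0::real))"
    by (auto intro!: tendsto_eq_intros)
  qed
  then show ?thesis using 3 by (simp add: DERIV_def flat_def[of _ 0])
 qed
qed

lemma C_k_flat: "C_k k f ==> C_k k (%x. flat n (f x))"
proof (induction k arbitrary: f n)
 case 0
 have "continuous_on UNIV (flat n)"
  using flat_has_derivative by (meson DERIV_continuous continuous_at_imp_continuous_on)
 with 0 show ?case by (auto elim: continuous_on_compose2)
next
 case (Suc k)
 let ?D = "%f x. frechet_derivative f (at x)"
 show ?case
 proof (rule C_k_SucI[where f'="%x k. ?D f x k * (flat (n + 2) (f x) - real n * flat (n + 1) (f x))"])
  show "((%x. flat n (f x)) has_derivative (%k. ?D f x k * (flat (n + 2) (f x) - real n * flat (n + 1) (f x)))) (at x)" for x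
   using Suc.prems flat_has_derivative
   by (intro DERIV_compose_FDERIV) (auto simp: C_k_Suc_differentiable frechet_derivative_works[symmetric])
  have "C_k k (%x. partial i f x * (flat (n + 2) (f x) + (- real n) * flat (n + 1) (f x)))" for i
   using Suc.prems C_k_SucD[OF Suc.prems] by (intro C_k_mult C_k_add C_k_const Suc.IH) auto
  then show "C_k k (%x. ?D f x (axis i 1) * (flat (n + 2) (f x) - real n * flat (n + 1) (f x)))" for i
   by (simp add: partial_def)
 qed
qed

lemma smooth_flat: "smooth f ==> smooth (%x. flat n (f x))"
 by (simp add: smooth_def C_k_flat)

text \<open>The squared norm is a polynomial, so no smoothness is lost at the centre.\<close>

definition bump :: "plane => real => plane => real" where
 "bump c r x = flat 0 (r^2 - (norm (x - c))^2)"

lemma smooth_bump: "smooth (bump c r)"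
proof -
 have "smooth (%x. r^2 - (SUM i:UNIV. (- (c $ i) + x \<bullet> axis i 1) * (- (c $ i) + x \<bullet> axis i 1)))"
  by (intro smooth_diff smooth_sum smooth_const smooth_mult smooth_affine_left)
 moreover have "(%x. r^2 - (SUM i:UNIV. (- (c $ i) + x \<bullet> axis i 1) * (- (c $ i) + x \<bullet> axis i 1))) = (%x. r^2 - (norm (x - c))^2)"
  by (auto simp: power2_norm_eq_inner inner_vec_def[of "_ - c"] inner_axis)
 ultimately show ?thesis unfolding bump_def[abs_def] by (auto intro: smooth_flat)
qed

lemma bump_nonneg: "bump c r x >= 0" by (simp add: bump_def flat_nonneg)

lemma bump_pos: "x : ball c r ==> bump c r x > 0"
 by (auto simp: bump_def flat_pos_iff dist_norm norm_minus_commute intro!: power_strict_mono)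

lemma bump_zero: "0 <= r ==> x ~: ball c r ==> bump c r x = 0"
 using power_mono[of r "norm (c - x)" 2] by (auto simp: bump_def flat_def dist_norm norm_minus_commute not_less)

lemma partition_of_unity:
 fixes S :: "plane set"
 assumes "compact S" and "!!x. x : S ==> r x > 0"
 obtains X psi where "finite X" "X <= S" "!!x. x : X ==> smooth (psi x)"
  "!!x y. x : X ==> y ~: ball x (r x) ==> psi x y = 0" "!!y. y : S ==> (SUM x:X. psi x y) = 1"
proof (cases "S = {}")
 case True
 show ?thesis by (rule that[of "{}" "%_ _. 0"]) (auto simp: True)
next
 case False
 obtain X where X: "X <= S" "finite X" "S <= (UN x:X. ball x (r x))"
 proof (rule compactE_image[OF assms(1), of S "%x. ball x (r x)"])
  show "S <= (UN c:S. ball c (r c))" using assms(2) by force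
 qed auto
 define \<sigma> where "\<sigma> y = (SUM x:X. bump x (r x) y)" for y
 have sm: "smooth \<sigma>" unfolding \<sigma>_def by (intro smooth_sum smooth_bump)
 have pos: "\<sigma> y > 0" if "y : S" for y
 proof -
  obtain x where "x : X" "y : ball x (r x)" using X \<open>y : S\<close> by blast
  then show ?thesis unfolding \<sigma>_def using X(2)
   by (intro sum_pos2[of X x]) (auto intro: bump_pos bump_nonneg simp del: mem_ball)
 qed
 obtain y0 where y0: "y0 : S" "!!y. y : S ==> \<sigma> y0 <= \<sigma> y"
  using continuous_attains_inf[OF assms(1) False smooth_continuous_on[OF sm]] by auto
 \<comment> \<open>The normaliser must be positive on the whole plane, while the sum
   \<open>\<sigma>\<close> of bumps is known to be positive on \<open>S\<close> only. The added term
   is 0 wherever \<open>\<sigma>\<close> is at least its minimum \<open>\<sigma> y0\<close> over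
   \<open>S\<close>, in particular on \<open>S\<close>, and positive elsewhere.\<close>
 define \<tau> where "\<tau> y = \<sigma> y + flat 0 (\<sigma> y0 - \<sigma> y)" for y
 have "\<tau> y > 0" for y
 proof (cases "\<sigma> y < \<sigma> y0")
  case True
  then show ?thesis unfolding \<tau>_def \<sigma>_def[of y]
   by (intro add_nonneg_pos sum_nonneg) (auto simp: flat_pos_iff bump_nonneg \<sigma>_def[symmetric])
 next
  case False
  then show ?thesis using pos[OF y0(1)] flat_nonneg[of 0] unfolding \<tau>_def by (smt (verit))
 qed
 then have nz: "\<tau> y ~= 0" for y by (metis less_irrefl)
 have s\<tau>: "smooth \<tau>" unfolding \<tau>_def
  by (intro smooth_add smooth_flat smooth_diff smooth_const sm)
 show ?thesis
 proof (rule that[of X "%x y. bump x (r x) y * inverse (\<tau> y)"])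
  show "smooth (%y. bump x (r x) y * inverse (\<tau> y))" for x
   by (intro smooth_mult smooth_bump smooth_inverse s\<tau> nz)
  show "bump x (r x) y * inverse (\<tau> y) = 0" if "x : X" "y ~: ball x (r x)" for x y
   using bump_zero[of "r x" y x] that assms(2)[of x] X by auto
  show "(SUM x:X. bump x (r x) y * inverse (\<tau> y)) = 1" if "y : S" for y
   using y0(2)[OF that] nz[of y] by (simp add: sum_distrib_right[symmetric] \<sigma>_def[symmetric] \<tau>_def flat_def)
 qed (use X in auto)
qed

section \<open>Square integrable functions\<close>

text \<open>Stated for an arbitrary measure because the same calculus serves the domain, single
  triangles, the plane, and the unit interval that parametrises a segment.\<close>

definition sqint :: "'a measure => ('a => real) => bool" where
 "sqint M f \<longleftrightarrow> f : borel_measurable M & integrable M (%x. (f x)^2)"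

definition l2 :: "'a measure => ('a => real) => real" where
 "l2 M f = sqrt (LINT x|M. (f x)^2)"

lemma sqint_measurable: "sqint M f ==> f : borel_measurable M"
 by (simp add: sqint_def)

lemma sqint_integrable: "sqint M f ==> integrable M (%x. (f x)^2)"
 by (simp add: sqint_def)

lemma l2_nonneg: "l2 M f >= 0" by (simp add: l2_def)

lemma l2_sq: "(l2 M f)^2 = (LINT x|M. (f x)^2)" by (simp add: l2_def)

lemma sqint_mult_integrable:
 assumes "sqint M f" "sqint M g" shows "integrable M (%x. f x * g x)"
proof (rule Bochner_Integration.integrable_bound)
 show "integrable M (%x. (f x)^2 + (g x)^2)" using assms by (simp add: sqint_def)
 show "(%x. f x * g x) : borel_measurable M" using assms by (auto simp: sqint_def)
 have "\<bar>f x * g x\<bar> <= (f x)^2 + (g x)^2" for x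
 proof -
  have "0 <= \<bar>f x\<bar> * \<bar>g x\<bar>" by simp
  then show ?thesis using sum_squares_bound[of "\<bar>f x\<bar>" "\<bar>g x\<bar>"] by (simp only: abs_mult power2_abs)
 qed
 then show "AE x in M. norm (f x * g x) <= norm ((f x)^2 + (g x)^2)" by simp
qed

lemma sqint_add: assumes "sqint M f" "sqint M g" shows "sqint M (%x. f x + g x)"
proof -
 have "(%x. (f x + g x)^2) = (%x. (f x)^2 + (g x)^2 + 2 * (f x * g x))"
  by (rule ext) (simp add: power2_eq_square algebra_simps)
 then show ?thesis using assms sqint_mult_integrable[OF assms] by (auto simp: sqint_def)
qed

lemma sqint_cmult: "sqint M f ==> sqint M (%x. c * f x)"
 by (auto simp: sqint_def power_mult_distrib)

lemma sqint_uminus: "sqint M f ==> sqint M (%x. - f x)"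
 using sqint_cmult[of M f "-1"] by simp

lemma sqint_diff: "sqint M f ==> sqint M g ==> sqint M (%x. f x - g x)"
 using sqint_add[OF _ sqint_uminus] by force

lemma sqint_zero: "sqint M (%x. 0)" by (simp add: sqint_def)

lemma sqint_sum: "(!!i. i : I ==> sqint M (f i)) ==> sqint M (%x. SUM i:I. f i x)"
 by (induction I rule: infinite_finite_induct) (auto simp: sqint_zero sqint_add)

lemma sqint_const: "finite_measure M ==> sqint M (%x. c)"
 by (auto simp: sqint_def finite_measure.integrable_const)

lemma sqint_bound:
 assumes "sqint M f" "g : borel_measurable M" "AE x in M. \<bar>g x\<bar> <= \<bar>f x\<bar>"
 shows "sqint M g"
 using assms unfolding sqint_def
 by (auto intro!: Bochner_Integration.integrable_bound[of M "%x. (f x)^2"] simp: abs_le_square_iff)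

lemma sqint_mult_bounded:
 assumes "sqint M f" "g : borel_measurable M" "!!x. x : space M ==> \<bar>g x\<bar> <= B"
 shows "sqint M (%x. f x * g x)"
proof (rule sqint_bound[OF sqint_cmult[OF assms(1), of B]])
 show "(%x. f x * g x) : borel_measurable M" using assms by (auto simp: sqint_def)
 have "\<bar>f x * g x\<bar> <= \<bar>B * f x\<bar>" if "x : space M" for x
 proof -
  have "\<bar>f x\<bar> * \<bar>g x\<bar> <= \<bar>f x\<bar> * \<bar>B\<bar>" using assms(3)[OF that] by (intro mult_left_mono) auto
  then show ?thesis by (simp add: abs_mult mult.commute)
 qed
 then show "AE x in M. \<bar>f x * g x\<bar> <= \<bar>B * f x\<bar>" by simp
qed

lemma l2_le:
 assumes "sqint M f" "g : borel_measurable M" "AE x in M. \<bar>g x\<bar> <= \<bar>f x\<bar>"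
 shows "l2 M g <= l2 M f"
 unfolding l2_def real_sqrt_le_iff
 using assms sqint_bound[OF assms] by (intro integral_mono_AE) (auto simp: sqint_def abs_le_square_iff)

lemma l2_cong: "(!!x. x : space M ==> f x = g x) ==> l2 M f = l2 M g"
 unfolding l2_def by (metis (no_types, lifting) Bochner_Integration.integral_cong)

lemma l2_cong_AE:
 "f : borel_measurable M ==> g : borel_measurable M ==> (AE x in M. f x = g x) ==> l2 M f = l2 M g"
 unfolding l2_def by (subst integral_cong_AE[of _ _ "%x. (g x)^2"]) auto

lemma sqint_cong_AE:
 assumes "sqint M f" "g : borel_measurable M" "AE x in M. f x = g x" shows "sqint M g"
 by (rule sqint_bound[OF assms(1,2)]) (use assms(3) in auto)

lemma l2_cmult: "l2 M (%x. c * f x) = \<bar>c\<bar> * l2 M f"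
 by (simp add: l2_def power_mult_distrib real_sqrt_mult)

lemma l2_minus_commute: "l2 M (%x. f x - g x) = l2 M (%x. g x - f x)"
 by (simp add: l2_def power2_commute)

lemma l2_zero [simp]: "l2 M (%x. 0) = 0" by (simp add: l2_def)

lemma integral_power2_sub:
 assumes "sqint M f" "sqint M g"
 shows "(LINT x|M. (f x - t * g x)^2) = (l2 M f)^2 - 2 * t * (LINT x|M. f x * g x) + t^2 * (l2 M g)^2"
proof -
 have "(LINT x|M. (f x - t * g x)^2) = (LINT x|M. (f x)^2 - (2 * t) * (f x * g x) + t^2 * (g x)^2)"
  by (rule Bochner_Integration.integral_cong) (simp_all add: power2_eq_square algebra_simps)
 also have "... = (l2 M f)^2 - 2 * t * (LINT x|M. f x * g x) + t^2 * (l2 M g)^2"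
  using assms sqint_mult_integrable[OF assms] by (simp add: sqint_def l2_sq)
 finally show ?thesis .
qed

lemma l2_Cauchy_Schwarz:
 assumes "sqint M f" "sqint M g"
 shows "\<bar>LINT x|M. f x * g x\<bar> <= l2 M f * l2 M g"
proof -
 let ?C = "LINT x|M. f x * g x"
 have *: "0 <= (l2 M f)^2 - 2 * t * ?C + t^2 * (l2 M g)^2" for t
  by (subst integral_power2_sub[OF assms, symmetric]) simp
 have "?C^2 <= (l2 M f * l2 M g)^2"
 proof (cases "l2 M g = 0")
  case True
  have "?C = 0"
  proof (rule ccontr)
   assume "?C ~= 0"
   \<comment> \<open>For \<open>l2 M g = 0\<close> the nonnegative quadratic degenerates to an
     affine function of t, whose value here would be -1.\<close>
   with *[of "((l2 M f)^2 + 1) / (2 * ?C)"] True show False by simp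
  qed
  then show ?thesis by simp
 next
  case False
  define G where "G = (l2 M g)^2"
  have G: "G > 0" using False by (simp add: G_def)
  then have "(?C / G)^2 * G = ?C^2 / G" "2 * (?C / G) * ?C = 2 * (?C^2 / G)"
   by (simp_all add: power2_eq_square)
  with *[of "?C / G"] have "?C^2 / G <= (l2 M f)^2" unfolding G_def[symmetric] by linarith
  then show ?thesis using G by (simp add: G_def pos_divide_le_eq power_mult_distrib)
 qed
 then show ?thesis using l2_nonneg by (metis abs_le_square_iff abs_of_nonneg mult_nonneg_nonneg)
qed

lemma l2_triangle:
 assumes "sqint M f" "sqint M g"
 shows "l2 M (%x. f x + g x) <= l2 M f + l2 M g"
proof -
 have "(l2 M (%x. f x + g x))^2 = (l2 M f)^2 + 2 * (LINT x|M. f x * g x) + (l2 M g)^2"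
  using integral_power2_sub[OF assms, of "-1"] unfolding l2_sq[of M "%x. f x + g x"] by simp
 also have "... <= (l2 M f + l2 M g)^2"
  using l2_Cauchy_Schwarz[OF assms] by (simp add: power2_sum)
 finally show ?thesis using l2_nonneg by (meson add_nonneg_nonneg power2_le_imp_le)
qed

lemma l2_triangle_diff:
 assumes "sqint M f" "sqint M g"
 shows "l2 M (%x. f x - g x) <= l2 M f + l2 M g"
 using l2_triangle[OF assms(1) sqint_cmult[OF assms(2), of "-1"]] l2_cmult[of M "-1" g] by simp

lemma l2_triangle3:
 assumes "sqint M f" "sqint M g" "sqint M k"
 shows "l2 M (%x. f x - k x) <= l2 M (%x. f x - g x) + l2 M (%x. g x - k x)"
 using l2_triangle[OF sqint_diff[OF assms(1,2)] sqint_diff[OF assms(2,3)]] by simp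

lemma l2_sum_le:
 "(!!i. i : I ==> sqint M (f i)) ==> l2 M (%x. SUM i:I. f i x) <= (SUM i:I. l2 M (f i))"
proof (induction I rule: infinite_finite_induct)
 case (insert i I)
 then show ?case
  using l2_triangle[of M "f i" "%x. SUM i:I. f i x"] by (simp add: sqint_sum)
qed auto

lemma l2_zero_AE: "sqint M f ==> l2 M f = 0 ==> AE x in M. f x = 0"
 by (auto simp: l2_def sqint_def integral_nonneg_eq_0_iff_AE)

text \<open>Completeness of L^2, from which traces are obtained as limits. A subsequence with
  summable increments converges almost everywhere, and Fatou's lemma turns the Cauchy bound into a
  bound for the distance to the limit.\<close>

lemma l2_Cauchy_convergent:
 assumes f: "!!k. sqint M (f k)"
  and C: "!!e. e > 0 ==> EX N. ALL m>=N. ALL n>=N. l2 M (%x. f m x - f n x) < e"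
 shows "EX g. sqint M g & (%k. l2 M (%x. f k x - g x)) \<longlonglongrightarrow> 0"
proof -
 have [measurable]: "f k : borel_measurable M" for k using f by (simp add: sqint_def)
 obtain N where N: "!!k m n. m >= N k ==> n >= N k ==> l2 M (%x. f m x - f n x) < (1/2) ^ k"
 proof -
  have "ALL k. EX N. ALL m>=N. ALL n>=N. l2 M (%x. f m x - f n x) < (1/2) ^ k" using C by simp
  then show ?thesis using that by metis
 qed
 \<comment> \<open>Cumulative sums make the indices \<open>r k\<close> increasing and larger than
   \<open>N k\<close>, so that the increments along this subsequence have norm at most
   2^(-k).\<close>
 define r where "r k = (SUM j<=k. N j + 1)" for k
 have r1: "N k + 1 <= r k" for k unfolding r_def by (rule member_le_sum) auto
 have r2: "r k <= r (Suc k)" for k by (simp add: r_def)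
 have "k <= r k" for k by (induction k) (auto simp: r_def)
 then have rK: "filterlim r at_top sequentially"
  by (intro filterlim_at_top_mono[OF filterlim_ident]) auto
 define d where "d k x = f (r (Suc k)) x - f (r k) x" for k x
 have [measurable]: "d k : borel_measurable M" for k unfolding d_def by measurable
 have sd: "sqint M (%x. \<bar>d k x\<bar>)" for k
  using sqint_diff[OF f f] by (auto simp: sqint_def d_def)
 have ld: "l2 M (%x. \<bar>d k x\<bar>) <= (1/2)^k" for k
  using N[of k "r (Suc k)" "r k"] r1[of k] r2[of k] by (auto simp: l2_def d_def)
 define S where "S n x = (SUM k<n. \<bar>d k x\<bar>)" for n x
 have [measurable]: "S n : borel_measurable M" for n unfolding S_def by measurable
 have sS: "sqint M (S n)" for n unfolding S_def by (intro sqint_sum sd)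
 have "l2 M (S n) <= 2" for n
 proof -
  have "l2 M (S n) <= (SUM k<n. l2 M (%x. \<bar>d k x\<bar>))" unfolding S_def by (intro l2_sum_le sd)
  also have "... <= (SUM k<n. (1/2)^k)" by (intro sum_mono ld)
  also have "... <= 2" by (simp add: geometric_sum)
  finally show ?thesis .
 qed
 then have S4: "(\<integral>\<^sup>+x. ennreal ((S n x)^2) \<partial>M) <= 4" for n
 proof -
  have "(\<integral>\<^sup>+x. ennreal ((S n x)^2) \<partial>M) = ennreal ((l2 M (S n))^2)"
   unfolding l2_sq using sS by (intro nn_integral_eq_integral) (auto simp: sqint_def)
  also have "... <= ennreal (2^2)"
   using \<open>l2 M (S n) <= 2\<close> l2_nonneg[of M "S n"] by (intro ennreal_leI power_mono)
  finally show ?thesis by simp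
 qed
 have "(\<integral>\<^sup>+x. (SUP n. ennreal ((S n x)^2)) \<partial>M) = (SUP n. \<integral>\<^sup>+x. ennreal ((S n x)^2) \<partial>M)"
 proof (rule nn_integral_monotone_convergence_SUP)
  show "incseq (%n x. ennreal ((S n x)^2))"
   unfolding S_def by (auto simp: incseq_def le_fun_def intro!: ennreal_leI power_mono sum_mono2 sum_nonneg)
 qed auto
 also have "... <= 4" using S4 by (auto intro: SUP_least)
 finally have "(\<integral>\<^sup>+x. (SUP n. ennreal ((S n x)^2)) \<partial>M) ~= \<infinity>" by (auto simp: top_unique)
 then have "AE x in M. (SUP n. ennreal ((S n x)^2)) ~= \<infinity>" by (intro nn_integral_noteq_infinite) auto
 then have conv: "AE x in M. convergent (%k. f (r k) x)"
 proof eventually_elim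
  case (elim x)
  then obtain B where B: "B >= 0" "(SUP n. ennreal ((S n x)^2)) = ennreal B"
   by (metis ennreal_cases infinity_ennreal_def)
  have "ennreal ((S n x)^2) <= ennreal B" for n unfolding B(2)[symmetric] by (rule SUP_upper) simp
  then have "(S n x)^2 <= B" for n using B(1) by simp
  then have "S n x <= sqrt B" for n by (simp add: real_le_rsqrt)
  then have "summable (%k. \<bar>d k x\<bar>)"
   unfolding S_def by (intro summableI_nonneg_bounded) auto
  then have "summable (%k. d k x)" by (rule summable_rabs_cancel)
  then have "(%n. SUM k<n. d k x) \<longlonglongrightarrow> (\<Sum>k. d k x)" by (rule summable_LIMSEQ)
  then have "(%n. f (r n) x - f (r 0) x) \<longlonglongrightarrow> (\<Sum>k. d k x)"
   unfolding d_def sum_lessThan_telescope[of "%k. f (r k) x"] .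
  from tendsto_add[OF this tendsto_const[of "f (r 0) x"]] show ?case
   by (auto simp: convergent_def)
 qed
 define g where "g x = lim (%k. f (r k) x)" for x
 have [measurable]: "g : borel_measurable M" unfolding g_def by (rule borel_measurable_lim_metric) simp
 have gl: "AE x in M. (%k. f (r k) x) \<longlonglongrightarrow> g x"
  using conv by eventually_elim (simp add: g_def convergent_LIMSEQ_iff)
 have bound: "integrable M (%x. (f n x - g x)^2) & l2 M (%x. f n x - g x) <= e"
  if e: "e > 0" and n: "ALL m>=K. ALL n>=K. l2 M (%x. f m x - f n x) < e" "n >= K" for e n K
 proof -
  have "(\<integral>\<^sup>+x. ennreal ((f n x - g x)^2) \<partial>M) = (\<integral>\<^sup>+x. liminf (%k. ennreal ((f n x - f (r k) x)^2)) \<partial>M)"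
  proof (rule nn_integral_cong_AE, use gl in eventually_elim)
   fix x assume "(%k. f (r k) x) \<longlonglongrightarrow> g x"
   then have "(%k. ennreal ((f n x - f (r k) x)^2)) \<longlonglongrightarrow> ennreal ((f n x - g x)^2)"
    by (intro tendsto_intros) auto
   then show "ennreal ((f n x - g x)^2) = liminf (%k. ennreal ((f n x - f (r k) x)^2))"
    by (rule lim_imp_Liminf[OF trivial_limit_sequentially, symmetric])
  qed
  also have "... <= liminf (%k. \<integral>\<^sup>+x. ennreal ((f n x - f (r k) x)^2) \<partial>M)"
   by (rule nn_integral_liminf) auto
  also have "... <= liminf (%k::nat. ennreal (e^2))"
  proof (rule Liminf_mono)
   have "eventually (%k. r k >= K) sequentially"
    using filterlim_at_top[of r sequentially] rK by blast
   then show "\<forall>\<^sub>F k in sequentially. (\<integral>\<^sup>+x. ennreal ((f n x - f (r k) x)^2) \<partial>M) <= ennreal (e^2)"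
   proof eventually_elim
    case (elim k)
    have "(\<integral>\<^sup>+x. ennreal ((f n x - f (r k) x)^2) \<partial>M) = ennreal ((l2 M (%x. f n x - f (r k) x))^2)"
     unfolding l2_sq using sqint_diff[OF f f] by (intro nn_integral_eq_integral) (auto simp: sqint_def)
    also have "... <= ennreal (e^2)"
     using n elim l2_nonneg[of M "%x. f n x - f (r k) x"] by (intro ennreal_leI power_mono) (auto simp: less_imp_le)
    finally show ?case .
   qed
  qed
  finally have *: "(\<integral>\<^sup>+x. ennreal ((f n x - g x)^2) \<partial>M) <= ennreal (e^2)"
   by (simp add: Liminf_const)
  then have I: "integrable M (%x. (f n x - g x)^2)"
   by (intro integrableI_bounded) (auto simp: le_less_trans[OF _ ennreal_less_top])
  then have "ennreal ((l2 M (%x. f n x - g x))^2) <= ennreal (e^2)"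
   unfolding l2_sq using * by (subst nn_integral_eq_integral[symmetric]) auto
  then have "(l2 M (%x. f n x - g x))^2 <= e^2" by (simp add: ennreal_le_iff)
  then show ?thesis using I e by (auto intro: power2_le_imp_le)
 qed
 have "sqint M g"
 proof -
  obtain K where "ALL m>=K. ALL n>=K. l2 M (%x. f m x - f n x) < 1" using C[of 1] by auto
  then have "integrable M (%x. (f K x - g x)^2)" using bound[of 1 K K] by simp
  then have "sqint M (%x. f K x - g x)" by (simp add: sqint_def)
  from sqint_diff[OF f[of K] this] show ?thesis by simp
 qed
 moreover have "(%k. l2 M (%x. f k x - g x)) \<longlonglongrightarrow> 0"
 proof (rule LIMSEQ_I)
  fix e :: real assume "e > 0"
  then obtain K where "ALL m>=K. ALL n>=K. l2 M (%x. f m x - f n x) < e/2" using C[of "e/2"] by auto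
  then have *: "l2 M (%x. f n x - g x) <= e/2" if "n >= K" for n using bound[of "e/2" K n] that \<open>e > 0\<close> by simp
  show "EX no. ALL n>=no. norm (l2 M (%x. f n x - g x) - 0) < e"
  proof (intro exI allI impI)
   fix n assume "K <= n"
   then show "norm (l2 M (%x. f n x - g x) - 0) < e"
    using *[of n] \<open>e > 0\<close> l2_nonneg[of M "%x. f n x - g x"] by simp
  qed
 qed
 ultimately show ?thesis by auto
qed

section \<open>Integration in the plane\<close>

lemma UNIV_2_eq: "(UNIV::2 set) = {1, 2}" by (auto simp: UNIV_2)

text \<open>Tonelli's and Fubini's theorems live on product measures; this carries Lebesgue measure
  on pairs of reals over to \<open>real^2\<close> along the coordinate map.\<close>

lemma lborel_plane_coordinates:
 "(lborel :: plane measure) = distr (lborel :: (real \<times> real) measure) borel (%(s, t). s *\<^sub>R axis 1 1 + t *\<^sub>R axis 2 1)"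
  (is "_ = distr _ _ ?f")
proof (rule lborel_eqI)
 have f[measurable]: "?f : borel_measurable borel"
  by (intro borel_measurable_continuous_onI) (auto simp: case_prod_unfold intro!: continuous_intros)
 show "emeasure (distr lborel borel ?f) (box l u) = ennreal (PROD b:Basis. (u - l) \<bullet> b)"
  if *: "!!b. b : Basis ==> l \<bullet> b <= u \<bullet> b" for l u :: plane
 proof -
  have "axis i 1 : (Basis :: plane set)" for i by (auto simp: Basis_vec_def)
  then have le: "l $ i <= u $ i" for i using *[of "axis i 1"] by (simp add: inner_axis)
  have "?f -` box l u = box (l $ 1, l $ 2) (u $ 1, u $ 2)"
   by (auto simp: mem_box_cart mem_box Basis_prod_def forall_2 axis_def)
  then have "emeasure (distr lborel borel ?f) (box l u) = emeasure lborel (box (l $ 1, l $ 2) (u $ 1, u $ 2))"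
   by (subst emeasure_distr) auto
  also have "... = ennreal (PROD b:Basis. ((u $ 1, u $ 2) - (l $ 1, l $ 2)) \<bullet> b)"
   using le by (intro emeasure_lborel_box) (auto simp: Basis_prod_def)
  also have "(PROD b:Basis. ((u $ 1, u $ 2) - (l $ 1, l $ 2)) \<bullet> b) = (u $ 1 - l $ 1) * (u $ 2 - l $ 2)"
   by (simp add: Basis_prod_def prod.union_disjoint prod.reindex inj_on_def)
  also have "... = (PROD b:Basis. (u - l) \<bullet> b)"
  proof -
   have "(PROD b:Basis. (u - l) \<bullet> b) = (PROD i:UNIV. (u - l) \<bullet> axis i 1)"
    by (rule prod.reindex_bij_betw[symmetric]) (auto simp: bij_betw_def inj_on_def axis_eq_axis Basis_vec_def)
   then show ?thesis by (simp add: inner_axis UNIV_2_eq)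
  qed
  finally show ?thesis .
 qed
qed simp

text \<open>Linear change of variables with arbitrary spanning vectors: the preimage of a box is a
  parallelogram, measured by the determinant formula for linear images. Coordinate lines and the
  skew parallelograms inside triangles are both special cases.\<close>

lemma lborel_plane_affine:
 fixes p u w :: plane
 defines "D \<equiv> u $ 1 * w $ 2 - u $ 2 * w $ 1"
 assumes "D ~= 0"
 shows "lborel = density (distr (lborel :: (real \<times> real) measure) borel (%(s, t). p + s *\<^sub>R u + t *\<^sub>R w)) (%_. ennreal \<bar>D\<bar>)"
proof (rule lborel_eqI)
 let ?f = "%(s, t). p + s *\<^sub>R u + t *\<^sub>R w"
 define L :: "plane => plane" where "L x = (x $ 1) *\<^sub>R u + (x $ 2) *\<^sub>R w" for x
 have linL: "linear L" unfolding L_def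
  by (auto intro!: linearI simp: algebra_simps)
 have detL: "det (matrix L) = D"
  by (simp add: det_2 matrix_def L_def D_def axis_def)
 have "inj L" using detL assms(2) det_nz_iff_inj[OF linL] by simp
 then obtain L' where L': "linear L'" "!!x. L' (L x) = x" "!!x. L (L' x) = x"
  using linear_injective_isomorphism[OF linL] by auto
 have f[measurable]: "?f : borel_measurable borel"
  by (intro borel_measurable_continuous_onI) (auto simp: case_prod_unfold intro!: continuous_intros)
 have g[measurable]: "(%(s, t). s *\<^sub>R axis 1 1 + t *\<^sub>R axis 2 1 :: plane) : borel_measurable borel"
  by (intro borel_measurable_continuous_onI) (auto simp: case_prod_unfold intro!: continuous_intros)
 show "emeasure (density (distr lborel borel ?f) (%_. ennreal \<bar>D\<bar>)) (box l r) = ennreal (PROD b:Basis. (r - l) \<bullet> b)"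
  if *: "!!b. b : Basis ==> l \<bullet> b <= r \<bullet> b" for l r
 proof -
  define B where "B = (%x. x - p) ` box l r"
  define S where "S = L' ` B"
  have B: "B : lmeasurable" unfolding B_def by (rule measurable_translation_subtract) simp
  have S: "S : lmeasurable" unfolding S_def by (rule measurable_linear_image[OF L'(1) B])
  have LS: "L ` S = B" unfolding S_def using L' by (auto simp: image_image)
  have S': "S = {x. p + L x : box l r}"
   unfolding S_def B_def using L' by (auto simp: image_iff) (metis add_diff_cancel_left')
  have "continuous_on UNIV (%x. p + L x)" using linL by (intro continuous_on_add continuous_on_const linear_continuous_on) (simp add: linear_conv_bounded_linear)
  then have "open S" unfolding S'
   using open_vimage[of "box l r" "%x. p + L x"] by (auto simp: vimage_def)
  then have [measurable]: "S : sets borel" by simp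
  have "emeasure (density (distr lborel borel ?f) (%_. ennreal \<bar>D\<bar>)) (box l r) = ennreal \<bar>D\<bar> * emeasure (lborel :: (real \<times> real) measure) (?f -` box l r)"
   by (subst emeasure_density_const) (auto simp: emeasure_distr)
  also have "?f -` box l r = (%(s, t). s *\<^sub>R axis 1 1 + t *\<^sub>R axis 2 1) -` S"
   unfolding S' by (auto simp: L_def axis_def algebra_simps)
  also have "emeasure lborel ... = emeasure lborel S"
   using arg_cong[OF lborel_plane_coordinates, of "%M. emeasure M S"] by (simp add: emeasure_distr)
  also have "emeasure lborel S = ennreal (measure lebesgue S)"
   using emeasure_eq_measure2[OF S] by simp
  also have "ennreal \<bar>D\<bar> * ... = ennreal (measure lebesgue B)"
   using measure_linear_image[OF linL S] by (simp add: LS detL ennreal_mult)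
  also have "measure lebesgue B = measure lebesgue (box l r)"
   unfolding B_def by (rule measure_translation_subtract)
  also have "ennreal ... = ennreal (PROD b:Basis. (r - l) \<bullet> b)"
   using * by (simp add: measure_lborel_box_eq)
  finally show ?thesis .
 qed
qed simp

lemma nn_integral_parallelogram:
 fixes p u w :: plane and f :: "plane => ennreal"
 assumes "u $ 1 * w $ 2 - u $ 2 * w $ 1 ~= 0" and [measurable]: "f : borel_measurable borel"
 shows "(\<integral>\<^sup>+x. f x \<partial>lborel) = ennreal \<bar>u $ 1 * w $ 2 - u $ 2 * w $ 1\<bar> *
  (\<integral>\<^sup>+s. \<integral>\<^sup>+t. f (p + s *\<^sub>R u + t *\<^sub>R w) \<partial>lborel \<partial>lborel)"
proof -
 have [measurable]: "(%(s, t). p + s *\<^sub>R u + t *\<^sub>R w) : borel_measurable borel"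
  by (intro borel_measurable_continuous_onI) (auto simp: case_prod_unfold intro!: continuous_intros)
 have "(\<integral>\<^sup>+x. f x \<partial>lborel) = ennreal \<bar>u $ 1 * w $ 2 - u $ 2 * w $ 1\<bar> *
  (\<integral>\<^sup>+z. f (case z of (s, t) => p + s *\<^sub>R u + t *\<^sub>R w) \<partial>lborel)"
  by (subst lborel_plane_affine[OF assms(1), of p])
   (auto simp: nn_integral_density nn_integral_distr nn_integral_cmult)
 also have "(\<integral>\<^sup>+z. f (case z of (s, t) => p + s *\<^sub>R u + t *\<^sub>R w) \<partial>lborel) =
  (\<integral>\<^sup>+s. \<integral>\<^sup>+t. f (p + s *\<^sub>R u + t *\<^sub>R w) \<partial>lborel \<partial>lborel)"
  using lborel.nn_integral_fst[of "%z. f (case z of (s, t) => p + s *\<^sub>R u + t *\<^sub>R w)" lborel]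
  by (simp add: lborel_prod)
 finally show ?thesis .
qed

lemma other_coordinate:
 obtains j :: 2 where "j ~= i" "UNIV = {i, j}" "\<bar>(axis i 1 :: plane) $ 1 * axis j 1 $ 2 - axis i 1 $ 2 * axis j 1 $ 1\<bar> = 1"
proof (cases "i = 1")
 case True
 show ?thesis by (rule that[of 2]) (auto simp: True UNIV_2_eq axis_def)
next
 case False
 then have "i = 2" using exhaust_2 by blast
 then show ?thesis by (intro that[of 1]) (auto simp: UNIV_2_eq axis_def)
qed

text \<open>Fubini along the lines in coordinate direction, on each of which the fundamental theorem of
 calculus applies.\<close>

lemma integral_derivative_eq_zero:
 fixes F G :: "plane => real" and i j :: 2
 assumes ij: "j ~= i" and int: "integrable lborel G" and "finite N"
  and cont: "!!t. t ~: N ==> continuous_on UNIV (%s. F (s *\<^sub>R axis i 1 + t *\<^sub>R axis j 1))"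
  and der: "!!t. t ~: N ==> EX S. finite S & (ALL s. s ~: S -->
    ((%s. F (s *\<^sub>R axis i 1 + t *\<^sub>R axis j 1)) has_vector_derivative G (s *\<^sub>R axis i 1 + t *\<^sub>R axis j 1)) (at s))"
  and supp: "!!x. norm x > R ==> F x = 0" "!!x. norm x > R ==> G x = 0"
 shows "(LINT x|lborel. G x) = 0"
proof -
 let ?f = "%(s, t). s *\<^sub>R axis i 1 + t *\<^sub>R axis j 1 :: plane"
 have D: "\<bar>(axis i 1 :: plane) $ 1 * axis j 1 $ 2 - axis i 1 $ 2 * axis j 1 $ 1\<bar> = 1"
  using ij exhaust_2[of i] exhaust_2[of j] by (auto simp: axis_def)
 have f[measurable]: "?f : borel_measurable borel"
  by (intro borel_measurable_continuous_onI) (auto simp: case_prod_unfold intro!: continuous_intros)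
 have eq: "lborel = distr lborel borel ?f"
  using lborel_plane_affine[of "axis i 1" "axis j 1" 0] D by (simp add: density_1)
 have [measurable]: "G : borel_measurable borel" using borel_measurable_integrable[OF int] by simp
 have I: "integrable (lborel \<Otimes>\<^sub>M lborel) (%(s, t). G (s *\<^sub>R axis i 1 + t *\<^sub>R axis j 1))"
 proof -
  have "integrable (distr lborel borel ?f) G" using int unfolding eq[symmetric] .
  moreover have "?f : measurable lborel borel" using f by simp
  ultimately show ?thesis using integrable_distr[of ?f lborel borel G] by (simp add: lborel_prod case_prod_unfold)
 qed
 have "(LINT x|lborel. G x) = (LINT z|lborel. G (?f z))"
  using integral_distr[of ?f lborel borel G] f by (simp add: eq[symmetric])
 also have "... = integral\<^sup>L (lborel \<Otimes>\<^sub>M lborel) (%(s, t). G (s *\<^sub>R axis i 1 + t *\<^sub>R axis j 1))"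
  by (simp add: lborel_prod case_prod_unfold)
 also have "... = (LINT t|lborel. LINT s|lborel. G (s *\<^sub>R axis i 1 + t *\<^sub>R axis j 1))"
  using lborel_pair.integral_snd[OF I] by simp
 also have "... = 0"
 proof (rule integral_eq_zero_AE)
  have "AE t in lborel. integrable lborel (%s. G (s *\<^sub>R axis i 1 + t *\<^sub>R axis j 1))"
   using lborel_pair.AE_integrable_snd[OF I] by simp
  moreover have "AE t in lborel. t ~: N"
   by (rule AE_not_in) (use \<open>finite N\<close> in \<open>simp add: finite_imp_null_set_lborel\<close>)
  ultimately show "AE t in lborel. (LINT s|lborel. G (s *\<^sub>R axis i 1 + t *\<^sub>R axis j 1)) = 0"
  proof eventually_elim
   case (elim t)
   let ?x = "%s. s *\<^sub>R axis i 1 + t *\<^sub>R axis j 1 :: plane"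
   obtain S where S: "finite S" "!!s. s ~: S ==> ((%s. F (?x s)) has_vector_derivative G (?x s)) (at s)"
    using der[OF elim(2)] by auto
   \<comment> \<open>From \<open>\<bar>s\<bar> = r\<close> on, the point has norm larger than
     \<open>R\<close>, so the fundamental theorem on [-r, r] gives 0 - 0.\<close>
   define r where "r = \<bar>R\<bar> + 1"
   have big: "norm (?x s) > R" if "\<bar>s\<bar> >= r" for s
   proof -
    have "\<bar>?x s $ i\<bar> <= norm (?x s)" by (rule component_le_norm_cart)
    moreover have "?x s $ i = s" using ij by (simp add: axis_def)
    ultimately have "\<bar>s\<bar> <= norm (?x s)" by metis
    then show ?thesis using that by (simp add: r_def)
   qed
   have "((%s. G (?x s)) has_integral F (?x r) - F (?x (-r))) {-r..r}"
    by (rule fundamental_theorem_of_calculus_interior_strong[OF S(1)])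
     (use S(2) continuous_on_subset[OF cont[OF elim(2)]] in \<open>auto simp: r_def\<close>)
   moreover have "F (?x r) = 0" "F (?x (-r)) = 0"
    using supp(1)[OF big[of r]] supp(1)[OF big[of "-r"]] by (simp_all add: r_def)
   ultimately have "((%s. G (?x s)) has_integral 0) {-r..r}" by simp
   then have "((%s. G (?x s)) has_integral 0) UNIV"
    by (rule has_integral_on_superset) (use supp(2)[OF big] in auto)
   then have "integral UNIV (%s. G (?x s)) = 0" by (rule integral_unique)
   then show ?case using integral_lborel[OF elim(1)] by simp
  qed
 qed
 finally show ?thesis .
qed

subsection \<open>Inequalities on the unit interval\<close>

lemma sqint_continuous_interval:
 assumes "continuous_on {a..b} (f :: real => real)" shows "sqint (lebesgue_on {a..b}) f"
proof -
 have "integrable (lebesgue_on {a..b}) (%x. (f x)^2)"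
  by (intro continuous_imp_integrable_real continuous_intros assms)
 moreover have "integrable (lebesgue_on {a..b}) f" by (intro continuous_imp_integrable_real assms)
 ultimately show ?thesis by (auto simp: sqint_def)
qed

text \<open>The fundamental theorem and Cauchy-Schwarz on [0, r]; the length r is at most 1 and
  drops out.\<close>

lemma power2_diff_le_integral_derivative:
 fixes f f' :: "real => real"
 assumes "!!t. t : {0..1} ==> (f has_real_derivative f' t) (at t)" "continuous_on {0..1} f'" "r : {0..1}"
 shows "(f r - f 0)^2 <= (LINT t|lebesgue_on {0..1}. (f' t)^2)"
proof -
 let ?M = "lebesgue_on {0..r}"
 have c: "continuous_on {0..r} f'" using assms(2,3) by (auto intro: continuous_on_subset)
 have sq: "sqint ?M f'" by (rule sqint_continuous_interval[OF c])
 have sq1: "sqint (lebesgue_on {0..1}) f'" by (rule sqint_continuous_interval[OF assms(2)])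
 have "(f' has_integral (f r - f 0)) {0..r}"
  by (rule fundamental_theorem_of_calculus)
   (use assms in \<open>auto simp: has_real_derivative_iff_has_vector_derivative[symmetric] intro: has_field_derivative_at_within\<close>)
 then have "f r - f 0 = integral {0..r} f'" by (simp add: integral_unique)
 also have "... = (LINT t|?M. f' t)"
  using continuous_imp_integrable_real[OF c] by (simp add: lebesgue_integral_eq_integral)
 finally have "\<bar>f r - f 0\<bar> = \<bar>LINT t|?M. f' t * 1\<bar>" by simp
 also have "... <= l2 ?M f' * l2 ?M (%_. 1)"
  by (rule l2_Cauchy_Schwarz[OF sq sqint_continuous_interval]) simp
 also have "l2 ?M (%_. 1) = sqrt r" using assms(3) by (simp add: l2_def measure_restrict_space)
 also have "l2 ?M f' * sqrt r <= l2 ?M f' * 1" using assms(3) l2_nonneg by (intro mult_left_mono) auto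
 finally have "\<bar>f r - f 0\<bar>^2 <= (l2 ?M f')^2" by (intro power_mono) auto
 then have "(f r - f 0)^2 <= (l2 ?M f')^2" by simp
 also have "... <= (LINT t|lebesgue_on {0..1}. (f' t)^2)"
 proof -
  have "(LINT t|?M. (f' t)^2) = (LINT t|lebesgue. indicator {0..r} t * (f' t)^2)"
   by (subst integral_restrict_space) auto
  also have "... <= (LINT t|lebesgue. indicator {0..1} t * (f' t)^2)"
   using sqint_integrable[OF sq] sqint_integrable[OF sq1] assms(3)
   by (intro integral_mono) (auto simp: integrable_restrict_space split: split_indicator)
  also have "... = (LINT t|lebesgue_on {0..1}. (f' t)^2)" by (subst integral_restrict_space) auto
  finally show ?thesis by (simp add: l2_sq)
 qed
 finally show ?thesis .
qed

text \<open>The one-dimensional trace inequality: (f 0)^2 is at most 2 (f t)^2 + 2 (f t - f 0)^2,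
  averaged over t.\<close>

lemma power2_le_integral_derivative:
 fixes f f' :: "real => real"
 assumes der: "!!t. t : {0..1} ==> (f has_real_derivative f' t) (at t)" and "continuous_on {0..1} f'"
 shows "(f 0)^2 <= (LINT t|lebesgue_on {0..1}. 2 * (f t)^2 + 2 * (f' t)^2)"
proof -
 let ?M = "lebesgue_on {0..1::real}"
 let ?A = "LINT t|?M. (f' t)^2"
 have c: "continuous_on {0..1} f"
  using der by (intro continuous_at_imp_continuous_on) (use der DERIV_isCont in blast)
 have int: "integrable ?M (%t. (f t)^2)" "integrable ?M (%t. (f' t)^2)"
  using sqint_continuous_interval[OF c] sqint_continuous_interval[OF assms(2)] by (auto simp: sqint_def)
 have "(f 0)^2 = (LINT t|?M. (f 0)^2)" by (simp add: measure_restrict_space)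
 also have "... <= (LINT t|?M. 2 * (f t)^2 + 2 * ?A)"
 proof (rule integral_mono)
  fix t assume "t : space ?M"
  then have "(f t - f 0)^2 <= ?A" using power2_diff_le_integral_derivative[OF assms] by simp
  moreover have "(f 0)^2 <= 2 * (f t)^2 + 2 * (f t - f 0)^2"
   using zero_le_power2[of "2 * f t - f 0"] by (simp add: power2_eq_square algebra_simps)
  ultimately show "(f 0)^2 <= 2 * (f t)^2 + 2 * ?A" by simp
 qed (use int in \<open>auto simp: finite_measure.integrable_const\<close>)
 also have "... = (LINT t|?M. 2 * (f t)^2 + 2 * (f' t)^2)"
  using int by (simp add: measure_restrict_space finite_measure.integrable_const)
 finally show ?thesis .
qed

section \<open>Mollification\<close>

lemma sqint_lborel_translate:
 fixes f :: "plane => real"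
 assumes "sqint lborel f"
 shows "sqint lborel (%x. f (c + x))" "l2 lborel (%x. f (c + x)) = l2 lborel f"
proof -
 have [measurable]: "f : borel_measurable borel" using assms by (simp add: sqint_def)
 have "integrable (distr lborel borel ((+) c)) (%x. (f x)^2)"
  using assms by (simp add: lborel_distr_plus sqint_def)
 then have "integrable lborel (%x. (f (c + x))^2)" by (rule integrable_distr[rotated]) simp
 then show "sqint lborel (%x. f (c + x))" by (simp add: sqint_def)
 have "(LINT x|distr lborel borel ((+) c). (f x)^2) = (LINT x|lborel. (f (c + x))^2)"
  by (rule integral_distr) auto
 then show "l2 lborel (%x. f (c + x)) = l2 lborel f" by (simp add: l2_def lborel_distr_plus)
qed

lemma integrable_continuous_bounded_support:
 fixes f :: "plane => real"
 assumes "continuous_on UNIV f" "!!x. norm x > R ==> f x = 0"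
 shows "integrable lborel f"
proof -
 have "integrable lborel (%x. indicator (cball 0 R) x *\<^sub>R f x)"
  by (rule borel_integrable_compact) (use assms(1) continuous_on_subset in auto)
 moreover have "(%x. indicator (cball 0 R) x *\<^sub>R f x) = f"
  using assms(2) by (auto split: split_indicator)
 ultimately show ?thesis by simp
qed

lemma sqint_continuous_bounded_support:
 fixes f :: "plane => real"
 assumes "continuous_on UNIV f" "!!x. norm x > R ==> f x = 0"
 shows "sqint lborel f"
 unfolding sqint_def
proof
 show "f : borel_measurable lborel" using assms(1) borel_measurable_continuous_onI by simp
 show "integrable lborel (%x. (f x)^2)"
  by (rule integrable_continuous_bounded_support[of _ R]) (use assms in \<open>auto intro!: continuous_intros\<close>)
qed

definition clamp1 :: "real => real => real" where "clamp1 m y = max (- m) (min m y)"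

lemma clamp1_abs: "0 <= m ==> \<bar>clamp1 m y\<bar> <= m" "0 <= m ==> \<bar>clamp1 m y\<bar> <= \<bar>y\<bar>" "\<bar>y\<bar> <= m ==> clamp1 m y = y"
 by (auto simp: clamp1_def)

definition cutoff :: "real => plane => real" where "cutoff m x = max 0 (min 1 (m + 1 - norm x))"

lemma cutoff_bounds: "0 <= cutoff m x" "cutoff m x <= 1" "norm x <= m ==> cutoff m x = 1" "norm x > m + 1 ==> cutoff m x = 0"
 by (auto simp: cutoff_def)

lemma continuous_on_clamp1: "continuous_on S f ==> continuous_on S (%x. clamp1 m (f x))"
 unfolding clamp1_def by (intro continuous_intros)

lemma continuous_on_cutoff: "continuous_on S (cutoff m)"
 unfolding cutoff_def by (intro continuous_intros)

lemma l2_tendsto_0_dominated: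
 assumes "!!n. g n : borel_measurable M" "AE x in M. (%n. g n x) \<longlonglongrightarrow> 0" "sqint M w" "!!n x. \<bar>g n x\<bar> <= \<bar>w x\<bar>"
 shows "(%n. l2 M (g n)) \<longlonglongrightarrow> 0"
proof -
 have "(%n. LINT x|M. (g n x)^2) \<longlonglongrightarrow> (LINT x|M. 0)"
 proof (rule integral_dominated_convergence[where w="%x. (w x)^2"])
  show "AE x in M. (%n. (g n x)^2) \<longlonglongrightarrow> 0"
   using assms(2) by eventually_elim (auto intro!: tendsto_eq_intros)
  show "AE x in M. norm ((g n x)^2) <= (w x)^2" for n using assms(4) by (simp add: abs_le_square_iff)
 qed (use assms(1,3) in \<open>auto simp: sqint_def\<close>)
 then have "(%n. sqrt (LINT x|M. (g n x)^2)) \<longlonglongrightarrow> sqrt 0" by (intro tendsto_real_sqrt) simp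
 then show ?thesis by (simp add: l2_def)
qed

text \<open>Truncation in value and in space brings f close to a bounded function of bounded
  support. A measurable function is an almost everywhere limit of continuous ones; after the same
  truncation these have a common square integrable majorant, so the limit holds in L^2.\<close>

lemma L2_dense_continuous:
 fixes f :: "plane => real"
 assumes f: "sqint lborel f" and "e > 0"
 obtains g R where "continuous_on UNIV g" "!!x. norm x > R ==> g x = 0" "l2 lborel (%x. f x - g x) < e"
proof -
 have [measurable]: "f : borel_measurable borel" using f by (simp add: sqint_def)
 have cl[measurable]: "clamp1 m : borel_measurable borel" "cutoff m : borel_measurable borel" for m
  using continuous_on_clamp1[OF continuous_on_id, of UNIV m] continuous_on_cutoff[of UNIV m]
  by (auto intro: borel_measurable_continuous_onI simp: id_def)
 define F where "F n x = clamp1 (real n) (f x) * cutoff (real n) x" for n x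
 have [measurable]: "F n : borel_measurable borel" for n unfolding F_def by measurable
 have Fle: "\<bar>F n x\<bar> <= \<bar>f x\<bar>" for n x
  unfolding F_def abs_mult using clamp1_abs(2)[of "real n" "f x"] cutoff_bounds(1,2)[of "real n" x]
  by (metis abs_ge_zero abs_of_nonneg mult_left_le of_nat_0_le_iff order_trans)
 have L1: "(%n. l2 lborel (%x. f x - F n x)) \<longlonglongrightarrow> 0"
 proof (rule l2_tendsto_0_dominated[where w="%x. 2 * f x"])
  show "AE x in lborel. (%n. f x - F n x) \<longlonglongrightarrow> 0"
  proof (intro AE_I2 tendsto_eventually)
   fix x
   show "\<forall>\<^sub>F n in sequentially. f x - F n x = 0"
   proof (rule eventually_sequentiallyI)
    fix n assume "nat \<lceil>max \<bar>f x\<bar> (norm x)\<rceil> <= n"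
    then have "\<bar>f x\<bar> <= real n" "norm x <= real n" by (linarith, linarith)
    then show "f x - F n x = 0" by (simp add: F_def clamp1_abs cutoff_bounds)
   qed
  qed
  show "\<bar>f x - F n x\<bar> <= \<bar>2 * f x\<bar>" for n x using Fle[of n x] by linarith
 qed (use f in \<open>auto intro: sqint_cmult\<close>)
 obtain m where m: "l2 lborel (%x. f x - F m x) < e / 2"
  using eventually_happens[OF order_tendstoD(2)[OF L1, of "e/2"]] \<open>e > 0\<close> by auto
 have "f : borel_measurable lebesgue" by (intro measurable_completion) simp
 then have "f measurable_on UNIV" by (rule lebesgue_measurable_imp_measurable_on_real) simp
 then obtain N g where N: "negligible N" and g: "!!n. continuous_on UNIV (g n)"
  and lim: "!!x. x ~: N ==> (%n. g n x) \<longlonglongrightarrow> f x"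
  unfolding measurable_on_def by auto
 define G where "G n x = clamp1 (real m) (g n x) * cutoff (real m) x" for n x
 have Gc: "continuous_on UNIV (G n)" for n
  unfolding G_def by (intro continuous_intros continuous_on_clamp1 g continuous_on_cutoff)
 have [measurable]: "G n : borel_measurable borel" for n by (rule borel_measurable_continuous_onI[OF Gc])
 have Gsupp: "G n x = 0" if "norm x > real m + 1" for n x using that by (simp add: G_def cutoff_bounds)
 have Fm: "sqint lborel (F m)"
  by (rule sqint_bound[OF f]) (use Fle in auto)
 have L2: "(%n. l2 lborel (%x. F m x - G n x)) \<longlonglongrightarrow> 0"
 proof (rule l2_tendsto_0_dominated[where w="%x. 2 * real m * cutoff (real m) x"])
  have "AE x in lebesgue. x ~: N" using N by (auto simp: negligible_iff_null_sets intro: AE_not_in)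
  then have "AE x in lborel. x ~: N" by (simp add: AE_completion_iff)
  then show "AE x in lborel. (%n. F m x - G n x) \<longlonglongrightarrow> 0"
  proof eventually_elim
   case (elim x)
   have "(%n. F m x - G n x) \<longlonglongrightarrow> F m x - clamp1 (real m) (f x) * cutoff (real m) x"
    unfolding G_def clamp1_def by (intro tendsto_intros lim elim)
   then show ?case by (simp add: F_def)
  qed
  show "\<bar>F m x - G n x\<bar> <= \<bar>2 * real m * cutoff (real m) x\<bar>" for n x
  proof -
   have "\<bar>clamp1 (real m) (f x) - clamp1 (real m) (g n x)\<bar> <= 2 * real m"
    using clamp1_abs(1)[of "real m" "f x"] clamp1_abs(1)[of "real m" "g n x"] by simp
   then show ?thesis
    using cutoff_bounds(1)[of "real m" x] unfolding F_def G_def left_diff_distrib[symmetric] abs_mult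
    by (simp add: mult_right_mono)
  qed
  show "sqint lborel (%x. 2 * real m * cutoff (real m) x)"
   by (intro sqint_cmult sqint_continuous_bounded_support[of _ "real m + 1"] continuous_on_cutoff) (simp add: cutoff_bounds)
 qed auto
 obtain n where n: "l2 lborel (%x. F m x - G n x) < e / 2"
  using eventually_happens[OF order_tendstoD(2)[OF L2, of "e/2"]] \<open>e > 0\<close> by auto
 have "l2 lborel (%x. f x - G n x) <= l2 lborel (%x. f x - F m x) + l2 lborel (%x. F m x - G n x)"
  by (intro l2_triangle3 f Fm sqint_continuous_bounded_support[OF Gc Gsupp])
 also have "... < e" using m n by simp
 finally show ?thesis using that[OF Gc Gsupp] by blast
qed

lemma L2_translation_continuous:
 fixes f :: "plane => real"
 assumes f: "sqint lborel f" and "e > 0"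
 shows "EX d>0. ALL k. norm k < d --> l2 lborel (%x. f (k + x) - f x) < e"
proof -
 obtain g R where g: "continuous_on UNIV g" "!!x. norm x > R ==> g x = 0" "l2 lborel (%x. f x - g x) < e / 3"
  using L2_dense_continuous[OF f, of "e/3"] \<open>e > 0\<close> by auto
 have sg: "sqint lborel g" by (rule sqint_continuous_bounded_support[OF g(1,2)])
 define Q where "Q = max R 0 + 1"
 have uc: "uniformly_continuous_on (cball 0 (Q + 1)) g"
  by (intro compact_uniformly_continuous continuous_on_subset[OF g(1)]) auto
 define V where "V = measure lborel (cball (0::plane) Q)"
 \<comment> \<open>A difference below \<open>e'\<close> on a ball of measure \<open>V\<close> has
   L^2 norm at most \<open>e' * sqrt V\<close>, hence below e/3; the summand 1 keeps the denominator
   positive.\<close>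
 define e' where "e' = e / 3 / (sqrt V + 1)"
 have V: "V >= 0" by (simp add: V_def)
 have e': "e' > 0" using \<open>e > 0\<close> V by (simp add: e'_def add_nonneg_pos)
 obtain d0 where d0: "d0 > 0" "!!x y. x : cball 0 (Q+1) ==> y : cball 0 (Q+1) ==> dist y x < d0 ==> dist (g y) (g x) < e'"
  using uc e' unfolding uniformly_continuous_on_def by metis
 have "l2 lborel (%x. f (k + x) - f x) < e" if k: "norm k < min d0 1" for k
 proof -
  have cg: "continuous_on UNIV (%x. g (k + x) - g x)"
   by (intro continuous_intros continuous_on_compose2[OF g(1)]) auto
  have "l2 lborel (%x. g (k + x) - g x) <= l2 lborel (%x. e' * indicator (cball (0::plane) Q) x)"
  proof (rule l2_le)
   show "sqint lborel (%x. e' * indicator (cball (0::plane) Q) x)"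
   proof (intro sqint_cmult)
    have "integrable lborel (indicator (cball (0::plane) Q) :: plane => real)"
     by (rule integrable_real_indicator) (use emeasure_bounded_finite[of "cball (0::plane) Q"] in auto)
    moreover have "(%x. (indicator (cball (0::plane) Q) x :: real)^2) = indicator (cball 0 Q)"
     by (auto split: split_indicator)
    ultimately show "sqint lborel (indicator (cball (0::plane) Q))" by (auto simp: sqint_def)
   qed
   show "(%x. g (k + x) - g x) : borel_measurable lborel" using cg borel_measurable_continuous_onI by simp
   have "\<bar>g (k + x) - g x\<bar> <= \<bar>e' * indicator (cball (0::plane) Q) x\<bar>" for x
   proof (cases "norm x <= Q")
    case True
    then have "k + x : cball 0 (Q+1)" "x : cball 0 (Q+1)"
     using norm_triangle_ineq[of k x] k by auto
    from d0(2)[OF this(2,1)] have "dist (g (k + x)) (g x) < e'" using k by (simp add: dist_norm)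
    then show ?thesis using True e' by (simp add: dist_norm)
   next
    case False
    then have "norm x > R" "norm (k + x) > R"
     using norm_triangle_ineq2[of x "-k"] k by (auto simp: Q_def add.commute)
    then show ?thesis by (simp add: g(2))
   qed
   then show "AE x in lborel. \<bar>g (k + x) - g x\<bar> <= \<bar>e' * indicator (cball (0::plane) Q) x\<bar>" by simp
  qed
  also have "... = e' * sqrt V"
   using e' unfolding l2_cmult by (simp add: l2_def power2_eq_square indicator_inter_arith[symmetric] V_def)
  also have "... < e / 3"
  proof -
   have "e' * (sqrt V + 1) = e / 3"
   proof -
    have "sqrt V + 1 ~= 0" using real_sqrt_ge_zero[OF V] by linarith
    then show ?thesis unfolding e'_def using nonzero_divide_eq_eq[of "sqrt V + 1" "e / 3" "e / 3 / (sqrt V + 1)"] by metis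
   qed
   moreover have "e' * sqrt V < e' * (sqrt V + 1)" using e' by (intro mult_strict_left_mono) auto
   ultimately show ?thesis by simp
  qed
  finally have 2: "l2 lborel (%x. g (k + x) - g x) < e / 3" .
  note tr = sqint_lborel_translate
  have "l2 lborel (%x. f (k + x) - f x) <= l2 lborel (%x. f (k + x) - g (k + x)) + l2 lborel (%x. g (k + x) - f x)"
   by (rule l2_triangle3[OF tr(1)[OF f] tr(1)[OF sg] f])
  also have "l2 lborel (%x. f (k + x) - g (k + x)) = l2 lborel (%x. f x - g x)"
   by (rule tr(2)[OF sqint_diff[OF f sg]])
  also have "l2 lborel (%x. g (k + x) - f x) <= l2 lborel (%x. g (k + x) - g x) + l2 lborel (%x. g x - f x)"
   by (rule l2_triangle3[OF tr(1)[OF sg] sg f])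
  finally show ?thesis using g(3) 2 l2_minus_commute[of lborel f g] by linarith
 qed
 then show ?thesis using d0(1) by (intro exI[of _ "min d0 1"]) auto
qed

definition conv :: "(plane => real) => (plane => real) => plane => real" where
 "conv f eta x = (LINT y|lborel. f y * eta (x - y))"

definition bounded_support :: "(plane => real) => bool" where
 "bounded_support eta \<longleftrightarrow> (EX R. ALL x. norm x > R --> eta x = 0)"

lemma partial_zero_open:
 assumes "open S" "x : S" "!!y. y : S ==> f y = 0" shows "partial i f x = 0"
proof -
 have "((%_. 0) has_derivative (%_. 0)) (at x)" by simp
 then have "(f has_derivative (%_. 0)) (at x)"
  by (rule has_derivative_transform_within_open[of _ _ x UNIV S]) (use assms in auto)
 then show ?thesis by (simp add: partial_eq)
qed

lemma bounded_support_partial: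
 assumes "bounded_support eta" shows "bounded_support (partial i eta)"
proof -
 obtain R where R: "!!x. norm x > R ==> eta x = 0" using assms by (auto simp: bounded_support_def)
 have "partial i eta x = 0" if "norm x > R" for x
  by (rule partial_zero_open[of "- cball 0 R"]) (use that R in auto)
 then show ?thesis by (auto simp: bounded_support_def)
qed

lemma bounded_support_uniformly_continuous:
 assumes "bounded_support eta" "continuous_on UNIV eta" "e > 0"
 shows "EX d>0. ALL x y. dist y x < d --> \<bar>eta y - eta x\<bar> < e"
proof -
 obtain R where R: "!!x. norm x > R ==> eta x = 0" using assms by (auto simp: bounded_support_def)
 have uc: "uniformly_continuous_on (cball 0 (R + 1)) eta"
  by (intro compact_uniformly_continuous continuous_on_subset[OF assms(2)]) auto
 then obtain d where d: "d > 0" "!!x y. x : cball 0 (R+1) ==> y : cball 0 (R+1) ==> dist y x < d ==> dist (eta y) (eta x) < e"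
  using assms(3) unfolding uniformly_continuous_on_def by metis
 have "\<bar>eta y - eta x\<bar> < e" if "dist y x < min d 1" for x y
 proof (cases "x : cball 0 (R+1) & y : cball 0 (R+1)")
  case True
  then show ?thesis using d(2)[of x y] that by (simp add: dist_norm)
 next
  case False
  then have "norm x > R" "norm y > R"
   using norm_triangle_ineq2[of x y] norm_triangle_ineq2[of y x] that by (auto simp: dist_norm norm_minus_commute)
  then show ?thesis by (simp add: R assms(3))
 qed
 then show ?thesis using d(1) by (intro exI[of _ "min d 1"]) auto
qed

lemma bounded_support_bounded:
 assumes "bounded_support eta" "continuous_on UNIV eta"
 obtains B where "!!x. \<bar>eta x\<bar> <= B"
proof -
 obtain R where R: "!!x. norm x > R ==> eta x = 0" using assms by (auto simp: bounded_support_def)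
 have "compact (eta ` cball 0 R)"
  by (intro compact_continuous_image continuous_on_subset[OF assms(2)]) auto
 then obtain B where B: "!!y. y : eta ` cball 0 R ==> norm y <= B" using compact_imp_bounded bounded_iff by metis
 have "\<bar>eta x\<bar> <= max B 0" for x using B[of "eta x"] R[of x] by (cases "norm x > R") force+
 then show ?thesis using that by blast
qed

lemma integrable_mult_bounded:
 fixes f g :: "plane => real"
 assumes "integrable lborel f" "g : borel_measurable borel" "!!x. \<bar>g x\<bar> <= B"
 shows "integrable lborel (%x. f x * g x)"
proof (rule Bochner_Integration.integrable_bound[of _ "%x. B * f x"])
 show "(%x. f x * g x) : borel_measurable lborel"
  using borel_measurable_integrable[OF assms(1)] assms(2) by auto
 have "\<bar>f x\<bar> * \<bar>g x\<bar> <= \<bar>f x\<bar> * \<bar>B\<bar>" for x using assms(3)[of x] by (intro mult_left_mono) auto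
 then show "AE x in lborel. norm (f x * g x) <= norm (B * f x)" by (simp add: abs_mult mult.commute)
qed (use assms in auto)

lemma smooth_line_derivative:
 assumes "smooth phi"
 shows "((%t. phi (p + t *\<^sub>R w)) has_real_derivative (SUM i:UNIV. partial i phi (p + t *\<^sub>R w) * w $ i)) (at t)"
proof -
 have "((%t. phi (p + t *\<^sub>R w)) has_derivative (%s. SUM i:UNIV. partial i phi (p + t *\<^sub>R w) * (s *\<^sub>R w) $ i)) (at t)"
  by (intro has_derivative_compose[where f="%t. p + t *\<^sub>R w" and g=phi] smooth_has_derivative assms)
   (auto intro!: derivative_eq_intros)
 then show ?thesis
  unfolding has_field_derivative_def
  by (rule has_derivative_eq_rhs) (auto simp: sum_distrib_left mult_ac fun_eq_iff)
qed

text \<open>Differentiation under the integral. By the mean value theorem and the uniform continuity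
  of the partial derivatives, the first-order remainder of \<open>eta\<close> is at most 2 e' |k|
  uniformly in the base point, the 2 counting coordinates.\<close>

lemma conv_has_derivative:
 assumes f: "integrable lborel f" and eta: "smooth eta" "bounded_support eta"
 shows "(conv f eta has_derivative (%k. SUM i:UNIV. conv f (partial i eta) x * k $ i)) (at x)"
proof -
 have [measurable]: "f : borel_measurable borel" using borel_measurable_integrable[OF f] by simp
 have ceta: "continuous_on UNIV eta" "continuous_on UNIV (partial i eta)" for i
  by (intro smooth_continuous_on smooth_partial eta)+
 have int: "integrable lborel (%y. f y * h (x - y))" if h: "continuous_on UNIV h" "bounded_support h" for h x
 proof -
  obtain B where "!!x. \<bar>h x\<bar> <= B" using bounded_support_bounded[OF h(2,1)] by blast
  moreover have "(%y. h (x - y)) : borel_measurable borel"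
   by (intro borel_measurable_continuous_onI continuous_on_compose2[OF h(1)] continuous_intros) auto
  ultimately show ?thesis by (intro integrable_mult_bounded[OF f]) auto
 qed
 note int0 = int[OF ceta(1) eta(2)] and intp = int[OF ceta(2) bounded_support_partial[OF eta(2)]]
 define J where "J = (LINT y|lborel. \<bar>f y\<bar>)"
 have J: "J >= 0" by (simp add: J_def)
 show ?thesis
  unfolding has_derivative_within_alt
 proof (intro conjI allI impI)
  show "bounded_linear (%k. SUM i:UNIV. conv f (partial i eta) x * k $ i)"
   by (intro bounded_linear_sum bounded_linear_const_mult bounded_linear_vec_nth)
  fix e :: real assume "e > 0"
  define e' where "e' = e / (2 * (J + 1))"
  have e': "e' > 0" using \<open>e > 0\<close> J by (simp add: e'_def)
  have "EX d>0. ALL x y. dist y x < d --> \<bar>partial i eta y - partial i eta x\<bar> < e'" for i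
   by (rule bounded_support_uniformly_continuous[OF bounded_support_partial[OF eta(2)] ceta(2) e'])
  then obtain d where d: "!!i. d i > 0" "!!i x y. dist y x < d i ==> \<bar>partial i eta y - partial i eta x\<bar> < e'" by metis
  define d0 where "d0 = min (d 1) (d 2)"
  have d0: "d0 > 0" "d0 <= d i" for i using d(1) exhaust_2[of i] by (auto simp: d0_def)
  have "norm (conv f eta y - conv f eta x - (SUM i:UNIV. conv f (partial i eta) x * (y - x) $ i)) <= e * norm (y - x)"
   if y: "norm (y - x) < d0" for y
  proof -
   define k where "k = y - x"
   have kd: "norm k < d0" using y by (simp add: k_def)
   define r where "r z = eta (z + k) - eta z - (SUM i:UNIV. partial i eta z * k $ i)" for z
   have r: "\<bar>r z\<bar> <= 2 * e' * norm k" for z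
   proof -
    have "EX t. 0 < t & t < 1 & (%t. eta (z + t *\<^sub>R k)) 1 - (%t. eta (z + t *\<^sub>R k)) 0 = (1 - 0) * (SUM i:UNIV. partial i eta (z + t *\<^sub>R k) * k $ i)"
     by (rule MVT2) (auto intro!: smooth_line_derivative eta(1))
    then obtain t where t: "0 < t" "t < 1" "eta (z + k) - eta z = (SUM i:UNIV. partial i eta (z + t *\<^sub>R k) * k $ i)"
     by auto
    have "\<bar>r z\<bar> = \<bar>SUM i:UNIV. (partial i eta (z + t *\<^sub>R k) - partial i eta z) * k $ i\<bar>"
     unfolding r_def t(3) by (simp add: sum_subtractf left_diff_distrib)
    also have "... <= (SUM i:(UNIV::2 set). e' * norm k)"
    proof (intro order_trans[OF sum_abs] sum_mono)
     fix i :: 2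
     have "dist (z + t *\<^sub>R k) z = t * norm k" using t by (simp add: dist_norm)
     also have "... <= 1 * norm k" using t by (intro mult_right_mono) auto
     also have "... < d i" using kd d0(2)[of i] by simp
     finally have "\<bar>partial i eta (z + t *\<^sub>R k) - partial i eta z\<bar> < e'" by (rule d(2))
     then show "\<bar>(partial i eta (z + t *\<^sub>R k) - partial i eta z) * k $ i\<bar> <= e' * norm k"
      unfolding abs_mult by (intro mult_mono component_le_norm_cart) auto
    qed
    finally show ?thesis by simp
   qed
   have "conv f eta y - conv f eta x - (SUM i:UNIV. conv f (partial i eta) x * k $ i) =
    (LINT z|lborel. f z * eta (y - z) - f z * eta (x - z) - (SUM i:UNIV. f z * partial i eta (x - z) * k $ i))"
    unfolding conv_def using int0 intp by simp
   also have "... = (LINT z|lborel. f z * r (x - z))"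
    by (rule Bochner_Integration.integral_cong) (auto simp: r_def k_def algebra_simps sum_distrib_left)
   finally have "norm (conv f eta y - conv f eta x - (SUM i:UNIV. conv f (partial i eta) x * k $ i)) = norm (LINT z|lborel. f z * r (x - z))"
    by simp
   also have "... <= (LINT z|lborel. norm (f z * r (x - z)))" by (rule integral_norm_bound)
   also have "... <= (LINT z|lborel. \<bar>f z\<bar> * (2 * e' * norm k))"
   proof (rule integral_mono)
    have "continuous_on UNIV (%z. r (x - z))"
     unfolding r_def by (intro continuous_intros continuous_on_compose2[OF ceta(1)] continuous_on_compose2[OF ceta(2)]) auto
    then show "integrable lborel (%z. norm (f z * r (x - z)))"
     using r by (intro integrable_norm integrable_mult_bounded[OF f]) (auto intro: borel_measurable_continuous_onI)
    show "integrable lborel (%z. \<bar>f z\<bar> * (2 * e' * norm k))" using f by auto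
    show "norm (f z * r (x - z)) <= \<bar>f z\<bar> * (2 * e' * norm k)" for z
     using r[of "x - z"] by (simp add: abs_mult mult_left_mono)
   qed
   also have "... = J * (2 * e' * norm k)" by (simp add: J_def)
   also have "... <= e * norm k"
   proof -
    have "J * (2 * e') <= e" using J \<open>e > 0\<close> by (simp add: e'_def field_simps)
    then show ?thesis using mult_right_mono[of "J * (2 * e')" e "norm k"] by (simp add: mult.assoc)
   qed
   finally show ?thesis by (simp add: k_def)
  qed
  then show "EX d>0. ALL y:UNIV. norm (y - x) < d -->
   norm (conv f eta y - conv f eta x - (SUM i:UNIV. conv f (partial i eta) x * (y - x) $ i)) <= e * norm (y - x)"
   using d0(1) by blast
 qed
qed

lemma partial_conv:
 assumes "integrable lborel f" "smooth eta" "bounded_support eta"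
 shows "partial i (conv f eta) x = conv f (partial i eta) x"
 using partial_eq[OF conv_has_derivative[OF assms]]
 by (simp add: axis_def if_distrib[of "(*) _"] cong: if_cong)

lemma smooth_conv:
 assumes "integrable lborel f" "smooth eta" "bounded_support eta"
 shows "smooth (conv f eta)"
proof -
 have "C_k k (conv f eta)" if "smooth eta" "bounded_support eta" for k eta
  using that
 proof (induction k arbitrary: eta)
  case 0
  then show ?case using conv_has_derivative[OF assms(1)]
   by (auto intro!: continuous_at_imp_continuous_on has_derivative_continuous)
 next
  case (Suc k)
  show ?case
  proof (rule C_k_SucI[OF conv_has_derivative[OF assms(1) Suc.prems]])
   show "C_k k (%x. SUM j:UNIV. conv f (partial j eta) x * axis i 1 $ j)" for i
    using Suc.IH[OF smooth_partial[OF Suc.prems(1)] bounded_support_partial[OF Suc.prems(2)]]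
    by (simp add: axis_def if_distrib[of "(*) _"] cong: if_cong)
  qed
 qed
 then show ?thesis using assms(2,3) by (simp add: smooth_def)
qed

lemma lborel_plane_scale:
 fixes t :: plane assumes "c ~= 0"
 shows "lborel = density (distr lborel borel (%x. t + c *\<^sub>R x)) (%_. ennreal (c^2))"
 using lborel_affine[OF assms, of t] by (simp add: ennreal_power[symmetric])

lemma lborel_integral_plane_scale:
 fixes g :: "plane => real" and t :: plane
 assumes "c ~= 0" and [measurable]: "g : borel_measurable borel"
 shows "(LINT y|lborel. g y) = c^2 * (LINT z|lborel. g (t + c *\<^sub>R z))"
 by (subst lborel_plane_scale[OF assms(1), of t]) (simp add: integral_density integral_distr)

lemma sqint_lborel_scale:
 fixes f :: "plane => real" and t :: plane
 assumes "c ~= 0" and f: "sqint lborel f"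
 shows "sqint lborel (%z. f (t + c *\<^sub>R z))"
proof -
 have [measurable]: "f : borel_measurable borel" using f by (simp add: sqint_def)
 have "integrable lborel (%x. (f x)^2)" using f by (simp add: sqint_def)
 then have "integrable (density (distr lborel borel (%x. t + c *\<^sub>R x)) (%_. ennreal (c^2))) (%x. (f x)^2)"
  using lborel_plane_scale[OF assms(1), of t] by simp
 then have "integrable lborel (%x. c^2 * (f (t + c *\<^sub>R x))^2)"
  by (simp add: integrable_density integrable_distr_eq)
 then show ?thesis using assms(1) by (simp add: sqint_def)
qed

text \<open>The kernel at scale \<open>delta\<close>; the exponent is the dimension, which preserves
  the integral. It need not be centred: a kernel supported in the unit disc around \<open>c\<close>
  becomes one supported in the disc of radius \<open>delta\<close> around
  \<open>delta *\<^sub>R c\<close>.\<close>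

definition sc :: "real => (plane => real) => plane => real" where
 "sc delta eta z = eta ((1 / delta) *\<^sub>R z) / delta^2"

text \<open>The error at x is the \<open>eta\<close>-average over z of f(x - delta z) - f(x). By
  Cauchy-Schwarz with weight \<open>eta\<close> and Tonelli, its norm is at most the largest
  translation error over the shifts delta z, which is small by continuity of translations in L^2.
  The support may sit around any \<open>c\<close>, so that near the boundary the kernel can be made
  to sample points of the domain only.\<close>

lemma mollify_approx:
 fixes f eta :: "plane => real"
 assumes f: "sqint lborel f" and eta: "continuous_on UNIV eta" "!!x. eta x >= 0" "ALL x. x ~: cball c 1 --> eta x = 0"
  "(LINT x|lborel. eta x) = 1" and "e > 0"
 shows "EX d>0. ALL delta. 0 < delta & delta < d --> sqint lborel (%x. conv f (sc delta eta) x - f x) & l2 lborel (%x. conv f (sc delta eta) x - f x) <= e"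
proof -
 have [measurable]: "f : borel_measurable borel" using f by (simp add: sqint_def)
 have [measurable]: "eta : borel_measurable borel" by (rule borel_measurable_continuous_onI[OF eta(1)])
 define R where "R = norm c + 1"
 have R: "R > 0" unfolding R_def using norm_ge_zero[of c] by linarith
 have suppeta: "norm z <= R" if "eta z ~= 0" for z
  using eta(3)[rule_format, of z] that norm_triangle_sub[of z c] by (force simp: R_def dist_norm norm_minus_commute)
 have etaint: "integrable lborel eta"
  by (rule integrable_continuous_bounded_support[OF eta(1), of R]) (use suppeta in force)
 have sqeta: "sqint lborel (%z. sqrt (eta z))"
  by (rule sqint_continuous_bounded_support[of _ R]) (use eta(1) suppeta in \<open>force intro!: continuous_intros\<close>)+
 have "bounded_support eta" unfolding bounded_support_def using suppeta by (intro exI[of _ R]) force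
 then obtain B where B: "!!x. \<bar>eta x\<bar> <= B" using bounded_support_bounded[OF _ eta(1)] by blast
 obtain d0 where d0: "d0 > 0" "!!k. norm k < d0 ==> l2 lborel (%x. f (k + x) - f x) < e"
  using L2_translation_continuous[OF f \<open>e > 0\<close>] by auto
 have "sqint lborel (%x. conv f (sc delta eta) x - f x) & l2 lborel (%x. conv f (sc delta eta) x - f x) <= e"
  if delta: "0 < delta" "delta < d0 / R" for delta
 proof -
  define D where "D x = conv f (sc delta eta) x - f x" for x
  have m[measurable]: "(%(x, y). f y * sc delta eta (x - y)) : borel_measurable (lborel \<Otimes>\<^sub>M lborel)"
   unfolding sc_def by measurable
  have [measurable]: "D : borel_measurable borel"
  proof -
   have "(%x. LINT y|lborel. f y * sc delta eta (x - y)) : borel_measurable lborel"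
    by (rule lborel.borel_measurable_lebesgue_integral[OF m])
   then show ?thesis unfolding D_def conv_def by simp
  qed
  have D2: "(D x)^2 <= (LINT z|lborel. (f (x - delta *\<^sub>R z) - f x)^2 * eta z) & integrable lborel (%z. (f (x - delta *\<^sub>R z) - f x)^2 * eta z)" for x
  proof -
   \<comment> \<open>Splitting the weight into two square roots leaves one factor whose norm is 1
     because \<open>eta\<close> has unit mass.\<close>
   define h where "h z = (f (x - delta *\<^sub>R z) - f x) * sqrt (eta z)" for z
   have s1: "sqint lborel (%z. f (x - delta *\<^sub>R z))"
    using sqint_lborel_scale[OF _ f, of "-delta" x] delta by simp
   have s2: "sqint lborel (%z. f (x - delta *\<^sub>R z) * sqrt (eta z))"
    by (rule sqint_mult_bounded[OF s1, of _ "sqrt B"]) (use B eta(2) in \<open>auto simp: real_sqrt_abs2 intro!: real_sqrt_le_mono\<close>)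
   have sh: "sqint lborel h"
    unfolding h_def left_diff_distrib by (intro sqint_diff s2 sqint_cmult sqeta)
   have "conv f (sc delta eta) x = (LINT z|lborel. f (x - delta *\<^sub>R z) * eta z)"
   proof -
    have "conv f (sc delta eta) x = (-delta)^2 * (LINT z|lborel. f (x + (-delta) *\<^sub>R z) * sc delta eta (x - (x + (-delta) *\<^sub>R z)))"
     unfolding conv_def by (rule lborel_integral_plane_scale) (use delta in \<open>auto simp: sc_def\<close>)
    also have "... = (LINT z|lborel. f (x - delta *\<^sub>R z) * eta z)"
     using delta by (subst integral_mult_right_zero[symmetric]) (simp add: sc_def)
    finally show ?thesis .
   qed
   moreover have "f x = (LINT z|lborel. f x * eta z)" using eta(4) by simp
   moreover have "integrable lborel (%z. f (x - delta *\<^sub>R z) * eta z)"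
    using sqint_mult_integrable[OF s2 sqeta] eta(2) by (simp add: mult.assoc)
   ultimately have "D x = (LINT z|lborel. (f (x - delta *\<^sub>R z) - f x) * eta z)"
    unfolding D_def left_diff_distrib using etaint by simp
   also have "... = (LINT z|lborel. h z * sqrt (eta z))"
    unfolding h_def using eta(2) by (simp add: mult.assoc)
   finally have "\<bar>D x\<bar> <= l2 lborel h * l2 lborel (%z. sqrt (eta z))"
    using l2_Cauchy_Schwarz[OF sh sqeta] by simp
   also have "l2 lborel (%z. sqrt (eta z)) = 1" using eta(2,4) by (simp add: l2_def)
   finally have "\<bar>D x\<bar>^2 <= (l2 lborel h)^2" by (intro power_mono) auto
   moreover have "(%z. (h z)^2) = (%z. (f (x - delta *\<^sub>R z) - f x)^2 * eta z)"
    unfolding h_def using eta(2) by (simp add: power_mult_distrib)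
   ultimately show ?thesis using sqint_integrable[OF sh] by (simp add: l2_sq)
  qed
  have "(\<integral>\<^sup>+x. ennreal ((D x)^2) \<partial>lborel) <= (\<integral>\<^sup>+x. \<integral>\<^sup>+z. ennreal ((f (x - delta *\<^sub>R z) - f x)^2 * eta z) \<partial>lborel \<partial>lborel)"
  proof (rule nn_integral_mono)
   fix x
   have "ennreal ((D x)^2) <= ennreal (LINT z|lborel. (f (x - delta *\<^sub>R z) - f x)^2 * eta z)"
    using D2[of x] by (intro ennreal_leI) simp
   also have "... = (\<integral>\<^sup>+z. ennreal ((f (x - delta *\<^sub>R z) - f x)^2 * eta z) \<partial>lborel)"
    using D2[of x] eta(2) by (intro nn_integral_eq_integral[symmetric]) auto
   finally show "ennreal ((D x)^2) <= (\<integral>\<^sup>+z. ennreal ((f (x - delta *\<^sub>R z) - f x)^2 * eta z) \<partial>lborel)" .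
  qed
  also have "... = (\<integral>\<^sup>+z. \<integral>\<^sup>+x. ennreal ((f (x - delta *\<^sub>R z) - f x)^2 * eta z) \<partial>lborel \<partial>lborel)"
   by (rule lborel_pair.Fubini'[symmetric]) (simp add: case_prod_unfold)
  also have "... <= (\<integral>\<^sup>+z. ennreal (e^2) * ennreal (eta z) \<partial>lborel)"
  proof (rule nn_integral_mono)
   fix z
   show "(\<integral>\<^sup>+x. ennreal ((f (x - delta *\<^sub>R z) - f x)^2 * eta z) \<partial>lborel) <= ennreal (e^2) * ennreal (eta z)"
   proof (cases "eta z = 0")
    case False
    define k where "k = - (delta *\<^sub>R z)"
    have "norm k <= delta * R" using suppeta[OF False] delta by (simp add: k_def)
    also have "... < d0" using delta R by (simp add: field_simps)
    finally have "l2 lborel (%x. f (k + x) - f x) < e" by (rule d0(2))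
    then have le: "(l2 lborel (%x. f (k + x) - f x))^2 <= e^2"
     using l2_nonneg[of lborel "%x. f (k + x) - f x"] by (intro power_mono) auto
    have sq: "sqint lborel (%x. f (k + x) - f x)"
     by (intro sqint_diff sqint_lborel_translate(1) f)
    have "(\<integral>\<^sup>+x. ennreal ((f (x - delta *\<^sub>R z) - f x)^2 * eta z) \<partial>lborel)
     = (\<integral>\<^sup>+x. ennreal ((f (k + x) - f x)^2) * ennreal (eta z) \<partial>lborel)"
     by (intro nn_integral_cong) (simp add: k_def ennreal_mult eta(2))
    also have "... = (\<integral>\<^sup>+x. ennreal ((f (k + x) - f x)^2) \<partial>lborel) * ennreal (eta z)"
     by (rule nn_integral_multc) simp
    also have "(\<integral>\<^sup>+x. ennreal ((f (k + x) - f x)^2) \<partial>lborel) = ennreal ((l2 lborel (%x. f (k + x) - f x))^2)"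
     unfolding l2_sq using sqint_integrable[OF sq] by (intro nn_integral_eq_integral) auto
    also have "... * ennreal (eta z) <= ennreal (e^2) * ennreal (eta z)"
     by (intro mult_right_mono ennreal_leI le) auto
    finally show ?thesis .
   qed simp
  qed
  also have "... = ennreal (e^2) * (\<integral>\<^sup>+z. ennreal (eta z) \<partial>lborel)" by (rule nn_integral_cmult) simp
  also have "(\<integral>\<^sup>+z. ennreal (eta z) \<partial>lborel) = 1"
   using nn_integral_eq_integral[OF etaint] eta(2,4) by simp
  finally have *: "(\<integral>\<^sup>+x. ennreal ((D x)^2) \<partial>lborel) <= ennreal (e^2)" by simp
  then have I: "integrable lborel (%x. (D x)^2)"
   by (intro integrableI_bounded) (auto simp: le_less_trans[OF _ ennreal_less_top])
  then have "ennreal ((l2 lborel D)^2) <= ennreal (e^2)"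
   unfolding l2_sq using * by (subst nn_integral_eq_integral[symmetric]) auto
  then have "(l2 lborel D)^2 <= e^2" by simp
  then have "l2 lborel D <= e" using \<open>e > 0\<close> by (auto intro: power2_le_imp_le)
  then show ?thesis using I by (simp add: sqint_def D_def[symmetric, abs_def])
 qed
 moreover have "d0 / R > 0" using d0 R by simp
 ultimately show ?thesis by blast
qed

lemma ex_mollifier:
 obtains eta :: "plane => real" where "smooth eta" "!!x. eta x >= 0" "ALL x. x ~: cball c 1 --> eta x = 0" "(LINT x|lborel. eta x) = 1"
proof -
 have z: "bump c 1 x = 0" if "x ~: cball c 1" for x using bump_zero[of 1 x c] that by force
 have c: "continuous_on UNIV (bump c 1)" by (rule smooth_continuous_on[OF smooth_bump])
 have int: "integrable lborel (bump c 1)"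
 proof (rule integrable_continuous_bounded_support[OF c])
  show "bump c 1 x = 0" if "norm x > norm c + 1" for x
   using z[of x] that norm_triangle_sub[of x c] by (force simp: dist_norm norm_minus_commute)
 qed
 define I where "I = (LINT x|lborel. bump c 1 x)"
 have "I ~= 0"
 proof
  assume "I = 0"
  then have "AE x in lborel. bump c 1 x = 0"
   using integral_nonneg_eq_0_iff_AE[OF int] bump_nonneg by (auto simp: I_def)
  then have "AE x in lborel. x ~: ball c 1"
   by eventually_elim (use bump_pos[of _ c 1] in force)
  then have "ball c 1 : null_sets lborel" by (subst AE_iff_null_sets) auto
  then have "negligible (ball c 1)" by (simp add: negligible_iff_null_sets null_sets_completionI)
  then show False using open_not_negligible[of "ball c 1"] by simp
 qed
 moreover have "I >= 0" unfolding I_def by (simp add: bump_nonneg)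
 ultimately have I: "I > 0" by simp
 show ?thesis
 proof (rule that[of "%x. (1 / I) * bump c 1 x"])
  show "smooth (%x. (1 / I) * bump c 1 x)" by (intro smooth_cmult smooth_bump)
 qed (use I z in \<open>auto simp: bump_nonneg I_def[symmetric]\<close>)
qed

lemma smooth_sc: assumes "smooth eta" shows "smooth (sc delta eta)"
proof -
 have "smooth (%z. (1 / delta^2) * eta (0 + (1 / delta) *\<^sub>R z))" by (intro smooth_cmult smooth_compose_shift assms)
 then show ?thesis by (simp add: sc_def[abs_def])
qed

lemma sc_zero:
 assumes "ALL x. x ~: cball c 1 --> eta x = 0" "delta > 0" "norm (z - delta *\<^sub>R c) > delta"
 shows "sc delta eta z = 0"
proof -
 have "(1 / delta) *\<^sub>R z ~: cball c 1"
 proof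
  assume "(1 / delta) *\<^sub>R z : cball c 1"
  then have "delta * norm ((1 / delta) *\<^sub>R z - c) <= delta * 1" using assms(2) by (simp add: dist_norm norm_minus_commute)
  moreover have "delta * norm ((1 / delta) *\<^sub>R z - c) = norm (delta *\<^sub>R ((1 / delta) *\<^sub>R z - c))" using assms(2) by simp
  ultimately show False using assms(2,3) by (simp add: scaleR_diff_right)
 qed
 then show ?thesis by (simp add: sc_def assms(1))
qed

lemma partial_sc_zero:
 assumes "ALL x. x ~: cball c 1 --> eta x = 0" "delta > 0" "norm (z - delta *\<^sub>R c) > delta"
 shows "partial i (sc delta eta) z = 0"
proof (rule partial_zero_open[of "- cball (delta *\<^sub>R c) delta"])
 show "sc delta eta y = 0" if "y : - cball (delta *\<^sub>R c) delta" for y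
  by (rule sc_zero[OF assms(1,2)]) (use that in \<open>auto simp: dist_norm norm_minus_commute\<close>)
qed (use assms(3) in \<open>auto simp: dist_norm norm_minus_commute\<close>)

lemma bounded_support_sc:
 assumes "ALL x. x ~: cball c 1 --> eta x = 0" "delta > 0" shows "bounded_support (sc delta eta)"
proof -
 have "sc delta eta z = 0" if "norm z > delta * norm c + delta" for z
  by (rule sc_zero[OF assms]) (use that assms(2) norm_triangle_ineq2[of z "delta *\<^sub>R c"] in auto)
 then show ?thesis by (auto simp: bounded_support_def)
qed

text \<open>As a function of y the shifted kernel is a test function once its support lies in
  \<open>Om\<close>, and only then can the definition of the weak derivative be applied to it. The
  sign comes from the reflection.\<close>

lemma test_function_sc:
 assumes eta: "smooth eta" "ALL x. x ~: cball c 1 --> eta x = 0" and delta: "delta > 0"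
  and sub: "!!z. z : cball c 1 ==> x - delta *\<^sub>R z : Om"
 shows "(%y. sc delta eta (x - y)) : test_functions Om"
  and "partial i (%y. sc delta eta (x - y)) y = - partial i (sc delta eta) (x - y)"
proof -
 let ?K = "(%z. x - delta *\<^sub>R z) ` cball c 1"
 have K: "compact ?K" by (intro compact_continuous_image continuous_intros) auto
 have sm: "smooth (%y. sc delta eta (x - y))"
  using smooth_compose_shift[OF smooth_sc[OF eta(1), of delta], of x "-1"] by simp
 have "{y. sc delta eta (x - y) ~= 0} <= ?K"
 proof
  fix y assume "y : {y. sc delta eta (x - y) ~= 0}"
  then have "(1 / delta) *\<^sub>R (x - y) : cball c 1" using eta(2) by (force simp: sc_def)
  moreover have "y = x - delta *\<^sub>R ((1 / delta) *\<^sub>R (x - y))" using delta by simp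
  ultimately show "y : ?K" by blast
 qed
 then have cl: "closure {y. sc delta eta (x - y) ~= 0} <= ?K"
  by (rule closure_minimal) (simp add: K compact_imp_closed)
 then have "compact (closure {y. sc delta eta (x - y) ~= 0})"
  by (metis K closed_closure compact_Int_closed inf.absorb2)
 then show "(%y. sc delta eta (x - y)) : test_functions Om"
  using sm cl sub by (auto simp: test_functions_def)
 show "partial i (%y. sc delta eta (x - y)) y = - partial i (sc delta eta) (x - y)"
  using partial_compose_shift[OF smooth_sc[OF eta(1), of delta], of i x "-1" y] by simp
qed

section \<open>Weak derivatives and density of smooth functions\<close>

lemma L2_iff: "f : L2 Om \<longleftrightarrow> sqint (lebesgue_on Om) f"
 by (simp add: L2_def sqint_def)

lemma L2_norm_eq_l2: "L2_norm Om f = l2 (lebesgue_on Om) f" for f :: "plane => real"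
 by (simp add: L2_norm_def l2_def)

lemma integral_lebesgue_on_eq_lborel:
 fixes f f0 :: "plane => real"
 assumes "f0 : borel_measurable borel" "Om : sets borel" "!!x. x ~: Om ==> f0 x = 0" "AE x in lebesgue_on Om. f0 x = f x"
  "f : borel_measurable (lebesgue_on Om)"
 shows "(LINT x|lebesgue_on Om. f x) = (LINT x|lborel. f0 x)"
proof -
 have [measurable]: "f0 : borel_measurable lebesgue" by (intro measurable_completion) (simp add: assms(1))
 have "(LINT x|lebesgue_on Om. f x) = (LINT x|lebesgue_on Om. f0 x)"
  using assms(4) by (intro integral_cong_AE assms measurable_restrict_space1) (auto elim: eventually_mono)
 also have "... = (LINT x|lebesgue. indicator Om x *\<^sub>R f0 x)"
  using assms(2) by (intro integral_restrict_space) auto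
 also have "(%x. indicator Om x *\<^sub>R f0 x) = f0" using assms(3) by (auto split: split_indicator)
 also have "(LINT x|lebesgue. f0 x) = (LINT x|lborel. f0 x)" by (rule integral_completion) (simp add: assms(1))
 finally show ?thesis .
qed

lemma sqint_lborel_restrict:
 fixes h :: "plane => real"
 assumes "sqint lborel h" "Om : sets borel"
 shows "sqint (lebesgue_on Om) h" "l2 (lebesgue_on Om) h <= l2 lborel h"
proof -
 have m: "h : borel_measurable lborel" "integrable lborel (%x. (h x)^2)" using assms by (auto simp: sqint_def)
 have ml: "h : borel_measurable lebesgue" by (intro measurable_completion m)
 have i: "integrable lebesgue (%x. (h x)^2)" using m by (subst integrable_completion) auto
 have i': "integrable lebesgue (%x. indicator Om x *\<^sub>R (h x)^2)"
  using assms(2) by (intro integrable_mult_indicator i) auto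
 have "integrable (lebesgue_on Om) (%x. (h x)^2)" using i' assms(2) by (subst integrable_restrict_space) auto
 then show "sqint (lebesgue_on Om) h" using ml by (auto simp: sqint_def measurable_restrict_space1)
 have "(LINT x|lebesgue_on Om. (h x)^2) = (LINT x|lebesgue. indicator Om x *\<^sub>R (h x)^2)"
  using assms(2) by (intro integral_restrict_space) auto
 also have "... <= (LINT x|lebesgue. (h x)^2)"
  by (intro integral_mono i i') (auto split: split_indicator)
 also have "... = (LINT x|lborel. (h x)^2)" using m by (intro integral_completion) auto
 finally show "l2 (lebesgue_on Om) h <= l2 lborel h" by (simp add: l2_def)
qed

text \<open>Members of L^2 are measurable for the completed measure on \<open>Om\<close>, whereas
  mollification and Tonelli work with Borel functions on the plane. The representative is extended
  by zero and keeps a prescribed support \<open>A\<close>.\<close>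

lemma borel_representative:
 fixes f :: "plane => real"
 assumes f: "sqint (lebesgue_on Om) f" and "Om : sets borel" "A : sets borel" "ALL x:Om - A. f x = 0"
 shows "EX f0. sqint lborel f0 & (ALL x. x ~: Om --> f0 x = 0) & (ALL x. x ~: A --> f0 x = 0) & (AE x in lebesgue_on Om. f0 x = f x)"
proof -
 define F where "F x = (if x : Om then f x else 0)" for x
 have Om: "Om : sets lebesgue" using assms(2) by simp
 have Fi: "F = (%x. indicator Om x *\<^sub>R f x)" by (auto simp: F_def)
 have Fm: "F : borel_measurable lebesgue"
  using f Om unfolding sqint_def Fi by (subst borel_measurable_restrict_space_iff[symmetric]) auto
 have "integrable lebesgue (%x. indicator Om x *\<^sub>R (f x)^2)"
  using f Om by (subst integrable_restrict_space[symmetric]) (auto simp: sqint_def)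
 also have "(%x. indicator Om x *\<^sub>R (f x)^2) = (%x. (F x)^2)" by (auto simp: F_def)
 finally have FI: "integrable lebesgue (%x. (F x)^2)" .
 obtain g where g: "g : borel_measurable lborel" "AE x in lborel. F x = g x"
  using completion_ex_borel_measurable_real[OF Fm] by auto
 define f0 where "f0 x = g x * indicator (Om \<inter> A) x" for x
 have f0m: "f0 : borel_measurable lborel" unfolding f0_def using g(1) assms(2,3) by auto
 have ae: "AE x in lebesgue. f0 x = F x"
 proof -
  have "AE x in lebesgue. F x = g x" using g(2) by (simp add: AE_completion_iff)
  then show ?thesis
  proof eventually_elim
   case (elim x)
   then show ?case using assms(4) by (auto simp: f0_def F_def indicator_def split: if_splits)
  qed
 qed
 have "integrable lebesgue (%x. (f0 x)^2)"
  using FI by (rule integrable_cong_AE_imp) (use f0m ae in \<open>auto intro: measurable_completion\<close>)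
 then have "sqint lborel f0" using f0m by (auto simp: sqint_def integrable_completion)
 moreover have "AE x in lebesgue_on Om. f0 x = f x"
 proof -
  have "AE x in lebesgue. x : Om --> f0 x = f x" using ae by eventually_elim (auto simp: F_def)
  then show ?thesis using Om by (simp add: AE_restrict_space_iff)
 qed
 ultimately show ?thesis by (intro exI[of _ f0]) (simp add: f0_def)
qed

lemma test_functionD:
 assumes "phi : test_functions Om"
 shows "smooth phi" "bounded_support phi" "x ~: Om ==> phi x = 0" "x ~: Om ==> partial i phi x = 0"
proof -
 let ?S = "closure {x. phi x ~= 0}"
 have *: "smooth phi" "compact ?S" "?S <= Om" using assms by (auto simp: test_functions_def)
 then show "smooth phi" by simp
 obtain R where R: "!!x. x : ?S ==> norm x <= R" using compact_imp_bounded[OF *(2)] by (auto simp: bounded_iff)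
 have z: "phi x = 0" if "x ~: ?S" for x using closure_subset[of "{x. phi x ~= 0}"] that by auto
 show "bounded_support phi" unfolding bounded_support_def using z R by (meson not_le)
 show "x ~: Om ==> phi x = 0" using z *(3) by blast
 show "partial i phi x = 0" if "x ~: Om"
 proof (rule partial_zero_open[of "- ?S"])
  show "x : - ?S" using that *(3) by blast
  show "open (- ?S)" by (rule open_Compl[OF closed_closure])
  show "phi y = 0" if "y : - ?S" for y using z[of y] that by simp
 qed
qed

lemma sqint_lebesgue_on_bounded_continuous:
 fixes f :: "plane => real"
 assumes "bounded Om" "Om : sets borel" "continuous_on UNIV f"
 shows "sqint (lebesgue_on Om) f"
proof -
 have c: "compact (closure Om)" using assms(1) by simp
 have i: "integrable lborel (%x. indicator (closure Om) x *\<^sub>R (f x)^2)"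
  by (rule borel_integrable_compact[OF c]) (use assms(3) continuous_on_subset in \<open>auto intro!: continuous_intros\<close>)
 have fm: "f : borel_measurable borel" by (rule borel_measurable_continuous_onI[OF assms(3)])
 have "(%x. indicator (closure Om) x *\<^sub>R (f x)^2) = (%x. (indicator (closure Om) x * f x)^2)"
  by (auto split: split_indicator)
 then have "sqint lborel (%x. indicator (closure Om) x * f x)"
  using i fm by (auto simp: sqint_def)
 from sqint_lborel_restrict(1)[OF this assms(2)] have "sqint (lebesgue_on Om) (%x. indicator (closure Om) x * f x)" .
 then show ?thesis
 proof (rule sqint_cong_AE)
  show "f : borel_measurable (lebesgue_on Om)" by (intro measurable_restrict_space1 measurable_completion) (simp add: fm)
  show "AE x in lebesgue_on Om. indicator (closure Om) x * f x = f x"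
   using closure_subset[of Om] by (intro AE_I2) (auto simp: indicator_def)
 qed
qed

lemma smooth_sqint: "bounded Om ==> open Om ==> smooth f ==> sqint (lebesgue_on Om) f"
 by (simp add: sqint_lebesgue_on_bounded_continuous smooth_continuous_on)

lemma sqint_mult_smooth:
 assumes "bounded Om" "open Om" "sqint (lebesgue_on Om) f" "smooth psi"
 shows "sqint (lebesgue_on Om) (%x. f x * psi x)"
proof -
 have "compact (psi ` closure Om)"
  by (intro compact_continuous_image smooth_continuous_on assms) (use assms in auto)
 then obtain B where "!!y. y : psi ` closure Om ==> norm y <= B" using compact_imp_bounded bounded_iff by metis
 then show ?thesis using closure_subset[of Om] smooth_sqint[OF assms(1,2,4)]
  by (intro sqint_mult_bounded[OF assms(3), of _ B]) (auto simp: sqint_def)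
qed

locale bounded_open =
 fixes Om :: "plane set"
 assumes bounded: "bounded Om" and opn: "open Om"
begin

abbreviation "MOm \<equiv> lebesgue_on Om"

lemma borel: "Om : sets borel" using opn by simp

lemma smooth_sq: "smooth f ==> sqint MOm f" by (rule smooth_sqint[OF bounded opn])

lemma test_sq: "phi : test_functions Om ==> sqint MOm phi" "phi : test_functions Om ==> sqint MOm (partial i phi)"
 by (intro smooth_sq smooth_partial test_functionD(1)[of _ Om], assumption)+

text \<open>The fundamental lemma of the calculus of variations. At points farther than
  \<open>delta\<close> from the complement the mollification is an integral against a test function,
  hence 0; letting \<open>delta\<close> tend to 0 shows that g vanishes almost everywhere on each of
  the sets \<open>A m\<close>, which exhaust \<open>Om\<close>.\<close>

lemma weak_zero:
 assumes g: "sqint MOm g" and 0: "!!phi. phi : test_functions Om ==> (LINT x|MOm. g x * phi x) = 0"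
 shows "AE x in MOm. g x = 0"
proof (cases "Om = {}")
 case False
 obtain g0 where g0: "sqint lborel g0" "!!x. x ~: Om ==> g0 x = 0" "AE x in MOm. g0 x = g x"
  using borel_representative[OF g borel, of UNIV] by (metis DiffE UNIV_I sets.top space_borel)
 have [measurable]: "g0 : borel_measurable borel" using g0 by (simp add: sqint_def)
 obtain eta :: "plane => real" where eta: "smooth eta" "!!x. eta x >= 0" "ALL x. x ~: cball 0 1 --> eta x = 0" "(LINT x|lborel. eta x) = 1"
  using ex_mollifier[of 0] by blast
 have ne: "- Om ~= {}" using bounded by (metis Compl_empty_eq compl_eq_compl_iff double_compl not_bounded_UNIV)
 define A where "A m = {x. infdist x (- Om) > 1 / real (Suc m)}" for m
 have "open (A m)" for m unfolding A_def by (intro open_Collect_less continuous_intros)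
 then have [measurable]: "A m : sets borel" for m by simp
 have A: "AE x in lborel. x : A m --> g0 x = 0" for m
 proof -
  define f where "f x = g0 x * indicator (A m) x" for x
  have fm[measurable]: "f : borel_measurable borel" unfolding f_def by measurable
  have sf: "sqint lborel f" by (rule sqint_bound[OF g0(1)]) (auto simp: f_def split: split_indicator)
  have small: "l2 lborel f <= e" if "e > 0" for e
  proof -
   obtain d where d: "d > 0" "!!delta. 0 < delta ==> delta < d ==> sqint lborel (%x. conv g0 (sc delta eta) x - g0 x) & l2 lborel (%x. conv g0 (sc delta eta) x - g0 x) <= e"
    using mollify_approx[OF g0(1) smooth_continuous_on[OF eta(1)] eta(2-4) \<open>e > 0\<close>] by blast
   define delta where "delta = min (d / 2) (1 / real (Suc m))"
   have delta: "0 < delta" "delta < d" "delta <= 1 / real (Suc m)" using d(1) by (auto simp: delta_def)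
   have c0: "conv g0 (sc delta eta) x = 0" if x: "x : A m" for x
   proof -
    have "x - delta *\<^sub>R z : Om" if "z : cball 0 1" for z
    proof (rule ccontr)
     assume "x - delta *\<^sub>R z ~: Om"
     then have "infdist x (- Om) <= dist x (x - delta *\<^sub>R z)" by (intro infdist_le) auto
     also have "... <= delta * 1" using that delta by (auto simp: dist_norm intro!: mult_left_mono)
     finally show False using x delta by (simp add: A_def)
    qed
    then have t: "(%y. sc delta eta (x - y)) : test_functions Om" by (rule test_function_sc(1)[OF eta(1,3) delta(1)])
    have "conv g0 (sc delta eta) x = (LINT y|MOm. g y * sc delta eta (x - y))"
     unfolding conv_def
    proof (rule integral_lebesgue_on_eq_lborel[symmetric])
     show "(%y. g0 y * sc delta eta (x - y)) : borel_measurable borel"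
      using smooth_borel_measurable[OF test_functionD(1)[OF t]] by simp
     show "(%y. g y * sc delta eta (x - y)) : borel_measurable MOm"
      using g test_sq(1)[OF t] by (auto simp: sqint_def)
    qed (use g0 borel in auto)
    then show ?thesis using 0[OF t] by simp
   qed
   have "l2 lborel f <= l2 lborel (%x. conv g0 (sc delta eta) x - g0 x)"
    using d(2)[OF delta(1,2)] by (intro l2_le) (auto simp: f_def c0 split: split_indicator)
   then show ?thesis using d(2)[OF delta(1,2)] by simp
  qed
  have "l2 lborel f = 0"
   using l2_nonneg[of lborel f] small[of "l2 lborel f / 2"] by (cases "l2 lborel f = 0") auto
  from l2_zero_AE[OF sf this] show ?thesis by eventually_elim (auto simp: f_def)
 qed
 have "AE x in lborel. ALL m. x : A m --> g0 x = 0" using A unfolding AE_all_countable by blast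
 then have "AE x in lborel. x : Om --> g0 x = 0"
 proof eventually_elim
  case (elim x)
  show ?case
  proof
   assume "x : Om"
   then have "infdist x (- Om) > 0"
    using in_closed_iff_infdist_zero[of "- Om" x] ne opn infdist_nonneg[of x "- Om"] by (auto simp: closed_def less_le)
   then obtain m where "1 / real (Suc m) < infdist x (- Om)" using reals_Archimedean by (metis inverse_eq_divide)
   then show "g0 x = 0" using elim by (auto simp: A_def)
  qed
 qed
 then have "AE x in lebesgue. x : Om --> g0 x = 0" by (simp add: AE_completion_iff)
 then have "AE x in MOm. g0 x = 0" using borel by (subst AE_restrict_space_iff) auto
 with g0(3) show ?thesis by eventually_elim simp
next
 case True
 then show ?thesis by (intro AE_I2) simp
qed

text \<open>\<open>weak_partial\<close> picks some weak derivative; uniqueness makes every fact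
  about a known weak derivative a fact about the picked one.\<close>

lemma weak_partial_unique:
 assumes "sqint MOm g" "sqint MOm g'" "has_weak_partial Om i v g" "has_weak_partial Om i v g'"
 shows "AE x in MOm. g x = g' x"
proof -
 have "AE x in MOm. g x - g' x = 0"
 proof (rule weak_zero[OF sqint_diff[OF assms(1,2)]])
  fix phi assume phi: "phi : test_functions Om"
  have "(LINT x|MOm. g x * phi x) = (LINT x|MOm. g' x * phi x)"
   using assms(3,4) phi by (simp add: has_weak_partial_def)
  then show "(LINT x|MOm. (g x - g' x) * phi x) = 0"
   using sqint_mult_integrable[OF assms(1) test_sq(1)[OF phi]] sqint_mult_integrable[OF assms(2) test_sq(1)[OF phi]]
   by (simp add: left_diff_distrib)
 qed
 then show ?thesis by simp
qed

lemma has_weak_partial_add: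
 assumes "sqint MOm v" "sqint MOm v'" "sqint MOm g" "sqint MOm g'" "has_weak_partial Om i v g" "has_weak_partial Om i v' g'"
 shows "has_weak_partial Om i (%x. v x + v' x) (%x. g x + g' x)"
 unfolding has_weak_partial_def
proof
 fix phi assume phi: "phi : test_functions Om"
 show "(LINT x|MOm. (v x + v' x) * partial i phi x) = - (LINT x|MOm. (g x + g' x) * phi x)"
  using assms(5,6) phi sqint_mult_integrable[OF assms(1) test_sq(2)[OF phi]] sqint_mult_integrable[OF assms(2) test_sq(2)[OF phi]]
   sqint_mult_integrable[OF assms(3) test_sq(1)[OF phi]] sqint_mult_integrable[OF assms(4) test_sq(1)[OF phi]]
  by (simp add: has_weak_partial_def distrib_right)
qed

lemma has_weak_partial_cmult:
 "has_weak_partial Om i v g ==> has_weak_partial Om i (%x. c * v x) (%x. c * g x)"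
 by (simp add: has_weak_partial_def mult.assoc)

lemma has_weak_partial_zero: "has_weak_partial Om i (%x. 0) (%x. 0)"
 by (simp add: has_weak_partial_def)

lemma test_function_mult:
 assumes "phi : test_functions Om" "smooth psi" shows "(%x. psi x * phi x) : test_functions Om"
proof -
 have phi: "smooth phi" "compact (closure {x. phi x ~= 0})" "closure {x. phi x ~= 0} <= Om"
  using assms(1) by (simp_all add: test_functions_def)
 have sub: "closure {x. psi x * phi x ~= 0} <= closure {x. phi x ~= 0}" by (rule closure_mono) auto
 then have "compact (closure {x. psi x * phi x ~= 0})"
  using compact_Int_closed[OF phi(2) closed_closure[of "{x. psi x * phi x ~= 0}"]] by (simp only: Int_absorb1)
 then show ?thesis using sub phi smooth_mult[OF assms(2) phi(1)] by (simp add: test_functions_def)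
qed

lemma has_weak_partial_mult_smooth:
 assumes v: "sqint MOm v" and g: "sqint MOm g" and w: "has_weak_partial Om i v g" and psi: "smooth psi"
 shows "has_weak_partial Om i (%x. v x * psi x) (%x. g x * psi x + v x * partial i psi x)"
 unfolding has_weak_partial_def
proof
 fix phi assume phi: "phi : test_functions Om"
 have t: "(%x. psi x * phi x) : test_functions Om" by (rule test_function_mult[OF phi psi])
 note sphi = test_functionD(1)[OF phi]
 have i1: "integrable MOm (%x. v x * (psi x * partial i phi x))"
  by (intro sqint_mult_integrable v smooth_sq smooth_mult psi smooth_partial sphi)
 have i2: "integrable MOm (%x. v x * (partial i psi x * phi x))"
  by (intro sqint_mult_integrable v smooth_sq smooth_mult psi smooth_partial sphi)
 have i3: "integrable MOm (%x. g x * (psi x * phi x))"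
  by (intro sqint_mult_integrable g smooth_sq smooth_mult psi sphi)
 have "(LINT x|MOm. v x * (psi x * partial i phi x)) + (LINT x|MOm. v x * (partial i psi x * phi x)) = (LINT x|MOm. v x * partial i (%x. psi x * phi x) x)"
  using i1 i2 by (subst Bochner_Integration.integral_add[symmetric]) (simp_all add: partial_mult[OF psi sphi] distrib_left)
 also have "... = - (LINT x|MOm. g x * (psi x * phi x))" using w t by (simp add: has_weak_partial_def)
 finally have "(LINT x|MOm. v x * (psi x * partial i phi x)) = - ((LINT x|MOm. g x * (psi x * phi x)) + (LINT x|MOm. v x * (partial i psi x * phi x)))"
  by simp
 also have "... = - (LINT x|MOm. (g x * psi x + v x * partial i psi x) * phi x)"
  using i2 i3 by (subst Bochner_Integration.integral_add[symmetric]) (simp_all add: distrib_right mult.assoc)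
 finally show "(LINT x|MOm. v x * psi x * partial i phi x) = - (LINT x|MOm. (g x * psi x + v x * partial i psi x) * phi x)"
  by (simp add: mult.assoc)
qed

text \<open>The zero extension of \<open>W\<close> has in general no weak derivative across the
  boundary. The shift condition repairs this: for x in \<open>Om\<close> near \<open>x0\<close> the
  displaced kernel samples points of \<open>Om\<close> only and is a test function there, so the
  derivative of the mollification is the mollification of \<open>G\<close>.\<close>

lemma local_smooth_approx:
 assumes r: "r > 0" "d0 > 0"
  and shift: "!!x z delta. x : Om ==> x : ball x0 r ==> z : cball c 1 ==> 0 < delta ==> delta <= d0 ==> x - delta *\<^sub>R z : Om"
  and W: "sqint MOm W" "!!i. sqint MOm (G i)" "!!i. has_weak_partial Om i W (G i)"
  and supp: "!!x. x : Om - cball x0 (r/2) ==> W x = 0" "!!i x. x : Om - cball x0 (r/2) ==> G i x = 0"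
  and "e > 0"
 obtains Phi where "smooth Phi" "l2 MOm (%x. Phi x - W x) <= e" "!!i. l2 MOm (%x. partial i Phi x - G i x) <= e"
proof -
 let ?A = "cball x0 (r/2)"
 have "ALL x:Om - ?A. W x = 0" "ALL x:Om - ?A. G i x = 0" for i by (rule ballI, erule supp)+
 note rep = borel_representative[OF W(1) borel borel_closed[OF closed_cball] this(1)]
  borel_representative[OF W(2) borel borel_closed[OF closed_cball] this(2)]
 from rep(1) obtain W0 where W0: "sqint lborel W0" "ALL x. x ~: Om --> W0 x = 0" "ALL x. x ~: ?A --> W0 x = 0" "AE x in MOm. W0 x = W x"
  by (elim exE conjE) (rule that)
 define G0 where "G0 i = (SOME g. sqint lborel g & (ALL x. x ~: Om --> g x = 0) & (ALL x. x ~: ?A --> g x = 0) & (AE x in MOm. g x = G i x))" for i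
 have "sqint lborel (G0 i) & (ALL x. x ~: Om --> G0 i x = 0) & (ALL x. x ~: ?A --> G0 i x = 0) & (AE x in MOm. G0 i x = G i x)" for i
  unfolding G0_def by (rule someI_ex[OF rep(2)])
 then have G0: "sqint lborel (G0 i)" "ALL x. x ~: Om --> G0 i x = 0" "ALL x. x ~: ?A --> G0 i x = 0" "AE x in MOm. G0 i x = G i x" for i
  by simp_all
 have W0int: "integrable lborel W0"
 proof -
  have "sqint lborel (indicator ?A :: plane => real)"
  proof -
   have "integrable lborel (indicator ?A :: plane => real)"
    by (rule integrable_real_indicator) (use emeasure_bounded_finite[of ?A] in auto)
   moreover have "(%x. (indicator ?A x :: real)^2) = indicator ?A" by (auto split: split_indicator)
   ultimately show ?thesis by (auto simp: sqint_def)
  qed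
  from sqint_mult_integrable[OF W0(1) this]
  have "integrable lborel (%x. W0 x * indicator ?A x)" .
  moreover have "(%x. W0 x * indicator ?A x) = W0" using W0(3) by (auto split: split_indicator)
  ultimately show ?thesis by simp
 qed
 obtain eta :: "plane => real" where eta: "smooth eta" "!!x. eta x >= 0" "ALL x. x ~: cball c 1 --> eta x = 0" "(LINT x|lborel. eta x) = 1"
  using ex_mollifier[of c] by blast
 note mol = mollify_approx[OF _ smooth_continuous_on[OF eta(1)] eta(2-4) \<open>e > 0\<close>]
 obtain d1 where d1: "d1 > 0" "!!delta. 0 < delta ==> delta < d1 ==> sqint lborel (%x. conv W0 (sc delta eta) x - W0 x) & l2 lborel (%x. conv W0 (sc delta eta) x - W0 x) <= e"
  using mol[OF W0(1)] by blast
 have "EX d>0. ALL delta. 0 < delta & delta < d --> sqint lborel (%x. conv (G0 i) (sc delta eta) x - G0 i x) & l2 lborel (%x. conv (G0 i) (sc delta eta) x - G0 i x) <= e" for i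
  using mol[OF G0(1)] by blast
 then obtain d2 where d2: "!!i. d2 i > 0" "!!i delta. 0 < delta ==> delta < d2 i ==> sqint lborel (%x. conv (G0 i) (sc delta eta) x - G0 i x) & l2 lborel (%x. conv (G0 i) (sc delta eta) x - G0 i x) <= e"
  by metis
 \<comment> \<open>The last bound makes the reach \<open>delta * (norm c + 1)\<close> of the kernel
   smaller than r/2, so that for x outside \<open>ball x0 r\<close> it misses the support of
   \<open>W\<close> and \<open>G\<close>.\<close>
 define delta where "delta = min (min d0 (d1 / 2)) (min (min (d2 1 / 2) (d2 2 / 2)) (r / 4 / (norm c + 1)))"
 have nc: "norm c + 1 > 0" using norm_ge_zero[of c] by linarith
 have delta: "0 < delta" "delta <= d0" "delta < d1" "delta <= r / 4 / (norm c + 1)"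
  using r d1(1) d2(1) nc by (auto simp: delta_def)
 have delta2: "delta < d2 i" for i using exhaust_2[of i] d2(1)[of i] by (auto simp: delta_def)
 have deltar: "delta * (norm c + 1) < r / 2"
 proof -
  have "delta * (norm c + 1) <= r / 4" using delta(4) unfolding pos_le_divide_eq[OF nc] .
  then show ?thesis using r by simp
 qed
 define Phi where "Phi = conv W0 (sc delta eta)"
 have bs: "bounded_support (sc delta eta)" by (rule bounded_support_sc[OF eta(3) delta(1)])
 have smPhi: "smooth Phi" unfolding Phi_def by (rule smooth_conv[OF W0int smooth_sc[OF eta(1)] bs])
 have pPhi: "partial i Phi x = conv (G0 i) (sc delta eta) x" if x: "x : Om" for i x
 proof -
  have "partial i Phi x = conv W0 (partial i (sc delta eta)) x"
   unfolding Phi_def by (rule partial_conv[OF W0int smooth_sc[OF eta(1)] bs])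
  also have "... = conv (G0 i) (sc delta eta) x"
  proof (cases "x : ball x0 r")
   case True
   have t: "(%y. sc delta eta (x - y)) : test_functions Om"
    by (rule test_function_sc(1)[OF eta(1,3) delta(1)]) (use shift[OF x True] delta in auto)
   have tp: "partial i (%y. sc delta eta (x - y)) y = - partial i (sc delta eta) (x - y)" for y
    by (rule test_function_sc(2)[OF eta(1,3) delta(1)]) (use shift[OF x True] delta in auto)
   note sm = test_functionD(1)[OF t]
   have "- conv W0 (partial i (sc delta eta)) x = (LINT y|lborel. W0 y * partial i (%y. sc delta eta (x - y)) y)"
    unfolding conv_def tp by simp
   also have "... = (LINT y|MOm. W y * partial i (%y. sc delta eta (x - y)) y)"
   proof (rule integral_lebesgue_on_eq_lborel[symmetric])
    show "(%y. W0 y * partial i (%y. sc delta eta (x - y)) y) : borel_measurable borel"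
     using smooth_borel_measurable[OF smooth_partial[OF sm]] W0(1) by (intro borel_measurable_times) (simp_all add: sqint_def)
    show "(%y. W y * partial i (%y. sc delta eta (x - y)) y) : borel_measurable MOm"
     by (rule borel_measurable_integrable[OF sqint_mult_integrable[OF W(1) test_sq(2)[OF t]]])
   qed (use W0 borel in auto)
   also have "... = - (LINT y|MOm. G i y * sc delta eta (x - y))"
    using W(3)[of i] t by (simp add: has_weak_partial_def)
   also have "(LINT y|MOm. G i y * sc delta eta (x - y)) = (LINT y|lborel. G0 i y * sc delta eta (x - y))"
   proof (rule integral_lebesgue_on_eq_lborel)
    show "(%y. G0 i y * sc delta eta (x - y)) : borel_measurable borel"
     using smooth_borel_measurable[OF sm] G0(1)[of i] by (intro borel_measurable_times) (simp_all add: sqint_def)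
    show "(%y. G i y * sc delta eta (x - y)) : borel_measurable MOm"
     by (rule borel_measurable_integrable[OF sqint_mult_integrable[OF W(2) test_sq(1)[OF t]]])
    show "AE y in MOm. G0 i y * sc delta eta (x - y) = G i y * sc delta eta (x - y)"
     using G0(4)[of i] by eventually_elim simp
   qed (use G0(2) borel in auto)
   finally show ?thesis by (simp add: conv_def)
  next
   case False
   have far: "norm (x - y - delta *\<^sub>R c) > delta" if "y : ?A" for y
   proof -
    have "r <= norm (x - x0)" using False by (simp add: dist_norm norm_minus_commute)
    also have "x - x0 = (x - y - delta *\<^sub>R c) + (y - x0) + delta *\<^sub>R c" by simp
    also have "norm ... <= norm (x - y - delta *\<^sub>R c) + norm (y - x0) + norm (delta *\<^sub>R c)"
     by (intro order_trans[OF norm_triangle_ineq] add_right_mono norm_triangle_ineq)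
    also have "norm (y - x0) <= r / 2" using that by (simp add: dist_norm norm_minus_commute)
    finally have "r / 2 <= norm (x - y - delta *\<^sub>R c) + delta * norm c" using delta(1) by simp
    then show ?thesis using deltar by (simp add: distrib_left)
   qed
   have "conv W0 (partial i (sc delta eta)) x = 0"
    unfolding conv_def
    using W0(3) partial_sc_zero[OF eta(3) delta(1) far] by (intro integral_eq_zero_AE AE_I2) (metis mult_eq_0_iff)
   moreover have "conv (G0 i) (sc delta eta) x = 0"
    unfolding conv_def
    using G0(3) sc_zero[OF eta(3) delta(1) far] by (intro integral_eq_zero_AE AE_I2) (metis mult_eq_0_iff)
   ultimately show ?thesis by simp
  qed
  finally show ?thesis .
 qed
 have "l2 MOm (%x. Phi x - W x) = l2 MOm (%x. Phi x - W0 x)"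
  using W0(4) W(1) smooth_sq[OF smPhi] sqint_lborel_restrict(1)[OF W0(1) borel]
  by (intro l2_cong_AE) (auto simp: sqint_def elim: eventually_mono)
 also have "... <= e"
  using d1(2)[OF delta(1,3)] sqint_lborel_restrict(2)[OF _ borel, of "%x. Phi x - W0 x"] unfolding Phi_def by simp
 finally have 1: "l2 MOm (%x. Phi x - W x) <= e" .
 have 2: "l2 MOm (%x. partial i Phi x - G i x) <= e" for i
 proof -
  have s: "sqint lborel (%x. conv (G0 i) (sc delta eta) x - G0 i x)" using d2(2)[OF delta(1) delta2] by blast
  have "l2 MOm (%x. partial i Phi x - G i x) = l2 MOm (%x. conv (G0 i) (sc delta eta) x - G0 i x)"
  proof (rule l2_cong_AE)
   show "(%x. partial i Phi x - G i x) : borel_measurable MOm"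
    using W(2)[of i] smooth_sq[OF smooth_partial[OF smPhi, of i]] by (auto simp: sqint_def)
   show "(%x. conv (G0 i) (sc delta eta) x - G0 i x) : borel_measurable MOm"
    using sqint_lborel_restrict(1)[OF s borel] by (simp add: sqint_def)
   have "AE x in MOm. x : Om" using AE_space[of MOm] by simp
   with G0(4)[of i] show "AE x in MOm. partial i Phi x - G i x = conv (G0 i) (sc delta eta) x - G0 i x"
    by eventually_elim (simp add: pPhi)
  qed
  also have "... <= e" using d2(2)[OF delta(1) delta2[of i]] sqint_lborel_restrict(2)[OF s borel] by simp
  finally show ?thesis .
 qed
 show ?thesis by (rule that[OF smPhi 1 2])
qed

end

lemma divide_mult_cancel_real: "c ~= 0 ==> a / c * c = (a::real)" by simp

text \<open>At an interior point any short shift will do. At a boundary point, motion along the axis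
  \<open>e2\<close> of the local graph leads into the domain, and so do all directions close to it
  that are steeper than the graph.\<close>

lemma lipschitz_shift:
 assumes "open Om" "lipschitz_boundary Om" "x0 : closure Om"
 shows "EX r>0. EX d>0. EX c. ALL x z delta. x : Om --> x : ball x0 r --> z : cball c 1 --> 0 < delta --> delta <= d --> x - delta *\<^sub>R z : Om"
proof (cases "x0 : Om")
 case True
 then obtain \<rho> where \<rho>: "\<rho> > 0" "ball x0 \<rho> <= Om" using assms(1) open_contains_ball by blast
 have "x - delta *\<^sub>R z : Om" if "x : ball x0 (\<rho>/2)" "z : cball 0 1" "0 < delta" "delta <= \<rho>/2" for x z delta
 proof -
  have "dist x0 (x - delta *\<^sub>R z) <= dist x0 x + dist x (x - delta *\<^sub>R z)" by (rule dist_triangle)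
  also have "dist x (x - delta *\<^sub>R z) = delta * norm z" using that by (simp add: dist_norm)
  also have "delta * norm z <= (\<rho>/2) * 1" using that \<rho> by (intro mult_mono) auto
  finally have "dist x0 (x - delta *\<^sub>R z) < \<rho>" using that by simp
  then show ?thesis using \<rho>(2) by auto
 qed
 then show ?thesis using \<rho>(1) by (intro exI[of _ "\<rho>/2"] conjI exI[of _ 0]) auto
next
 case False
 then have x0: "x0 : frontier Om" using assms(1,3) by (simp add: frontier_def interior_open)
 obtain r0 e1 e2 f L where r0: "r0 > 0" and e: "norm e1 = 1" "norm e2 = 1" "e1 \<bullet> e2 = 0"
  and L: "L-lipschitz_on UNIV f" and g: "Om \<inter> ball x0 r0 = {y : ball x0 r0. f (y \<bullet> e1) < y \<bullet> e2}"
  using bspec[OF assms(2)[unfolded lipschitz_boundary_def] x0] by (elim exE conjE) (rule that)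
 have L0: "L >= 0" using L by (rule lipschitz_on_nonneg)
 \<comment> \<open>Every z within distance 1 of \<open>c\<close> has second coordinate at most -L
   and first coordinate at most 1 in absolute value: the point x - delta z rises by at least delta
   L, and the graph below it by at most that.\<close>
 define M where "M = L + 1"
 define c where "c = - (M *\<^sub>R e2)"
 define d where "d = r0 / 2 / (M + 1)"
 have d0: "d > 0" using r0 L0 by (simp add: d_def M_def)
 have "x - delta *\<^sub>R z : Om" if x: "x : Om" "x : ball x0 (r0/2)" and z: "z : cball c 1" and delta: "0 < delta" "delta <= d" for x z delta
 proof -
  define zeta where "zeta = z - c"
  have zeta: "norm zeta <= 1" using z by (simp add: zeta_def dist_norm norm_minus_commute)
  have z_eq: "z = zeta - M *\<^sub>R e2" by (simp add: zeta_def c_def)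
  have nz: "norm z <= M + 1"
   using norm_triangle_ineq4[of zeta "M *\<^sub>R e2"] zeta e L0 by (simp add: z_eq M_def)
  have "delta * norm z <= d * (M + 1)" using delta nz L0 by (intro mult_mono) (auto simp: M_def)
  also have "... = r0 / 2" unfolding d_def using L0 by (intro divide_mult_cancel_real) (simp add: M_def)
  finally have dz: "delta * norm z <= r0 / 2" .
  have "dist x0 (x - delta *\<^sub>R z) <= dist x0 x + dist x (x - delta *\<^sub>R z)" by (rule dist_triangle)
  also have "dist x (x - delta *\<^sub>R z) = delta * norm z" using delta by (simp add: dist_norm)
  finally have inb: "x - delta *\<^sub>R z : ball x0 r0" using x(2) dz by simp
  have "x : ball x0 r0" using x(2) r0 by simp
  then have fx: "f (x \<bullet> e1) < x \<bullet> e2" using g x(1) by blast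
  have "\<bar>zeta \<bullet> e1\<bar> <= 1" "\<bar>zeta \<bullet> e2\<bar> <= 1"
   using Cauchy_Schwarz_ineq2[of zeta e1] Cauchy_Schwarz_ineq2[of zeta e2] zeta e by auto
  then have ze: "\<bar>z \<bullet> e1\<bar> <= 1" "z \<bullet> e2 <= - L"
   using e by (auto simp: z_eq M_def inner_diff_left inner_commute[of e2 e1] norm_eq_1)
  have "f ((x - delta *\<^sub>R z) \<bullet> e1) - f (x \<bullet> e1) <= L * dist ((x - delta *\<^sub>R z) \<bullet> e1) (x \<bullet> e1)"
   using lipschitz_onD[OF L, of "(x - delta *\<^sub>R z) \<bullet> e1" "x \<bullet> e1"] by (simp add: dist_real_def)
  also have "dist ((x - delta *\<^sub>R z) \<bullet> e1) (x \<bullet> e1) = delta * \<bar>z \<bullet> e1\<bar>"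
   using delta by (simp add: dist_real_def inner_diff_left abs_mult)
  also have "L * (delta * \<bar>z \<bullet> e1\<bar>) <= L * (delta * 1)"
   using L0 delta ze by (intro mult_left_mono) auto
  also have "L * (delta * 1) <= - (delta * (z \<bullet> e2))"
   using mult_left_mono[OF ze(2), of delta] delta by (simp add: mult.commute)
  finally have "f ((x - delta *\<^sub>R z) \<bullet> e1) < (x - delta *\<^sub>R z) \<bullet> e2"
   using fx by (simp add: inner_diff_left)
  then show ?thesis using g inb by blast
 qed
 then show ?thesis using r0 d0 by (intro exI[of _ "r0/2"] conjI exI[of _ d] exI[of _ c]) auto
qed

locale lip_domain = bounded_open +
 assumes lip: "lipschitz_boundary Om"
begin

text \<open>Density up to the boundary: each product of v with a member of a partition of unity is
  supported in a ball where the local approximation applies.\<close>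

theorem smooth_dense:
 assumes v: "sqint MOm v" and g: "!!i. sqint MOm (g i)" and w: "!!i. has_weak_partial Om i v (g i)" and "e > 0"
 shows "EX Phi. smooth Phi & l2 MOm (%x. Phi x - v x) <= e & (ALL i. l2 MOm (%x. partial i Phi x - g i x) <= e)"
proof -
 define P where "P x0 r d c \<longleftrightarrow> r > 0 & d > 0 & (ALL x z delta. x : Om --> x : ball x0 r --> z : cball c 1 --> 0 < delta --> delta <= d --> x - delta *\<^sub>R z : Om)" for x0 r d c
 have "ALL x0:closure Om. EX r d c. P x0 r d c"
  using lipschitz_shift[OF opn lip] unfolding P_def by blast
 then obtain r d c where P: "!!x0. x0 : closure Om ==> P x0 (r x0) (d x0) (c x0)" by metis
 have cpt: "compact (closure Om)" using bounded by simp
 have r0: "r x / 2 > 0" if "x : closure Om" for x using P[OF that] by (simp add: P_def)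
 have "EX X psi. finite X & X <= closure Om & (ALL x:X. smooth (psi x)) & (ALL x:X. ALL y. y ~: ball x (r x / 2) --> psi x y = 0) &
  (ALL y:closure Om. (SUM x:X. psi x y) = 1)"
 proof (rule partition_of_unity[OF cpt, of "%x. r x / 2"])
  fix X psi
  assume "finite X" "X <= closure Om" "!!x. x : X ==> smooth (psi x)"
   "!!x y. x : X ==> y ~: ball x (r x / 2) ==> psi x y = 0" "!!y. y : closure Om ==> (SUM x:X. psi x y) = 1"
  then show ?thesis by (intro exI[of _ X] exI[of _ psi]) (simp del: mem_ball)
 qed (erule r0)
 then obtain X psi where X': "finite X" "X <= closure Om" "ALL x:X. smooth (psi x)"
  "ALL x:X. ALL y. y ~: ball x (r x / 2) --> psi x y = 0" "ALL y:closure Om. (SUM x:X. psi x y) = 1"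
  by (elim exE conjE) (rule that)
 have X: "finite X" "X <= closure Om" "!!x. x : X ==> smooth (psi x)"
  "!!x y. x : X ==> y ~: ball x (r x / 2) ==> psi x y = 0" "!!y. y : closure Om ==> (SUM x:X. psi x y) = 1"
  using X' by (simp_all del: mem_ball)
 \<comment> \<open>An equal share of the error for every piece; the summand 1 covers an empty
   partition.\<close>
 define e' where "e' = e / (real (card X) + 1)"
 have e': "e' > 0" using \<open>e > 0\<close> by (simp add: e'_def)
 have ce: "real (card X) * e' <= e" using \<open>e > 0\<close> by (simp add: e'_def field_simps)
 define Q where "Q x Phi \<longleftrightarrow> smooth Phi & l2 MOm (%y. Phi y - v y * psi x y) <= e' &
  (ALL i. l2 MOm (%y. partial i Phi y - (g i y * psi x y + v y * partial i (psi x) y)) <= e')" for x Phi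
 have "ALL x:X. EX Phi. Q x Phi"
 proof
  fix x assume x: "x : X"
  have xc: "x : closure Om" using X(2) x by auto
  note Px = P[OF xc, unfolded P_def]
  have rd: "r x > 0" "d x > 0" using Px by simp_all
  have sh: "y - delta *\<^sub>R z : Om" if "y : Om" "y : ball x (r x)" "z : cball (c x) 1" "0 < delta" "delta <= d x" for y z delta
   using Px that by blast
  have s1: "sqint MOm (%y. v y * psi x y)" by (rule sqint_mult_smooth[OF bounded opn v X(3)[OF x]])
  have s2: "sqint MOm (%y. g i y * psi x y + v y * partial i (psi x) y)" for i
   by (intro sqint_add sqint_mult_smooth[OF bounded opn] g v smooth_partial X(3) x)
  have h: "has_weak_partial Om i (%y. v y * psi x y) (%y. g i y * psi x y + v y * partial i (psi x) y)" for i
   by (rule has_weak_partial_mult_smooth[OF v g w X(3)[OF x]])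
  have z1: "psi x y = 0" if "y : Om - cball x (r x / 2)" for y using X(4)[OF x, of y] that by simp
  have z2: "partial i (psi x) y = 0" if "y : Om - cball x (r x / 2)" for i y
   by (rule partial_zero_open[of "- cball x (r x / 2)"]) (use that X(4)[OF x] in auto)
  show "EX Phi. Q x Phi" unfolding Q_def
  proof (rule local_smooth_approx[OF rd _ s1 s2 h _ _ e', where c="c x" and ?x0.0=x])
   fix Phi assume "smooth Phi" "l2 MOm (%y. Phi y - v y * psi x y) <= e'"
    "!!i. l2 MOm (%y. partial i Phi y - (g i y * psi x y + v y * partial i (psi x) y)) <= e'"
   then show "EX Phi. smooth Phi & l2 MOm (%y. Phi y - v y * psi x y) <= e' &
    (ALL i. l2 MOm (%y. partial i Phi y - (g i y * psi x y + v y * partial i (psi x) y)) <= e')" by blast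
  qed (simp_all add: z1 z2 sh del: mem_ball mem_cball)
 qed
 from bchoice[OF this] obtain Phi where "ALL x:X. Q x (Phi x)" ..
 then have Phi: "!!x. x : X ==> smooth (Phi x)" "!!x. x : X ==> l2 MOm (%y. Phi x y - v y * psi x y) <= e'"
  "!!x i. x : X ==> l2 MOm (%y. partial i (Phi x) y - (g i y * psi x y + v y * partial i (psi x) y)) <= e'"
  by (simp_all add: Q_def)
 have sm: "smooth (%y. SUM x:X. Phi x y)" by (intro smooth_sum Phi)
 have "l2 MOm (%y. (SUM x:X. Phi x y) - v y) = l2 MOm (%y. SUM x:X. Phi x y - v y * psi x y)"
 proof (rule l2_cong)
  fix y assume "y : space MOm"
  then have "(SUM x:X. psi x y) = 1" using X(5)[of y] closure_subset[of Om] by auto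
  then show "(SUM x:X. Phi x y) - v y = (SUM x:X. Phi x y - v y * psi x y)"
   by (simp add: sum_subtractf sum_distrib_left[symmetric])
 qed
 also have "... <= (SUM x:X. l2 MOm (%y. Phi x y - v y * psi x y))"
  by (intro l2_sum_le sqint_diff smooth_sq Phi sqint_mult_smooth[OF bounded opn v] X(3))
 also have "... <= (SUM x:X. e')" by (intro sum_mono Phi)
 finally have 1: "l2 MOm (%y. (SUM x:X. Phi x y) - v y) <= e" using ce by simp
 have 2: "l2 MOm (%y. partial i (%y. SUM x:X. Phi x y) y - g i y) <= e" for i
 proof -
  have "l2 MOm (%y. partial i (%y. SUM x:X. Phi x y) y - g i y) =
   l2 MOm (%y. SUM x:X. partial i (Phi x) y - (g i y * psi x y + v y * partial i (psi x) y))"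
  proof (rule l2_cong)
   fix y assume "y : space MOm"
   then have y: "y : Om" by simp
   have "(SUM x:X. psi x y) = 1" using X(5)[of y] closure_subset[of Om] y by auto
   \<comment> \<open>The weights sum to 1 on the open set \<open>Om\<close>, so their derivatives
     sum to 0 there, and the extra terms of the product rule cancel.\<close>
   moreover have "(SUM x:X. partial i (psi x) y) = 0"
   proof -
    have "partial i (%y. (SUM x:X. psi x y) - 1) y = 0"
     by (rule partial_zero_open[OF opn y]) (use X(5) closure_subset[of Om] in auto)
    then show ?thesis
     by (simp add: partial_diff[OF smooth_sum[OF X(3)] smooth_const] partial_sum X(3) partial_const)
   qed
   ultimately show "partial i (%y. SUM x:X. Phi x y) y - g i y = (SUM x:X. partial i (Phi x) y - (g i y * psi x y + v y * partial i (psi x) y))"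
    by (simp add: partial_sum Phi(1) sum_subtractf sum.distrib sum_distrib_left[symmetric])
  qed
  also have "... <= (SUM x:X. l2 MOm (%y. partial i (Phi x) y - (g i y * psi x y + v y * partial i (psi x) y)))"
   by (intro l2_sum_le sqint_diff smooth_sq smooth_partial Phi sqint_add sqint_mult_smooth[OF bounded opn] v g X(3))
  also have "... <= (SUM x:X. e')" by (intro sum_mono Phi)
  finally show ?thesis using ce by simp
 qed
 from sm 1 2 show ?thesis by blast
qed

end

section \<open>Sobolev functions\<close>

text \<open>If the line contained more than one point of the segment, it would contain
  \<open>p\<close>, whose transverse coordinate would then be t. So excluding one value of t per
  segment suffices.\<close>

lemma finite_segment_line:
 fixes p q :: plane
 assumes "j ~= i" "p $ j ~= t"
 shows "finite {s. s *\<^sub>R axis i 1 + t *\<^sub>R axis j 1 : closed_segment p q}"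
proof -
 have comp: "(s *\<^sub>R axis i 1 + t *\<^sub>R axis j 1 :: plane) $ i = s" "(s *\<^sub>R axis i 1 + t *\<^sub>R axis j 1 :: plane) $ j = t" for s
  using assms(1) by (auto simp: axis_def)
 have "s = (1 - (t - p $ j) / (q $ j - p $ j)) * p $ i + (t - p $ j) / (q $ j - p $ j) * q $ i"
  if sg: "s *\<^sub>R axis i 1 + t *\<^sub>R axis j 1 : closed_segment p q" for s
 proof -
  obtain u where u: "s *\<^sub>R axis i 1 + t *\<^sub>R axis j 1 = (1 - u) *\<^sub>R p + u *\<^sub>R q"
   using sg by (auto simp: closed_segment_def)
  have t: "t = (1 - u) * p $ j + u * q $ j" using arg_cong[OF u, of "%x. x $ j"] comp(2)[of s] by simp
  have s: "s = (1 - u) * p $ i + u * q $ i" using arg_cong[OF u, of "%x. x $ i"] comp(1)[of s] by simp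
  have "u * (q $ j - p $ j) = t - p $ j" using t by (simp add: algebra_simps)
  moreover have "q $ j - p $ j ~= 0" using assms(2) t by (auto simp: algebra_simps)
  ultimately have "u = (t - p $ j) / (q $ j - p $ j)" by (simp add: nonzero_eq_divide_eq)
  then show ?thesis using s by simp
 qed
 then have "{s. s *\<^sub>R axis i 1 + t *\<^sub>R axis j 1 : closed_segment p q} <=
  {(1 - (t - p $ j) / (q $ j - p $ j)) * p $ i + (t - p $ j) / (q $ j - p $ j) * q $ i}" by blast
 then show ?thesis by (rule finite_subset) simp
qed

context bounded_open
begin

text \<open>Continuity across the edges is what removes the jump terms. The product \<open>F\<close>
  of f and a test function is continuous on the plane and, on all but finitely many coordinate
  lines, differentiable except at finitely many crossings with edges; so the integral of its
  derivative vanishes.\<close>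

lemma has_weak_partial_piecewise:
 assumes T: "finite T" "!!K. K : T ==> closed K" "\<Union>T = closure Om"
  and disj: "!!K K'. K : T ==> K' : T ==> K ~= K' ==> interior K \<inter> interior K' = {}"
  and seg: "finite Sg" "(UN K:T. frontier K) <= (UN (p, q):Sg. closed_segment p q)" "negligible (UN K:T. frontier K)"
  and psi: "!!K. K : T ==> smooth (psi K)" and f: "!!K x. K : T ==> x : K ==> f x = psi K x"
  and g: "!!K x. K : T ==> x : interior K ==> g x = partial i (psi K) x"
  and sq: "sqint MOm f" "sqint MOm g"
 shows "has_weak_partial Om i f g"
 unfolding has_weak_partial_def
proof
 fix phi assume phi: "phi : test_functions Om"
 note tf = test_functionD[OF phi]
 obtain j where j: "j ~= i" using other_coordinate[of i] by metis
 define F where "F x = f x * phi x" for x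
 define G where "G x = (SUM K:T. indicator (interior K) x * partial i (%x. psi K x * phi x) x)" for x
 have Gint: "G x = partial i (%x. psi K x * phi x) x" if "K : T" "x : interior K" for K x
 proof -
  have "G x = (SUM K':T. if K' = K then partial i (%x. psi K x * phi x) x else 0)"
   unfolding G_def
  proof (rule sum.cong)
   fix K' assume "K' : T"
   then show "indicator (interior K') x * partial i (%x. psi K' x * phi x) x = (if K' = K then partial i (%x. psi K x * phi x) x else 0)"
    using disj[of K' K] that by (auto simp: indicator_def)
  qed simp
  then show ?thesis using that T(1) by simp
 qed
 have Gout: "G x = 0" if "x ~: closure Om" for x
 proof -
  have "x ~: interior K" if "K : T" for K
   using \<open>x ~: closure Om\<close> that T(3) interior_subset[of K] by blast
  then show ?thesis unfolding G_def by (intro sum.neutral) (simp add: indicator_def)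
 qed
 obtain R where R: "!!x. x : closure Om ==> norm x <= R" using bounded_closure[OF bounded] by (auto simp: bounded_iff)
 have Fc: "continuous_on UNIV F"
 proof -
  have "continuous_on (\<Union>T) f"
  proof -
   have "continuous_on (UN K:T. K) f"
   proof (rule continuous_on_closed_Union[OF T(1,2)])
    show "continuous_on K f" if "K : T" for K
     by (rule continuous_on_eq[OF smooth_continuous_on[OF psi[OF that]]]) (rule f[OF that, symmetric])
   qed
   then show ?thesis by simp
  qed
  then have "continuous_on (\<Union>T) F" unfolding F_def
   by (intro continuous_on_mult smooth_continuous_on[OF tf(1)])
  moreover have "continuous_on (- Om) F"
   using continuous_on_const[of "- Om" "0::real"] by (rule continuous_on_eq) (simp add: F_def tf(3))
  ultimately have "continuous_on (\<Union>T \<union> - Om) F"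
   using opn T(3) by (intro continuous_on_closed_Un) auto
  moreover have "\<Union>T \<union> - Om = UNIV" using T(3) closure_subset[of Om] by auto
  ultimately show ?thesis by simp
 qed
 have Gi: "integrable lborel G"
  unfolding G_def
 proof (intro Bochner_Integration.integrable_sum)
  fix K assume K: "K : T"
  have c: "continuous_on UNIV (partial i (%x. psi K x * phi x))"
   by (intro smooth_continuous_on smooth_partial smooth_mult psi K tf(1))
  have "integrable lborel (%x. indicator (cball 0 R) x *\<^sub>R partial i (%x. psi K x * phi x) x)"
   by (rule borel_integrable_compact) (use c continuous_on_subset in auto)
  then have "integrable lborel (%x. indicator (interior K) x *\<^sub>R (indicator (cball 0 R) x *\<^sub>R partial i (%x. psi K x * phi x) x))"
   by (rule integrable_mult_indicator[rotated]) simp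
  moreover have "indicator (interior K) x *\<^sub>R (indicator (cball 0 R) x *\<^sub>R partial i (%x. psi K x * phi x) x) =
   indicator (interior K) x * partial i (%x. psi K x * phi x) x" for x
   using R[of x] K T(3) interior_subset[of K] by (cases "x : interior K") (auto simp: indicator_def)
  ultimately show "integrable lborel (%x. indicator (interior K) x * partial i (%x. psi K x * phi x) x)" by (simp only:)
 qed
 have "(LINT x|lborel. G x) = 0"
 proof (rule integral_derivative_eq_zero[OF j Gi, where N="(%(p, q). p $ j) ` Sg" and F=F and R=R])
  show "finite ((%(p, q). p $ j) ` Sg)" using seg(1) by simp
  show "continuous_on UNIV (%s. F (s *\<^sub>R axis i 1 + t *\<^sub>R axis j 1))" for t
   by (intro continuous_on_compose2[OF Fc] continuous_intros) auto
  show "F x = 0" if "norm x > R" for x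
   using R[of x] closure_subset[of Om] tf(3)[of x] that by (auto simp: F_def)
  show "G x = 0" if "norm x > R" for x using R[of x] Gout[of x] that by force
  fix t assume t: "t ~: (%(p, q). p $ j) ` Sg"
  define S where "S = (UN (p, q):Sg. {s. s *\<^sub>R axis i 1 + t *\<^sub>R axis j 1 : closed_segment p q})"
  have "finite S" unfolding S_def
  proof (rule finite_UN_I[OF seg(1)])
   fix pq assume pq: "pq : Sg"
   obtain p q where [simp]: "pq = (p, q)" by (cases pq)
   have "p $ j ~= t" using t pq by force
   then show "finite (case pq of (p, q) => {s. s *\<^sub>R axis i 1 + t *\<^sub>R axis j 1 : closed_segment p q})"
    using finite_segment_line[OF j] by simp
  qed
  moreover have "((%s. F (s *\<^sub>R axis i 1 + t *\<^sub>R axis j 1)) has_vector_derivative G (s *\<^sub>R axis i 1 + t *\<^sub>R axis j 1)) (at s)"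
   if s: "s ~: S" for s
  proof -
   let ?y = "%s. s *\<^sub>R axis i 1 + t *\<^sub>R axis j 1 :: plane"
   have cont: "continuous_on UNIV ?y" by (intro continuous_intros)
   have "?y s ~: (UN (p, q):Sg. closed_segment p q)" using s by (auto simp: S_def)
   then have nf: "?y s ~: frontier K" if "K : T" for K using seg(2) that by blast
   show ?thesis
   proof (cases "?y s : \<Union>T")
    case True
    then obtain K where K: "K : T" "?y s : K" by blast
    then have yi: "?y s : interior K"
     using nf[of K] T(2)[of K] by (simp add: frontier_def)
    have sm: "smooth (%x. psi K x * phi x)" by (intro smooth_mult psi K tf(1))
    have "((%s. (%x. psi K x * phi x) (t *\<^sub>R axis j 1 + s *\<^sub>R axis i 1)) has_real_derivative
     (SUM k:UNIV. partial k (%x. psi K x * phi x) (t *\<^sub>R axis j 1 + s *\<^sub>R axis i 1) * axis i 1 $ k)) (at s)"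
     by (rule smooth_line_derivative[OF sm])
    moreover have "(SUM k:UNIV. partial k (%x. psi K x * phi x) (t *\<^sub>R axis j 1 + s *\<^sub>R axis i 1) * axis i 1 $ k) = G (?y s)"
     using Gint[OF K(1) yi] by (simp add: axis_def if_distrib[of "(*) _"] add.commute cong: if_cong)
    ultimately have "((%s. psi K (?y s) * phi (?y s)) has_vector_derivative G (?y s)) (at s)"
     by (simp add: has_real_derivative_iff_has_vector_derivative add.commute)
    then show ?thesis
    proof (rule has_vector_derivative_transform_within_open)
     show "open (?y -` interior K)" by (rule open_vimage[OF open_interior cont])
     show "s : ?y -` interior K" using yi by simp
     show "psi K (?y s) * phi (?y s) = F (?y s)" if "s : ?y -` interior K" for s
      using that f[OF K(1), of "?y s"] interior_subset[of K] by (auto simp: F_def)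
    qed
   next
    case False
    have "((%s. 0) has_vector_derivative 0) (at s)" by simp
    then have "((%s. F (?y s)) has_vector_derivative 0) (at s)"
    proof (rule has_vector_derivative_transform_within_open)
     show "open (?y -` (- \<Union>T))" by (rule open_vimage[OF _ cont]) (simp add: T(3) open_Compl)
     show "s : ?y -` (- \<Union>T)" using False by simp
     show "0 = F (?y s)" if "s : ?y -` (- \<Union>T)" for s
      using that tf(3)[of "?y s"] closure_subset[of Om] T(3) by (auto simp: F_def)
    qed
    then show ?thesis using Gout[of "?y s"] False T(3) by simp
   qed
  qed
  ultimately show "EX S. finite S & (ALL s. s ~: S --> ((%s. F (s *\<^sub>R axis i 1 + t *\<^sub>R axis j 1)) has_vector_derivative G (s *\<^sub>R axis i 1 + t *\<^sub>R axis j 1)) (at s))"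
   by blast
 qed
 moreover have "(LINT x|MOm. f x * partial i phi x + g x * phi x) = (LINT x|lborel. indicator Om x * G x)"
 proof (rule integral_lebesgue_on_eq_lborel)
  show "(%x. indicator Om x * G x) : borel_measurable borel"
   using borel_measurable_integrable[OF Gi] borel by (intro borel_measurable_times) auto
  show "(%x. f x * partial i phi x + g x * phi x) : borel_measurable MOm"
   by (intro borel_measurable_add borel_measurable_integrable sqint_mult_integrable sq test_sq[OF phi])
  have "AE x in lebesgue. x ~: (UN K:T. frontier K)"
   by (rule AE_not_in[OF seg(3)[unfolded negligible_iff_null_sets]])
  then have "AE x in MOm. x ~: (UN K:T. frontier K)" using borel by (subst AE_restrict_space_iff) (auto elim: eventually_mono)
  moreover have "AE x in MOm. x : Om" using AE_space[of MOm] by simp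
  ultimately show "AE x in MOm. indicator Om x * G x = f x * partial i phi x + g x * phi x"
  proof eventually_elim
   case (elim x)
   then have "x : \<Union>T" using T(3) closure_subset[of Om] by blast
   then obtain K where K: "K : T" "x : K" by blast
   then have xi: "x : interior K" using elim T(2)[OF K(1)] by (auto simp: frontier_def)
   have "G x = psi K x * partial i phi x + partial i (psi K) x * phi x"
    unfolding Gint[OF K(1) xi] by (rule partial_mult[OF psi[OF K(1)] tf(1)])
   then show ?case using elim f[OF K] g[OF K(1) xi] by simp
  qed
 qed (use borel in auto)
 moreover have "(LINT x|lborel. indicator Om x * G x) = (LINT x|lborel. G x)"
 proof (rule Bochner_Integration.integral_cong)
  fix x
  show "indicator Om x * G x = G x"
  proof (cases "x : Om")
   case False
   have "partial i (%x. psi K x * phi x) x = 0" if "K : T" for K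
    using partial_mult[OF psi[OF that] tf(1), of i x] tf(3)[OF False] tf(4)[OF False] by simp
   then have "G x = 0" unfolding G_def by (intro sum.neutral) simp
   then show ?thesis by simp
  qed simp
 qed simp
 ultimately have "(LINT x|MOm. f x * partial i phi x + g x * phi x) = 0" by simp
 then show "(LINT x|MOm. f x * partial i phi x) = - (LINT x|MOm. g x * phi x)"
  using sqint_mult_integrable[OF sq(1) test_sq(2)[OF phi]] sqint_mult_integrable[OF sq(2) test_sq(1)[OF phi]]
  by (simp add: eq_neg_iff_add_eq_0)
qed

lemma H1D:
 assumes "v : H1 Om"
 shows "sqint MOm v" "sqint MOm (weak_partial Om i v)" "has_weak_partial Om i v (weak_partial Om i v)"
proof -
 have "EX g. g : L2 Om & has_weak_partial Om i v g" using assms unfolding H1_def by blast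
 from someI_ex[OF this] show "sqint MOm (weak_partial Om i v)" "has_weak_partial Om i v (weak_partial Om i v)"
  unfolding weak_partial_def by (simp_all add: L2_iff)
 show "sqint MOm v" using assms by (simp add: H1_def L2_iff)
qed

lemma H1_intro:
 assumes "sqint MOm v" "!!i. sqint MOm (g i)" "!!i. has_weak_partial Om i v (g i)"
 shows "v : H1 Om" "AE x in MOm. weak_partial Om i v x = g i x"
proof -
 have "EX g:L2 Om. has_weak_partial Om i v g" for i
  by (rule bexI[of _ "g i"]) (simp_all add: assms L2_iff)
 then show *: "v : H1 Om" by (simp add: H1_def L2_iff assms)
 show "AE x in MOm. weak_partial Om i v x = g i x"
  by (rule weak_partial_unique[OF H1D(2)[OF *] assms(2) H1D(3)[OF *] assms(3)])
qed

lemma l2_weak_partial_cong: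
 assumes "sqint MOm v" "!!i. sqint MOm (g i)" "!!i. has_weak_partial Om i v (g i)"
 shows "l2 MOm (weak_partial Om i v) = l2 MOm (g i)"
 using H1_intro[OF assms] by (intro l2_cong_AE sqint_measurable assms H1D(2)) auto

lemma H1_add: 
 assumes "v : H1 Om" "w : H1 Om"
 shows "(%x. v x + w x) : H1 Om" "AE x in MOm. weak_partial Om i (%x. v x + w x) x = weak_partial Om i v x + weak_partial Om i w x"
 by (rule H1_intro[OF sqint_add[OF H1D(1)[OF assms(1)] H1D(1)[OF assms(2)]] sqint_add[OF H1D(2)[OF assms(1)] H1D(2)[OF assms(2)]]
    has_weak_partial_add[OF H1D(1)[OF assms(1)] H1D(1)[OF assms(2)] H1D(2)[OF assms(1)] H1D(2)[OF assms(2)] H1D(3)[OF assms(1)] H1D(3)[OF assms(2)]]])+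

lemma H1_cmult:
 assumes "v : H1 Om"
 shows "(%x. c * v x) : H1 Om" "AE x in MOm. weak_partial Om i (%x. c * v x) x = c * weak_partial Om i v x"
 by (rule H1_intro[OF sqint_cmult[OF H1D(1)[OF assms]] sqint_cmult[OF H1D(2)[OF assms]] has_weak_partial_cmult[OF H1D(3)[OF assms]]])+

lemma H1_diff:
 assumes "v : H1 Om" "w : H1 Om"
 shows "(%x. v x - w x) : H1 Om" "AE x in MOm. weak_partial Om i (%x. v x - w x) x = weak_partial Om i v x - weak_partial Om i w x"
proof -
 note a = H1_add[OF assms(1) H1_cmult(1)[OF assms(2), of "-1"]]
 show "(%x. v x - w x) : H1 Om" using a(1) by simp
 have "AE x in MOm. weak_partial Om i (%x. v x - w x) x = weak_partial Om i v x + weak_partial Om i (%x. -1 * w x) x"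
  using a(2)[of i] by simp
 with H1_cmult(2)[OF assms(2), of i "-1"]
 show "AE x in MOm. weak_partial Om i (%x. v x - w x) x = weak_partial Om i v x - weak_partial Om i w x"
  by eventually_elim simp
qed

lemma L2_norm_weak_grad_sq:
 assumes "v : H1 Om"
 shows "(L2_norm Om (weak_grad Om v))^2 = (SUM i:UNIV. (l2 MOm (weak_partial Om i v))^2)"
proof -
 have "(norm (weak_grad Om v x))^2 = (SUM i:UNIV. (weak_partial Om i v x)^2)" for x
  unfolding power2_norm_eq_inner inner_vec_def weak_grad_def by (simp add: power2_eq_square)
 then show ?thesis
  unfolding L2_norm_def using sqint_integrable[OF H1D(2)[OF assms]]
  by (simp add: l2_sq integral_nonneg_AE sum_nonneg)
qed

lemma H1_norm_sq:
 assumes "v : H1 Om"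
 shows "(H1_norm Om v)^2 = (l2 MOm v)^2 + (SUM i:UNIV. (l2 MOm (weak_partial Om i v))^2)"
 unfolding H1_norm_def L2_norm_weak_grad_sq[OF assms] L2_norm_eq_l2
 by (simp add: sum_nonneg)

end

section \<open>Poincar\'e and trace inequalities\<close>

definition grad2 :: "(plane => real) => plane => real" where
 "grad2 phi x = (SUM i:UNIV. (partial i phi x)^2)"

lemma grad2_nonneg: "grad2 phi x >= 0" by (simp add: grad2_def sum_nonneg)

lemma continuous_on_grad2: "smooth phi ==> continuous_on S (grad2 phi)"
 unfolding grad2_def by (intro continuous_intros smooth_continuous_on smooth_partial)

lemma directional_derivative_le: "(SUM i:UNIV. partial i phi x * w $ i)^2 <= grad2 phi x * (norm w)^2"
proof -
 have "(SUM i:UNIV. partial i phi x * w $ i)^2 = ((\<chi> i. partial i phi x) \<bullet> w)^2" by (simp add: inner_vec_def)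
 also have "... <= ((\<chi> i. partial i phi x) \<bullet> (\<chi> i. partial i phi x)) * (w \<bullet> w)" by (rule Cauchy_Schwarz_ineq)
 also have "... = grad2 phi x * (norm w)^2"
 proof -
  have "(\<chi> i. partial i phi x) \<bullet> (\<chi> i. partial i phi x) = grad2 phi x"
   by (simp add: grad2_def inner_vec_def power2_eq_square)
  then show ?thesis by (simp only: power2_norm_eq_inner)
 qed
 finally show ?thesis .
qed

lemma ennreal_integral_unit_interval:
 fixes c :: "real => real"
 assumes "continuous_on UNIV c" "!!t. c t >= 0"
 shows "ennreal (LINT t|lebesgue_on {0..1}. c t) = (\<integral>\<^sup>+t. ennreal (c t) * indicator {0..1} t \<partial>lborel)"
proof -
 have [measurable]: "c : borel_measurable borel" by (rule borel_measurable_continuous_onI[OF assms(1)])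
 have "integrable (lebesgue_on {0..1}) c"
  by (intro continuous_imp_integrable_real continuous_on_subset[OF assms(1)]) auto
 then have "ennreal (LINT t|lebesgue_on {0..1}. c t) = (\<integral>\<^sup>+t. ennreal (c t) \<partial>lebesgue_on {0..1})"
  using assms(2) by (intro nn_integral_eq_integral[symmetric]) auto
 also have "... = (\<integral>\<^sup>+t. ennreal (c t) * indicator {0..1} t \<partial>lebesgue)" by (rule nn_integral_restrict_space) auto
 also have "... = (\<integral>\<^sup>+t. ennreal (c t) * indicator {0..1} t \<partial>lborel)"
  by (rule nn_integral_completion)
 finally show ?thesis .
qed

lemma nn_integral_plane_scale:
 fixes g :: "plane => ennreal" and t :: plane
 assumes "c ~= 0" and [measurable]: "g : borel_measurable borel"
 shows "(\<integral>\<^sup>+y. g y \<partial>lborel) = ennreal (c^2) * (\<integral>\<^sup>+z. g (t + c *\<^sub>R z) \<partial>lborel)"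
 by (subst lborel_plane_scale[OF assms(1), of t])
  (simp add: nn_integral_density nn_integral_distr nn_integral_cmult)

lemma nn_integral_plane_scale_le:
 fixes g :: "plane => ennreal" and t :: plane
 assumes "c >= 1/2" and [measurable]: "g : borel_measurable borel"
 shows "(\<integral>\<^sup>+z. g (t + c *\<^sub>R z) \<partial>lborel) <= 4 * (\<integral>\<^sup>+y. g y \<partial>lborel)"
proof -
 have "1 <= 4 * c^2" using power_mono[OF assms(1), of 2] by (simp add: power2_eq_square)
 then have "ennreal 1 <= ennreal (4 * c^2)" by (intro ennreal_leI)
 then have "1 * (\<integral>\<^sup>+z. g (t + c *\<^sub>R z) \<partial>lborel) <= ennreal (4 * c^2) * (\<integral>\<^sup>+z. g (t + c *\<^sub>R z) \<partial>lborel)"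
  by (intro mult_right_mono) auto
 also have "ennreal (4 * c^2) = 4 * ennreal (c^2)" by (simp add: ennreal_mult)
 also have "4 * ennreal (c^2) * (\<integral>\<^sup>+z. g (t + c *\<^sub>R z) \<partial>lborel) = 4 * (\<integral>\<^sup>+y. g y \<partial>lborel)"
  using nn_integral_plane_scale[of c g t] assms by (simp add: mult.assoc)
 finally show ?thesis by simp
qed

text \<open>On a segment inside the convex set, the half next to one end point is a contraction image of
 the set with factor at least one half.\<close>

lemma poincare_pairs:
 assumes U: "convex U" "open U" and h: "!!x y. x : U ==> y : U ==> dist x y <= h" and phi: "smooth phi"
 shows "(\<integral>\<^sup>+x. \<integral>\<^sup>+y. ennreal ((phi x - phi y)^2) * indicator U x * indicator U y \<partial>lborel \<partial>lborel)
  <= ennreal (4 * h^2) * emeasure lborel U * (\<integral>\<^sup>+x. ennreal (grad2 phi x) * indicator U x \<partial>lborel)"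
proof -
 have [measurable]: "U : sets borel" using U(2) by simp
 have gm[measurable]: "grad2 phi : borel_measurable borel"
  by (rule borel_measurable_continuous_onI[OF continuous_on_grad2[OF phi]])
 have [measurable]: "phi : borel_measurable borel" by (rule smooth_borel_measurable[OF phi])
 define k where "k x = ennreal (h^2 * grad2 phi x) * indicator U x" for x
 have k[measurable]: "k : borel_measurable borel" unfolding k_def by measurable
 define H where "H t x y = k (x + t *\<^sub>R (y - x)) * indicator U x * indicator U y * indicator {0..1::real} t" for t x y
 have pt: "ennreal ((phi x - phi y)^2) * indicator U x * indicator U y <= (\<integral>\<^sup>+t. H t x y \<partial>lborel)" for x y
 proof (cases "x : U & y : U")
  case True
  define f where "f t = phi (x + t *\<^sub>R (y - x))" for t
  define f' where "f' t = (SUM i:UNIV. partial i phi (x + t *\<^sub>R (y - x)) * (y - x) $ i)" for t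
  have der: "(f has_real_derivative f' t) (at t)" for t
   unfolding f_def f'_def by (rule smooth_line_derivative[OF phi])
  have cf: "continuous_on UNIV f'" unfolding f'_def
   by (intro continuous_intros continuous_on_compose2[OF smooth_continuous_on[OF smooth_partial[OF phi]]]) auto
  have "(f 1 - f 0)^2 <= (LINT t|lebesgue_on {0..1}. (f' t)^2)"
   by (rule power2_diff_le_integral_derivative[OF der continuous_on_subset[OF cf]]) auto
  then have "ennreal ((phi x - phi y)^2) <= ennreal (LINT t|lebesgue_on {0..1}. (f' t)^2)"
   by (intro ennreal_leI) (simp add: f_def power2_commute)
  also have "... = (\<integral>\<^sup>+t. ennreal ((f' t)^2) * indicator {0..1} t \<partial>lborel)"
   by (rule ennreal_integral_unit_interval) (intro continuous_intros cf, simp)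
  also have "... <= (\<integral>\<^sup>+t. H t x y \<partial>lborel)"
  proof (rule nn_integral_mono)
   fix t :: real
   show "ennreal ((f' t)^2) * indicator {0..1} t <= H t x y"
   proof (cases "t : {0..1}")
    case t: True
    have "x + t *\<^sub>R (y - x) = (1 - t) *\<^sub>R x + t *\<^sub>R y" by (simp add: algebra_simps)
    then have inU: "x + t *\<^sub>R (y - x) : U" using U(1) True t by (simp add: convex_alt)
    have "(f' t)^2 <= grad2 phi (x + t *\<^sub>R (y - x)) * (norm (y - x))^2"
     unfolding f'_def by (rule directional_derivative_le)
    also have "... <= grad2 phi (x + t *\<^sub>R (y - x)) * h^2"
     using h[of x y] True by (intro mult_left_mono grad2_nonneg power_mono) (auto simp: dist_norm norm_minus_commute)
    finally show ?thesis using t True inU by (simp add: H_def k_def ennreal_leI mult.commute)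
   qed simp
  qed
  finally show ?thesis using True by simp
 qed auto
 have Hm[measurable]: "(%(x, y). H t x y) : borel_measurable (lborel \<Otimes>\<^sub>M lborel)" for t
  unfolding H_def by measurable
 have Hm2[measurable]: "(%(y, t). H t x y) : borel_measurable (lborel \<Otimes>\<^sub>M lborel)" for x
  unfolding H_def by measurable
 have each: "(\<integral>\<^sup>+x. \<integral>\<^sup>+y. H t x y \<partial>lborel \<partial>lborel) <= 4 * (\<integral>\<^sup>+x. k x \<partial>lborel) * emeasure lborel U * indicator {0..1} t" for t :: real
 proof (cases "t : {0..1}")
  case True
  show ?thesis
  proof (cases "t <= 1/2")
   case t: True
   have "(\<integral>\<^sup>+x. \<integral>\<^sup>+y. H t x y \<partial>lborel \<partial>lborel) = (\<integral>\<^sup>+y. \<integral>\<^sup>+x. H t x y \<partial>lborel \<partial>lborel)"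
    by (rule lborel_pair.Fubini'[symmetric]) (simp add: Hm)
   also have "... <= (\<integral>\<^sup>+y. 4 * (\<integral>\<^sup>+x. k x \<partial>lborel) * indicator U y \<partial>lborel)"
   proof (rule nn_integral_mono)
    fix y
    have "(\<integral>\<^sup>+x. H t x y \<partial>lborel) <= (\<integral>\<^sup>+x. k (t *\<^sub>R y + (1 - t) *\<^sub>R x) * indicator U y \<partial>lborel)"
     by (rule nn_integral_mono) (auto simp: H_def algebra_simps split: split_indicator)
    also have "... = (\<integral>\<^sup>+x. k (t *\<^sub>R y + (1 - t) *\<^sub>R x) \<partial>lborel) * indicator U y"
     by (rule nn_integral_multc) simp
    also have "... <= 4 * (\<integral>\<^sup>+x. k x \<partial>lborel) * indicator U y"
     using t by (intro mult_right_mono nn_integral_plane_scale_le) auto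
    finally show "(\<integral>\<^sup>+x. H t x y \<partial>lborel) <= 4 * (\<integral>\<^sup>+x. k x \<partial>lborel) * indicator U y" .
   qed
   also have "... = 4 * (\<integral>\<^sup>+x. k x \<partial>lborel) * emeasure lborel U"
    by (rule nn_integral_cmult_indicator) simp
   finally show ?thesis using True by simp
  next
   case t: False
   have "(\<integral>\<^sup>+x. \<integral>\<^sup>+y. H t x y \<partial>lborel \<partial>lborel) <= (\<integral>\<^sup>+x. 4 * (\<integral>\<^sup>+x. k x \<partial>lborel) * indicator U x \<partial>lborel)"
   proof (rule nn_integral_mono)
    fix x
    have "(\<integral>\<^sup>+y. H t x y \<partial>lborel) <= (\<integral>\<^sup>+y. k ((1 - t) *\<^sub>R x + t *\<^sub>R y) * indicator U x \<partial>lborel)"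
     by (rule nn_integral_mono) (auto simp: H_def algebra_simps split: split_indicator)
    also have "... = (\<integral>\<^sup>+y. k ((1 - t) *\<^sub>R x + t *\<^sub>R y) \<partial>lborel) * indicator U x"
     by (rule nn_integral_multc) simp
    also have "... <= 4 * (\<integral>\<^sup>+x. k x \<partial>lborel) * indicator U x"
     using t by (intro mult_right_mono nn_integral_plane_scale_le) auto
    finally show "(\<integral>\<^sup>+y. H t x y \<partial>lborel) <= 4 * (\<integral>\<^sup>+x. k x \<partial>lborel) * indicator U x" .
   qed
   also have "... = 4 * (\<integral>\<^sup>+x. k x \<partial>lborel) * emeasure lborel U"
    by (rule nn_integral_cmult_indicator) simp
   finally show ?thesis using True by simp
  qed
 qed (simp add: H_def)
 have "(\<integral>\<^sup>+x. \<integral>\<^sup>+y. ennreal ((phi x - phi y)^2) * indicator U x * indicator U y \<partial>lborel \<partial>lborel)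
   <= (\<integral>\<^sup>+x. \<integral>\<^sup>+y. \<integral>\<^sup>+t. H t x y \<partial>lborel \<partial>lborel \<partial>lborel)"
  by (intro nn_integral_mono pt)
 also have "... = (\<integral>\<^sup>+x. \<integral>\<^sup>+t. \<integral>\<^sup>+y. H t x y \<partial>lborel \<partial>lborel \<partial>lborel)"
  by (intro nn_integral_cong lborel_pair.Fubini'[symmetric]) (simp add: Hm2 case_prod_unfold)
 also have "... = (\<integral>\<^sup>+t. \<integral>\<^sup>+x. \<integral>\<^sup>+y. H t x y \<partial>lborel \<partial>lborel \<partial>lborel)"
 proof (rule lborel_pair.Fubini'[symmetric])
  show "(%(x, t). \<integral>\<^sup>+y. H t x y \<partial>lborel) : borel_measurable (lborel \<Otimes>\<^sub>M lborel)"
   unfolding H_def by measurable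
 qed
 also have "... <= (\<integral>\<^sup>+t. 4 * (\<integral>\<^sup>+x. k x \<partial>lborel) * emeasure lborel U * indicator {0..1::real} t \<partial>lborel)"
  by (intro nn_integral_mono each)
 also have "... = 4 * (\<integral>\<^sup>+x. k x \<partial>lborel) * emeasure lborel U"
  by (subst nn_integral_cmult_indicator) auto
 also have "(\<integral>\<^sup>+x. k x \<partial>lborel) = ennreal (h^2) * (\<integral>\<^sup>+x. ennreal (grad2 phi x) * indicator U x \<partial>lborel)"
  unfolding k_def by (subst nn_integral_cmult[symmetric]) (auto simp: ennreal_mult grad2_nonneg mult.assoc)
 finally show ?thesis by (simp add: ennreal_mult mult_ac)
qed

text \<open>The variance as a double integral over pairs. It serves twice: with differences bounded
  along segments it yields the Poincare inequality, with the kernel of the Slobodeckij seminorm the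
  fractional bound. The last claim says that the mean is the best constant.\<close>

lemma integral_pairs_eq:
 fixes g :: "'a => real"
 assumes "finite_measure M" and g: "sqint M g" and m: "measure M (space M) = m" "m > 0"
 defines "c \<equiv> (LINT x|M. g x) / m"
 shows "(LINT x|M. LINT y|M. (g x - g y)^2) = 2 * m * (l2 M (%x. g x - c))^2"
  and "integrable M (%x. LINT y|M. (g x - g y)^2)" and "integrable M (%y. (z - g y)^2)"
  and "l2 M (%x. g x - c) <= l2 M (%x. g x - b)"
proof -
 interpret finite_measure M by fact
 have one: "sqint M (%_. 1)" by (rule sqint_const) fact
 have gi: "integrable M g" using sqint_mult_integrable[OF g one] by simp
 have g2: "integrable M (%x. (g x)^2)" by (rule sqint_integrable[OF g])
 let ?I = "LINT x|M. g x" and ?J = "LINT x|M. (g x)^2"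
 have sh: "(LINT y|M. (z - g y)^2) = m * z^2 - 2 * z * ?I + ?J & integrable M (%y. (z - g y)^2)" for z
 proof -
  have "(%y. (z - g y)^2) = (%y. z^2 - (2 * z) * g y + (g y)^2)" by (auto simp: power2_eq_square algebra_simps)
  then show ?thesis using gi g2 m by (simp add: integrable_const)
 qed
 show "integrable M (%y. (z - g y)^2)" using sh by simp
 have eq: "(%x. LINT y|M. (g x - g y)^2) = (%x. m * (g x)^2 - 2 * ?I * g x + ?J)" using sh by (simp add: mult.commute mult.left_commute)
 then show "integrable M (%x. LINT y|M. (g x - g y)^2)" using gi g2 by (simp add: integrable_const)
 have "(LINT x|M. LINT y|M. (g x - g y)^2) = m * ?J - 2 * ?I * ?I + m * ?J"
  unfolding eq using gi g2 m by (simp add: integrable_const)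
 moreover have osc: "(l2 M (%x. g x - b))^2 = m * b^2 - 2 * b * ?I + ?J" for b
  using sh[of b] by (simp add: l2_sq power2_commute)
 moreover have "m * (m * c^2 - 2 * c * ?I + ?J) = m * ?J - ?I * ?I"
  using m(2) by (simp add: c_def field_simps power2_eq_square)
 ultimately show "(LINT x|M. LINT y|M. (g x - g y)^2) = 2 * m * (l2 M (%x. g x - c))^2" by (simp add: mult.assoc)
 have "(m * b^2 - 2 * b * ?I + ?J) - (m * c^2 - 2 * c * ?I + ?J) = m * (b - c)^2"
  using m(2) by (simp add: c_def field_simps power2_eq_square)
 then have "(l2 M (%x. g x - c))^2 <= (l2 M (%x. g x - b))^2" unfolding osc using m(2) by (smt (verit) mult_nonneg_nonneg zero_le_power2)
 then show "l2 M (%x. g x - c) <= l2 M (%x. g x - b)" using l2_nonneg by (rule power2_le_imp_le)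
qed

definition mean :: "plane set => (plane => real) => real" where
 "mean U g = (LINT x|lebesgue_on U. g x) / measure lebesgue U"

text \<open>The L^2 distance of g to the constants on U, attained at the mean; not a supremum of
  differences.\<close>

definition osc :: "plane set => (plane => real) => real" where
 "osc U g = l2 (lebesgue_on U) (%x. g x - mean U g)"

lemma finite_measure_lebesgue_on:
 fixes U :: "plane set" assumes "bounded U" "open U" shows "finite_measure (lebesgue_on U)"
proof
 have "U : lmeasurable" using assms by (simp add: lmeasurable_open)
 have "U : sets lebesgue" using assms(2) by simp
 then have "emeasure (lebesgue_on U) (space (lebesgue_on U)) = emeasure lebesgue U"
  by (subst emeasure_restrict_space) auto
 then show "emeasure (lebesgue_on U) (space (lebesgue_on U)) ~= \<infinity>"
  using fmeasurableD2[OF \<open>U : lmeasurable\<close>] by (simp only: infinity_ennreal_def not_False_eq_True)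
qed

lemma measure_open_pos:
 fixes U :: "plane set" assumes "bounded U" "open U" "U ~= {}" shows "measure lebesgue U > 0"
proof -
 have U: "U : lmeasurable" using assms by (simp add: lmeasurable_open)
 have "~ negligible U" using open_not_negligible assms by blast
 then have "measure lebesgue U ~= 0" using U by (simp add: negligible_iff_measure0)
 then show ?thesis by (simp add: zero_less_measure_iff)
qed

lemma osc_facts:
 assumes "bounded U" "open U" "U ~= {}" "sqint (lebesgue_on U) g"
 shows "(LINT x|lebesgue_on U. LINT y|lebesgue_on U. (g x - g y)^2) = 2 * measure lebesgue U * (osc U g)^2"
  and "integrable (lebesgue_on U) (%x. LINT y|lebesgue_on U. (g x - g y)^2)"
  and "integrable (lebesgue_on U) (%y. (z - g y)^2)"
  and "osc U g <= l2 (lebesgue_on U) (%x. g x - b)"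
proof -
 have "U : sets lebesgue" using assms(2) by simp
 then have "measure (lebesgue_on U) (space (lebesgue_on U)) = measure lebesgue U"
  by (subst measure_restrict_space) auto
 note * = integral_pairs_eq[OF finite_measure_lebesgue_on[OF assms(1,2)] assms(4) this measure_open_pos[OF assms(1-3)]]
 show "(LINT x|lebesgue_on U. LINT y|lebesgue_on U. (g x - g y)^2) = 2 * measure lebesgue U * (osc U g)^2"
  and "integrable (lebesgue_on U) (%x. LINT y|lebesgue_on U. (g x - g y)^2)"
  and "integrable (lebesgue_on U) (%y. (z - g y)^2)"
  and "osc U g <= l2 (lebesgue_on U) (%x. g x - b)"
  using * by (simp_all add: osc_def mean_def)
qed

lemma l2_sq_nn:
 fixes f :: "plane => real"
 assumes "U : sets borel" "f : borel_measurable borel" "sqint (lebesgue_on U) f"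
 shows "ennreal ((l2 (lebesgue_on U) f)^2) = (\<integral>\<^sup>+x. ennreal ((f x)^2) * indicator U x \<partial>lborel)"
proof -
 have "ennreal ((l2 (lebesgue_on U) f)^2) = (\<integral>\<^sup>+x. ennreal ((f x)^2) \<partial>lebesgue_on U)"
  unfolding l2_sq using assms by (intro nn_integral_eq_integral[symmetric]) (auto simp: sqint_def)
 also have "... = (\<integral>\<^sup>+x. ennreal ((f x)^2) * indicator U x \<partial>lebesgue)"
  using assms by (intro nn_integral_restrict_space) auto
 also have "... = (\<integral>\<^sup>+x. ennreal ((f x)^2) * indicator U x \<partial>lborel)"
  by (rule nn_integral_completion)
 finally show ?thesis .
qed

text \<open>Both sides of \<open>poincare_pairs\<close> carry the measure of U once, after the left
  one is rewritten as a variance; it cancels, and 4 h^2 against 2 leaves 2 h^2.\<close>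

theorem poincare_smooth:
 assumes U: "convex U" "open U" "bounded U" "U ~= {}" and h: "!!x y. x : U ==> y : U ==> dist x y <= h" and phi: "smooth phi"
 shows "(osc U phi)^2 <= 2 * h^2 * (SUM i:UNIV. (l2 (lebesgue_on U) (partial i phi))^2)"
proof -
 let ?M = "lebesgue_on U"
 define m where "m = measure lebesgue U"
 have m: "m > 0" unfolding m_def by (rule measure_open_pos[OF U(3,2,4)])
 have Ub: "U : sets borel" using U(2) by simp
 have [measurable]: "phi : borel_measurable borel" by (rule smooth_borel_measurable[OF phi])
 have sq: "sqint ?M phi" "sqint ?M (partial i phi)" for i
  by (rule smooth_sqint[OF U(3,2)], intro phi smooth_partial)+
 note of = osc_facts[OF U(3,2,4) sq(1)]
 define S where "S = (SUM i:UNIV. (l2 ?M (partial i phi))^2)"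
 have S0: "S >= 0" by (simp add: S_def sum_nonneg)
 have mE: "emeasure lborel U = ennreal m"
 proof -
  have "U : lmeasurable" using U by (simp add: lmeasurable_open)
  from emeasure_eq_measure2[OF this] show ?thesis using Ub by (simp add: m_def)
 qed
 have G: "(\<integral>\<^sup>+x. ennreal (grad2 phi x) * indicator U x \<partial>lborel) = ennreal S"
 proof -
  have "(\<integral>\<^sup>+x. ennreal (grad2 phi x) * indicator U x \<partial>lborel) = (\<integral>\<^sup>+x. (SUM i:UNIV. ennreal ((partial i phi x)^2) * indicator U x) \<partial>lborel)"
   by (intro nn_integral_cong) (simp add: grad2_def sum_distrib_right[symmetric] sum_ennreal)
  also have "... = (SUM i:UNIV. \<integral>\<^sup>+x. ennreal ((partial i phi x)^2) * indicator U x \<partial>lborel)"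
   using Ub smooth_borel_measurable[OF smooth_partial[OF phi]] by (intro nn_integral_sum) auto
  also have "... = (SUM i:UNIV. ennreal ((l2 ?M (partial i phi))^2))"
   by (intro sum.cong l2_sq_nn[symmetric] Ub smooth_borel_measurable smooth_partial phi sq) simp
  finally show ?thesis by (simp add: S_def sum_ennreal)
 qed
 have "ennreal (2 * m * (osc U phi)^2) = ennreal (LINT x|?M. LINT y|?M. (phi x - phi y)^2)"
  by (simp add: of(1) m_def)
 also have "... = (\<integral>\<^sup>+x. ennreal (LINT y|?M. (phi x - phi y)^2) \<partial>?M)"
  by (rule nn_integral_eq_integral[symmetric, OF of(2)]) simp
 also have "... = (\<integral>\<^sup>+x. ennreal (LINT y|?M. (phi x - phi y)^2) * indicator U x \<partial>lebesgue)"
  using Ub by (intro nn_integral_restrict_space) auto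
 also have "... = (\<integral>\<^sup>+x. (\<integral>\<^sup>+y. ennreal ((phi x - phi y)^2) * indicator U y \<partial>lborel) * indicator U x \<partial>lebesgue)"
 proof (intro nn_integral_cong)
  fix x
  have s: "sqint ?M (%y. phi x - phi y)" using sq(1) sqint_const[OF finite_measure_lebesgue_on[OF U(3,2)]] by (intro sqint_diff) auto
  have "ennreal (LINT y|?M. (phi x - phi y)^2) = (\<integral>\<^sup>+y. ennreal ((phi x - phi y)^2) * indicator U y \<partial>lborel)"
   using l2_sq_nn[OF Ub _ s] by (simp add: l2_sq)
  then show "ennreal (LINT y|?M. (phi x - phi y)^2) * indicator U x = (\<integral>\<^sup>+y. ennreal ((phi x - phi y)^2) * indicator U y \<partial>lborel) * indicator U x"
   by simp
 qed
 also have "... = (\<integral>\<^sup>+x. \<integral>\<^sup>+y. ennreal ((phi x - phi y)^2) * indicator U x * indicator U y \<partial>lborel \<partial>lborel)"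
  unfolding nn_integral_completion using Ub
  by (intro nn_integral_cong) (subst nn_integral_multc[symmetric], auto simp: mult_ac)
 also have "... <= ennreal (4 * h^2) * emeasure lborel U * (\<integral>\<^sup>+x. ennreal (grad2 phi x) * indicator U x \<partial>lborel)"
  by (rule poincare_pairs[OF U(1,2) h phi])
 also have "... = ennreal (4 * h^2 * m * S)" unfolding mE G using m S0 by (simp add: ennreal_mult)
 finally have "2 * m * (osc U phi)^2 <= 4 * h^2 * m * S" using m S0 by (simp add: ennreal_le_iff)
 then have "m * (osc U phi)^2 <= m * (2 * h^2 * S)" by (simp add: mult_ac)
 then show ?thesis using m by (simp add: S_def)
qed

section \<open>The trace inequality on a triangle\<close>

definition cross :: "plane => plane => real" where "cross u w = u $ 1 * w $ 2 - u $ 2 * w $ 1"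

text \<open>The one-dimensional trace inequality along \<open>w\<close> from each point of the base,
  integrated over the parallelogram spanned by \<open>u\<close> and \<open>w\<close>;
  \<open>\<bar>cross u w\<bar>\<close> is the Jacobian.\<close>

lemma parallelogram_trace:
 assumes phi: "smooth phi" and D: "cross u w ~= 0" and K: "K : sets borel"
  and sub: "!!s t. s : {0..1} ==> t : {0..1} ==> p + s *\<^sub>R u + t *\<^sub>R w : K" and l: "norm w <= l"
 shows "ennreal \<bar>cross u w\<bar> * (\<integral>\<^sup>+s. ennreal ((phi (p + s *\<^sub>R u))^2) * indicator {0..1} s \<partial>lborel)
  <= (\<integral>\<^sup>+x. ennreal (2 * (phi x)^2 + 2 * l^2 * grad2 phi x) * indicator K x \<partial>lborel)"
proof -
 define k where "k x = ennreal (2 * (phi x)^2 + 2 * l^2 * grad2 phi x) * indicator K x" for x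
 have [measurable]: "phi : borel_measurable borel" "grad2 phi : borel_measurable borel" "K : sets borel"
  using borel_measurable_continuous_onI[OF continuous_on_grad2[OF phi]] smooth_borel_measurable[OF phi] K by auto
 have k[measurable]: "k : borel_measurable borel" unfolding k_def by measurable
 have pt: "ennreal ((phi (p + s *\<^sub>R u))^2) * indicator {0..1} s <= (\<integral>\<^sup>+t. k (p + s *\<^sub>R u + t *\<^sub>R w) \<partial>lborel)" for s
 proof (cases "s : {0..1}")
  case True
  let ?q = "p + s *\<^sub>R u"
  define f' where "f' t = (SUM i:UNIV. partial i phi (?q + t *\<^sub>R w) * w $ i)" for t
  have der: "((%t. phi (?q + t *\<^sub>R w)) has_real_derivative f' t) (at t)" for t
   unfolding f'_def by (rule smooth_line_derivative[OF phi])
  have cf: "continuous_on UNIV f'" unfolding f'_def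
   by (intro continuous_intros continuous_on_compose2[OF smooth_continuous_on[OF smooth_partial[OF phi]]]) auto
  have cphi: "continuous_on UNIV (%t. phi (?q + t *\<^sub>R w))"
   by (intro continuous_intros continuous_on_compose2[OF smooth_continuous_on[OF phi]]) auto
  have "(phi (?q + 0 *\<^sub>R w))^2 <= (LINT t|lebesgue_on {0..1}. 2 * (phi (?q + t *\<^sub>R w))^2 + 2 * (f' t)^2)"
   by (rule power2_le_integral_derivative[OF der continuous_on_subset[OF cf]]) auto
  then have "ennreal ((phi ?q)^2) <= ennreal (LINT t|lebesgue_on {0..1}. 2 * (phi (?q + t *\<^sub>R w))^2 + 2 * (f' t)^2)"
   by (intro ennreal_leI) simp
  also have "... = (\<integral>\<^sup>+t. ennreal (2 * (phi (?q + t *\<^sub>R w))^2 + 2 * (f' t)^2) * indicator {0..1} t \<partial>lborel)"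
   by (rule ennreal_integral_unit_interval) (intro continuous_intros cf cphi, simp)
  also have "... <= (\<integral>\<^sup>+t. k (?q + t *\<^sub>R w) \<partial>lborel)"
  proof (rule nn_integral_mono)
   fix t :: real
   show "ennreal (2 * (phi (?q + t *\<^sub>R w))^2 + 2 * (f' t)^2) * indicator {0..1} t <= k (?q + t *\<^sub>R w)"
   proof (cases "t : {0..1}")
    case t: True
    have "(f' t)^2 <= grad2 phi (?q + t *\<^sub>R w) * (norm w)^2"
     unfolding f'_def by (rule directional_derivative_le)
    also have "... <= grad2 phi (?q + t *\<^sub>R w) * l^2"
     using l by (intro mult_left_mono grad2_nonneg power_mono) auto
    finally have "2 * (phi (?q + t *\<^sub>R w))^2 + 2 * (f' t)^2 <= 2 * (phi (?q + t *\<^sub>R w))^2 + 2 * l^2 * grad2 phi (?q + t *\<^sub>R w)"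
     by (simp add: mult.commute)
    then have "ennreal (2 * (phi (?q + t *\<^sub>R w))^2 + 2 * (f' t)^2) <= ennreal (2 * (phi (?q + t *\<^sub>R w))^2 + 2 * l^2 * grad2 phi (?q + t *\<^sub>R w))"
     by (rule ennreal_leI)
    moreover have "indicator {0..1} t = (1::ennreal)" "indicator K (?q + t *\<^sub>R w) = (1::ennreal)"
     using t sub[OF True t] by auto
    ultimately show ?thesis by (simp only: k_def mult_1_right)
   qed simp
  qed
  finally show ?thesis using True by simp
 qed simp
 have "ennreal \<bar>cross u w\<bar> * (\<integral>\<^sup>+s. ennreal ((phi (p + s *\<^sub>R u))^2) * indicator {0..1} s \<partial>lborel)
  <= ennreal \<bar>cross u w\<bar> * (\<integral>\<^sup>+s. \<integral>\<^sup>+t. k (p + s *\<^sub>R u + t *\<^sub>R w) \<partial>lborel \<partial>lborel)"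
  by (intro mult_left_mono nn_integral_mono pt) simp
 also have "... = (\<integral>\<^sup>+x. k x \<partial>lborel)"
  using nn_integral_parallelogram[of u w k p] D by (simp add: cross_def)
 finally show ?thesis by (simp add: k_def)
qed

lemma nn_integral_halves:
 fixes f :: "real => ennreal"
 assumes [measurable]: "f : borel_measurable borel"
 shows "2 * (\<integral>\<^sup>+t. f t * indicator {0..1} t \<partial>lborel) <=
  (\<integral>\<^sup>+s. f (s/2) * indicator {0..1} s \<partial>lborel) + (\<integral>\<^sup>+s. f (1/2 + s/2) * indicator {0..1} s \<partial>lborel)"
proof -
 have "(\<integral>\<^sup>+t. f t * indicator {0..1} t \<partial>lborel) <= (\<integral>\<^sup>+t. f t * indicator {0..1/2} t + f t * indicator {1/2..1} t \<partial>lborel)"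
  by (intro nn_integral_mono) (auto split: split_indicator)
 also have "... = (\<integral>\<^sup>+t. f t * indicator {0..1/2} t \<partial>lborel) + (\<integral>\<^sup>+t. f t * indicator {1/2..1} t \<partial>lborel)"
  by (rule nn_integral_add) auto
 also have "(\<integral>\<^sup>+t. f t * indicator {0..1/2} t \<partial>lborel) = ennreal (1/2) * (\<integral>\<^sup>+s. f (s/2) * indicator {0..1} s \<partial>lborel)"
  by (subst nn_integral_real_affine[where c="1/2" and t=0]) (auto intro!: arg_cong2[where f="(*)"] nn_integral_cong split: split_indicator)
 also have "(\<integral>\<^sup>+t. f t * indicator {1/2..1} t \<partial>lborel) = ennreal (1/2) * (\<integral>\<^sup>+s. f (1/2 + s/2) * indicator {0..1} s \<partial>lborel)"
  by (subst nn_integral_real_affine[where c="1/2" and t="1/2"]) (auto intro!: arg_cong2[where f="(*)"] nn_integral_cong split: split_indicator)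
 finally have "2 * (\<integral>\<^sup>+t. f t * indicator {0..1} t \<partial>lborel) <=
  2 * (ennreal (1/2) * (\<integral>\<^sup>+s. f (s/2) * indicator {0..1} s \<partial>lborel) + ennreal (1/2) * (\<integral>\<^sup>+s. f (1/2 + s/2) * indicator {0..1} s \<partial>lborel))"
  by (rule mult_left_mono) simp
 moreover have "2 * (ennreal (1/2) * A) = A" for A :: ennreal
 proof -
  have "2 * ennreal (1/2) = ennreal (2 * (1/2))" by (subst ennreal_mult) auto
  then show ?thesis by (simp add: mult.assoc[symmetric])
 qed
 ultimately show ?thesis by (simp add: distrib_left)
qed

lemma hull3_mem:
 fixes p q r :: plane
 assumes "a >= 0" "b >= 0" "c >= 0" "a + b + c = 1"
 shows "a *\<^sub>R p + b *\<^sub>R q + c *\<^sub>R r : convex hull {p, q, r}"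
 unfolding convex_hull_3 using assms by blast

text \<open>Translates of the whole edge leave the triangle, but each half of p q is the base of a
  parallelogram inside it, with second side (r - p)/2 or (r - q)/2. Both parallelograms have a
  quarter of the determinant of the triangle.\<close>

theorem triangle_trace:
 fixes p q r :: plane
 assumes phi: "smooth phi" and D: "cross (q - p) (r - p) ~= 0" and h: "dist r p <= h" "dist r q <= h"
 defines "U \<equiv> interior (convex hull {p, q, r})"
 shows "(LINT t|lebesgue_on {0..1}. (phi (linepath p q t))^2) <=
  8 / \<bar>cross (q - p) (r - p)\<bar> * ((l2 (lebesgue_on U) phi)^2 + h^2 * (SUM i:UNIV. (l2 (lebesgue_on U) (partial i phi))^2))"
proof -
 define K where "K = convex hull {p, q, r}"
 have cK: "compact K" unfolding K_def by (intro compact_convex_hull finite_imp_compact) simp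
 have Kb: "K : sets borel" using compact_imp_closed[OF cK] by simp
 have U: "open U" "bounded U" "U <= K" "U : sets borel"
  using bounded_subset[OF compact_imp_bounded[OF cK] interior_subset] interior_subset unfolding U_def K_def by auto
 define d where "d = \<bar>cross (q - p) (r - p)\<bar>"
 have d: "d > 0" using D by (simp add: d_def)
 define u where "u = (1/2) *\<^sub>R (q - p)"
 define w1 where "w1 = (1/2) *\<^sub>R (r - p)"
 define w2 where "w2 = (1/2) *\<^sub>R (r - q)"
 define m where "m = (1/2) *\<^sub>R (p + q)"
 have c1: "\<bar>cross u w1\<bar> = d / 4" "\<bar>cross u w2\<bar> = d / 4"
  by (simp_all add: cross_def u_def w1_def w2_def d_def algebra_simps abs_if divide_simps)
 define I where "I = (\<integral>\<^sup>+x. ennreal (2 * (phi x)^2 + 2 * (h/2)^2 * grad2 phi x) * indicator K x \<partial>lborel)"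
 have A1: "ennreal (d/4) * (\<integral>\<^sup>+s. ennreal ((phi (p + s *\<^sub>R u))^2) * indicator {0..1} s \<partial>lborel) <= I"
  unfolding I_def c1(1)[symmetric]
 proof (rule parallelogram_trace[OF phi _ Kb])
  show "cross u w1 ~= 0" using c1(1) d by auto
  show "norm w1 <= h / 2" using h(1) by (simp add: w1_def dist_norm)
  fix s t :: real assume "s : {0..1}" "t : {0..1}"
  then have "(1 - s/2 - t/2) *\<^sub>R p + (s/2) *\<^sub>R q + (t/2) *\<^sub>R r : K"
   unfolding K_def by (intro hull3_mem) auto
  then show "p + s *\<^sub>R u + t *\<^sub>R w1 : K" by (simp add: u_def w1_def algebra_simps)
 qed
 have A2: "ennreal (d/4) * (\<integral>\<^sup>+s. ennreal ((phi (m + s *\<^sub>R u))^2) * indicator {0..1} s \<partial>lborel) <= I"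
  unfolding I_def c1(2)[symmetric]
 proof (rule parallelogram_trace[OF phi _ Kb])
  show "cross u w2 ~= 0" using c1(2) d by auto
  show "norm w2 <= h / 2" using h(2) by (simp add: w2_def dist_norm)
  fix s t :: real assume "s : {0..1}" "t : {0..1}"
  then have "(1/2 - s/2) *\<^sub>R p + (1/2 + s/2 - t/2) *\<^sub>R q + (t/2) *\<^sub>R r : K"
   unfolding K_def by (intro hull3_mem) auto
  then show "m + s *\<^sub>R u + t *\<^sub>R w2 : K" by (simp add: u_def w2_def m_def algebra_simps)
 qed
 define J where "J = (\<integral>\<^sup>+t. ennreal ((phi (linepath p q t))^2) * indicator {0..1} t \<partial>lborel)"
 have lp: "linepath p q (s/2) = p + s *\<^sub>R u" "linepath p q (1/2 + s/2) = m + s *\<^sub>R u" for s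
  by (simp_all add: linepath_def u_def m_def vec_eq_iff field_simps)
 have cl: "continuous_on UNIV (%t. phi (linepath p q t))"
  by (intro continuous_on_compose2[OF smooth_continuous_on[OF phi]] continuous_on_linepath) auto
 have "2 * J <= (\<integral>\<^sup>+s. ennreal ((phi (p + s *\<^sub>R u))^2) * indicator {0..1} s \<partial>lborel) + (\<integral>\<^sup>+s. ennreal ((phi (m + s *\<^sub>R u))^2) * indicator {0..1} s \<partial>lborel)"
  unfolding J_def lp[symmetric]
  by (rule nn_integral_halves) (use borel_measurable_continuous_onI[OF cl] in simp)
 then have "ennreal (d/4) * (2 * J) <= ennreal (d/4) * ((\<integral>\<^sup>+s. ennreal ((phi (p + s *\<^sub>R u))^2) * indicator {0..1} s \<partial>lborel) + (\<integral>\<^sup>+s. ennreal ((phi (m + s *\<^sub>R u))^2) * indicator {0..1} s \<partial>lborel))"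
  by (rule mult_left_mono) simp
 also have "... <= I + I" unfolding distrib_left by (intro add_mono A1 A2)
 finally have J1: "ennreal (d/4) * (2 * J) <= I + I" .
 have Jl: "J = ennreal (LINT t|lebesgue_on {0..1}. (phi (linepath p q t))^2)"
  unfolding J_def by (rule ennreal_integral_unit_interval[symmetric]) (intro continuous_intros cl, simp)
 define S where "S = (SUM i:UNIV. (l2 (lebesgue_on U) (partial i phi))^2)"
 have S0: "S >= 0" by (simp add: S_def sum_nonneg)
 have "I = ennreal (2 * (l2 (lebesgue_on U) phi)^2 + 2 * (h/2)^2 * S)"
 proof -
  have "negligible (frontier K)" unfolding K_def by (rule negligible_convex_frontier) simp
  then have "AE x in lebesgue. x ~: frontier K" by (intro AE_not_in) (simp add: negligible_iff_null_sets)
  then have ae: "AE x in lborel. x ~: frontier K" by (simp add: AE_completion_iff)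
  have "I = (\<integral>\<^sup>+x. ennreal (2 * (phi x)^2 + 2 * (h/2)^2 * grad2 phi x) * indicator U x \<partial>lborel)"
   unfolding I_def
  proof (rule nn_integral_cong_AE, use ae in eventually_elim)
   fix x assume "x ~: frontier K"
   then have "x : K \<longleftrightarrow> x : U"
    using compact_imp_closed[OF cK] interior_subset[of K] by (auto simp: frontier_def U_def K_def)
   then show "ennreal (2 * (phi x)^2 + 2 * (h/2)^2 * grad2 phi x) * indicator K x = ennreal (2 * (phi x)^2 + 2 * (h/2)^2 * grad2 phi x) * indicator U x"
    by (simp add: indicator_def)
  qed
  also have "... = (\<integral>\<^sup>+x. (ennreal (2 * (phi x)^2 + 2 * (h/2)^2 * grad2 phi x)) \<partial>lebesgue_on U)"
   using U(4) by (subst nn_integral_restrict_space) (auto simp: nn_integral_completion)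
  also have "... = ennreal (LINT x|lebesgue_on U. 2 * (phi x)^2 + 2 * (h/2)^2 * grad2 phi x)"
   using sqint_integrable[OF smooth_sqint[OF U(2,1) phi]] sqint_integrable[OF smooth_sqint[OF U(2,1) smooth_partial[OF phi]]]
   by (intro nn_integral_eq_integral) (auto simp: grad2_def intro!: AE_I2 add_nonneg_nonneg mult_nonneg_nonneg sum_nonneg)
  also have "(LINT x|lebesgue_on U. 2 * (phi x)^2 + 2 * (h/2)^2 * grad2 phi x) = 2 * (l2 (lebesgue_on U) phi)^2 + 2 * (h/2)^2 * S"
   using sqint_integrable[OF smooth_sqint[OF U(2,1) phi]] sqint_integrable[OF smooth_sqint[OF U(2,1) smooth_partial[OF phi]]]
   by (simp add: grad2_def S_def l2_sq)
  finally show ?thesis .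
 qed
 with J1 Jl have "ennreal (d/4) * (2 * ennreal (LINT t|lebesgue_on {0..1}. (phi (linepath p q t))^2)) <=
  ennreal (2 * (l2 (lebesgue_on U) phi)^2 + 2 * (h/2)^2 * S) + ennreal (2 * (l2 (lebesgue_on U) phi)^2 + 2 * (h/2)^2 * S)" by simp
 also have "... = ennreal (4 * (l2 (lebesgue_on U) phi)^2 + h^2 * S)"
  using S0 by (subst ennreal_plus[symmetric]) (auto intro!: arg_cong[where f=ennreal] simp: power_divide)
 also have "ennreal (d/4) * (2 * ennreal (LINT t|lebesgue_on {0..1}. (phi (linepath p q t))^2)) =
  ennreal (d/4 * (2 * (LINT t|lebesgue_on {0..1}. (phi (linepath p q t))^2)))"
 proof -
  have "2 * ennreal X = ennreal (2 * X)" if "X >= 0" for X using ennreal_mult[of 2 X] that by simp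
  then show ?thesis using d by (simp only: integral_nonneg_AE AE_I2 zero_le_power2 ennreal_mult[symmetric]) (simp add: ennreal_mult[symmetric])
 qed
 finally have "d/4 * (2 * (LINT t|lebesgue_on {0..1}. (phi (linepath p q t))^2)) <= 4 * (l2 (lebesgue_on U) phi)^2 + h^2 * S"
  using S0 by (subst (asm) ennreal_le_iff) auto
 then have "d * (LINT t|lebesgue_on {0..1}. (phi (linepath p q t))^2) <= 8 * ((l2 (lebesgue_on U) phi)^2 + h^2 * S)"
 proof -
  assume *: "d/4 * (2 * (LINT t|lebesgue_on {0..1}. (phi (linepath p q t))^2)) <= 4 * (l2 (lebesgue_on U) phi)^2 + h^2 * S"
  have "0 <= h^2 * S" using S0 by simp
  moreover have "d/4 * (2 * (LINT t|lebesgue_on {0..1}. (phi (linepath p q t))^2)) = d * (LINT t|lebesgue_on {0..1}. (phi (linepath p q t))^2) / 2" by simp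
  ultimately show ?thesis using * unfolding distrib_left by linarith
 qed
 then have "(LINT t|lebesgue_on {0..1}. (phi (linepath p q t))^2) <= 8 * ((l2 (lebesgue_on U) phi)^2 + h^2 * S) / d"
  using d by (simp add: pos_le_divide_eq mult.commute)
 then show ?thesis by (simp add: d_def S_def)
qed

lemma cross_zero_dependent:
 fixes p q r :: plane
 assumes "cross (q - p) (r - p) = 0" "p ~= q" "q ~= r" "p ~= r"
 shows "affine_dependent {p, q, r}"
proof -
 define u where "u = q - p"
 define w where "w = r - p"
 have c: "u $ 1 * w $ 2 = u $ 2 * w $ 1" using assms(1) by (simp add: cross_def u_def w_def)
 obtain alpha beta where ab: "alpha ~= 0 | beta ~= 0" "alpha *\<^sub>R u + beta *\<^sub>R w = 0"
 proof (cases "u $ 1 = 0")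
  case False
  show ?thesis by (rule that[of "w $ 1" "- u $ 1"]) (use False c in \<open>auto simp: vec_eq_iff forall_2 algebra_simps\<close>)
 next
  case True
  have "u ~= 0" using assms(2) by (simp add: u_def)
  then have u2: "u $ 2 ~= 0" using True by (auto simp: vec_eq_iff forall_2)
  show ?thesis by (rule that[of "w $ 2" "- u $ 2"]) (use u2 c True in \<open>auto simp: vec_eq_iff forall_2 algebra_simps\<close>)
 qed
 define f where "f x = (if x = p then - (alpha + beta) else if x = q then alpha else beta)" for x
 have "sum f {p, q, r} = 0" "(SUM v:{p, q, r}. f v *\<^sub>R v) = alpha *\<^sub>R u + beta *\<^sub>R w"
  using assms(2-4) by (simp_all add: f_def u_def w_def algebra_simps)
 moreover have "EX v:{p, q, r}. f v ~= 0" using ab(1) assms(2-4) by (auto simp: f_def)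
 ultimately show ?thesis using ab(2) by (subst affine_dependent_explicit_finite) auto
qed

text \<open>In the coordinates (s, t) of p + s u + t w the triangle lies in the unit square.
  Together with the inscribed disc this bounds from below the determinant that stands in the
  denominator of the trace inequality.\<close>

lemma triangle_measure_le:
 fixes p q r :: plane
 assumes D: "cross (q - p) (r - p) ~= 0"
 shows "measure lebesgue (convex hull {p, q, r}) <= \<bar>cross (q - p) (r - p)\<bar>"
proof -
 define K where "K = convex hull {p, q, r}"
 define u where "u = q - p"
 define w where "w = r - p"
 have cK: "compact K" unfolding K_def by (intro compact_convex_hull finite_imp_compact) simp
 have [measurable]: "K : sets borel" using compact_imp_closed[OF cK] by simp
 have Dw: "cross u w ~= 0" using D by (simp add: u_def w_def)
 have "indicator K (p + s *\<^sub>R u + t *\<^sub>R w) <= (indicator {0..1} s * indicator {0..1} t :: ennreal)" for s t :: real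
 proof (cases "p + s *\<^sub>R u + t *\<^sub>R w : K")
  case True
  then obtain a b c where abc: "a >= 0" "b >= 0" "c >= 0" "a + b + c = 1" "p + s *\<^sub>R u + t *\<^sub>R w = a *\<^sub>R p + b *\<^sub>R q + c *\<^sub>R r"
   unfolding K_def convex_hull_3 by blast
  have a: "a = 1 - b - c" using abc(4) by simp
  have "a *\<^sub>R p + b *\<^sub>R q + c *\<^sub>R r = p + b *\<^sub>R u + c *\<^sub>R w"
   unfolding a by (simp add: u_def w_def algebra_simps)
  then have e: "(s - b) *\<^sub>R u = (c - t) *\<^sub>R w" using abc(5) by (simp add: algebra_simps)
  have e1: "(s - b) * u $ 1 = (c - t) * w $ 1" and e2: "(s - b) * u $ 2 = (c - t) * w $ 2"
   using arg_cong[OF e, of "%x. x $ 1"] arg_cong[OF e, of "%x. x $ 2"] by simp_all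
  have "(s - b) * cross u w = ((s - b) * u $ 1) * w $ 2 - ((s - b) * u $ 2) * w $ 1" by (simp add: cross_def algebra_simps)
  also have "... = 0" unfolding e1 e2 by simp
  finally have "s = b" using Dw by simp
  have "(c - t) * cross u w = u $ 1 * ((c - t) * w $ 2) - u $ 2 * ((c - t) * w $ 1)" by (simp add: cross_def algebra_simps)
  also have "... = 0" unfolding e1[symmetric] e2[symmetric] by simp
  finally have "t = c" using Dw by simp
  show ?thesis using abc \<open>s = b\<close> \<open>t = c\<close> by (auto simp: indicator_def)
 qed simp
 then have "(\<integral>\<^sup>+s. \<integral>\<^sup>+t. indicator K (p + s *\<^sub>R u + t *\<^sub>R w) \<partial>lborel \<partial>lborel) <= (\<integral>\<^sup>+s. \<integral>\<^sup>+t. indicator {0..1::real} s * indicator {0..1::real} t \<partial>lborel \<partial>lborel)"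
  by (intro nn_integral_mono)
 also have "... = 1" by (simp add: nn_integral_cmult_indicator)
 finally have "ennreal \<bar>cross u w\<bar> * (\<integral>\<^sup>+s. \<integral>\<^sup>+t. indicator K (p + s *\<^sub>R u + t *\<^sub>R w) \<partial>lborel \<partial>lborel) <= ennreal \<bar>cross u w\<bar> * 1"
  by (rule mult_left_mono) simp
 moreover have "(\<integral>\<^sup>+x. indicator K x \<partial>lborel) = ennreal \<bar>cross u w\<bar> * (\<integral>\<^sup>+s. \<integral>\<^sup>+t. indicator K (p + s *\<^sub>R u + t *\<^sub>R w) \<partial>lborel \<partial>lborel)"
  unfolding cross_def using Dw by (intro nn_integral_parallelogram) (auto simp: cross_def)
 ultimately have "emeasure lborel K <= ennreal \<bar>cross u w\<bar>" by simp
 moreover have "emeasure lborel K = ennreal (measure lebesgue K)"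
  using emeasure_eq_measure2[OF lmeasurable_compact[OF cK]] by simp
 ultimately show ?thesis by (simp add: K_def u_def w_def)
qed

section \<open>Mesh geometry\<close>

context lip_domain
begin

text \<open>Adds to the definition of a Lipschitz boundary that the closure stays on or above the
  graph, by continuity of \<open>f\<close>, and that the frontier point itself is on it, since it is
  not in \<open>Om\<close>.\<close>

lemma frontier_graph:
 assumes "z : frontier Om"
 obtains r e1 e2 f L where "r > 0" "norm e1 = 1" "norm e2 = 1" "e1 \<bullet> e2 = 0" "L-lipschitz_on UNIV f"
  "Om \<inter> ball z r = {y : ball z r. f (y \<bullet> e1) < y \<bullet> e2}" "f (z \<bullet> e1) = z \<bullet> e2"
  "ALL y. y : closure Om --> y : ball z r --> f (y \<bullet> e1) <= y \<bullet> e2"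
proof -
 obtain r e1 e2 f L where r: "r > 0" and e: "norm e1 = 1" "norm e2 = 1" "e1 \<bullet> e2 = 0"
  and L: "L-lipschitz_on UNIV f" and g: "Om \<inter> ball z r = {y : ball z r. f (y \<bullet> e1) < y \<bullet> e2}"
  using bspec[OF lip[unfolded lipschitz_boundary_def] assms] by (elim exE conjE) (rule that)
 have cf: "continuous_on UNIV f" using L by (rule lipschitz_on_continuous_on)
 have cl: "f (y \<bullet> e1) <= y \<bullet> e2" if y: "y : closure Om" "y : ball z r" for y
 proof (rule ccontr)
  assume "~ f (y \<bullet> e1) <= y \<bullet> e2"
  define N where "N = ball z r \<inter> {y. y \<bullet> e2 < f (y \<bullet> e1)}"
  have "open {y. y \<bullet> e2 < f (y \<bullet> e1)}"
   by (intro open_Collect_less continuous_intros continuous_on_compose2[OF cf]) auto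
  then have "open N" by (auto simp: N_def)
  moreover have "N \<inter> Om = {}"
  proof -
   have "y \<bullet> e2 > f (y \<bullet> e1)" if "y : Om" "y : ball z r" for y using g that by blast
   then show ?thesis by (force simp: N_def)
  qed
  ultimately have "N \<inter> closure Om = {}" by (simp add: open_Int_closure_eq_empty)
  moreover have "y : N" using y \<open>~ f (y \<bullet> e1) <= y \<bullet> e2\<close> by (simp add: N_def)
  ultimately show False using y by blast
 qed
 have z: "z : closure Om" "z ~: Om" using assms opn by (auto simp: frontier_def interior_open)
 have "z : ball z r" using r by simp
 then have "~ f (z \<bullet> e1) < z \<bullet> e2" using g z(2) by blast
 then have "f (z \<bullet> e1) = z \<bullet> e2" using cl[OF z(1)] r by simp
 moreover have "ALL y. y : closure Om --> y : ball z r --> f (y \<bullet> e1) <= y \<bullet> e2" using cl by blast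
 ultimately show ?thesis by (rule that[OF r e L g])
qed

text \<open>No slits: points just below the graph are outside the closure, so a frontier point
  cannot be interior to it. Hence the interiors of triangles, and all discs covered by triangles,
  lie in \<open>Om\<close>.\<close>

lemma interior_closure_eq: "interior (closure Om) = Om"
proof
 show "Om <= interior (closure Om)" by (rule interior_maximal[OF closure_subset opn])
 show "interior (closure Om) <= Om"
 proof
  fix x assume x: "x : interior (closure Om)"
  show "x : Om"
  proof (rule ccontr)
   assume "x ~: Om"
   then have fr: "x : frontier Om" using x interior_subset opn by (auto simp: frontier_def interior_open)
   obtain r e1 e2 f L where r: "r > 0" and e: "norm e1 = 1" "norm e2 = 1" "e1 \<bullet> e2 = 0" and L: "L-lipschitz_on UNIV f"
  and g: "Om \<inter> ball x r = {y : ball x r. f (y \<bullet> e1) < y \<bullet> e2}" and fx: "f (x \<bullet> e1) = x \<bullet> e2"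
  and cl: "ALL y. y : closure Om --> y : ball x r --> f (y \<bullet> e1) <= y \<bullet> e2"
  by (rule frontier_graph[OF fr]) (rule that)
   obtain d where d: "d > 0" "ball x d <= closure Om" using x by (auto simp: mem_interior)
   define t where "t = min d r / 2"
   have t: "t > 0" "t < d" "t < r" using d r by (auto simp: t_def)
   define y where "y = x - t *\<^sub>R e2"
   have dy: "dist x y = t" using t e by (simp add: y_def dist_norm)
   have "f (y \<bullet> e1) <= y \<bullet> e2" using cl d(2) dy t by (metis mem_ball subsetD)
   moreover have "y \<bullet> e1 = x \<bullet> e1" using e by (simp add: y_def inner_diff_left inner_commute[of e2 e1])
   moreover have "y \<bullet> e2 = x \<bullet> e2 - t" using e by (simp add: y_def inner_diff_left norm_eq_1)
   ultimately show False using fx t by simp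
  qed
 qed
qed

text \<open>At a boundary point, both points are lifted along \<open>e2\<close>, which keeps them
  above the graph, up to a height at which the segment joining them is above the graph as well. The
  path avoids z because it stays in \<open>Om\<close>.\<close>

lemma punctured_connection:
 assumes z: "z : closure Om" and "R > 0"
 shows "EX eps>0. ALL x y. x : Om \<inter> ball z eps - {z} --> y : Om \<inter> ball z eps - {z} -->
  (EX C. connected C & x : C & y : C & C <= Om \<inter> ball z R - {z})"
proof (cases "z : Om")
 case True
 obtain d where d: "d > 0" "ball z d <= Om" using True opn open_contains_ball by blast
 define eps where "eps = min d R"
 have eps: "eps > 0" using d \<open>R > 0\<close> by (simp add: eps_def)
 have "connected (ball z eps - {z})" by (rule connected_open_delete) auto
 moreover have "ball z eps - {z} <= Om \<inter> ball z R - {z}" using d by (auto simp: eps_def)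
 ultimately show ?thesis using eps by (intro exI[of _ eps]) blast
next
 case False
 then have fr: "z : frontier Om" using z opn by (simp add: frontier_def interior_open)
 obtain r e1 e2 f L where r: "r > 0" and e: "norm e1 = 1" "norm e2 = 1" "e1 \<bullet> e2 = 0" and L: "L-lipschitz_on UNIV f"
  and g: "Om \<inter> ball z r = {y : ball z r. f (y \<bullet> e1) < y \<bullet> e2}" and fz: "f (z \<bullet> e1) = z \<bullet> e2"
  and cl: "ALL y. y : closure Om --> y : ball z r --> f (y \<bullet> e1) <= y \<bullet> e2"
  by (rule frontier_graph[OF fr]) (rule that)
 have L0: "L >= 0" using L by (rule lipschitz_on_nonneg)
 define Q where "Q = min R r"
 have Q: "Q > 0" "Q <= R" "Q <= r" using \<open>R > 0\<close> r by (auto simp: Q_def)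
 \<comment> \<open>Within distance eps of z the graph exceeds the height of z by at most L eps, and
   a point lies below that height by less than eps; a lift of more than (L + 1) eps therefore clears
   the graph. With \<open>eps = Q / (M + 1)\<close> the lifted points remain in
   \<open>ball z Q\<close>.\<close>
 define M where "M = L + 2"
 define eps where "eps = Q / (M + 1)"
 have eps: "eps > 0" using Q L0 by (simp add: eps_def M_def)
 have epsM: "eps + M * eps = Q"
 proof -
  have "eps * (M + 1) = Q" unfolding eps_def using L0 by (intro divide_mult_cancel_real) (simp add: M_def)
  then show ?thesis by (simp add: algebra_simps)
 qed
 define H where "H = M * eps"
 have H: "H >= 0" using eps L0 by (simp add: H_def M_def)
 have inOm: "w : Om \<inter> ball z R - {z}" if "w : ball z Q" "f (w \<bullet> e1) < w \<bullet> e2" for w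
 proof -
  have "w : ball z r" "w : ball z R" using that(1) Q by simp_all
  then have "w : Om" using g that(2) by blast
  then show ?thesis using \<open>w : ball z R\<close> False by blast
 qed
 have comp: "\<bar>(x - z) \<bullet> e1\<bar> < eps" "\<bar>(x - z) \<bullet> e2\<bar> < eps" if "x : ball z eps" for x
  using that Cauchy_Schwarz_ineq2[of "x - z" e1] Cauchy_Schwarz_ineq2[of "x - z" e2] e
  by (auto simp: dist_norm norm_minus_commute)
 have seg: "x + t *\<^sub>R e2 : ball z Q" if "x : ball z eps" "0 <= t" "t <= H" for x t
 proof -
  have "dist z (x + t *\<^sub>R e2) <= dist z x + dist x (x + t *\<^sub>R e2)" by (rule dist_triangle)
  also have "dist x (x + t *\<^sub>R e2) = t" using that e by (simp add: dist_norm)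
  finally show ?thesis using that epsM by (simp add: H_def)
 qed
 have up: "x + t *\<^sub>R e2 : Om \<inter> ball z R - {z}" if x: "x : Om" "x : ball z eps" and t: "0 <= t" "t <= H" for x t
 proof (rule inOm)
  show "x + t *\<^sub>R e2 : ball z Q" by (rule seg[OF x(2) t])
  have "x : ball z r" using x(2) Q H epsM by (simp add: H_def)
  then have "f (x \<bullet> e1) < x \<bullet> e2" using g x(1) by blast
  then show "f ((x + t *\<^sub>R e2) \<bullet> e1) < (x + t *\<^sub>R e2) \<bullet> e2"
   using e t by (simp add: inner_add_left inner_commute[of e2 e1] norm_eq_1)
 qed
 have top: "x + H *\<^sub>R e2 : Om \<inter> ball z R - {z}" if x: "x : ball z eps" for x
 proof (rule inOm)
  show "x + H *\<^sub>R e2 : ball z Q" by (rule seg[OF x H order_refl])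
  have "f (x \<bullet> e1) - f (z \<bullet> e1) <= L * dist (x \<bullet> e1) (z \<bullet> e1)"
   using lipschitz_onD[OF L, of "x \<bullet> e1" "z \<bullet> e1"] by (simp add: dist_real_def)
  also have "dist (x \<bullet> e1) (z \<bullet> e1) <= eps" using comp(1)[OF x] by (simp add: dist_real_def inner_diff_left)
  finally have "f (x \<bullet> e1) <= z \<bullet> e2 + L * eps" using fz L0 by (simp add: mult_left_mono)
  also have "... < x \<bullet> e2 + H"
   using comp(2)[OF x] eps by (simp add: H_def M_def inner_diff_left algebra_simps)
  finally show "f ((x + H *\<^sub>R e2) \<bullet> e1) < (x + H *\<^sub>R e2) \<bullet> e2"
   using e by (simp add: inner_add_left inner_commute[of e2 e1] norm_eq_1)
 qed
 have "EX C. connected C & x : C & y : C & C <= Om \<inter> ball z R - {z}"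
  if x: "x : Om \<inter> ball z eps - {z}" and y: "y : Om \<inter> ball z eps - {z}" for x y
 proof -
  let ?x = "x + H *\<^sub>R e2" and ?y = "y + H *\<^sub>R e2"
  have up': "closed_segment w (w + H *\<^sub>R e2) <= Om \<inter> ball z R - {z}" if "w : Om \<inter> ball z eps - {z}" for w
  proof
   fix v assume "v : closed_segment w (w + H *\<^sub>R e2)"
   then obtain s where s: "0 <= s" "s <= 1" "v = (1 - s) *\<^sub>R w + s *\<^sub>R (w + H *\<^sub>R e2)" by (auto simp: closed_segment_def)
   then have "v = w + (s * H) *\<^sub>R e2" by (simp add: algebra_simps)
   moreover have "s * H <= 1 * H" using s H by (intro mult_right_mono) auto
   ultimately show "v : Om \<inter> ball z R - {z}" using up[of w "s * H"] that s H by simp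
  qed
  have top': "closed_segment ?x ?y <= Om \<inter> ball z R - {z}"
  proof
   fix v assume "v : closed_segment ?x ?y"
   then obtain s where s: "0 <= s" "s <= 1" "v = (1 - s) *\<^sub>R ?x + s *\<^sub>R ?y" by (auto simp: closed_segment_def)
   then have "v = ((1 - s) *\<^sub>R x + s *\<^sub>R y) + H *\<^sub>R e2" by (simp add: algebra_simps)
   moreover have "(1 - s) *\<^sub>R x + s *\<^sub>R y : ball z eps"
    using x y s convexD_alt[OF convex_ball, of x z eps y s] by simp
   ultimately show "v : Om \<inter> ball z R - {z}" using top by simp
  qed
  let ?C = "closed_segment x ?x \<union> closed_segment ?x ?y \<union> closed_segment ?y y"
  have "connected ?C"
   by (intro connected_Un connected_segment) (use ends_in_segment in blast)+
  moreover have "?C <= Om \<inter> ball z R - {z}"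
   using up'[OF x] up'[OF y] top' closed_segment_commute[of ?y y] by blast
  ultimately show ?thesis by (intro exI[of _ ?C]) auto
 qed
 then show ?thesis using eps by blast
qed

end

section \<open>Simplices, faces and edges of a conforming mesh\<close>

definition verts :: "plane set => plane set" where "verts K = {z. z extreme_point_of K}"

lemma simplex_verts:
 assumes "2 simplex K"
 shows "finite (verts K)" "card (verts K) = 3" "~ affine_dependent (verts K)" "K = convex hull (verts K)"
proof -
 obtain C where C: "~ affine_dependent C" "int (card C) = 2 + 1" "K = convex hull C"
  using assms unfolding simplex_def by blast
 have "verts K = C" unfolding verts_def C(3) using extreme_point_of_convex_hull_affine_independent[OF C(1)] by blast
 then show "finite (verts K)" "card (verts K) = 3" "~ affine_dependent (verts K)" "K = convex hull (verts K)"
  using C aff_independent_finite[OF C(1)] by auto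
qed

lemma third_vertex:
 assumes "2 simplex K" "z : verts K" "y : verts K" "z ~= y"
 obtains r where "verts K = {z, y, r}" "r ~= z" "r ~= y"
proof -
 note v = simplex_verts[OF assms(1)]
 have "card (verts K - {z, y}) = 1"
  using assms v by (subst card_Diff_subset) auto
 then obtain r where "verts K - {z, y} = {r}" by (auto simp: card_1_singleton_iff)
 then show ?thesis using assms by (intro that[of r]) auto
qed

lemma simplex_cross:
 assumes "2 simplex K" "verts K = {p, q, r}" "p ~= q" "q ~= r" "p ~= r"
 shows "cross (q - p) (r - p) ~= 0"
 using cross_zero_dependent[of q p r] simplex_verts(3)[OF assms(1)] assms by auto

lemma two_simplex_facts:
 fixes K :: "plane set"
 assumes "2 simplex K"
 shows "compact K" "convex K" "closed K" "interior K ~= {}" "closure (interior K) = K" "bounded (interior K)" "convex (interior K)"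
proof -
 show c: "compact K" "convex K" "closed K" using assms compact_simplex convex_simplex closed_simplex by blast+
 have "aff_dim K = 2" by (rule aff_dim_simplex[OF assms])
 then have "rel_interior K = interior K" by (intro interior_rel_interior) simp
 moreover have "K ~= {}" using \<open>aff_dim K = 2\<close> by auto
 ultimately show ni: "interior K ~= {}" using rel_interior_eq_empty[OF c(2)] by auto
 show "closure (interior K) = K" using convex_closure_interior[OF c(2) ni] c(3) by simp
 show "bounded (interior K)" using bounded_subset[OF compact_imp_bounded[OF c(1)] interior_subset] .
 show "convex (interior K)" using c(2) by (rule convex_interior)
qed

lemma simplex_frontier:
 fixes K :: "plane set"
 assumes "2 simplex K" "x : frontier K"
 obtains z y where "z : verts K" "y : verts K" "z ~= y" "x : closed_segment z y"
proof -
 note v = simplex_verts[OF assms(1)]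
 have "frontier K = \<Union>{convex hull (verts K - {a}) | a. a : verts K}"
  using frontier_of_convex_hull[of "verts K"] v(2) by (simp add: v(4)[symmetric])
 then have "x : \<Union>{convex hull (verts K - {a}) | a. a : verts K}" using assms(2) by simp
 then obtain a where a: "a : verts K" "x : convex hull (verts K - {a})" by blast
 have "card (verts K - {a}) = 2" using v a by simp
 then obtain z y where zy: "verts K - {a} = {z, y}" "z ~= y" by (meson card_2_iff)
 then show ?thesis using a by (intro that[of z y]) (auto simp: segment_convex_hull)
qed

locale mesh = lip_domain +
 fixes T :: "plane set set"
 assumes triT: "triangulation T" and simp2: "!!K. K : T ==> 2 simplex K" and cover: "\<Union>T = closure Om"
begin

lemma finT: "finite T" using triT by (simp add: triangulation_def)

lemmas vertsT = simplex_verts[OF simp2] and factsT = two_simplex_facts[OF simp2]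

lemma face_inter: "K : T ==> K' : T ==> (K \<inter> K') face_of K & (K \<inter> K') face_of K'"
 using triT unfolding triangulation_def by (metis Int_commute)

lemma verts_sub: "K : T ==> verts K <= K"
 using extreme_point_of_def by (auto simp: verts_def)

text \<open>The intersection is a face of both triangles, and a face of a simplex is the hull of
  some of its vertices; both descriptions have the same extreme points.\<close>

lemma inter_hull:
 assumes K: "K : T" "K' : T" shows "K \<inter> K' = convex hull (verts K \<inter> verts K')"
proof -
 note f = face_inter[OF K]
 obtain c where c: "c <= verts K" "K \<inter> K' = convex hull c"
  using f face_of_convex_hull_affine_independent[OF vertsT(3)[OF K(1)]] vertsT(4)[OF K(1)] by metis
 obtain c' where c': "c' <= verts K'" "K \<inter> K' = convex hull c'"
  using f face_of_convex_hull_affine_independent[OF vertsT(3)[OF K(2)]] vertsT(4)[OF K(2)] by metis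
 have i: "~ affine_dependent c" "~ affine_dependent c'"
  using c c' vertsT(3) K affine_independent_subset by blast+
 have "{z. z extreme_point_of (K \<inter> K')} = c" "{z. z extreme_point_of (K \<inter> K')} = c'"
  using extreme_point_of_convex_hull_affine_independent[OF i(1)] extreme_point_of_convex_hull_affine_independent[OF i(2)] c c'
  by auto
 then have sub: "c <= verts K \<inter> verts K'" using c c' by auto
 have "verts K \<inter> verts K' <= c"
 proof
  fix z assume z: "z : verts K \<inter> verts K'"
  then have "z : K \<inter> K'" using verts_sub K by blast
  then have "z extreme_point_of (K \<inter> K')" using z extreme_point_of_face[of "K \<inter> K'" K z] f by (auto simp: verts_def)
  then show "z : c" using \<open>{z. z extreme_point_of (K \<inter> K')} = c\<close> by blast
 qed
 then show ?thesis using c sub by auto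
qed

text \<open>No hanging nodes: a vertex of one triangle that lies in another is an extreme point of
  their common face, hence of both.\<close>

lemma vertex_in:
 assumes "K : T" "z : mesh_vertices T" "z : K" shows "z : verts K"
proof -
 obtain K0 where K0: "K0 : T" "z : verts K0" using assms(2) by (auto simp: mesh_vertices_def verts_def)
 note f = face_inter[OF assms(1) K0(1)]
 have "z : K \<inter> K0" using assms(3) K0 verts_sub by blast
 then have "z extreme_point_of (K \<inter> K0)" using K0(2) f extreme_point_of_face[of "K \<inter> K0" K0 z] by (auto simp: verts_def)
 then show ?thesis using f extreme_point_of_face[of "K \<inter> K0" K z] by (auto simp: verts_def)
qed

lemma mesh_vertices_eq: "mesh_vertices T = (UN K:T. verts K)"
 by (auto simp: mesh_vertices_def verts_def)

lemma finV: "finite (mesh_vertices T)"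
 unfolding mesh_vertices_eq using finT vertsT(1) by auto

lemma interior_disj: "K : T ==> K' : T ==> K ~= K' ==> interior K \<inter> interior K' = {}"
proof (rule ccontr)
 assume K: "K : T" "K' : T" "K ~= K'" "interior K \<inter> interior K' ~= {}"
 then obtain x where x: "x : interior K" "x : interior K'" by blast
 then have xx: "x : K \<inter> K'" using interior_subset by blast
 note f = face_inter[OF K(1,2)]
 have "K \<inter> K' = K" using face_of_disjoint_interior[of "K \<inter> K'" K] f x xx by blast
 moreover have "K \<inter> K' = K'" using face_of_disjoint_interior[of "K \<inter> K'" K'] f x xx by blast
 ultimately show False using K(3) by simp
qed

lemma interior_sub: "K : T ==> interior K <= Om"
 using interior_closure_eq interior_mono[of K "closure Om"] cover by blast

lemma edge_iff: "E : mesh_edges T \<longleftrightarrow> (EX K:T. EX z:verts K. EX y:verts K. z ~= y & E = closed_segment z y)"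
proof
 assume "E : mesh_edges T"
 then obtain K where K: "K : T" "E face_of K" "aff_dim E = 1" by (auto simp: mesh_edges_def)
 obtain c where c: "c <= verts K" "E = convex hull c"
  using K face_of_convex_hull_affine_independent[OF vertsT(3)[OF K(1)]] vertsT(4)[OF K(1)] by metis
 have "~ affine_dependent c" using c vertsT(3) K affine_independent_subset by blast
 then have "int (card c) = aff_dim c + 1" by (rule aff_dim_affine_independent)
 then have "card c = 2" using K(3) c(2) by (simp add: aff_dim_convex_hull)
 then obtain z y where "c = {z, y}" "z ~= y" by (meson card_2_iff)
 then show "EX K:T. EX z:verts K. EX y:verts K. z ~= y & E = closed_segment z y"
  using c K(1) by (auto simp: segment_convex_hull)
next
 assume "EX K:T. EX z:verts K. EX y:verts K. z ~= y & E = closed_segment z y"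
 then obtain K z y where K: "K : T" "z : verts K" "y : verts K" "z ~= y" "E = closed_segment z y" by blast
 have "E = convex hull {z, y}" using K by (simp add: segment_convex_hull)
 then have "E face_of K"
  using face_of_convex_hull_affine_independent[OF vertsT(3)[OF K(1)], of E] vertsT(4)[OF K(1)] K(2,3)
  by (metis empty_subsetI insert_subset)
 moreover have "aff_dim E = 1" using \<open>E = convex hull {z, y}\<close> K(4) by (simp add: aff_dim_convex_hull aff_dim_2)
 ultimately show "E : mesh_edges T" using K(1) by (auto simp: mesh_edges_def)
qed

lemma edges_endpoints:
 assumes "closed_segment z y : mesh_edges T"
 obtains K where "K : T" "z : verts K" "y : verts K" "z ~= y"
proof -
 obtain K z' y' where K: "K : T" "z' : verts K" "y' : verts K" "z' ~= y'" "closed_segment z y = closed_segment z' y'"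
  using assms unfolding edge_iff by blast
 then have "{z, y} = {z', y'}" using closed_segment_eq by (metis doubleton_eq_iff)
 then show ?thesis using K by (intro that[of K]) (auto simp: doubleton_eq_iff)
qed

lemma frontier_edge:
 assumes "K : T" "x : frontier K"
 shows "EX E:mesh_edges T. x : E"
 using simplex_frontier[OF simp2[OF assms(1)] assms(2)] assms(1) edge_iff by metis

lemma frontier_domain_edge:
 assumes "x : frontier Om" shows "EX E:mesh_edges T. x : E"
proof -
 have "x : closure Om" "x ~: Om" using assms opn by (auto simp: frontier_def interior_open)
 then obtain K where K: "K : T" "x : K" using cover by blast
 then have "x ~: interior K" using interior_sub \<open>x ~: Om\<close> by blast
 then have "x : frontier K" using K factsT(3)[OF K(1)] by (simp add: frontier_def)
 then show ?thesis using frontier_edge K by blast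
qed

lemma isolate:
 "EX e>0. ALL K:T. x ~: K --> ball x e \<inter> K = {}"
proof -
 define F where "F = \<Union>{K:T. x ~: K}"
 have "closed F" unfolding F_def using finT factsT(3) by (intro closed_Union) auto
 moreover have "x : - F" by (auto simp: F_def)
 ultimately obtain e where "e > 0" "ball x e <= - F" using open_contains_ball[of "- F"] by (auto simp: closed_def)
 then show ?thesis by (intro exI[of _ e]) (auto simp: F_def)
qed

text \<open>The common face of \<open>K\<close> and \<open>K0\<close> contains a relatively interior
  point of the edge, and a face that meets the relative interior of a subset contains all of
  it.\<close>

lemma edge_sub_of_meet:
 assumes E: "K0 : T" "z : verts K0" "y : verts K0" "z ~= y" and x: "x : open_segment z y" and K: "K : T" "x : K"
 shows "closed_segment z y <= K"
proof -
 have sub: "closed_segment z y <= K0"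
  using E verts_sub[OF E(1)] by (intro closed_segment_subset factsT(2)[OF E(1)]) auto
 have "closed_segment z y <= K \<inter> K0"
 proof (rule subset_of_face_of)
  show "(K \<inter> K0) face_of K0" using face_inter K(1) E(1) by blast
  have "x : K0" using sub x open_closed_segment by blast
  then show "(K \<inter> K0) \<inter> rel_interior (closed_segment z y) ~= {}"
   using x K(2) E(4) by (auto simp: rel_interior_closed_segment)
 qed (rule sub)
 then show ?thesis by blast
qed

text \<open>Excludes an edge running partly inside the domain and partly along the boundary. Near x
  only triangles containing x occur, and these contain the whole edge; a homothety centred at an end
  point v of the edge carries the disc around x to a disc around x' without leaving any of
  them.\<close>

lemma edge_dichotomy:
 assumes E: "K0 : T" "z : verts K0" "y : verts K0" "z ~= y" and x: "x : open_segment z y" "x : Om"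
 shows "open_segment z y <= Om"
proof
 fix x' assume x': "x' : open_segment z y"
 obtain e1 where e1: "e1 > 0" "ball x e1 <= Om" using x(2) opn open_contains_ball by blast
 obtain e2 where e2: "e2 > 0" "ALL K:T. x ~: K --> ball x e2 \<inter> K = {}" using isolate by blast
 define e where "e = min e1 e2"
 have e: "e > 0" using e1 e2 by (simp add: e_def)
 obtain s where s: "0 < s" "s < 1" "x = (1 - s) *\<^sub>R z + s *\<^sub>R y" using x(1) by (auto simp: in_segment)
 obtain s' where s': "0 < s'" "s' < 1" "x' = (1 - s') *\<^sub>R z + s' *\<^sub>R y" using x' by (auto simp: in_segment)
 obtain mu v where mu: "0 <= mu" "mu < 1" "v : closed_segment z y" "x' = (1 - mu) *\<^sub>R x + mu *\<^sub>R v"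
 proof (cases "s <= s'")
  case True
  define mu where "mu = (s' - s) / (1 - s)"
  have m: "mu * (1 - s) = s' - s" unfolding mu_def using s by (intro divide_mult_cancel_real) simp
  have "mu < 1" "0 <= mu" using True s s' by (auto simp: mu_def divide_less_eq)
  moreover have "x' = (1 - mu) *\<^sub>R x + mu *\<^sub>R y"
  proof -
   have s'eq: "s' = s + mu * (1 - s)" using m by simp
   show ?thesis unfolding s(3) s'(3) s'eq by (simp add: algebra_simps)
  qed
  ultimately show ?thesis by (intro that[of mu y]) auto
 next
  case False
  define mu where "mu = (s - s') / s"
  have m: "mu * s = s - s'" unfolding mu_def using s by (intro divide_mult_cancel_real) simp
  have "mu < 1" "0 <= mu" using False s s' by (auto simp: mu_def divide_less_eq)
  moreover have "x' = (1 - mu) *\<^sub>R x + mu *\<^sub>R z"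
  proof -
   have s'eq: "s' = s - mu * s" using m by simp
   show ?thesis unfolding s(3) s'(3) s'eq by (simp add: algebra_simps)
  qed
  ultimately show ?thesis by (intro that[of mu z]) auto
 qed
 have "ball x' ((1 - mu) * e) <= closure Om"
 proof
  fix w assume w: "w : ball x' ((1 - mu) * e)"
  \<comment> \<open>The preimage of w under the homothety with centre v and ratio 1 - mu.\<close>
  define xx where "xx = x + (1 / (1 - mu)) *\<^sub>R (w - x')"
  have "dist x xx = norm (w - x') / (1 - mu)" using mu by (simp add: xx_def dist_norm)
  also have "... < e" using w mu by (simp add: dist_norm norm_minus_commute pos_divide_less_eq mult.commute)
  finally have xxb: "xx : ball x e" by simp
  then have "xx : Om" using e1 by (auto simp: e_def)
  then obtain K where K: "K : T" "xx : K" using cover closure_subset by blast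
  have "xx : ball x e2" using xxb by (simp add: e_def)
  then have "x : K" using e2(2) K by blast
  then have "v : K" using edge_sub_of_meet[OF E x(1) K(1)] mu(3) by blast
  have "w = (1 - mu) *\<^sub>R xx + mu *\<^sub>R v"
   using mu by (simp add: xx_def scaleR_add_right mu(4))
  then have "w : K" using factsT(2)[OF K(1)] K(2) \<open>v : K\<close> mu by (simp add: convexD_alt)
  then show "w : closure Om" using K cover by blast
 qed
 moreover have "(1 - mu) * e > 0" using mu e by simp
 ultimately have "x' : interior (closure Om)" by (meson centre_in_ball interiorI open_ball)
 then show "x' : Om" by (simp add: interior_closure_eq)
qed

definition adj :: "plane => (plane set \<times> plane set) set" where
 "adj z = {(K, K'). K : T & K' : T & z : verts K & z : verts K' & (EX y. y ~= z & y : verts K & y : verts K')}"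

text \<open>Two edge-connected classes of triangles around a vertex would meet only in that vertex, so
 they would disconnect the domain near it.\<close>

lemma star_connected:
 assumes K: "K : T" "z : verts K" and K': "K' : T" "z : verts K'"
 shows "(K, K') : (adj z)\<^sup>*"
proof (rule ccontr)
 assume not: "(K, K') ~: (adj z)\<^sup>*"
 have zc: "z : closure Om" using K verts_sub cover by blast
 have zV: "z : mesh_vertices T" using K by (auto simp: mesh_vertices_eq)
 \<comment> \<open>Inside \<open>ball z R\<close> only triangles with vertex z occur, so the two
   classes of triangles cover every connecting set there.\<close>
 obtain R where R: "R > 0" "ALL K:T. z ~: K --> ball z R \<inter> K = {}" using isolate by blast
 obtain eps where eps: "eps > 0" "!!x y. x : Om \<inter> ball z eps - {z} ==> y : Om \<inter> ball z eps - {z} ==>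
  EX C. connected C & x : C & y : C & C <= Om \<inter> ball z R - {z}"
  using punctured_connection[OF zc R(1)] by blast
 have pick: "EX x. x : interior L & x : Om \<inter> ball z eps - {z}" if L: "L : T" "z : verts L" for L
 proof -
  have "z : closure (interior L)" using factsT(5)[OF L(1)] verts_sub[OF L(1)] L(2) by blast
  then obtain x where x: "x : interior L" "dist x z < eps" using eps(1) by (meson closure_approachable)
  have "z ~: interior L" using L(2) extreme_point_not_in_interior by (auto simp: verts_def)
  then have "x ~= z" using x by blast
  then show ?thesis using x interior_sub[OF L(1)] by (intro exI[of _ x]) (auto simp: dist_commute)
 qed
 obtain x where x: "x : interior K" "x : Om \<inter> ball z eps - {z}" using pick[OF K] by blast
 obtain y where y: "y : interior K'" "y : Om \<inter> ball z eps - {z}" using pick[OF K'] by blast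
 obtain C where C: "connected C" "x : C" "y : C" "C <= Om \<inter> ball z R - {z}" using eps(2)[OF x(2) y(2)] by blast
 define S where "S = {L : T. z : verts L}"
 define S1 where "S1 = {L : S. (K, L) : (adj z)\<^sup>*}"
 define A where "A = \<Union>S1"
 define B where "B = \<Union>(S - S1)"
 have fS: "finite S" using finT by (simp add: S_def)
 have SS: "S1 <= S" "S <= T" by (auto simp: S1_def S_def)
 have clA: "closed A" unfolding A_def
  by (intro closed_Union finite_subset[OF SS(1) fS] ballI factsT(3)) (use SS in blast)
 have clB: "closed B" unfolding B_def
  by (intro closed_Union finite_Diff fS ballI factsT(3)) (use SS in blast)
 have cov: "C <= A \<union> B"
 proof
  fix w assume "w : C"
  then have w: "w : Om" "w : ball z R" using C(4) by auto
  then obtain L where L: "L : T" "w : L" using cover closure_subset by blast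
  then have "z : L" using R(2) w(2) by blast
  then have "L : S" using vertex_in[OF L(1) zV] L(1) by (simp add: S_def)
  then show "w : A \<union> B" using L(2) by (auto simp: A_def B_def)
 qed
 have dis: "A \<inter> B \<inter> C = {}"
 proof (rule ccontr)
  assume "A \<inter> B \<inter> C ~= {}"
  then obtain w L1 L2 where w: "w : C" "w : L1" "L1 : S1" "w : L2" "L2 : S - S1" by (auto simp: A_def B_def)
  have L: "L1 : T" "z : verts L1" "L2 : T" "z : verts L2" "(K, L1) : (adj z)\<^sup>*" "(K, L2) ~: (adj z)\<^sup>*"
   using w by (auto simp: S1_def S_def)
  have "verts L1 \<inter> verts L2 = {z}"
  proof (rule ccontr)
   assume "verts L1 \<inter> verts L2 ~= {z}"
   then obtain v where "v ~= z" "v : verts L1" "v : verts L2" using L by blast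
   then have "(L1, L2) : adj z" using L by (auto simp: adj_def)
   then show False using rtrancl_into_rtrancl[OF L(5)] L(6) by simp
  qed
  then have "L1 \<inter> L2 = {z}" using inter_hull[OF L(1,3)] by simp
  then have "w = z" using w by blast
  then show False using w(1) C(4) by blast
 qed
 have "x : A" using x(1) interior_subset K by (auto simp: A_def S1_def S_def)
 moreover have "y : B" using y(1) interior_subset[of K'] K' not by (auto simp: B_def S1_def S_def)
 ultimately show False using connected_closedD[OF C(1) dis cov clA clB] C(2,3) by blast
qed

end

section \<open>Nodal functions and piecewise smooth functions\<close>

lemma affine_eq_hull:
 fixes d d' :: plane
 assumes "ALL z:S. c + d \<bullet> z = c' + d' \<bullet> z" "x : convex hull S"
 shows "c + d \<bullet> x = c' + d' \<bullet> x"
proof -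
 have eq: "c + d \<bullet> z = c' + d' \<bullet> z \<longleftrightarrow> (d - d') \<bullet> z = c' - c" for z by (auto simp: inner_diff_left)
 have "convex hull S <= {x. (d - d') \<bullet> x = c' - c}"
  by (rule hull_minimal) (use assms(1) eq convex_hyperplane in auto)
 then show ?thesis using assms(2) eq by auto
qed

lemma affine_interpolation:
 fixes val :: "plane => real"
 assumes "2 simplex K"
 shows "EX c d. ALL z:verts K. c + d \<bullet> z = val z"
proof -
 note v = simplex_verts[OF assms]
 obtain p q r where pqr: "verts K = {p, q, r}" "p ~= q" "q ~= r" "p ~= r"
  using v(2) by (auto simp: card_3_iff)
 define u where "u = q - p"
 define w where "w = r - p"
 define D where "D = cross u w"
 have D: "D ~= 0" using simplex_cross[OF assms pqr] by (simp add: D_def u_def w_def)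
 define A where "A = val q - val p"
 define B where "B = val r - val p"
 \<comment> \<open>Cramer's rule for the equations d . u = A and d . w = B.\<close>
 define d :: plane where "d = (\<chi> i. if i = 1 then (A * w $ 2 - B * u $ 2) / D else (B * u $ 1 - A * w $ 1) / D)"
 have inner2: "x \<bullet> y = x $ 1 * y $ 1 + x $ 2 * y $ 2" for x y :: plane by (simp add: inner_vec_def UNIV_2_eq)
 have "d \<bullet> u = (A * w $ 2 - B * u $ 2) / D * u $ 1 + (B * u $ 1 - A * w $ 1) / D * u $ 2" by (simp add: inner2 d_def)
 also have "... = A * (u $ 1 * w $ 2 - u $ 2 * w $ 1) / D" by (simp add: algebra_simps diff_divide_distrib add_divide_distrib)
 also have "... = A" using D by (simp add: D_def cross_def)
 finally have du: "d \<bullet> u = A" .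
 have "d \<bullet> w = (A * w $ 2 - B * u $ 2) / D * w $ 1 + (B * u $ 1 - A * w $ 1) / D * w $ 2" by (simp add: inner2 d_def)
 also have "... = B * (u $ 1 * w $ 2 - u $ 2 * w $ 1) / D" by (simp add: algebra_simps diff_divide_distrib add_divide_distrib)
 also have "... = B" using D by (simp add: D_def cross_def)
 finally have dw: "d \<bullet> w = B" .
 have "ALL z:verts K. (val p - d \<bullet> p) + d \<bullet> z = val z"
  unfolding pqr(1) using du dw by (auto simp: u_def w_def A_def B_def inner_diff_right)
 then show ?thesis by blast
qed

lemma partial_cong_open:
 assumes "open S" "x : S" "!!y. y : S ==> f y = g y" "smooth f" "smooth g"
 shows "partial i f x = partial i g x"
proof -
 have "partial i (%y. f y - g y) x = 0" by (rule partial_zero_open[OF assms(1,2)]) (simp add: assms(3))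
 then show ?thesis by (simp add: partial_diff[OF assms(4,5)])
qed

context mesh
begin

text \<open>Conformity makes the piecewise definition consistent: a point of two triangles lies in
  the hull of their common vertices, where both affine functions take the prescribed values. This
  justifies the description operator in \<open>nodal_function\<close>.\<close>

lemma nodal_ex1:
 "EX! u. (ALL K:T. affine_fun_on K u) & (ALL z:mesh_vertices T. u z = c z) & (ALL x. x ~: \<Union>T --> u x = 0)"
proof (rule ex_ex1I)
 have "ALL K:T. EX cd. ALL z:verts K. fst cd + snd cd \<bullet> z = c z"
  using affine_interpolation[OF simp2, of _ c] by (metis fst_conv snd_conv)
 from bchoice[OF this] obtain P where P: "ALL K:T. ALL z:verts K. fst (P K) + snd (P K) \<bullet> z = c z" ..
 define A where "A K x = fst (P K) + snd (P K) \<bullet> x" for K x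
 define u where "u x = (if x : \<Union>T then A (SOME K. K : T & x : K) x else 0)" for x
 have u: "u x = A K x" if K: "K : T" "x : K" for K x
 proof -
  define K' where "K' = (SOME K. K : T & x : K)"
  have K': "K' : T & x : K'" unfolding K'_def by (rule someI[of _ K]) (use K in simp)
  have "x : convex hull (verts K \<inter> verts K')" using inter_hull[OF K(1), of K'] K K' by blast
  moreover have "ALL z:verts K \<inter> verts K'. fst (P K') + snd (P K') \<bullet> z = fst (P K) + snd (P K) \<bullet> z"
   using P K(1) K' by simp
  ultimately have "A K' x = A K x" unfolding A_def using affine_eq_hull by blast
  then show ?thesis using K by (auto simp: u_def K'_def)
 qed
 show "EX u. (ALL K:T. affine_fun_on K u) & (ALL z:mesh_vertices T. u z = c z) & (ALL x. x ~: \<Union>T --> u x = 0)"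
 proof (intro exI conjI ballI allI impI)
  show "affine_fun_on K u" if "K : T" for K
   unfolding affine_fun_on_def using u[OF that] by (auto simp: A_def)
  show "u z = c z" if z: "z : mesh_vertices T" for z
  proof -
   obtain K where K: "K : T" "z : verts K" using z by (auto simp: mesh_vertices_eq)
   then show ?thesis using u[OF K(1), of z] verts_sub[OF K(1)] P by (auto simp: A_def)
  qed
  show "u x = 0" if "x ~: \<Union>T" for x using that by (simp add: u_def)
 qed
 fix u u'
 assume u: "(ALL K:T. affine_fun_on K u) & (ALL z:mesh_vertices T. u z = c z) & (ALL x. x ~: \<Union>T --> u x = 0)"
  and u': "(ALL K:T. affine_fun_on K u') & (ALL z:mesh_vertices T. u' z = c z) & (ALL x. x ~: \<Union>T --> u' x = 0)"
 show "u = u'"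
 proof
  fix x
  show "u x = u' x"
  proof (cases "x : \<Union>T")
   case True
   then obtain K where K: "K : T" "x : K" by blast
   obtain a d where ad: "ALL x:K. u x = a + d \<bullet> x" using u K(1) unfolding affine_fun_on_def by blast
   obtain a' d' where ad': "ALL x:K. u' x = a' + d' \<bullet> x" using u' K(1) unfolding affine_fun_on_def by blast
   have "ALL z:verts K. a + d \<bullet> z = a' + d' \<bullet> z"
   proof
    fix z assume z: "z : verts K"
    then have "z : K" "z : mesh_vertices T" using verts_sub[OF K(1)] K(1) by (auto simp: mesh_vertices_eq)
    then show "a + d \<bullet> z = a' + d' \<bullet> z" using ad ad' u u' by metis
   qed
   then have "a + d \<bullet> x = a' + d' \<bullet> x" using affine_eq_hull K vertsT(4)[OF K(1)] by blast
   then show ?thesis using ad ad' K(2) by simp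
  qed (use u u' in auto)
 qed
qed

lemma nodal:
 shows "K : T ==> affine_fun_on K (nodal_function T c)" "z : mesh_vertices T ==> nodal_function T c z = c z"
  "x ~: \<Union>T ==> nodal_function T c x = 0"
 using theI'[OF nodal_ex1[of c]] unfolding nodal_function_def by blast+

lemma nodal_eq:
 assumes "!!K. K : T ==> affine_fun_on K u" "!!z. z : mesh_vertices T ==> u z = c z" "!!x. x ~: \<Union>T ==> u x = 0"
 shows "nodal_function T c = u"
 unfolding nodal_function_def by (rule the1_equality[OF nodal_ex1]) (use assms in blast)

lemma affine_fun_on_add: "affine_fun_on S f ==> affine_fun_on S g ==> affine_fun_on S (%x. f x + g x)"
 unfolding affine_fun_on_def
proof (elim exE)
 fix c d c' d' assume "ALL x:S. f x = c + d \<bullet> x" "ALL x:S. g x = c' + d' \<bullet> x"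
 then have "ALL x:S. f x + g x = (c + c') + (d + d') \<bullet> x" by (simp add: inner_add_left)
 then show "EX c d. ALL x:S. f x + g x = c + d \<bullet> x" by blast
qed

lemma affine_fun_on_cmult: "affine_fun_on S f ==> affine_fun_on S (%x. k * f x)"
 unfolding affine_fun_on_def
proof (elim exE)
 fix c d assume "ALL x:S. f x = c + d \<bullet> x"
 then have "ALL x:S. k * f x = k * c + (k *\<^sub>R d) \<bullet> x" by (simp add: distrib_left)
 then show "EX c d. ALL x:S. k * f x = c + d \<bullet> x" by blast
qed

lemma affine_fun_on_sum: "(!!i. i : I ==> affine_fun_on S (f i)) ==> affine_fun_on S (%x. SUM i:I. f i x)"
proof (induction I rule: infinite_finite_induct)
 case (insert i I)
 then show ?case using affine_fun_on_add[of S "f i" "%x. SUM i:I. f i x"] by simp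
qed (auto simp: affine_fun_on_def intro!: exI[of _ 0])

lemma nodal_diff: "nodal_function T (%z. c z - c' z) = (%x. nodal_function T c x - nodal_function T c' x)"
proof (rule nodal_eq)
 fix K assume "K : T"
 then have "affine_fun_on K (%x. nodal_function T c x + (-1) * nodal_function T c' x)"
  by (intro affine_fun_on_add affine_fun_on_cmult nodal(1))
 then show "affine_fun_on K (%x. nodal_function T c x - nodal_function T c' x)" by simp
qed (simp_all add: nodal(2,3))

lemma nodal_sum:
 "nodal_function T c = (%x. SUM z:mesh_vertices T. c z * nodal_basis T z x)"
proof (rule nodal_eq)
 show "affine_fun_on K (%x. SUM z:mesh_vertices T. c z * nodal_basis T z x)" if "K : T" for K
  unfolding nodal_basis_def by (intro affine_fun_on_sum affine_fun_on_cmult nodal(1) that)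
 show "(SUM y:mesh_vertices T. c y * nodal_basis T y z) = c z" if "z : mesh_vertices T" for z
 proof -
  have "(SUM y:mesh_vertices T. c y * nodal_basis T y z) = (SUM y:mesh_vertices T. if y = z then c y else 0)"
   by (rule sum.cong) (auto simp: nodal_basis_def nodal(2) that)
  then show ?thesis using that finV by simp
 qed
 show "(SUM z:mesh_vertices T. c z * nodal_basis T z x) = 0" if "x ~: \<Union>T" for x
  unfolding nodal_basis_def by (intro sum.neutral) (use nodal(3)[OF that] in simp)
qed

text \<open>The class contains smooth functions and finite element functions and is closed under
  differences, so that one trace bound covers the error of an interpolant. Agreement on closed
  triangles includes continuity across edges.\<close>

definition pws :: "(plane => real) => bool" where
 "pws f \<longleftrightarrow> (ALL K:T. EX psi. smooth psi & (ALL x:K. f x = psi x))"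

lemma pwsI_smooth: "smooth f ==> pws f" unfolding pws_def by blast

lemma pws_affine: assumes "!!K. K : T ==> affine_fun_on K f" shows "pws f"
 unfolding pws_def
proof
 fix K assume "K : T"
 then obtain c d where "ALL x:K. f x = c + d \<bullet> x" using assms unfolding affine_fun_on_def by blast
 then show "EX psi. smooth psi & (ALL x:K. f x = psi x)" using smooth_affine[of c d] by blast
qed

lemma pws_nodal: "pws (nodal_function T c)" by (rule pws_affine[OF nodal(1)])

lemma pws_diff: assumes "pws f" "pws g" shows "pws (%x. f x - g x)"
 unfolding pws_def
proof
 fix K assume K: "K : T"
 obtain psi where psi: "smooth psi" "ALL x:K. f x = psi x" using assms(1) K unfolding pws_def by blast
 obtain psi' where psi': "smooth psi'" "ALL x:K. g x = psi' x" using assms(2) K unfolding pws_def by blast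
 show "EX psi. smooth psi & (ALL x:K. f x - g x = psi x)"
  by (intro exI[of _ "%x. psi x - psi' x"] conjI smooth_diff psi psi') (simp add: psi psi')
qed

lemma pws_continuous: assumes "pws f" shows "continuous_on (closure Om) f"
proof -
 have "continuous_on (UN K:T. K) f"
 proof (rule continuous_on_closed_Union[OF finT factsT(3)])
  fix K assume "K : T"
  then obtain psi where psi: "smooth psi" "ALL x:K. f x = psi x" using assms unfolding pws_def by blast
  show "continuous_on K f" by (rule continuous_on_eq[OF smooth_continuous_on[OF psi(1)]]) (simp add: psi)
 qed
 then show ?thesis using cover by simp
qed

abbreviation "MK K \<equiv> lebesgue_on (interior K)"

lemma nullF: "negligible (UN K:T. frontier K)"
 using finT factsT(2) by (intro negligible_Union) (auto intro: negligible_convex_frontier)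

lemma AE_interior: "AE x in MOm. EX K:T. x : interior K"
proof -
 have "AE x in lebesgue. x ~: (UN K:T. frontier K)"
  by (rule AE_not_in[OF nullF[unfolded negligible_iff_null_sets]])
 then have "AE x in MOm. x ~: (UN K:T. frontier K)" using borel by (subst AE_restrict_space_iff) (auto elim: eventually_mono)
 moreover have "AE x in MOm. x : Om" using AE_space[of MOm] by simp
 ultimately show ?thesis
 proof eventually_elim
  case (elim x)
  then obtain K where K: "K : T" "x : K" using cover closure_subset by blast
  then have "x : interior K" using elim factsT(3)[OF K(1)] by (auto simp: frontier_def)
  then show ?case using K by blast
 qed
qed

lemma setsK: "interior K : sets lebesgue" "Om : sets lebesgue"
 using borel by auto

lemma integrable_restrict:
 fixes g :: "plane => real"
 assumes "K : T" "integrable MOm g" shows "integrable (MK K) g"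
proof -
 have "integrable lebesgue (%x. indicator Om x *\<^sub>R g x)"
  using assms(2) setsK(2) by (subst (asm) integrable_restrict_space) auto
 then have "integrable lebesgue (%x. indicator (interior K) x *\<^sub>R (indicator Om x *\<^sub>R g x))"
  by (rule integrable_mult_indicator[OF setsK(1)])
 moreover have "(%x. indicator (interior K) x *\<^sub>R (indicator Om x *\<^sub>R g x)) = (%x. indicator (interior K) x *\<^sub>R g x)"
 proof
  fix x
  show "indicator (interior K) x *\<^sub>R (indicator Om x *\<^sub>R g x) = indicator (interior K) x *\<^sub>R g x"
   using interior_sub[OF assms(1)] by (cases "x : interior K") auto
 qed
 ultimately have "integrable lebesgue (%x. indicator (interior K) x *\<^sub>R g x)" by simp
 then show ?thesis by (subst integrable_restrict_space) (use setsK in auto)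
qed

lemma measurable_restrict:
 assumes "K : T" "g : borel_measurable MOm" shows "g : borel_measurable (MK K)"
proof -
 have "restrict_space MOm (interior K) = MK K"
  using interior_sub[OF assms(1)] by (subst restrict_restrict_space) (use setsK in \<open>auto simp: Int_absorb1\<close>)
 then show ?thesis using measurable_restrict_space1[OF assms(2), of "interior K"] by simp
qed

lemma AE_restrict:
 assumes "K : T" "AE x in MOm. P x" shows "AE x in MK K. P x"
proof -
 have "AE x in lebesgue. x : Om --> P x" using assms(2) setsK(2) by (subst (asm) AE_restrict_space_iff) auto
 then have "AE x in lebesgue. x : interior K --> P x"
  by eventually_elim (use interior_sub[OF assms(1)] in blast)
 then show ?thesis using setsK(1) by (subst AE_restrict_space_iff) auto
qed

lemma integral_mesh:
 fixes g :: "plane => real"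
 assumes g: "integrable MOm g"
 shows "(LINT x|MOm. g x) = (SUM K:T. LINT x|MK K. g x)"
proof -
 have i: "integrable lebesgue (%x. indicator (interior K) x *\<^sub>R g x)" if "K : T" for K
  using integrable_restrict[OF that g] setsK by (subst (asm) integrable_restrict_space) auto
 have "(LINT x|MOm. g x) = (LINT x|lebesgue. indicator Om x *\<^sub>R g x)"
  using setsK by (intro integral_restrict_space) auto
 also have "... = (LINT x|lebesgue. (SUM K:T. indicator (interior K) x *\<^sub>R g x))"
 proof (rule integral_cong_AE)
  show "(%x. indicator Om x *\<^sub>R g x) : borel_measurable lebesgue"
   using g setsK(2) by (subst (asm) integrable_restrict_space) auto
  show "(%x. SUM K:T. indicator (interior K) x *\<^sub>R g x) : borel_measurable lebesgue"
   using i by (intro borel_measurable_integrable Bochner_Integration.integrable_sum)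
  have "AE x in lebesgue. x : Om --> (EX K:T. x : interior K)"
   using AE_interior setsK(2) by (subst (asm) AE_restrict_space_iff) auto
  then show "AE x in lebesgue. indicator Om x *\<^sub>R g x = (SUM K:T. indicator (interior K) x *\<^sub>R g x)"
  proof eventually_elim
   case (elim x)
   show ?case
   proof (cases "x : Om")
    case True
    then obtain K where K: "K : T" "x : interior K" using elim by blast
    have "(SUM K':T. indicator (interior K') x *\<^sub>R g x) = (SUM K':T. if K' = K then g x else 0)"
     by (rule sum.cong) (use K interior_disj in \<open>auto simp: indicator_def\<close>)
    then show ?thesis using True K finT by simp
   next
    case False
    then have "(SUM K:T. indicator (interior K) x *\<^sub>R g x) = 0"
     by (intro sum.neutral) (use interior_sub in \<open>auto simp: indicator_def\<close>)
    then show ?thesis using False by simp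
   qed
  qed
 qed
 also have "... = (SUM K:T. LINT x|lebesgue. indicator (interior K) x *\<^sub>R g x)"
  using i by (rule Bochner_Integration.integral_sum)
 also have "... = (SUM K:T. LINT x|MK K. g x)"
  using setsK by (intro sum.cong integral_restrict_space[symmetric]) auto
 finally show ?thesis .
qed

lemma sqint_restrict: "K : T ==> sqint MOm g ==> sqint (MK K) g"
 unfolding sqint_def using integrable_restrict measurable_restrict by blast

lemma l2_mesh: "sqint MOm g ==> (l2 MOm g)^2 = (SUM K:T. (l2 (MK K) g)^2)"
 unfolding l2_sq by (intro integral_mesh sqint_integrable)

text \<open>Lets the chosen weak derivatives of finite element functions be computed triangle by
  triangle, with whichever smooth extension is at hand.\<close>

lemma pws_H1:
 assumes "pws f"
 shows "f : H1 Om" and "K : T ==> smooth psi ==> (ALL x:K. f x = psi x) ==> AE x in MK K. weak_partial Om i f x = partial i psi x"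
proof -
 have "ALL K:T. EX psi. smooth psi & (ALL x:K. f x = psi x)" using assms unfolding pws_def .
 from bchoice[OF this] obtain \<Psi> where \<Psi>: "ALL K:T. smooth (\<Psi> K) & (ALL x:K. f x = \<Psi> K x)" ..
 define g where "g i x = (SUM K:T. indicator (interior K) x * partial i (\<Psi> K) x)" for i x
 have gK: "g i x = partial i (\<Psi> K) x" if K: "K : T" "x : interior K" for i K x
 proof -
  have "g i x = (SUM K':T. if K' = K then partial i (\<Psi> K) x else 0)"
   unfolding g_def by (rule sum.cong) (use K interior_disj in \<open>auto simp: indicator_def\<close>)
  then show ?thesis using K finT by simp
 qed
 have sf: "sqint MOm f"
 proof -
  have "compact (f ` closure Om)"
   by (rule compact_continuous_image[OF pws_continuous[OF assms]]) (use bounded in simp)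
  then obtain B where B: "!!y. y : f ` closure Om ==> norm y <= B" using compact_imp_bounded bounded_iff by metis
  have m: "f : borel_measurable MOm"
   using continuous_on_subset[OF pws_continuous[OF assms] closure_subset] setsK(2)
   by (rule continuous_imp_measurable_on_sets_lebesgue)
  show ?thesis
  proof (rule sqint_bound[OF sqint_const[OF finite_measure_lebesgue_on[OF bounded opn], of B] m])
   have "\<bar>f x\<bar> <= \<bar>B\<bar>" if "x : Om" for x using B[of "f x"] closure_subset that by fastforce
   then show "AE x in MOm. \<bar>f x\<bar> <= \<bar>B\<bar>" by (intro AE_I2) simp
  qed
 qed
 have sg: "sqint MOm (g i)" for i
  unfolding g_def
 proof (intro sqint_sum)
  fix K assume K: "K : T"
  have s: "sqint MOm (partial i (\<Psi> K))" using \<Psi> K by (intro smooth_sq smooth_partial) simp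
  have "indicator (interior K) : borel_measurable MOm"
   by (intro measurable_restrict_space1 borel_measurable_indicator setsK)
  from borel_measurable_times[OF this sqint_measurable[OF s]]
  show "sqint MOm (%x. indicator (interior K) x * partial i (\<Psi> K) x)"
   by (rule sqint_bound[OF s]) (auto intro!: AE_I2 simp: indicator_def)
 qed
 define Sg where "Sg = mesh_vertices T \<times> mesh_vertices T"
 have hw: "has_weak_partial Om i f (g i)" for i
 proof (rule has_weak_partial_piecewise[OF finT factsT(3) cover interior_disj, where Sg=Sg and psi=\<Psi>])
  show "finite Sg" using finV by (simp add: Sg_def)
  show "(UN K:T. frontier K) <= (UN (p, q):Sg. closed_segment p q)"
  proof
   fix x assume "x : (UN K:T. frontier K)"
   then obtain K where K: "K : T" "x : frontier K" by blast
   obtain z y where "z : verts K" "y : verts K" "x : closed_segment z y"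
    using simplex_frontier[OF simp2[OF K(1)] K(2)] by blast
   then show "x : (UN (p, q):Sg. closed_segment p q)" using K by (auto simp: Sg_def mesh_vertices_eq)
  qed
 qed (use \<Psi> gK nullF sf sg in auto)
 show "f : H1 Om" by (rule H1_intro(1)[OF sf sg hw])
 assume K: "K : T" "smooth psi" "ALL x:K. f x = psi x"
 have "AE x in MK K. weak_partial Om i f x = g i x" by (rule AE_restrict[OF K(1) H1_intro(2)[OF sf sg hw]])
 moreover have "AE x in MK K. x : interior K" using AE_space[of "MK K"] by simp
 ultimately show "AE x in MK K. weak_partial Om i f x = partial i psi x"
 proof eventually_elim
  case (elim x)
  have "partial i (\<Psi> K) x = partial i psi x"
   by (rule partial_cong_open[OF open_interior elim(2)]) (use K \<Psi> interior_subset[of K] in auto)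
  then show ?case using elim gK[OF K(1)] by simp
 qed
qed

end

section \<open>Traces\<close>

abbreviation "II \<equiv> lebesgue_on {0..1::real}"

lemma l2_eq_zeroI: "l2 M f <= 0 ==> l2 M f = 0"
 by (rule antisym[OF _ l2_nonneg])

lemma linepath_diff: "linepath p q s - linepath p q t = (s - t) *\<^sub>R (q - p)"
 by (simp add: linepath_def algebra_simps)

lemma linepath_inj: "p ~= q ==> linepath p q s = linepath p q t ==> s = t"
 using linepath_diff[of p q s t] by auto

lemma linepath_in_segment_iff:
 assumes "p ~= q" shows "linepath p q s : closed_segment p q \<longleftrightarrow> s : {0..1}"
proof
 assume "linepath p q s : closed_segment p q"
 then obtain t where "t : {0..1}" "linepath p q s = linepath p q t" by (metis linepath_image_01 imageE)
 then show "s : {0..1}" using linepath_inj[OF assms] by blast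
qed (simp add: linepath_in_path)

lemma linepath_linepath: "linepath (linepath p q alpha) (linepath p q beta) s = linepath p q (alpha + (beta - alpha) * s)"
 by (simp add: linepath_def algebra_simps)

lemma dist_linepath: "dist (linepath p q alpha) (linepath p q beta) = \<bar>beta - alpha\<bar> * dist p q"
 by (simp add: dist_norm linepath_diff norm_minus_commute abs_minus_commute)

text \<open>Arc length is independent of the parametrisation: a segment on the line through p and q,
  run through in either direction, is integrated in the parameter of p q.\<close>

lemma seg_transfer:
 fixes p q :: plane and F :: "plane => ennreal"
 assumes pq: "p ~= q" and ab: "z = linepath p q alpha" "y = linepath p q beta" "alpha ~= beta"
  and F: "F : borel_measurable borel"
 shows "ennreal (dist z y) * (\<integral>\<^sup>+s. F (linepath z y s) * indicator {0..1} s \<partial>lborel) =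
  ennreal (dist p q) * (\<integral>\<^sup>+t. F (linepath p q t) * indicator (closed_segment z y) (linepath p q t) \<partial>lborel)"
proof -
 have zy: "z ~= y" using linepath_inj[OF pq] ab by metis
 have cl: "continuous_on UNIV (linepath p q)" by (rule continuous_on_linepath)
 have [measurable]: "linepath p q : borel_measurable borel" by (rule borel_measurable_continuous_onI[OF cl])
 have [measurable]: "F : borel_measurable borel" "closed_segment z y : sets borel" using F by auto
 have "(\<integral>\<^sup>+t. F (linepath p q t) * indicator (closed_segment z y) (linepath p q t) \<partial>lborel) =
  ennreal \<bar>beta - alpha\<bar> * (\<integral>\<^sup>+s. F (linepath p q (alpha + (beta - alpha) * s)) * indicator (closed_segment z y) (linepath p q (alpha + (beta - alpha) * s)) \<partial>lborel)"
  by (rule nn_integral_real_affine) (use ab(3) in simp_all)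
 also have "(\<integral>\<^sup>+s. F (linepath p q (alpha + (beta - alpha) * s)) * indicator (closed_segment z y) (linepath p q (alpha + (beta - alpha) * s)) \<partial>lborel) =
  (\<integral>\<^sup>+s. F (linepath z y s) * indicator {0..1} s \<partial>lborel)"
  unfolding ab(1,2) linepath_linepath[symmetric]
  using linepath_in_segment_iff[OF zy, unfolded ab(1,2)] by (intro nn_integral_cong) (simp add: indicator_def)
 finally have "ennreal (dist p q) * (\<integral>\<^sup>+t. F (linepath p q t) * indicator (closed_segment z y) (linepath p q t) \<partial>lborel) =
  (ennreal (dist p q) * ennreal \<bar>beta - alpha\<bar>) * (\<integral>\<^sup>+s. F (linepath z y s) * indicator {0..1} s \<partial>lborel)"
  by (simp add: mult.assoc)
 moreover have "ennreal (dist p q) * ennreal \<bar>beta - alpha\<bar> = ennreal (dist z y)"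
  unfolding ab dist_linepath by (subst ennreal_mult[symmetric]) (auto simp: mult.commute)
 ultimately show ?thesis by simp
qed

text \<open>Two common points already determine the line; \<open>k\<close> is the ratio of the
  speeds of the two parametrisations.\<close>

lemma collinear_params:
 fixes p q z y :: plane
 assumes "~ finite {t. linepath p q t : closed_segment z y}" "p ~= q"
 obtains alpha beta where "z = linepath p q alpha" "y = linepath p q beta" "alpha ~= beta"
proof -
 let ?A = "{t. linepath p q t : closed_segment z y}"
 obtain t1 where t1: "t1 : ?A" using assms(1) by (metis ex_in_conv finite.emptyI)
 have "~ finite (?A - {t1})" using assms(1) by simp
 then obtain t2 where t2: "t2 : ?A" "t2 ~= t1" by (metis DiffE ex_in_conv finite.emptyI singletonI)
 obtain s1 where s1: "linepath p q t1 = linepath z y s1" using t1 by (auto simp: in_segment linepath_def)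
 obtain s2 where s2: "linepath p q t2 = linepath z y s2" using t2 by (auto simp: in_segment linepath_def)
 have e: "(t2 - t1) *\<^sub>R (q - p) = (s2 - s1) *\<^sub>R (y - z)"
  using linepath_diff[of p q t2 t1] linepath_diff[of z y s2 s1] s1 s2 by simp
 have "s2 ~= s1" using e t2(2) assms(2) by auto
 define k where "k = (t2 - t1) / (s2 - s1)"
 have k: "k *\<^sub>R (q - p) = y - z"
 proof -
  have "k *\<^sub>R (q - p) = (1 / (s2 - s1)) *\<^sub>R ((t2 - t1) *\<^sub>R (q - p))" by (simp add: k_def)
  also have "... = y - z" unfolding e using \<open>s2 ~= s1\<close> by simp
  finally show ?thesis .
 qed
 have k0: "k ~= 0" using t2(2) \<open>s2 ~= s1\<close> by (simp add: k_def)
 have gen: "linepath z y s = linepath p q (t1 + (s - s1) * k)" for s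
 proof -
  have "linepath p q (t1 + (s - s1) * k) = linepath p q t1 + ((s - s1) * k) *\<^sub>R (q - p)"
   by (simp add: linepath_def algebra_simps)
  also have "((s - s1) * k) *\<^sub>R (q - p) = (s - s1) *\<^sub>R (y - z)" using k by (simp flip: scaleR_scaleR)
  also have "linepath p q t1 + (s - s1) *\<^sub>R (y - z) = linepath z y s" unfolding s1 by (simp add: linepath_def algebra_simps)
  finally show ?thesis by simp
 qed
 show ?thesis
 proof (rule that)
  show "z = linepath p q (t1 + (0 - s1) * k)" using gen[of 0] by (simp add: linepath_def)
  show "y = linepath p q (t1 + (1 - s1) * k)" using gen[of 1] by (simp add: linepath_def)
  show "t1 + (0 - s1) * k ~= t1 + (1 - s1) * k" using k0 by (simp add: algebra_simps)
 qed
qed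

text \<open>Needed because \<open>H1_D\<close> refers to arbitrary boundary segments and not to mesh
  edges. Segments of the cover that meet the line in finitely many points are negligible; the others
  are collinear with it, and their integrals are transferred.\<close>

lemma seg_cover:
 fixes p q :: plane and F :: "plane => ennreal"
 assumes pq: "p ~= q" and Sg: "finite Sg" and N: "finite N"
  and cov: "!!t. t : {0..1} ==> t ~: N ==> EX zy:Sg. linepath p q t : closed_segment (fst zy) (snd zy)"
  and F: "F : borel_measurable borel"
 shows "ennreal (dist p q) * (\<integral>\<^sup>+t. F (linepath p q t) * indicator {0..1} t \<partial>lborel) <=
  (SUM zy:Sg. ennreal (dist (fst zy) (snd zy)) * (\<integral>\<^sup>+s. F (linepath (fst zy) (snd zy) s) * indicator {0..1} s \<partial>lborel))"
proof -
 have cl: "continuous_on UNIV (linepath p q)" by (rule continuous_on_linepath)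
 have [measurable]: "linepath p q : borel_measurable borel" by (rule borel_measurable_continuous_onI[OF cl])
 have [measurable]: "F : borel_measurable borel" by (rule F)
 have [measurable]: "closed_segment (fst zy) (snd zy) : sets borel" for zy :: "plane \<times> plane" by auto
 define A where "A zy = {t. linepath p q t : closed_segment (fst zy) (snd zy)}" for zy
 define G where "G = {zy : Sg. ~ finite (A zy)}"
 \<comment> \<open>The exceptional parameters: those exempted by \<open>N\<close> and the crossings
   with transversal segments.\<close>
 define B where "B = N \<union> (UN zy:Sg - G. A zy)"
 have fG: "finite G" using Sg by (simp add: G_def)
 have "finite B" unfolding B_def using N Sg by (auto simp: G_def)
 then have "AE t in lborel. t ~: B" by (intro AE_not_in) (simp add: finite_imp_null_set_lborel)
 then have "AE t in lborel. F (linepath p q t) * indicator {0..1} t <=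
   (SUM zy:G. F (linepath p q t) * indicator (closed_segment (fst zy) (snd zy)) (linepath p q t))"
 proof eventually_elim
  case (elim t)
  show ?case
  proof (cases "t : {0..1}")
   case True
   then obtain zy where zy: "zy : Sg" "linepath p q t : closed_segment (fst zy) (snd zy)"
    using cov[of t] elim unfolding B_def by blast
   then have "zy : G" using elim by (auto simp: B_def A_def)
   then have "F (linepath p q t) * indicator (closed_segment (fst zy) (snd zy)) (linepath p q t) <=
    (SUM zy:G. F (linepath p q t) * indicator (closed_segment (fst zy) (snd zy)) (linepath p q t))"
    by (intro member_le_sum fG) auto
   then show ?thesis using zy True by simp
  qed simp
 qed
 then have "(\<integral>\<^sup>+t. F (linepath p q t) * indicator {0..1} t \<partial>lborel) <=
  (\<integral>\<^sup>+t. (SUM zy:G. F (linepath p q t) * indicator (closed_segment (fst zy) (snd zy)) (linepath p q t)) \<partial>lborel)"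
  by (rule nn_integral_mono_AE)
 also have "... = (SUM zy:G. \<integral>\<^sup>+t. F (linepath p q t) * indicator (closed_segment (fst zy) (snd zy)) (linepath p q t) \<partial>lborel)"
  by (rule nn_integral_sum) measurable
 finally have "ennreal (dist p q) * (\<integral>\<^sup>+t. F (linepath p q t) * indicator {0..1} t \<partial>lborel) <=
  ennreal (dist p q) * (SUM zy:G. \<integral>\<^sup>+t. F (linepath p q t) * indicator (closed_segment (fst zy) (snd zy)) (linepath p q t) \<partial>lborel)"
  by (rule mult_left_mono) simp
 also have "... = (SUM zy:G. ennreal (dist (fst zy) (snd zy)) * (\<integral>\<^sup>+s. F (linepath (fst zy) (snd zy) s) * indicator {0..1} s \<partial>lborel))"
  unfolding sum_distrib_left
 proof (rule sum.cong)
  fix zy assume "zy : G"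
  then have "~ finite {t. linepath p q t : closed_segment (fst zy) (snd zy)}" by (simp add: G_def A_def)
  then obtain alpha beta where "fst zy = linepath p q alpha" "snd zy = linepath p q beta" "alpha ~= beta"
   using collinear_params[OF _ pq] by metis
  from seg_transfer[OF pq this F]
  show "ennreal (dist p q) * (\<integral>\<^sup>+t. F (linepath p q t) * indicator (closed_segment (fst zy) (snd zy)) (linepath p q t) \<partial>lborel) =
   ennreal (dist (fst zy) (snd zy)) * (\<integral>\<^sup>+s. F (linepath (fst zy) (snd zy) s) * indicator {0..1} s \<partial>lborel)" by simp
 qed simp
 also have "... <= (SUM zy:Sg. ennreal (dist (fst zy) (snd zy)) * (\<integral>\<^sup>+s. F (linepath (fst zy) (snd zy) s) * indicator {0..1} s \<partial>lborel))"
  by (rule sum_mono2) (use Sg in \<open>auto simp: G_def\<close>)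
 finally show ?thesis .
qed

context mesh
begin

lemma AE_mesh:
 assumes "!!K. K : T ==> AE x in MK K. P x" shows "AE x in MOm. P x"
proof -
 have "AE x in lebesgue. x : interior K --> P x" if "K : T" for K
  using assms[OF that] setsK(1) by (subst (asm) AE_restrict_space_iff) auto
 then have "AE x in lebesgue. ALL K:T. x : interior K --> P x" using finT by (subst AE_finite_all) auto
 moreover have "AE x in lebesgue. x : Om --> (EX K:T. x : interior K)"
  using AE_interior setsK(2) by (subst (asm) AE_restrict_space_iff) auto
 ultimately have "AE x in lebesgue. x : Om --> P x" by eventually_elim blast
 then show ?thesis using setsK(2) by (subst AE_restrict_space_iff) auto
qed

lemma smooth_H1:
 assumes "smooth phi" shows "phi : H1 Om" "AE x in MOm. weak_partial Om i phi x = partial i phi x"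
proof -
 show "phi : H1 Om" by (rule pws_H1(1)[OF pwsI_smooth[OF assms]])
 show "AE x in MOm. weak_partial Om i phi x = partial i phi x"
  by (rule AE_mesh, rule pws_H1(2)[OF pwsI_smooth[OF assms]]) (use assms in auto)
qed

definition NN :: "(plane => real) => real" where
 "NN v = l2 MOm v + (SUM i:UNIV. l2 MOm (weak_partial Om i v))"

lemma NN_nonneg: "NN v >= 0" by (simp add: NN_def l2_nonneg sum_nonneg)

lemma l2_lin:
 assumes "v : H1 Om" "w : H1 Om"
 shows "(%x. alpha * v x + beta * w x) : H1 Om" "l2 MOm (%x. alpha * v x + beta * w x) <= \<bar>alpha\<bar> * l2 MOm v + \<bar>beta\<bar> * l2 MOm w"
  and "AE x in MOm. weak_partial Om i (%x. alpha * v x + beta * w x) x = alpha * weak_partial Om i v x + beta * weak_partial Om i w x"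
  and "l2 MOm (weak_partial Om i (%x. alpha * v x + beta * w x)) <= \<bar>alpha\<bar> * l2 MOm (weak_partial Om i v) + \<bar>beta\<bar> * l2 MOm (weak_partial Om i w)"
proof -
 note c = H1_cmult[OF assms(1), where c=alpha] H1_cmult[OF assms(2), where c=beta]
 note a = H1_add[OF c(1) c(3)]
 show "(%x. alpha * v x + beta * w x) : H1 Om" by (rule a(1))
 show "l2 MOm (%x. alpha * v x + beta * w x) <= \<bar>alpha\<bar> * l2 MOm v + \<bar>beta\<bar> * l2 MOm w"
  using l2_triangle[OF sqint_cmult[OF H1D(1)[OF assms(1)]] sqint_cmult[OF H1D(1)[OF assms(2)]]] by (simp add: l2_cmult)
 show ae: "AE x in MOm. weak_partial Om i (%x. alpha * v x + beta * w x) x = alpha * weak_partial Om i v x + beta * weak_partial Om i w x"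
  using a(2)[of i] c(2)[of i] c(4)[of i] by eventually_elim simp
 have "l2 MOm (weak_partial Om i (%x. alpha * v x + beta * w x)) = l2 MOm (%x. alpha * weak_partial Om i v x + beta * weak_partial Om i w x)"
  by (rule l2_cong_AE[OF _ _ ae]) (intro sqint_measurable H1D(2) a(1) sqint_add sqint_cmult assms)+
 also have "... <= \<bar>alpha\<bar> * l2 MOm (weak_partial Om i v) + \<bar>beta\<bar> * l2 MOm (weak_partial Om i w)"
  using l2_triangle[OF sqint_cmult[OF H1D(2)[OF assms(1)]] sqint_cmult[OF H1D(2)[OF assms(2)]]] by (simp add: l2_cmult)
 finally show "l2 MOm (weak_partial Om i (%x. alpha * v x + beta * w x)) <= \<bar>alpha\<bar> * l2 MOm (weak_partial Om i v) + \<bar>beta\<bar> * l2 MOm (weak_partial Om i w)" .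
qed

text \<open>The case k = 1 is \<open>NN\<close>; k = h gives the scaled norm in which all errors are
  measured. Adding norms instead of squares makes the triangle inequality immediate.\<close>

definition NW :: "real => (plane => real) => real" where
 "NW k v = l2 MOm v + k * (SUM i:UNIV. l2 MOm (weak_partial Om i v))"

lemma NW_lin:
 assumes "k >= 0" "v : H1 Om" "w : H1 Om"
 shows "NW k (%x. alpha * v x + beta * w x) <= \<bar>alpha\<bar> * NW k v + \<bar>beta\<bar> * NW k w"
proof -
 have "NW k (%x. alpha * v x + beta * w x) <= (\<bar>alpha\<bar> * l2 MOm v + \<bar>beta\<bar> * l2 MOm w) +
  k * (SUM i:UNIV. \<bar>alpha\<bar> * l2 MOm (weak_partial Om i v) + \<bar>beta\<bar> * l2 MOm (weak_partial Om i w))"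
  unfolding NW_def by (intro add_mono mult_left_mono sum_mono l2_lin assms)
 also have "... = \<bar>alpha\<bar> * NW k v + \<bar>beta\<bar> * NW k w"
  by (simp add: NW_def sum.distrib sum_distrib_left[symmetric] algebra_simps)
 finally show ?thesis .
qed

lemma NN_lin:
 assumes "v : H1 Om" "w : H1 Om"
 shows "(%x. alpha * v x + beta * w x) : H1 Om" "NN (%x. alpha * v x + beta * w x) <= \<bar>alpha\<bar> * NN v + \<bar>beta\<bar> * NN w"
 using l2_lin(1)[OF assms] NW_lin[OF zero_le_one assms] by (simp_all add: NN_def NW_def)

lemma NN_minus_commute: "v : H1 Om ==> w : H1 Om ==> NN (%x. v x - w x) <= NN (%x. w x - v x)"
 using NN_lin(2)[of "%x. w x - v x" "%x. w x - v x" "-1" 0] H1_diff(1)[of w v] by simp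

lemma NN_triangle3:
 "u : H1 Om ==> v : H1 Om ==> w : H1 Om ==> NN (%x. u x - w x) <= NN (%x. u x - v x) + NN (%x. v x - w x)"
 using NN_lin(2)[OF H1_diff(1) H1_diff(1), of u v v w 1 1] by simp

lemma H1_norm_NN:
 assumes "v : H1 Om" shows "H1_norm Om v <= NN v" "NN v <= 3 * H1_norm Om v"
proof -
 have nn: "H1_norm Om v >= 0" by (simp add: H1_norm_def)
 have "(H1_norm Om v)^2 <= (NN v)^2"
  unfolding H1_norm_sq[OF assms] NN_def UNIV_2_eq
  using mult_nonneg_nonneg[OF l2_nonneg[of MOm v] l2_nonneg[of MOm "weak_partial Om 1 v"]]
   mult_nonneg_nonneg[OF l2_nonneg[of MOm v] l2_nonneg[of MOm "weak_partial Om 2 v"]]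
   mult_nonneg_nonneg[OF l2_nonneg[of MOm "weak_partial Om 1 v"] l2_nonneg[of MOm "weak_partial Om 2 v"]]
  by (simp add: power2_eq_square algebra_simps)
 then show "H1_norm Om v <= NN v" using NN_nonneg by (rule power2_le_imp_le)
 have 0: "l2 MOm v <= H1_norm Om v"
  by (rule power2_le_imp_le[OF _ nn]) (simp add: H1_norm_sq[OF assms] sum_nonneg)
 have 1: "l2 MOm (weak_partial Om i v) <= H1_norm Om v" for i
 proof (rule power2_le_imp_le[OF _ nn])
  have "(l2 MOm (weak_partial Om i v))^2 <= (SUM i:UNIV. (l2 MOm (weak_partial Om i v))^2)"
   by (rule member_le_sum) auto
  then show "(l2 MOm (weak_partial Om i v))^2 <= (H1_norm Om v)^2" unfolding H1_norm_sq[OF assms] by (simp add: add_increasing)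
 qed
 show "NN v <= 3 * H1_norm Om v" using 0 1[of 1] 1[of 2] unfolding NN_def UNIV_2_eq by simp
qed

lemma dense:
 assumes "v : H1 Om" "e > 0" obtains phi where "smooth phi" "NN (%x. phi x - v x) <= e"
proof -
 have "EX Phi. smooth Phi & l2 MOm (%x. Phi x - v x) <= e/3 & (ALL i. l2 MOm (%x. partial i Phi x - weak_partial Om i v x) <= e/3)"
  by (rule smooth_dense[OF H1D(1)[OF assms(1)] H1D(2)[OF assms(1)] H1D(3)[OF assms(1)]]) (use assms(2) in simp)
 then obtain phi where phi: "smooth phi" "l2 MOm (%x. phi x - v x) <= e/3" "!!i. l2 MOm (%x. partial i phi x - weak_partial Om i v x) <= e/3"
  by blast
 have "l2 MOm (weak_partial Om i (%x. phi x - v x)) <= e/3" for i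
 proof -
  have "l2 MOm (weak_partial Om i (%x. phi x - v x)) = l2 MOm (%x. partial i phi x - weak_partial Om i v x)"
  proof (rule l2_cong_AE)
   show "AE x in MOm. weak_partial Om i (%x. phi x - v x) x = partial i phi x - weak_partial Om i v x"
    using H1_diff(2)[OF smooth_H1(1)[OF phi(1)] assms(1), of i] smooth_H1(2)[OF phi(1), of i] by eventually_elim simp
  qed (intro sqint_measurable H1D(2) H1_diff(1) smooth_H1(1) phi(1) assms(1) sqint_diff smooth_sq smooth_partial)+
  then show ?thesis using phi(3)[of i] by simp
 qed
 then have "NN (%x. phi x - v x) <= e/3 + (SUM i:(UNIV::2 set). e/3)" unfolding NN_def by (intro add_mono phi(2) sum_mono)
 then show ?thesis using that[OF phi(1)] by simp
qed

text \<open>What a segment must satisfy for \<open>trace_on\<close> to be meaningful. The constant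
  may depend on the mesh, since it multiplies approximation errors that tend to 0.\<close>

definition tr_ok :: "plane => plane => real => bool" where
 "tr_ok p q C \<longleftrightarrow> p ~= q & closed_segment p q <= closure Om & C >= 0 &
  (ALL f. pws f --> l2 II (%t. f (linepath p q t)) <= C * NN f)"

lemma pws_line:
 assumes "pws f" "closed_segment p q <= closure Om"
 shows "sqint II (%t. f (linepath p q t))"
proof (rule sqint_continuous_interval)
 show "continuous_on {0..1} (%t. f (linepath p q t))"
  by (rule continuous_on_compose2[OF pws_continuous[OF assms(1)] continuous_on_linepath])
   (use assms(2) linepath_image_01[of p q] in blast)
qed

lemma seg_integral_eq: "seg_integral p q f = dist p q * (LINT t|II. f (linepath p q t))"
 unfolding seg_integral_def set_lebesgue_integral_def by (subst integral_restrict_space) auto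

lemma seg_L2_iff: "g : seg_L2 p q \<longleftrightarrow> sqint II (%t. g (linepath p q t))"
 by (simp add: seg_L2_def sqint_def)

text \<open>Every trace, whichever sequence produced it, is this close to any piecewise smooth f;
  letting f approximate v pins the trace down.\<close>

lemma has_trace_close:
 assumes ok: "tr_ok p q C" and v: "v : H1 Om" and g: "has_trace Om p q v g" and f: "pws f"
 shows "l2 II (%t. g (linepath p q t) - f (linepath p q t)) <= C * NN (%x. v x - f x)"
proof -
 obtain phi where phi: "!!k. smooth (phi k)" "(%k. H1_norm Om (%x. phi k x - v x)) \<longlonglongrightarrow> 0"
  "(%k. seg_integral p q (%x. (phi k x - g x)^2)) \<longlonglongrightarrow> 0"
  using g unfolding has_trace_def by blast
 have sg: "sqint II (%t. g (linepath p q t))" using g by (simp add: has_trace_def seg_L2_iff)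
 have ok': "p ~= q" "closed_segment p q <= closure Om" "C >= 0" "!!f. pws f ==> l2 II (%t. f (linepath p q t)) <= C * NN f"
  using ok by (auto simp: tr_ok_def)
 have fH: "f : H1 Om" by (rule pws_H1(1)[OF f])
 have phiH: "phi k : H1 Om" for k by (rule smooth_H1(1)[OF phi(1)])
 have "(%k. sqrt (seg_integral p q (%x. (phi k x - g x)^2) / dist p q)) \<longlonglongrightarrow> sqrt (0 / dist p q)"
  using ok'(1) by (intro tendsto_intros phi(3)) auto
 moreover have "sqrt (seg_integral p q (%x. (phi k x - g x)^2) / dist p q) = l2 II (%t. phi k (linepath p q t) - g (linepath p q t))" for k
  using ok'(1) by (simp add: seg_integral_eq l2_def)
 ultimately have L1: "(%k. l2 II (%t. phi k (linepath p q t) - g (linepath p q t))) \<longlonglongrightarrow> 0" by simp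
 have L2: "(%k. C * (3 * H1_norm Om (%x. phi k x - v x) + NN (%x. v x - f x))) \<longlonglongrightarrow> C * (3 * 0 + NN (%x. v x - f x))"
  by (intro tendsto_intros phi(2))
 have le: "l2 II (%t. g (linepath p q t) - f (linepath p q t)) <=
  l2 II (%t. phi k (linepath p q t) - g (linepath p q t)) + C * (3 * H1_norm Om (%x. phi k x - v x) + NN (%x. v x - f x))" for k
 proof -
  have "l2 II (%t. g (linepath p q t) - f (linepath p q t)) <=
   l2 II (%t. g (linepath p q t) - phi k (linepath p q t)) + l2 II (%t. phi k (linepath p q t) - f (linepath p q t))"
   by (intro l2_triangle3 sg pws_line ok'(2) f pwsI_smooth phi(1))
  moreover have "l2 II (%t. phi k (linepath p q t) - f (linepath p q t)) <= C * NN (%x. phi k x - f x)"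
   using ok'(4)[OF pws_diff[OF pwsI_smooth[OF phi(1)[of k]] f]] .
  moreover have "C * NN (%x. phi k x - f x) <= C * (3 * H1_norm Om (%x. phi k x - v x) + NN (%x. v x - f x))"
   using NN_triangle3[OF phiH[of k] v fH] H1_norm_NN(2)[OF H1_diff(1)[OF phiH[of k] v]]
   by (intro mult_left_mono[OF _ ok'(3)]) simp
  ultimately show ?thesis using l2_minus_commute[of II "%t. g (linepath p q t)" "%t. phi k (linepath p q t)"] by linarith
 qed
 have "(%k. l2 II (%t. phi k (linepath p q t) - g (linepath p q t)) + C * (3 * H1_norm Om (%x. phi k x - v x) + NN (%x. v x - f x)))
  \<longlonglongrightarrow> 0 + C * (3 * 0 + NN (%x. v x - f x))" by (intro tendsto_add L1 L2)
 then have "l2 II (%t. g (linepath p q t) - f (linepath p q t)) <= 0 + C * (3 * 0 + NN (%x. v x - f x))"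
  by (rule LIMSEQ_le_const) (use le in blast)
 then show ?thesis by simp
qed

text \<open>By \<open>tr_ok\<close> the restrictions of an approximating sequence are Cauchy on the
  segment, so completeness yields a limit.\<close>

lemma ex_trace:
 assumes ok: "tr_ok p q C" and v: "v : H1 Om" shows "EX g. has_trace Om p q v g"
proof -
 have ok': "p ~= q" "closed_segment p q <= closure Om" "C >= 0" "!!f. pws f ==> l2 II (%t. f (linepath p q t)) <= C * NN f"
  using ok by (auto simp: tr_ok_def)
 have "ALL k. EX phi. smooth phi & NN (%x. phi x - v x) <= 1 / real (Suc k)"
 proof
  fix k show "EX phi. smooth phi & NN (%x. phi x - v x) <= 1 / real (Suc k)"
   by (rule dense[OF v, of "1 / real (Suc k)"]) auto
 qed
 from choice[OF this] obtain phi where phi: "ALL k. smooth (phi k) & NN (%x. phi k x - v x) <= 1 / real (Suc k)" ..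
 have sm: "smooth (phi k)" and cl: "NN (%x. phi k x - v x) <= 1 / real (Suc k)" for k using phi by auto
 have phiH: "phi k : H1 Om" for k by (rule smooth_H1(1)[OF sm])
 have lim: "(%k. NN (%x. phi k x - v x)) \<longlonglongrightarrow> 0"
  by (rule tendsto_sandwich[OF _ _ tendsto_const LIMSEQ_inverse_real_of_nat])
   (use cl NN_nonneg in \<open>auto simp: inverse_eq_divide\<close>)
 have sq: "sqint II (%t. phi k (linepath p q t))" for k by (intro pws_line ok'(2) pwsI_smooth sm)
 have "EX G. sqint II G & (%k. l2 II (%t. phi k (linepath p q t) - G t)) \<longlonglongrightarrow> 0"
 proof (rule l2_Cauchy_convergent[OF sq])
  fix e :: real assume "e > 0"
  define e' where "e' = e / 2 / (C + 1)"
  have e': "e' > 0" using \<open>e > 0\<close> ok'(3) by (simp add: e'_def)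
  have Ce: "C * (2 * e') < e"
  proof -
   have "C * (2 * e') < (C + 1) * (2 * e')" using e' by (intro mult_strict_right_mono) auto
   also have "... = 2 * (e' * (C + 1))" by simp
   also have "e' * (C + 1) = e / 2" unfolding e'_def by (rule divide_mult_cancel_real) (use ok'(3) in simp)
   finally show ?thesis by simp
  qed
  obtain M where M: "!!k. k >= M ==> NN (%x. phi k x - v x) < e'"
   using order_tendstoD(2)[OF lim e'] by (auto simp: eventually_sequentially)
  have "l2 II (%t. phi m (linepath p q t) - phi n (linepath p q t)) < e" if "m >= M" "n >= M" for m n
  proof -
   have "NN (%x. phi m x - phi n x) <= NN (%x. phi m x - v x) + NN (%x. v x - phi n x)"
    by (rule NN_triangle3[OF phiH v phiH])
   also have "NN (%x. v x - phi n x) <= NN (%x. phi n x - v x)" by (rule NN_minus_commute[OF v phiH])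
   finally have "NN (%x. phi m x - phi n x) <= 2 * e'" using M[OF that(1)] M[OF that(2)] by simp
   then have "C * NN (%x. phi m x - phi n x) <= C * (2 * e')" using ok'(3) by (rule mult_left_mono)
   moreover have "l2 II (%t. phi m (linepath p q t) - phi n (linepath p q t)) <= C * NN (%x. phi m x - phi n x)"
    using ok'(4)[OF pwsI_smooth[OF smooth_diff[OF sm[of m] sm[of n]]]] .
   ultimately have "l2 II (%t. phi m (linepath p q t) - phi n (linepath p q t)) <= C * (2 * e')" by linarith
   then show ?thesis using Ce by simp
  qed
  then show "EX N. ALL m>=N. ALL n>=N. l2 II (%x. phi m (linepath p q x) - phi n (linepath p q x)) < e" by blast
 qed
 then obtain G where G: "sqint II G" "(%k. l2 II (%t. phi k (linepath p q t) - G t)) \<longlonglongrightarrow> 0" by blast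
 \<comment> \<open>The limit is a function of the parameter; injectivity of the parametrisation
   turns it into a function of the point.\<close>
 define g where "g x = G (SOME t. linepath p q t = x)" for x
 have gG: "g (linepath p q t) = G t" for t
  unfolding g_def using linepath_inj[OF ok'(1)] by (metis (mono_tags, lifting) someI)
 have "has_trace Om p q v g"
  unfolding has_trace_def
 proof (intro conjI exI allI)
  show "g : seg_L2 p q" using G(1) by (simp add: seg_L2_iff gG)
  show "smooth (phi k)" for k by (rule sm)
  show "(%k. H1_norm Om (%x. phi k x - v x)) \<longlonglongrightarrow> 0"
   by (rule tendsto_sandwich[OF _ _ tendsto_const lim])
    (use H1_norm_NN(1)[OF H1_diff(1)[OF phiH v]] in \<open>auto simp: H1_norm_def\<close>)
  have "(%k. dist p q * (l2 II (%t. phi k (linepath p q t) - G t))^2) \<longlonglongrightarrow> dist p q * 0^2"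
   by (intro tendsto_intros G(2))
  then show "(%k. seg_integral p q (%x. (phi k x - g x)^2)) \<longlonglongrightarrow> 0"
   by (simp add: seg_integral_eq l2_sq gG)
 qed
 then show ?thesis by blast
qed

lemma trace_close:
 assumes ok: "tr_ok p q C" and v: "v : H1 Om"
 shows "sqint II (%t. trace_on Om p q v (linepath p q t))"
  and "pws f ==> l2 II (%t. trace_on Om p q v (linepath p q t) - f (linepath p q t)) <= C * NN (%x. v x - f x)"
proof -
 have tr: "has_trace Om p q v (trace_on Om p q v)"
  unfolding trace_on_def by (rule someI_ex[OF ex_trace[OF assms]])
 show "sqint II (%t. trace_on Om p q v (linepath p q t))" using tr by (simp add: has_trace_def seg_L2_iff)
 show "l2 II (%t. trace_on Om p q v (linepath p q t) - f (linepath p q t)) <= C * NN (%x. v x - f x)" if "pws f"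
  by (rule has_trace_close[OF ok v tr that])
qed

lemma NN_zero: "NN (%x. 0) = 0"
proof -
 have "l2 MOm (weak_partial Om i (%x. 0)) = 0" for i
  using l2_weak_partial_cong[OF sqint_zero sqint_zero has_weak_partial_zero, of i] by simp
 then show ?thesis by (simp add: NN_def)
qed

lemma trace_pws:
 assumes ok: "tr_ok p q C" and f: "pws f"
 shows "AE t in II. trace_on Om p q f (linepath p q t) = f (linepath p q t)"
proof -
 have fH: "f : H1 Om" by (rule pws_H1(1)[OF f])
 have sq: "sqint II (%t. trace_on Om p q f (linepath p q t) - f (linepath p q t))"
  using ok by (intro sqint_diff trace_close(1)[OF ok fH] pws_line f) (simp add: tr_ok_def)
 have "l2 II (%t. trace_on Om p q f (linepath p q t) - f (linepath p q t)) <= 0"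
  using trace_close(2)[OF ok fH f] by (simp add: NN_zero)
 then have "l2 II (%t. trace_on Om p q f (linepath p q t) - f (linepath p q t)) = 0" by (rule l2_eq_zeroI)
 from l2_zero_AE[OF sq this] show ?thesis by simp
qed

text \<open>The chosen traces of v, of w and of the combination come from unrelated sequences. Each
  is compared with smooth functions, and the discrepancy is bounded by a multiple of an arbitrary
  e.\<close>

lemma trace_lin:
 assumes ok: "tr_ok p q C" and v: "v : H1 Om" and w: "w : H1 Om"
 shows "AE t in II. trace_on Om p q (%x. alpha * v x + beta * w x) (linepath p q t) =
  alpha * trace_on Om p q v (linepath p q t) + beta * trace_on Om p q w (linepath p q t)"
proof -
 let ?u = "%x. alpha * v x + beta * w x"
 let ?L = "linepath p q"
 have C0: "C >= 0" and sub: "closed_segment p q <= closure Om" using ok by (auto simp: tr_ok_def)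
 have uH: "?u : H1 Om" by (rule NN_lin(1)[OF v w])
 note s = trace_close(1)[OF ok v] trace_close(1)[OF ok w] trace_close(1)[OF ok uH]
 let ?d = "%t. trace_on Om p q ?u (?L t) - (alpha * trace_on Om p q v (?L t) + beta * trace_on Om p q w (?L t))"
 have sd: "sqint II ?d" by (intro sqint_diff sqint_add sqint_cmult s)
 have bound: "l2 II ?d <= 2 * C * ((\<bar>alpha\<bar> + \<bar>beta\<bar>) * e)" if "e > 0" for e
 proof -
  obtain phi where phi: "smooth phi" "NN (%x. phi x - v x) <= e" using dense[OF v \<open>e > 0\<close>] by blast
  obtain omega where omega: "smooth omega" "NN (%x. omega x - w x) <= e" using dense[OF w \<open>e > 0\<close>] by blast
  have H: "phi : H1 Om" "omega : H1 Om" by (rule smooth_H1(1)[OF phi(1)], rule smooth_H1(1)[OF omega(1)])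
  have n1: "NN (%x. v x - phi x) <= e" using NN_minus_commute[OF v H(1)] phi(2) by simp
  have n2: "NN (%x. w x - omega x) <= e" using NN_minus_commute[OF w H(2)] omega(2) by simp
  let ?f = "%x. alpha * phi x + beta * omega x"
  have pf: "pws ?f" by (intro pwsI_smooth smooth_add smooth_cmult phi omega)
  have "NN (%x. ?u x - ?f x) = NN (%x. alpha * (v x - phi x) + beta * (w x - omega x))" by (simp add: algebra_simps)
  also have "... <= \<bar>alpha\<bar> * NN (%x. v x - phi x) + \<bar>beta\<bar> * NN (%x. w x - omega x)"
   by (rule NN_lin(2)[OF H1_diff(1)[OF v H(1)] H1_diff(1)[OF w H(2)]])
  also have "... <= \<bar>alpha\<bar> * e + \<bar>beta\<bar> * e" by (intro add_mono mult_left_mono n1 n2) auto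
  finally have a1: "l2 II (%t. trace_on Om p q ?u (?L t) - ?f (?L t)) <= C * (\<bar>alpha\<bar> * e + \<bar>beta\<bar> * e)"
   using trace_close(2)[OF ok uH pf] C0 by (meson mult_left_mono order_trans)
  have a2: "l2 II (%t. trace_on Om p q v (?L t) - phi (?L t)) <= C * e"
   using trace_close(2)[OF ok v pwsI_smooth[OF phi(1)]] mult_left_mono[OF n1 C0] by simp
  have a3: "l2 II (%t. trace_on Om p q w (?L t) - omega (?L t)) <= C * e"
   using trace_close(2)[OF ok w pwsI_smooth[OF omega(1)]] mult_left_mono[OF n2 C0] by simp
  have sL: "sqint II (%t. phi (?L t))" "sqint II (%t. omega (?L t))" "sqint II (%t. ?f (?L t))"
   by (intro pws_line sub pwsI_smooth phi omega, intro pws_line sub pwsI_smooth phi omega, intro pws_line sub pf)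
  have "?d = (%t. (trace_on Om p q ?u (?L t) - ?f (?L t)) - (alpha * (trace_on Om p q v (?L t) - phi (?L t)) + beta * (trace_on Om p q w (?L t) - omega (?L t))))"
   by (auto simp: algebra_simps)
  then have "l2 II ?d <= l2 II (%t. trace_on Om p q ?u (?L t) - ?f (?L t)) +
   l2 II (%t. alpha * (trace_on Om p q v (?L t) - phi (?L t)) + beta * (trace_on Om p q w (?L t) - omega (?L t)))"
   by (simp only:) (intro l2_triangle_diff sqint_diff sqint_add sqint_cmult s sL)
  also have "l2 II (%t. alpha * (trace_on Om p q v (?L t) - phi (?L t)) + beta * (trace_on Om p q w (?L t) - omega (?L t))) <=
   l2 II (%t. alpha * (trace_on Om p q v (?L t) - phi (?L t))) + l2 II (%t. beta * (trace_on Om p q w (?L t) - omega (?L t)))"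
   by (intro l2_triangle sqint_diff sqint_cmult s sL)
  also have "... <= \<bar>alpha\<bar> * (C * e) + \<bar>beta\<bar> * (C * e)"
   unfolding l2_cmult by (intro add_mono mult_left_mono a2 a3) auto
  finally show ?thesis using a1 by (simp add: algebra_simps)
 qed
 have "l2 II ?d <= 0"
 proof (rule field_le_epsilon)
  fix e :: real assume "e > 0"
  define k where "k = 2 * C * (\<bar>alpha\<bar> + \<bar>beta\<bar>) + 1"
  have k: "k > 0" using C0 by (simp add: k_def add_nonneg_pos)
  have "l2 II ?d <= 2 * C * ((\<bar>alpha\<bar> + \<bar>beta\<bar>) * (e / k))" by (rule bound) (use \<open>e > 0\<close> k in simp)
  also have "... = (2 * C * (\<bar>alpha\<bar> + \<bar>beta\<bar>)) * (e / k)" by simp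
  also have "... <= k * (e / k)" using k \<open>e > 0\<close> by (intro mult_right_mono) (auto simp: k_def)
  also have "... = e" using k by simp
  finally show "l2 II ?d <= 0 + e" by simp
 qed
 then have "l2 II ?d = 0" by (rule l2_eq_zeroI)
 from l2_zero_AE[OF sd this] show ?thesis by simp
qed

lemma has_weak_partial_iff_AE:
 assumes "sqint MOm v" "sqint MOm v'" "AE x in MOm. v x = v' x"
 shows "has_weak_partial Om i v g \<longleftrightarrow> has_weak_partial Om i v' g"
proof -
 have "(LINT x|MOm. v x * partial i phi x) = (LINT x|MOm. v' x * partial i phi x)" if phi: "phi : test_functions Om" for phi
  using assms(3) sqint_measurable[OF assms(1)] sqint_measurable[OF assms(2)] sqint_measurable[OF test_sq(2)[OF phi]]
  by (intro integral_cong_AE) (auto elim: eventually_mono)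
 then show ?thesis by (simp add: has_weak_partial_def)
qed

text \<open>Both functions have the same approximating sequences, so the predicates under the choice
  operator coincide. The result is equality of the chosen functions, not just almost
  everywhere.\<close>

lemma trace_on_AE:
 assumes v: "v : H1 Om" "v' : H1 Om" "AE x in MOm. v x = v' x"
 shows "trace_on Om p q v = trace_on Om p q v'"
proof -
 have "H1_norm Om (%x. phi x - v x) = H1_norm Om (%x. phi x - v' x)" if phi: "smooth phi" for phi
 proof -
  have s: "sqint MOm (%x. phi x - v x)" "sqint MOm (%x. phi x - v' x)" by (intro sqint_diff smooth_sq phi H1D(1) v)+
  have ae: "AE x in MOm. phi x - v x = phi x - v' x" using v(3) by eventually_elim simp
  have "weak_partial Om i (%x. phi x - v x) = weak_partial Om i (%x. phi x - v' x)" for i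
   unfolding weak_partial_def using has_weak_partial_iff_AE[OF s ae, of i] by simp
  then have "weak_grad Om (%x. phi x - v x) = weak_grad Om (%x. phi x - v' x)" by (auto simp: weak_grad_def)
  moreover have "l2 MOm (%x. phi x - v x) = l2 MOm (%x. phi x - v' x)"
   by (rule l2_cong_AE[OF sqint_measurable[OF s(1)] sqint_measurable[OF s(2)] ae])
  ultimately show ?thesis by (simp add: H1_norm_def L2_norm_eq_l2)
 qed
 then have "has_trace Om p q v g = has_trace Om p q v' g" for g
  unfolding has_trace_def by (intro conj_cong refl ex_cong1) auto
 then show ?thesis by (simp add: trace_on_def)
qed

end

section \<open>Quantitative estimates on a regular mesh\<close>

lemma integral_unit_quadratic: "(LINT t|II. a + b * t + c * t^2) = a + b / 2 + c / 3"
proof -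
 have c: "continuous_on {0..1} (%t. a + b * t + c * t^2)" by (intro continuous_intros)
 have "((%t. a + b * t + c * t^2) has_integral (a * 1 + b * 1^2 / 2 + c * 1 ^ 3 / 3) - (a * 0 + b * 0^2 / 2 + c * 0 ^ 3 / 3)) {0..1::real}"
  by (rule fundamental_theorem_of_calculus)
   (auto intro!: derivative_eq_intros simp: has_real_derivative_iff_has_vector_derivative[symmetric] power2_eq_square)
 then have "integral {0..1} (%t. a + b * t + c * t^2) = a + b / 2 + c / 3" by (simp add: integral_unique)
 then show ?thesis
  using continuous_imp_integrable_real[OF c] by (simp add: lebesgue_integral_eq_integral)
qed

lemma sqint_sz: "sqint II (%t. 4 - 6 * t)"
 by (rule sqint_continuous_interval) (intro continuous_intros)

text \<open>The Scott-Zhang nodal functional in the parameter of the edge: 4 - 6 t is the function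
  dual to 1 - t within the basis 1 - t, t. The factor 1 / length of the dual basis function cancels
  the arc length, so neither \<open>szf\<close> nor its norm 2 depends on the mesh size.\<close>

definition szf :: "(real => real) => real" where "szf u = (LINT t|II. (4 - 6 * t) * u t)"

lemma szf_bound: assumes "sqint II u" shows "\<bar>szf u\<bar> <= 2 * l2 II u"
proof -
 have "(LINT t|II. (4 - 6 * t)^2) = (LINT t|II. 16 + (-48) * t + 36 * t^2)"
  by (rule Bochner_Integration.integral_cong) (auto simp: power2_eq_square algebra_simps)
 also have "... = 2^2" unfolding integral_unit_quadratic by simp
 finally have "l2 II (%t. 4 - 6 * t) = 2" unfolding l2_def by (simp only: real_sqrt_abs)
 then show ?thesis unfolding szf_def using l2_Cauchy_Schwarz[OF sqint_sz assms] by simp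
qed

lemma szf_diff: "sqint II u ==> sqint II w ==> szf (%t. u t - w t) = szf u - szf w"
 unfolding szf_def right_diff_distrib
 by (intro Bochner_Integration.integral_diff sqint_mult_integrable sqint_sz)

lemma szf_affine: "szf (%t. alpha + beta * t) = alpha"
proof -
 have eq: "(%t::real. (4 - 6 * t) * (alpha + beta * t)) = (%t. 4 * alpha + (4 * beta - 6 * alpha) * t + (- 6 * beta) * t^2)"
  by (auto simp: power2_eq_square algebra_simps)
 show ?thesis unfolding szf_def eq integral_unit_quadratic by (simp add: field_simps)
qed

lemma affine_line: "(%t. c + d \<bullet> linepath z y t) = (%t. (c + d \<bullet> z) + (d \<bullet> (y - z)) * t)"
 by (auto simp: linepath_def inner_add_right inner_diff_right algebra_simps)

context mesh
begin

text \<open>Edges as ordered pairs, each in both orientations, because \<open>szf\<close> singles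
  out the first end point.\<close>

definition EP :: "(plane \<times> plane) set" where
 "EP = {(z, y). EX K:T. z : verts K & y : verts K & z ~= y}"

lemma finEP: "finite EP"
proof (rule finite_subset)
 show "EP <= mesh_vertices T \<times> mesh_vertices T" by (auto simp: EP_def mesh_vertices_eq)
qed (simp add: finV)

lemma EP_iff: "(z, y) : EP \<longleftrightarrow> closed_segment z y : mesh_edges T"
proof
 show "closed_segment z y : mesh_edges T" if "(z, y) : EP" using that unfolding EP_def edge_iff by blast
 show "(z, y) : EP" if "closed_segment z y : mesh_edges T"
  by (rule edges_endpoints[OF that]) (auto simp: EP_def)
qed

lemma edge_in_K: "K : T ==> z : verts K ==> y : verts K ==> closed_segment z y <= K"
 using verts_sub factsT(2) by (intro closed_segment_subset) auto

lemma line_in_K: "K : T ==> z : verts K ==> y : verts K ==> t : {0..1} ==> linepath z y t : K"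
 using edge_in_K linepath_in_path by blast

lemma EP_closure: "(z, y) : EP ==> closed_segment z y <= closure Om"
proof -
 assume "(z, y) : EP"
 then obtain K where K: "K : T" "z : verts K" "y : verts K" by (auto simp: EP_def)
 then show ?thesis using edge_in_K[OF K] cover by blast
qed

lemma nodal_line:
 assumes "(z, y) : EP" "t : {0..1}"
 shows "nodal_function T c (linepath z y t) = c z + (c y - c z) * t"
proof -
 obtain K where K: "K : T" "z : verts K" "y : verts K" using assms(1) by (auto simp: EP_def)
 obtain a d where ad: "ALL x:K. nodal_function T c x = a + d \<bullet> x" using nodal(1)[OF K(1), of c] unfolding affine_fun_on_def by blast
 have V: "z : mesh_vertices T" "y : mesh_vertices T" "z : K" "y : K" using K verts_sub[OF K(1)] by (auto simp: mesh_vertices_eq)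
 have "a + d \<bullet> z = c z" "a + d \<bullet> y = c y" using ad V nodal(2)[OF V(1), of c] nodal(2)[OF V(2), of c] by auto
 then have "(a + d \<bullet> z) + (d \<bullet> (y - z)) * t = c z + (c y - c z) * t" by (simp add: inner_diff_right)
 moreover have "nodal_function T c (linepath z y t) = a + d \<bullet> linepath z y t" using ad line_in_K[OF K assms(2)] by simp
 ultimately show ?thesis using fun_cong[OF affine_line[of a d z y], of t] by simp
qed

text \<open>The two duality conditions are linear equations for the two coefficients of an affine
  function of t, so the choice in \<open>sz_dual\<close> is determined on the edge.\<close>

lemma sz_dual_line:
 assumes zy: "(z, y) : EP" and t: "t : {0..1}"
 shows "sz_dual T z y (linepath z y t) = (4 - 6 * t) / dist z y"
proof -
 define L where "L = dist z y"
 have ne: "z ~= y" using zy by (auto simp: EP_def)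
 then have L: "L > 0" by (simp add: L_def)
 have bz: "nodal_basis T z (linepath z y t) = 1 - t" if "t : {0..1}" for t
  unfolding nodal_basis_def nodal_line[OF zy that] using ne by simp
 have by': "nodal_basis T y (linepath z y t) = t" if "t : {0..1}" for t
  unfolding nodal_basis_def nodal_line[OF zy that] using ne by simp
 have I1: "seg_integral z y (%x. theta x * nodal_basis T z x) = L * (alpha / 2 + beta / 6)"
  and I2: "seg_integral z y (%x. theta x * nodal_basis T y x) = L * (alpha / 2 + beta / 3)"
  if th: "!!t. t : {0..1} ==> theta (linepath z y t) = alpha + beta * t" for theta alpha beta
 proof -
  have "(LINT t|II. theta (linepath z y t) * nodal_basis T z (linepath z y t)) = (LINT t|II. alpha + (beta - alpha) * t + (- beta) * t^2)"
   by (rule Bochner_Integration.integral_cong) (auto simp: th bz power2_eq_square algebra_simps)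
  then show "seg_integral z y (%x. theta x * nodal_basis T z x) = L * (alpha / 2 + beta / 6)"
   unfolding seg_integral_eq L_def integral_unit_quadratic by (simp add: field_simps)
  have "(LINT t|II. theta (linepath z y t) * nodal_basis T y (linepath z y t)) = (LINT t|II. 0 + alpha * t + beta * t^2)"
   by (rule Bochner_Integration.integral_cong) (auto simp: th by' power2_eq_square algebra_simps)
  then show "seg_integral z y (%x. theta x * nodal_basis T y x) = L * (alpha / 2 + beta / 3)"
   unfolding seg_integral_eq L_def integral_unit_quadratic by simp
 qed
 let ?P = "%theta. affine_fun_on (closed_segment z y) theta & seg_integral z y (%x. theta x * nodal_basis T z x) = 1 &
  seg_integral z y (%x. theta x * nodal_basis T y x) = 0"
 have "EX theta. ?P theta"
 proof -
  \<comment> \<open>Since |y - z| = L, this gives d . (y - z) = -6/L; the function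
    \<open>theta\<close> shows that the duality conditions can be met.\<close>
  define d where "d = (- 6 / L / L^2) *\<^sub>R (y - z)"
  define theta where "theta x = (4 / L - d \<bullet> z) + d \<bullet> x" for x
  have "d \<bullet> (y - z) = - 6 / L"
  proof -
   have "d \<bullet> (y - z) = - 6 / L / L^2 * (norm (y - z))^2" by (simp add: d_def power2_norm_eq_inner)
   also have "norm (y - z) = L" by (simp add: L_def dist_norm norm_minus_commute)
   finally show ?thesis using L by simp
  qed
  then have th: "theta (linepath z y t) = 4 / L + (- 6 / L) * t" for t
   unfolding theta_def using fun_cong[OF affine_line[of "4 / L - d \<bullet> z" d z y], of t] by simp
  have "affine_fun_on (closed_segment z y) theta" unfolding affine_fun_on_def theta_def by blast
  moreover have "seg_integral z y (%x. theta x * nodal_basis T z x) = 1" using I1[OF th] L by simp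
  moreover have "seg_integral z y (%x. theta x * nodal_basis T y x) = 0" using I2[OF th] L by simp
  ultimately show ?thesis by blast
 qed
 then have P: "?P (sz_dual T z y)" unfolding sz_dual_def by (rule someI_ex)
 then obtain a d where ad: "ALL x:closed_segment z y. sz_dual T z y x = a + d \<bullet> x" unfolding affine_fun_on_def by blast
 define alpha where "alpha = a + d \<bullet> z"
 define beta where "beta = d \<bullet> (y - z)"
 have th: "sz_dual T z y (linepath z y t) = alpha + beta * t" if "t : {0..1}" for t
 proof -
  have "linepath z y t : closed_segment z y" using that by (rule linepath_in_path)
  then show ?thesis using ad fun_cong[OF affine_line[of a d z y], of t] by (simp add: alpha_def beta_def)
 qed
 have e1: "L * (alpha / 2 + beta / 6) = 1" using P I1[OF th] by simp
 have e2: "L * (alpha / 2 + beta / 3) = 0" using P I2[OF th] by simp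
 have e3: "alpha / 2 + beta / 3 = 0" using e2 L by simp
 have "L * (beta / 6) = - 1" using e1 e2 by (simp add: distrib_left)
 then have b: "beta = - 6 / L" using L by (simp add: field_simps)
 then have "alpha = 4 / L" using e3 by simp
 then show ?thesis using th[OF t] b L by (simp add: L_def diff_divide_distrib)
qed

lemma scott_zhang_value:
 assumes "(z, y) : EP"
 shows "seg_integral z y (%x. sz_dual T z y x * g x) = szf (%t. g (linepath z y t))"
proof -
 have d: "dist z y ~= 0" using assms by (auto simp: EP_def)
 have "(LINT t|II. sz_dual T z y (linepath z y t) * g (linepath z y t)) = (LINT t|II. (1 / dist z y) * ((4 - 6 * t) * g (linepath z y t)))"
  by (rule Bochner_Integration.integral_cong) (auto simp: sz_dual_line[OF assms])
 then show ?thesis unfolding seg_integral_eq szf_def using d by simp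
qed

end

text \<open>Shape regularity and quasi-uniformity combined: the size of every triangle is comparable
  to the one number h. The constants of the final estimates are functions of \<open>gamma\<close>
  alone.\<close>

locale rmesh = mesh +
 fixes h gamma :: real
 assumes h0: "h > 0" and gamma0: "gamma > 0"
  and diam: "!!K x y. K : T ==> x : K ==> y : K ==> dist x y <= h"
  and inball: "!!K. K : T ==> EX x. cball x (gamma * h) <= K"
begin

lemma measure_cball_plane: "r >= 0 ==> measure lebesgue (cball (c::plane) r) = pi * r^2"
 using content_cball[of r c] by (simp add: unit_ball_vol_2)

lemma measure_ball_plane: "r >= 0 ==> measure lebesgue (ball (c::plane) r) = pi * r^2"
 using content_ball[of r c] by (simp add: unit_ball_vol_2)

lemma lmK: "K : T ==> interior K : lmeasurable"
 using factsT(6) by (simp add: lmeasurable_open)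

lemma area_low: assumes "K : T" shows "pi * (gamma * h)^2 <= measure lebesgue (interior K)"
proof -
 obtain x where "cball x (gamma * h) <= K" using inball[OF assms] by blast
 then have "ball x (gamma * h) <= interior K" by (meson ball_subset_cball interior_maximal open_ball order_trans)
 then have "measure lebesgue (ball x (gamma * h)) <= measure lebesgue (interior K)"
  by (rule measure_mono_fmeasurable[OF _ _ lmK[OF assms]]) simp
 then show ?thesis using measure_ball_plane[of "gamma * h" x] h0 gamma0 by simp
qed

lemma area_up: assumes "K : T" shows "measure lebesgue (interior K) <= pi * h^2"
proof -
 obtain x where x: "x : interior K" using factsT(4)[OF assms] by blast
 have "interior K <= cball x h" 
 proof
  fix y assume "y : interior K"
  then show "y : cball x h" using diam[OF assms, of x y] x interior_subset[of K] by (simp add: subset_iff)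
 qed
 then have "measure lebesgue (interior K) <= measure lebesgue (cball x h)"
  by (rule measure_mono_fmeasurable) (use setsK in auto)
 then show ?thesis using measure_cball_plane[of h x] h0 by simp
qed

text \<open>The factor 8 / D from \<open>triangle_trace\<close>, with the determinant D bounded
  below by the area pi (gamma h)^2 of the inscribed disc and h^2 split off.\<close>

definition Ct :: real where "Ct = 8 / (pi * gamma^2)"

lemma Ct_pos: "Ct > 0" using gamma0 by (simp add: Ct_def)

lemma edge_trace_smooth:
 assumes K: "K : T" "z : verts K" "y : verts K" "z ~= y" and psi: "smooth psi"
 shows "(l2 II (%t. psi (linepath z y t)))^2 <= Ct / h^2 * ((l2 (MK K) psi)^2 + h^2 * (SUM i:UNIV. (l2 (MK K) (partial i psi))^2))"
proof -
 obtain r where r: "verts K = {z, y, r}" "r ~= z" "r ~= y" using third_vertex[OF simp2[OF K(1)] K(2-4)] by metis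
 have hull: "K = convex hull {z, y, r}" using vertsT(4)[OF K(1)] r(1) by simp
 define D where "D = \<bar>cross (y - z) (r - z)\<bar>"
 have cr: "cross (y - z) (r - z) ~= 0" by (rule simplex_cross[OF simp2[OF K(1)] r(1)]) (use K(4) r in auto)
 have rK: "r : K" "z : K" "y : K" using verts_sub[OF K(1)] r(1) by auto
 have "pi * (gamma * h)^2 <= measure lebesgue (interior K)" by (rule area_low[OF K(1)])
 also have "... <= measure lebesgue K"
  by (rule measure_mono_fmeasurable[OF interior_subset]) (use setsK lmeasurable_compact[OF factsT(1)[OF K(1)]] in auto)
 also have "... <= D" unfolding D_def hull by (rule triangle_measure_le[OF cr])
 finally have D: "pi * (gamma * h)^2 <= D" .
 have p: "pi * (gamma * h)^2 > 0" using gamma0 h0 by simp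
 have "8 / D <= 8 / (pi * (gamma * h)^2)" using D p by (intro divide_left_mono) auto
 also have "... = Ct / h^2" by (simp add: Ct_def power_mult_distrib)
 finally have DC: "8 / D <= Ct / h^2" .
 have "(l2 II (%t. psi (linepath z y t)))^2 <= 8 / D * ((l2 (MK K) psi)^2 + h^2 * (SUM i:UNIV. (l2 (MK K) (partial i psi))^2))"
  unfolding l2_sq[of II] D_def using triangle_trace[OF psi cr, of h] diam[OF K(1) rK(1,2)] diam[OF K(1) rK(1,3)] hull by simp
 also have "... <= Ct / h^2 * ((l2 (MK K) psi)^2 + h^2 * (SUM i:UNIV. (l2 (MK K) (partial i psi))^2))"
  by (intro mult_right_mono DC add_nonneg_nonneg mult_nonneg_nonneg sum_nonneg) auto
 finally show ?thesis .
qed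

definition loc :: "(plane => real) => plane set => real" where
 "loc f K = (l2 (MK K) f)^2 + h^2 * (SUM i:UNIV. (l2 (MK K) (weak_partial Om i f))^2)"

lemma loc_nonneg: "loc f K >= 0"
 unfolding loc_def by (intro add_nonneg_nonneg mult_nonneg_nonneg sum_nonneg) auto

lemma loc_pws:
 assumes f: "pws f" and K: "K : T" and psi: "smooth psi" "ALL x:K. f x = psi x"
 shows "loc f K = (l2 (MK K) psi)^2 + h^2 * (SUM i:UNIV. (l2 (MK K) (partial i psi))^2)"
proof -
 have "l2 (MK K) f = l2 (MK K) psi" by (rule l2_cong) (use psi interior_subset[of K] in auto)
 moreover have "l2 (MK K) (weak_partial Om i f) = l2 (MK K) (partial i psi)" for i
 proof (rule l2_cong_AE[OF _ _ pws_H1(2)[OF f K psi]])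
  show "weak_partial Om i f : borel_measurable (MK K)"
   by (intro sqint_measurable sqint_restrict[OF K] H1D(2) pws_H1(1)[OF f])
  show "partial i psi : borel_measurable (MK K)"
   by (intro sqint_measurable smooth_sqint factsT(6)[OF K] open_interior smooth_partial psi)
 qed
 ultimately show ?thesis by (simp add: loc_def)
qed

lemma edge_trace:
 assumes f: "pws f" and K: "K : T" "z : verts K" "y : verts K" "z ~= y"
 shows "(l2 II (%t. f (linepath z y t)))^2 <= Ct / h^2 * loc f K"
proof -
 obtain psi where psi: "smooth psi" "ALL x:K. f x = psi x" using f K(1) unfolding pws_def by blast
 have "l2 II (%t. f (linepath z y t)) = l2 II (%t. psi (linepath z y t))"
  by (rule l2_cong) (use psi line_in_K[OF K(1-3)] in auto)
 then show ?thesis using edge_trace_smooth[OF K psi(1)] loc_pws[OF f K(1) psi] by simp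
qed

lemma loc_sum:
 assumes "f : H1 Om"
 shows "(SUM K:T. loc f K) = (l2 MOm f)^2 + h^2 * (SUM i:UNIV. (l2 MOm (weak_partial Om i f))^2)"
proof -
 have "(SUM K:T. loc f K) = (SUM K:T. (l2 (MK K) f)^2) + h^2 * (SUM K:T. SUM i:UNIV. (l2 (MK K) (weak_partial Om i f))^2)"
  by (simp add: loc_def sum.distrib sum_distrib_left)
 also have "(SUM K:T. SUM i:UNIV. (l2 (MK K) (weak_partial Om i f))^2) = (SUM i:UNIV. SUM K:T. (l2 (MK K) (weak_partial Om i f))^2)"
  by (rule sum.swap)
 also have "... = (SUM i:UNIV. (l2 MOm (weak_partial Om i f))^2)"
  by (intro sum.cong refl l2_mesh[symmetric] H1D(2) assms)
 also have "(SUM K:T. (l2 (MK K) f)^2) = (l2 MOm f)^2" by (rule l2_mesh[symmetric, OF H1D(1)[OF assms]])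
 finally show ?thesis .
qed

lemma loc_le_NN: assumes "f : H1 Om" "K : T" shows "loc f K <= (1 + h^2) * (NN f)^2"
proof -
 have "loc f K <= (SUM K:T. loc f K)" by (rule member_le_sum[OF assms(2)]) (auto simp: loc_nonneg finT)
 also have "... <= (1 + h^2) * ((l2 MOm f)^2 + (SUM i:UNIV. (l2 MOm (weak_partial Om i f))^2))"
  unfolding loc_sum[OF assms(1)] by (simp add: distrib_left distrib_right sum_nonneg)
 also have "... = (1 + h^2) * (H1_norm Om f)^2" unfolding H1_norm_sq[OF assms(1)] ..
 also have "... <= (1 + h^2) * (NN f)^2"
  using H1_norm_NN(1)[OF assms(1)] by (intro mult_left_mono power_mono) (auto simp: H1_norm_def)
 finally show ?thesis .
qed

text \<open>A piecewise smooth function is arbitrary off the closure of \<open>Om\<close>; cutting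
  it off there makes it Borel measurable on the plane, as \<open>seg_cover\<close> requires.\<close>

lemma l2_line_nn:
 assumes f: "pws f" and "closed_segment p q <= closure Om"
 shows "ennreal ((l2 II (%t. f (linepath p q t)))^2) =
  (\<integral>\<^sup>+t. ennreal ((indicator (closure Om) (linepath p q t) *\<^sub>R f (linepath p q t))^2) * indicator {0..1} t \<partial>lborel)"
proof -
 have s: "sqint II (%t. f (linepath p q t))" by (rule pws_line[OF assms])
 have "ennreal ((l2 II (%t. f (linepath p q t)))^2) = (\<integral>\<^sup>+t. ennreal ((f (linepath p q t))^2) \<partial>II)"
  unfolding l2_sq using sqint_integrable[OF s] by (intro nn_integral_eq_integral[symmetric]) auto
 also have "... = (\<integral>\<^sup>+t. ennreal ((indicator (closure Om) (linepath p q t) *\<^sub>R f (linepath p q t))^2) \<partial>II)"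
 proof (rule nn_integral_cong)
  fix t assume "t : space II"
  then have "linepath p q t : closure Om" using linepath_in_path[of t p q] assms(2) by auto
  then show "ennreal ((f (linepath p q t))^2) = ennreal ((indicator (closure Om) (linepath p q t) *\<^sub>R f (linepath p q t))^2)" by simp
 qed
 also have "... = (\<integral>\<^sup>+t. ennreal ((indicator (closure Om) (linepath p q t) *\<^sub>R f (linepath p q t))^2) * indicator {0..1} t \<partial>lborel)"
  by (subst nn_integral_restrict_space) (auto simp: nn_integral_completion)
 finally show ?thesis .
qed

lemma pws_borel: assumes "pws f" shows "(%x. ennreal ((indicator (closure Om) x *\<^sub>R f x)^2)) : borel_measurable borel"
proof -
 have "(%x. indicator (closure Om) x *\<^sub>R f x) : borel_measurable borel"
  by (rule borel_measurable_continuous_on_indicator[OF _ pws_continuous[OF assms]]) simp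
 then show ?thesis by measurable
qed

lemma seg_bound:
 assumes f: "pws f" and pq: "p ~= q" "closed_segment p q <= closure Om" and Sg: "Sg <= EP" and N: "finite N"
  and cov: "!!t. t : {0..1} ==> t ~: N ==> EX zy:Sg. linepath p q t : closed_segment (fst zy) (snd zy)"
 shows "dist p q * (l2 II (%t. f (linepath p q t)))^2 <= (SUM zy:Sg. dist (fst zy) (snd zy) * (l2 II (%t. f (linepath (fst zy) (snd zy) t)))^2)"
proof -
 have fS: "finite Sg" by (rule finite_subset[OF Sg finEP])
 have "ennreal (dist p q * (l2 II (%t. f (linepath p q t)))^2) <=
  (SUM zy:Sg. ennreal (dist (fst zy) (snd zy)) * (\<integral>\<^sup>+s. ennreal ((indicator (closure Om) (linepath (fst zy) (snd zy) s) *\<^sub>R f (linepath (fst zy) (snd zy) s))^2) * indicator {0..1} s \<partial>lborel))"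
  unfolding ennreal_mult[OF zero_le_dist zero_le_power2] l2_line_nn[OF f pq(2)]
  by (rule seg_cover[OF pq(1) fS N cov pws_borel[OF f]])
 also have "... = (SUM zy:Sg. ennreal (dist (fst zy) (snd zy) * (l2 II (%t. f (linepath (fst zy) (snd zy) t)))^2))"
 proof (rule sum.cong)
  fix zy assume "zy : Sg"
  then have "closed_segment (fst zy) (snd zy) <= closure Om" using Sg EP_closure[of "fst zy" "snd zy"] by auto
  from l2_line_nn[OF f this]
  show "ennreal (dist (fst zy) (snd zy)) * (\<integral>\<^sup>+s. ennreal ((indicator (closure Om) (linepath (fst zy) (snd zy) s) *\<^sub>R f (linepath (fst zy) (snd zy) s))^2) * indicator {0..1} s \<partial>lborel)
   = ennreal (dist (fst zy) (snd zy) * (l2 II (%t. f (linepath (fst zy) (snd zy) t)))^2)"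
   by (simp add: ennreal_mult)
 qed simp
 also have "... = ennreal (SUM zy:Sg. dist (fst zy) (snd zy) * (l2 II (%t. f (linepath (fst zy) (snd zy) t)))^2)"
  by (rule sum_ennreal) simp
 finally show ?thesis by (simp add: ennreal_le_iff sum_nonneg)
qed

lemma dist_EP: "(z, y) : EP ==> dist z y <= h"
proof -
 assume "(z, y) : EP"
 then obtain K where K: "K : T" "z : verts K" "y : verts K" by (auto simp: EP_def)
 then show ?thesis using diam[OF K(1)] verts_sub[OF K(1)] by blast
qed

text \<open>Summing the edge bounds over the whole mesh is wasteful, but only the existence of a
  constant matters here.\<close>

lemma tr_ok_cover:
 assumes pq: "p ~= q" "closed_segment p q <= closure Om" and N: "finite N"
  and cov: "!!t. t : {0..1} ==> t ~: N ==> EX zy:EP. linepath p q t : closed_segment (fst zy) (snd zy)"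
 shows "EX C. tr_ok p q C"
proof -
 define B where "B = (SUM zy:EP. h * (Ct / h^2 * (1 + h^2)))"
 have B: "B >= 0" unfolding B_def using h0 Ct_pos by (intro sum_nonneg) auto
 have "l2 II (%t. f (linepath p q t)) <= sqrt (B / dist p q) * NN f" if f: "pws f" for f
 proof -
  have fH: "f : H1 Om" by (rule pws_H1(1)[OF f])
  have "dist p q * (l2 II (%t. f (linepath p q t)))^2 <= (SUM zy:EP. dist (fst zy) (snd zy) * (l2 II (%t. f (linepath (fst zy) (snd zy) t)))^2)"
   by (rule seg_bound[OF f pq subset_refl N cov])
  also have "... <= (SUM zy:EP. h * (Ct / h^2 * (1 + h^2)) * (NN f)^2)"
  proof (rule sum_mono)
   fix zy assume zy: "zy : EP"
   then obtain K where K: "K : T" "fst zy : verts K" "snd zy : verts K" "fst zy ~= snd zy" by (auto simp: EP_def)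
   have "(l2 II (%t. f (linepath (fst zy) (snd zy) t)))^2 <= Ct / h^2 * loc f K" by (rule edge_trace[OF f K])
   also have "... <= Ct / h^2 * ((1 + h^2) * (NN f)^2)"
    using Ct_pos by (intro mult_left_mono loc_le_NN fH K(1)) simp
   finally have "dist (fst zy) (snd zy) * (l2 II (%t. f (linepath (fst zy) (snd zy) t)))^2 <= h * (Ct / h^2 * ((1 + h^2) * (NN f)^2))"
    using dist_EP[of "fst zy" "snd zy"] zy h0 by (intro mult_mono) auto
   then show "dist (fst zy) (snd zy) * (l2 II (%t. f (linepath (fst zy) (snd zy) t)))^2 <= h * (Ct / h^2 * (1 + h^2)) * (NN f)^2"
    by (simp add: mult.assoc)
  qed
  also have "... = B * (NN f)^2" by (simp add: B_def sum_distrib_right)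
  finally have "(l2 II (%t. f (linepath p q t)))^2 <= B * (NN f)^2 / dist p q"
   using pq(1) by (simp add: pos_le_divide_eq mult.commute)
  also have "... = (sqrt (B / dist p q) * NN f)^2" using B by (simp add: power_mult_distrib)
  finally show ?thesis by (rule power2_le_imp_le) (use B NN_nonneg in simp)
 qed
 then have "tr_ok p q (sqrt (B / dist p q))" unfolding tr_ok_def using pq B by simp
 then show ?thesis by blast
qed

lemma tr_ok_edge: assumes "(z, y) : EP" shows "EX C. tr_ok z y C"
proof (rule tr_ok_cover[of z y "{}"])
 show "z ~= y" using assms by (auto simp: EP_def)
 show "closed_segment z y <= closure Om" by (rule EP_closure[OF assms])
 show "EX zy:EP. linepath z y t : closed_segment (fst zy) (snd zy)" if "t : {0..1}" for t
  using assms linepath_in_path[OF that, of z y] by (intro bexI[of _ "(z, y)"]) auto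
qed simp

lemma tr_ok_frontier: assumes "p ~= q" "closed_segment p q <= frontier Om" shows "EX C. tr_ok p q C"
proof (rule tr_ok_cover[of p q "{}"])
 show "closed_segment p q <= closure Om" using assms(2) by (auto simp: frontier_def)
 show "EX zy:EP. linepath p q t : closed_segment (fst zy) (snd zy)" if "t : {0..1}" for t
 proof -
  have "linepath p q t : frontier Om" using linepath_in_path[OF that, of p q] assms(2) by blast
  then obtain E where E: "E : mesh_edges T" "linepath p q t : E" using frontier_domain_edge by blast
  then obtain K z y where "K : T" "z : verts K" "y : verts K" "z ~= y" "E = closed_segment z y" unfolding edge_iff by blast
  then show ?thesis using E(2) by (intro bexI[of _ "(z, y)"]) (auto simp: EP_def)
 qed
qed (use assms in auto)

end

section \<open>The Scott--Zhang interpolant\<close>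

text \<open>The mean is the best constant, so the combination of the two means may replace the mean
  of k. Equality is asked for almost everywhere because the chosen weak derivatives are additive
  only in that sense.\<close>

lemma osc_lin:
 assumes U: "bounded U" "open U" "U ~= {}" and f: "sqint (lebesgue_on U) f" and g: "sqint (lebesgue_on U) g"
  and k: "k : borel_measurable (lebesgue_on U)" "AE x in lebesgue_on U. k x = alpha * f x + beta * g x"
 shows "osc U k <= \<bar>alpha\<bar> * osc U f + \<bar>beta\<bar> * osc U g"
proof -
 let ?M = "lebesgue_on U"
 have one: "sqint ?M (%_. c)" for c by (rule sqint_const[OF finite_measure_lebesgue_on[OF U(1,2)]])
 have s: "sqint ?M (%x. f x - mean U f)" "sqint ?M (%x. g x - mean U g)" by (intro sqint_diff f g one)+
 have sl: "sqint ?M (%x. alpha * f x + beta * g x)" by (intro sqint_add sqint_cmult f g)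
 have sk: "sqint ?M k" by (rule sqint_cong_AE[OF sl k(1)]) (use k(2) in \<open>auto elim: eventually_mono\<close>)
 let ?b = "alpha * mean U f + beta * mean U g"
 have "osc U k <= l2 ?M (%x. k x - ?b)" by (rule osc_facts(4)[OF U sk])
 also have "... = l2 ?M (%x. alpha * (f x - mean U f) + beta * (g x - mean U g))"
 proof (rule l2_cong_AE)
  show "AE x in ?M. k x - ?b = alpha * (f x - mean U f) + beta * (g x - mean U g)"
   using k(2) by eventually_elim (simp add: algebra_simps)
 qed (intro sqint_measurable sqint_diff sqint_add sqint_cmult sk one f g)+
 also have "... <= \<bar>alpha\<bar> * osc U f + \<bar>beta\<bar> * osc U g"
  using l2_triangle[OF sqint_cmult[OF s(1)] sqint_cmult[OF s(2)]] by (simp add: l2_cmult osc_def)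
 finally show ?thesis .
qed

lemma osc_nonneg: "osc U g >= 0" by (simp add: osc_def l2_nonneg)

lemma l2_const_sq:
 assumes "bounded U" "open U" shows "(l2 (lebesgue_on U) (%_. c))^2 = c^2 * measure lebesgue U"
 using assms(2) by (simp add: l2_sq measure_restrict_space)

lemma affine_bound_hull:
 fixes d :: plane
 assumes "ALL z:S. \<bar>c + d \<bullet> z\<bar> <= B" "x : convex hull S" shows "\<bar>c + d \<bullet> x\<bar> <= B"
proof -
 have "convex hull S <= {x. d \<bullet> x <= B - c} \<inter> {x. d \<bullet> x >= - B - c}"
  by (rule hull_minimal) (use assms(1) convex_halfspace_le convex_halfspace_ge in \<open>auto intro!: convex_Int simp: abs_le_iff\<close>)
 then show ?thesis using assms(2) by (auto simp: abs_le_iff)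
qed

lemma norm_sq_components: "(SUM i:UNIV. (b $ i)^2) = (norm (b::real^'n))^2"
 unfolding power2_norm_eq_inner inner_vec_def by (simp add: power2_eq_square)

context rmesh
begin

definition star :: "plane => plane set set" where "star z = {K : T. z : verts K}"

lemma fin_star: "finite (star z)" using finT by (simp add: star_def)

definition Nb :: real where "Nb = 1 / gamma^2"

lemma Nb0: "Nb >= 0" by (simp add: Nb_def)

text \<open>The interiors of the triangles at z are disjoint, have area at least pi (gamma h)^2
  each, and lie in the disc of radius h around z.\<close>

lemma card_star: "real (card (star z)) <= Nb"
proof -
 have "measure lebesgue (UN K:star z. interior K) = (SUM K:star z. measure lebesgue (interior K))"
 proof (rule measure_finite_Union[OF fin_star])
  show "disjoint_family_on interior (star z)" using interior_disj by (auto simp: disjoint_family_on_def star_def)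
  show "emeasure lebesgue (interior K) ~= \<infinity>" if "K : star z" for K
   using fmeasurableD2[OF lmK[of K]] that by (simp only: star_def mem_Collect_eq infinity_ennreal_def not_False_eq_True)
 qed auto
 moreover have "(SUM K:star z. pi * (gamma * h)^2) <= (SUM K:star z. measure lebesgue (interior K))"
  by (intro sum_mono area_low) (simp add: star_def)
 moreover have "measure lebesgue (UN K:star z. interior K) <= measure lebesgue (cball z h)"
 proof (rule measure_mono_fmeasurable)
  show "(UN K:star z. interior K) <= cball z h"
  proof
   fix x assume "x : (UN K:star z. interior K)"
   then obtain K where K: "K : T" "z : verts K" "x : interior K" by (auto simp: star_def)
   then have "z : K" "x : K" using verts_sub interior_subset by blast+
   then show "x : cball z h" using diam[OF K(1)] by simp
  qed
  show "(UN K:star z. interior K) : sets lebesgue" by (intro sets.finite_UN fin_star setsK)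
 qed simp
 ultimately have "real (card (star z)) * (pi * (gamma * h)^2) <= pi * h^2"
  using measure_cball_plane[of h z] h0 sum_constant[of "pi * (gamma * h)^2" "star z"] by linarith
 then have "real (card (star z)) * gamma^2 * (pi * h^2) <= 1 * (pi * h^2)" by (simp add: power_mult_distrib mult_ac)
 then have "real (card (star z)) * gamma^2 <= 1" using h0 by (simp add: mult_le_cancel_right)
 then show ?thesis using gamma0 by (simp add: Nb_def pos_le_divide_eq)
qed

definition e2 :: "(plane => real) => plane set => real" where
 "e2 v K = (SUM i:UNIV. (osc (interior K) (weak_partial Om i v))^2)"

lemma e2_nonneg: "e2 v K >= 0" by (simp add: e2_def sum_nonneg)

lemma osc_cong:
 assumes K: "K : T" and "sqint (MK K) f" "sqint (MK K) g" "AE x in MK K. f x = g x"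
 shows "osc (interior K) f = osc (interior K) g"
proof -
 note U = factsT(6)[OF K] open_interior[of K] factsT(4)[OF K]
 have "osc (interior K) f <= \<bar>1\<bar> * osc (interior K) g + \<bar>0\<bar> * osc (interior K) g"
  by (rule osc_lin[OF U assms(3,3) sqint_measurable[OF assms(2)]]) (use assms(4) in \<open>auto elim: eventually_mono\<close>)
 moreover have "osc (interior K) g <= \<bar>1\<bar> * osc (interior K) f + \<bar>0\<bar> * osc (interior K) f"
  by (rule osc_lin[OF U assms(2,2) sqint_measurable[OF assms(3)]]) (use assms(4) in \<open>auto elim: eventually_mono\<close>)
 ultimately show ?thesis by simp
qed

lemma e2_smooth:
 assumes "K : T" "smooth phi" shows "e2 phi K = (SUM i:UNIV. (osc (interior K) (partial i phi))^2)"
proof -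
 have "osc (interior K) (weak_partial Om i phi) = osc (interior K) (partial i phi)" for i
  by (rule osc_cong[OF assms(1)])
   (intro sqint_restrict[OF assms(1)] H1D(2) smooth_H1(1) smooth_sq smooth_partial assms(2) AE_restrict[OF assms(1)] smooth_H1(2))+
 then show ?thesis by (simp add: e2_def)
qed

text \<open>The slope is the mean gradient, which turns the gradient error into \<open>e2\<close>;
  the constant term is the mean of the remainder, to which the Poincare inequality applies. The
  factor 3 is 2 + 1.\<close>

lemma best_affine:
 assumes K: "K : T" and phi: "smooth phi"
 shows "EX c d. (l2 (MK K) (%x. phi x - (c + d \<bullet> x)))^2 +
  h^2 * (SUM i:UNIV. (l2 (MK K) (partial i (%x. phi x - (c + d \<bullet> x))))^2) <= 3 * h^2 * e2 phi K"
proof -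
 let ?U = "interior K"
 define d :: plane where "d = (\<chi> i. mean ?U (partial i phi))"
 define r where "r x = phi x - (0 + d \<bullet> x)" for x
 define c where "c = mean ?U r"
 have sr: "smooth r" unfolding r_def by (intro smooth_diff phi smooth_affine)
 have p: "partial i (%x. phi x - (b + d \<bullet> x)) = (%x. partial i phi x - mean ?U (partial i phi))" for i b
  by (rule ext) (simp add: partial_diff[OF phi smooth_affine] partial_affine d_def)
 have "(%x. phi x - (c + d \<bullet> x)) = (%x. r x - mean ?U r)" by (auto simp: r_def c_def)
 then have 1: "(l2 (MK K) (%x. phi x - (c + d \<bullet> x)))^2 = (osc ?U r)^2" by (simp add: osc_def)
 have 2: "(SUM i:UNIV. (l2 (MK K) (partial i (%x. phi x - (b + d \<bullet> x))))^2) = e2 phi K" for b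
  unfolding p e2_smooth[OF assms] osc_def ..
 have "(osc ?U r)^2 <= 2 * h^2 * (SUM i:UNIV. (l2 (MK K) (partial i r))^2)"
  by (rule poincare_smooth[OF factsT(7)[OF K] open_interior factsT(6,4)[OF K] _ sr])
   (use diam[OF K] interior_subset[of K] in blast)
 also have "(SUM i:UNIV. (l2 (MK K) (partial i r))^2) = e2 phi K" using 2[of 0] unfolding r_def .
 finally show ?thesis using 1 2[of c] by (intro exI[of _ c] exI[of _ d]) (simp add: algebra_simps)
qed

text \<open>\<open>c1\<close> bounds the edge trace of the best affine error; \<open>c2\<close> the
  distance of a nodal value to the best affine function (4 \<open>c1\<close> per passage to a
  neighbour, at most \<open>Nb^2\<close> passages, and 2 \<open>c1\<close> on the chosen edge);
  \<open>c3\<close> the error on one triangle; \<open>c4\<close> its sum over the mesh;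
  \<open>c5\<close> passes from squares to \<open>NW\<close>.\<close>

definition c1 :: real where "c1 = sqrt (3 * Ct)"
definition c2 :: real where "c2 = (4 * Nb^2 + 2) * c1"
definition c3 :: real where "c3 = 6 + 2 * pi * c2^2 * (1 + 4 / gamma^2)"
definition c4 :: real where "c4 = c3 * (9 * Nb^2)"
definition c5 :: real where "c5 = sqrt (3 * c4)"

lemma c_pos: "c1 >= 0" "c2 >= 0" "c3 >= 0" "c4 >= 0" "c5 >= 0"
proof -
 show 1: "c1 >= 0" using Ct_pos by (simp add: c1_def)
 show "c2 >= 0" unfolding c2_def using 1 by (intro mult_nonneg_nonneg) auto
 show 3: "c3 >= 0" unfolding c3_def by (intro add_nonneg_nonneg mult_nonneg_nonneg) auto
 show 4: "c4 >= 0" unfolding c4_def using 3 by simp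
 show "c5 >= 0" unfolding c5_def using 4 by simp
qed

text \<open>The interpolant of a smooth function from its point values; \<open>sznH\<close> below
  uses chosen traces instead. The estimate is proved here and carried over by density.\<close>

definition szn :: "(plane => plane) => (plane => real) => plane => real" where
 "szn s phi = nodal_function T (%z. szf (%t. phi (linepath z (s z) t)))"

definition sumM :: "(plane => real) => plane => real" where "sumM phi z = (SUM K:star z. sqrt (e2 phi K))"

lemma sumM_ge: "K : star z ==> sqrt (e2 phi K) <= sumM phi z"
 unfolding sumM_def by (rule member_le_sum) (auto simp: e2_nonneg fin_star)

lemma sumM_nonneg: "sumM phi z >= 0" unfolding sumM_def by (intro sum_nonneg) (simp add: e2_nonneg)

text \<open>\<open>szf\<close> reproduces the value at z of an affine function. The nodal value is
  compared first with the best affine function of a triangle at the chosen edge, then with that of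
  \<open>K\<close> along a chain of triangles around z, where neighbours are compared through phi on
  their common edge.\<close>

lemma nodal_values_close:
 assumes phi: "smooth phi" and s: "!!z. z : mesh_vertices T ==> (z, s z) : EP"
  and P: "!!K. K : T ==> (l2 (MK K) (%x. phi x - (c K + d K \<bullet> x)))^2 +
   h^2 * (SUM i:UNIV. (l2 (MK K) (partial i (%x. phi x - (c K + d K \<bullet> x))))^2) <= 3 * h^2 * e2 phi K"
  and K: "K : T" "z : verts K"
 shows "\<bar>szf (%t. phi (linepath z (s z) t)) - (c K + d K \<bullet> z)\<bar> <= c2 * sumM phi z"
proof -
 define p where "p K x = c K + d K \<bullet> x" for K x
 have sp: "smooth (p K)" for K unfolding p_def by (rule smooth_affine)
 have edge: "l2 II (%t. phi (linepath z y t) - p L (linepath z y t)) <= c1 * sqrt (e2 phi L)"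
  if L: "L : T" "z : verts L" "y : verts L" "z ~= y" for L y
 proof -
  have "(l2 II (%t. phi (linepath z y t) - p L (linepath z y t)))^2 <= Ct / h^2 * ((l2 (MK L) (%x. phi x - p L x))^2 +
   h^2 * (SUM i:UNIV. (l2 (MK L) (partial i (%x. phi x - p L x)))^2))"
   by (rule edge_trace_smooth[OF L smooth_diff[OF phi sp]])
  also have "... <= Ct / h^2 * (3 * h^2 * e2 phi L)"
   unfolding p_def using Ct_pos by (intro mult_left_mono P[OF L(1)]) simp
  also have "... = (c1 * sqrt (e2 phi L))^2" using h0 Ct_pos e2_nonneg by (simp add: c1_def power_mult_distrib)
  finally show ?thesis by (rule power2_le_imp_le) (simp add: c_pos e2_nonneg)
 qed
 have sq: "sqint II (%t. f (linepath z y t))" if "smooth f" "(z, y) : EP" for f y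
  by (intro pws_line pwsI_smooth that EP_closure)
 have szp: "szf (%t. p L (linepath z y t)) = p L z" for L y
  unfolding p_def affine_line by (rule szf_affine)
 \<comment> \<open>Both functions are affine, so \<open>szf\<close> on the common edge turns the
   difference of their values at z into an L^2 distance there, to which the trace bound in either
   triangle applies.\<close>
 have adj1: "\<bar>p L z - p L' z\<bar> <= 4 * c1 * sumM phi z" if LL: "(L, L') : adj z" for L L'
 proof -
  obtain y where y: "L : T" "L' : T" "z : verts L" "z : verts L'" "y ~= z" "y : verts L" "y : verts L'"
   using LL unfolding adj_def by blast
  have ep: "(z, y) : EP" using y by (auto simp: EP_def)
  have "p L z - p L' z = szf (%t. p L (linepath z y t) - p L' (linepath z y t))"
   unfolding szf_diff[OF sq[OF sp ep] sq[OF sp ep]] szp ..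
  then have "\<bar>p L z - p L' z\<bar> <= 2 * l2 II (%t. p L (linepath z y t) - p L' (linepath z y t))"
   using szf_bound[OF sqint_diff[OF sq[OF sp ep] sq[OF sp ep]]] by simp
  also have "l2 II (%t. p L (linepath z y t) - p L' (linepath z y t)) <=
   l2 II (%t. p L (linepath z y t) - phi (linepath z y t)) + l2 II (%t. phi (linepath z y t) - p L' (linepath z y t))"
   by (rule l2_triangle3[OF sq[OF sp ep] sq[OF phi ep] sq[OF sp ep]])
  also have "l2 II (%t. p L (linepath z y t) - phi (linepath z y t)) = l2 II (%t. phi (linepath z y t) - p L (linepath z y t))"
   by (rule l2_minus_commute)
  finally have "\<bar>p L z - p L' z\<bar> <= 2 * (c1 * sqrt (e2 phi L) + c1 * sqrt (e2 phi L'))"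
   using edge[OF y(1,3,6) y(5)[symmetric]] edge[OF y(2,4,7) y(5)[symmetric]] by simp
  also have "... <= 2 * (c1 * sumM phi z + c1 * sumM phi z)"
   using y c_pos(1) by (intro mult_left_mono add_mono sumM_ge) (auto simp: star_def)
  finally show ?thesis by simp
 qed
 have adjn: "\<bar>p L z - p L' z\<bar> <= real n * (4 * c1 * sumM phi z)" if "(L, L') : adj z ^^ n" for n L L'
  using that
 proof (induction n arbitrary: L')
  case (Suc n)
  then obtain L'' where "(L, L'') : adj z ^^ n" "(L'', L') : adj z" by auto
  then have "\<bar>p L z - p L'' z\<bar> <= real n * (4 * c1 * sumM phi z)" "\<bar>p L'' z - p L' z\<bar> <= 4 * c1 * sumM phi z"
   using Suc.IH adj1 by blast+
  moreover have "real (Suc n) * (4 * c1 * sumM phi z) = real n * (4 * c1 * sumM phi z) + 4 * c1 * sumM phi z" by (simp add: algebra_simps)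
  ultimately show ?case by linarith
 qed simp
 have V: "z : mesh_vertices T" using K by (auto simp: mesh_vertices_eq)
 note ep = s[OF V]
 obtain L where L: "L : T" "z : verts L" "s z : verts L" "z ~= s z" using ep by (auto simp: EP_def)
 have sub: "adj z <= star z \<times> star z" by (auto simp: adj_def star_def)
 have fa: "finite (adj z)" by (rule finite_subset[OF sub]) (simp add: fin_star)
 \<comment> \<open>A path can be taken with at most as many steps as the relation has pairs, hence
   at most the square of the number of triangles at z.\<close>
 obtain n where n: "n <= card (adj z)" "(L, K) : adj z ^^ n"
  using star_connected[OF L(1,2) K] rtrancl_finite_eq_relpow[OF fa] by auto
 have "card (adj z) <= card (star z) * card (star z)"
  using card_mono[OF _ sub] fin_star by (simp add: card_cartesian_product)
 then have "real n <= real (card (star z)) * real (card (star z))" using n(1) by (metis le_trans of_nat_le_iff of_nat_mult)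
 also have "... <= Nb * Nb" using card_star[of z] Nb0 by (intro mult_mono) auto
 finally have nN: "real n <= Nb^2" by (simp add: power2_eq_square)
 have "szf (%t. phi (linepath z (s z) t)) - p L z = szf (%t. phi (linepath z (s z) t) - p L (linepath z (s z) t))"
  unfolding szf_diff[OF sq[OF phi ep] sq[OF sp ep]] szp ..
 then have "\<bar>szf (%t. phi (linepath z (s z) t)) - p L z\<bar> <= 2 * (c1 * sqrt (e2 phi L))"
  using szf_bound[OF sqint_diff[OF sq[OF phi ep] sq[OF sp ep]], of L] edge[OF L] by linarith
 also have "... <= 2 * (c1 * sumM phi z)" using L c_pos(1) by (intro mult_left_mono sumM_ge) (auto simp: star_def)
 finally have A: "\<bar>szf (%t. phi (linepath z (s z) t)) - p L z\<bar> <= 2 * (c1 * sumM phi z)" .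
 have "\<bar>p L z - p K z\<bar> <= real n * (4 * c1 * sumM phi z)" by (rule adjn[OF n(2)])
 also have "... <= Nb^2 * (4 * c1 * sumM phi z)" using nN c_pos(1) sumM_nonneg by (intro mult_right_mono) auto
 finally have "\<bar>szf (%t. phi (linepath z (s z) t)) - p K z\<bar> <= 2 * (c1 * sumM phi z) + Nb^2 * (4 * c1 * sumM phi z)"
  using A by linarith
 also have "... = c2 * sumM phi z" by (simp add: c2_def algebra_simps)
 finally show ?thesis by (simp add: p_def)
qed

text \<open>The inverse estimate. Bounded by B at the vertices, the affine function is bounded by B
  on the triangle; from the centre of the inscribed disc along its gradient it grows by
  \<open>norm b * (gamma * h)\<close>, which is therefore at most 2 B.\<close>

lemma affine_local:
 fixes b :: plane
 assumes K: "K : T" and v: "ALL z:verts K. \<bar>a + b \<bullet> z\<bar> <= B"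
 shows "norm b * (gamma * h) <= 2 * B"
  and "(l2 (MK K) (%x. a + b \<bullet> x))^2 + h^2 * (SUM i:UNIV. (l2 (MK K) (partial i (%x. a + b \<bullet> x)))^2) <= B^2 * (1 + 4 / gamma^2) * (pi * h^2)"
proof -
 obtain z where "z : verts K" using vertsT(2)[OF K] by (metis card.empty ex_in_conv zero_neq_numeral)
 then have B0: "B >= 0" using v abs_ge_zero order_trans by blast
 have w: "\<bar>a + b \<bullet> x\<bar> <= B" if "x : K" for x
  using affine_bound_hull[OF v] that vertsT(4)[OF K] by blast
 show g: "norm (b) * (gamma * h) <= 2 * B"
 proof (cases "b = 0")
  case False
  define v where "v = b"
  have v: "norm v > 0" using False by (simp add: v_def)
  obtain x where x: "cball x (gamma * h) <= K" using inball[OF K] by blast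
  define y where "y = x + (gamma * h / norm v) *\<^sub>R v"
  have "y : cball x (gamma * h)" "x : cball x (gamma * h)" using v h0 gamma0 by (auto simp: y_def dist_norm)
  then have "\<bar>a + v \<bullet> y\<bar> <= B" "\<bar>a + v \<bullet> x\<bar> <= B" using x w unfolding v_def by blast+
  moreover have "v \<bullet> y - v \<bullet> x = norm v * (gamma * h)"
   using v by (simp add: y_def inner_add_right power2_norm_eq_inner[symmetric] power2_eq_square)
  ultimately show ?thesis unfolding v_def[symmetric] by linarith
 qed (simp add: B0)
 let ?U = "interior K"
 have U: "bounded ?U" "open ?U" by (auto simp: factsT(6)[OF K])
 define q where "q x = a + b \<bullet> x" for x
 have sq: "sqint (MK K) q" unfolding q_def by (rule smooth_sqint[OF U smooth_affine])
 have one: "sqint (MK K) (%_. k)" for k by (rule sqint_const[OF finite_measure_lebesgue_on[OF U]])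
 have area: "measure lebesgue ?U <= pi * h^2" by (rule area_up[OF K])
 have qB: "(l2 (MK K) q)^2 <= B^2 * (pi * h^2)"
 proof -
  have "(l2 (MK K) q)^2 <= (l2 (MK K) (%_. B))^2"
  proof (intro power_mono l2_nonneg l2_le one sqint_measurable sq)
   show "AE x in MK K. \<bar>q x\<bar> <= \<bar>B\<bar>" using w B0 interior_subset[of K] by (intro AE_I2) (auto simp: q_def)
  qed
  also have "... = B^2 * measure lebesgue ?U" by (rule l2_const_sq[OF U])
  also have "... <= B^2 * (pi * h^2)" by (intro mult_left_mono area) simp
  finally show ?thesis .
 qed
 have gB: "(SUM i:UNIV. (l2 (MK K) (partial i q))^2) <= (2 * B / (gamma * h))^2 * (pi * h^2)"
 proof -
  have "partial i q = (%_. b $ i)" for i unfolding q_def by (rule ext) (rule partial_affine)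
  then have "(SUM i:UNIV. (l2 (MK K) (partial i q))^2) = (norm b)^2 * measure lebesgue ?U"
   by (simp only: l2_const_sq[OF U] sum_distrib_right[symmetric] norm_sq_components)
  also have "... <= (2 * B / (gamma * h))^2 * (pi * h^2)"
   using g h0 gamma0 by (intro mult_mono power_mono area) (auto simp: pos_le_divide_eq)
  finally show ?thesis .
 qed
 have "h^2 * ((2 * B / (gamma * h))^2 * (pi * h^2)) = B^2 * (4 / gamma^2) * (pi * h^2)"
  using h0 by (simp add: power_divide power_mult_distrib)
 moreover have "h^2 * (SUM i:UNIV. (l2 (MK K) (partial i q))^2) <= h^2 * ((2 * B / (gamma * h))^2 * (pi * h^2))"
  by (intro mult_left_mono gB) simp
 ultimately show "(l2 (MK K) (%x. a + b \<bullet> x))^2 + h^2 * (SUM i:UNIV. (l2 (MK K) (partial i (%x. a + b \<bullet> x)))^2) <= B^2 * (1 + 4 / gamma^2) * (pi * h^2)"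
  using qB unfolding q_def[abs_def] by (simp add: algebra_simps)
qed

definition MM :: "(plane => real) => plane set => real" where "MM phi K = (SUM z:verts K. sumM phi z)"

text \<open>With p the best affine function on \<open>K\<close>, the part phi - p is controlled by
  \<open>best_affine\<close>, while the interpolant minus p is affine with nodal values at most
  \<open>c2 * MM phi K\<close>, so that the inverse estimate applies.\<close>

lemma local_estimate:
 assumes phi: "smooth phi" and s: "!!z. z : mesh_vertices T ==> (z, s z) : EP" and K: "K : T"
 shows "loc (%x. phi x - szn s phi x) K <= c3 * h^2 * (MM phi K)^2"
proof -
 have "ALL K:T. EX cd. (l2 (MK K) (%x. phi x - (fst cd + snd cd \<bullet> x)))^2 +
  h^2 * (SUM i:UNIV. (l2 (MK K) (partial i (%x. phi x - (fst cd + snd cd \<bullet> x))))^2) <= 3 * h^2 * e2 phi K"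
  using best_affine[OF _ phi] by simp
 from bchoice[OF this] obtain cd where cd: "ALL K:T. (l2 (MK K) (%x. phi x - (fst (cd K) + snd (cd K) \<bullet> x)))^2 +
  h^2 * (SUM i:UNIV. (l2 (MK K) (partial i (%x. phi x - (fst (cd K) + snd (cd K) \<bullet> x))))^2) <= 3 * h^2 * e2 phi K" ..
 define c where "c = fst (cd K)"
 define d where "d = snd (cd K)"
 obtain a b where ab: "ALL x:K. szn s phi x = a + b \<bullet> x"
  using nodal(1)[OF K] unfolding szn_def affine_fun_on_def by blast
 define B where "B = c2 * MM phi K"
 have MM0: "MM phi K >= 0" unfolding MM_def by (intro sum_nonneg sumM_nonneg)
 have B0: "B >= 0" using MM0 c_pos(2) by (simp add: B_def)
 have "ALL z:verts K. \<bar>(a - c) + (b - d) \<bullet> z\<bar> <= B"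
 proof
  fix z assume z: "z : verts K"
  then have zz: "z : K" "z : mesh_vertices T" using verts_sub[OF K] K by (auto simp: mesh_vertices_eq)
  have "szn s phi z = szf (%t. phi (linepath z (s z) t))" unfolding szn_def by (rule nodal(2)[OF zz(2)])
  then have "a + b \<bullet> z = szf (%t. phi (linepath z (s z) t))" using ab zz(1) by simp
  then have "\<bar>(a + b \<bullet> z) - (c + d \<bullet> z)\<bar> <= c2 * sumM phi z"
   using nodal_values_close[OF phi s _ K z, of "%K. fst (cd K)" "%K. snd (cd K)"] cd by (simp add: c_def d_def)
  also have "... <= B" unfolding B_def MM_def
   by (intro mult_left_mono c_pos member_le_sum[OF z]) (auto simp: sumM_nonneg vertsT(1)[OF K])
  finally show "\<bar>(a - c) + (b - d) \<bullet> z\<bar> <= B" by (simp add: inner_diff_left algebra_simps)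
 qed
 note loc_q = affine_local(2)[OF K this]
 let ?U = "interior K"
 have U: "bounded ?U" "open ?U" by (auto simp: factsT(6)[OF K])
 have sq: "sqint (MK K) f" if "smooth f" for f by (rule smooth_sqint[OF U that])
 have sum2: "(l2 (MK K) (%x. f x - k x))^2 <= 2 * (l2 (MK K) f)^2 + 2 * (l2 (MK K) k)^2"
  if "sqint (MK K) f" "sqint (MK K) k" for f k
 proof -
  have "(l2 (MK K) (%x. f x - k x))^2 <= (l2 (MK K) f + l2 (MK K) k)^2"
   by (intro power_mono l2_triangle_diff that l2_nonneg)
  also have "... <= 2 * (l2 (MK K) f)^2 + 2 * (l2 (MK K) k)^2"
   using zero_le_power2[of "l2 (MK K) f - l2 (MK K) k"] by (simp add: power2_eq_square algebra_simps)
  finally show ?thesis .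
 qed
 define p where "p x = phi x - (c + d \<bullet> x)" for x
 define q where "q x = (a - c) + (b - d) \<bullet> x" for x
 have sp: "smooth p" "smooth q" unfolding p_def q_def by (intro smooth_diff phi smooth_affine)+
 have pq: "phi x - (a + b \<bullet> x) = p x - q x" for x by (simp add: p_def q_def inner_diff_left)
 have "loc (%x. phi x - szn s phi x) K = (l2 (MK K) (%x. p x - q x))^2 + h^2 * (SUM i:UNIV. (l2 (MK K) (partial i (%x. p x - q x)))^2)"
  by (rule loc_pws[OF pws_diff[OF pwsI_smooth[OF phi]] K smooth_diff[OF sp]])
   (use ab pq pws_nodal in \<open>auto simp: szn_def\<close>)
 also have "... <= (2 * (l2 (MK K) p)^2 + 2 * (l2 (MK K) q)^2) +
  h^2 * (SUM i:UNIV. 2 * (l2 (MK K) (partial i p))^2 + 2 * (l2 (MK K) (partial i q))^2)"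
 proof (intro add_mono sum2 sq sp mult_left_mono sum_mono zero_le_power2)
  have "partial i (%x. p x - q x) = (%x. partial i p x - partial i q x)" for i by (rule ext) (rule partial_diff[OF sp])
  then show "(l2 (MK K) (partial i (%x. p x - q x)))^2 <= 2 * (l2 (MK K) (partial i p))^2 + 2 * (l2 (MK K) (partial i q))^2" for i
   using sum2[OF sq[OF smooth_partial[OF sp(1)]] sq[OF smooth_partial[OF sp(2)]]] by simp
 qed
 also have "... = 2 * ((l2 (MK K) p)^2 + h^2 * (SUM i:UNIV. (l2 (MK K) (partial i p))^2)) +
  2 * ((l2 (MK K) q)^2 + h^2 * (SUM i:UNIV. (l2 (MK K) (partial i q))^2))"
  by (simp add: sum.distrib sum_distrib_left[symmetric] algebra_simps)
 also have "... <= 2 * (3 * h^2 * e2 phi K) + 2 * (B^2 * (1 + 4 / gamma^2) * (pi * h^2))"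
  using cd K loc_q unfolding p_def q_def c_def d_def by (intro add_mono mult_left_mono) auto
 also have "2 * (3 * h^2 * e2 phi K) <= 6 * h^2 * (MM phi K)^2"
 proof -
  obtain z where z: "z : verts K" using vertsT(2)[OF K] by (metis card.empty ex_in_conv zero_neq_numeral)
  have "sqrt (e2 phi K) <= sumM phi z" using z K by (intro sumM_ge) (simp add: star_def)
  also have "... <= MM phi K" unfolding MM_def
   by (intro member_le_sum[OF z]) (auto simp: sumM_nonneg vertsT(1)[OF K])
  finally have "(sqrt (e2 phi K))^2 <= (MM phi K)^2" by (intro power_mono) (auto simp: e2_nonneg)
  then have "e2 phi K <= (MM phi K)^2" using e2_nonneg by simp
  then show ?thesis by (simp add: mult_left_mono)
 qed
 finally show ?thesis by (simp add: B_def c3_def power_mult_distrib algebra_simps)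
qed

text \<open>Finite overlap. One 3 and one \<open>Nb\<close> come from Cauchy-Schwarz over the
  vertices of a triangle and over a star, the other two from exchanging sums: a vertex has at most
  \<open>Nb\<close> triangles, a triangle three vertices.\<close>

lemma sum_MM: "(SUM K:T. (MM phi K)^2) <= 9 * Nb^2 * (SUM K:T. e2 phi K)"
proof -
 define V where "V = mesh_vertices T"
 define F where "F z = (SUM K:star z. e2 phi K)" for z
 have F0: "F z >= 0" for z unfolding F_def by (intro sum_nonneg e2_nonneg)
 have 1: "(sumM phi z)^2 <= Nb * F z" for z
 proof -
  have "(sumM phi z)^2 <= (SUM K:star z. (sqrt (e2 phi K))^2) * real (card (star z))"
   unfolding sumM_def by (rule sum_squared_le_sum_of_squares)
  also have "(SUM K:star z. (sqrt (e2 phi K))^2) = F z" by (simp add: F_def e2_nonneg)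
  also have "F z * real (card (star z)) <= F z * Nb" by (intro mult_left_mono card_star F0)
  finally show ?thesis by (simp add: mult.commute)
 qed
 have vK: "verts K = {z : V. z : verts K}" if "K : T" for K using that by (auto simp: V_def mesh_vertices_eq)
 have "(SUM K:T. (MM phi K)^2) <= (SUM K:T. SUM z:verts K. 3 * (Nb * F z))"
 proof (rule sum_mono)
  fix K assume K: "K : T"
  have "(MM phi K)^2 <= (SUM z:verts K. (sumM phi z)^2) * real (card (verts K))"
   unfolding MM_def by (rule sum_squared_le_sum_of_squares)
  also have "... = (SUM z:verts K. 3 * (sumM phi z)^2)" using vertsT(2)[OF K] by (simp add: sum_distrib_left mult.commute)
  also have "... <= (SUM z:verts K. 3 * (Nb * F z))" by (intro sum_mono mult_left_mono 1) simp
  finally show "(MM phi K)^2 <= (SUM z:verts K. 3 * (Nb * F z))" .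
 qed
 also have "... = (SUM K:T. SUM z:{z : V. z : verts K}. 3 * (Nb * F z))" by (rule sum.cong[OF refl]) (use vK in simp)
 also have "... = (SUM z:V. SUM K:{K : T. z : verts K}. 3 * (Nb * F z))"
  by (rule sum.swap_restrict[OF finT]) (simp add: V_def finV)
 also have "... = (SUM z:V. 3 * Nb * (real (card (star z)) * F z))" by (simp add: star_def mult_ac)
 also have "... <= (SUM z:V. 3 * Nb * (Nb * F z))"
  by (intro sum_mono mult_left_mono mult_right_mono card_star F0) (simp add: Nb0)
 also have "... = 3 * Nb^2 * (SUM z:V. F z)" unfolding sum_distrib_left by (rule sum.cong) (auto simp: power2_eq_square)
 also have "(SUM z:V. F z) = (SUM z:V. SUM K:{K : T. z : verts K}. e2 phi K)" by (simp add: F_def star_def)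
 also have "... = (SUM K:T. SUM z:{z : V. z : verts K}. e2 phi K)"
  by (rule sum.swap_restrict[OF _ finT]) (simp add: V_def finV)
 also have "... = (SUM K:T. 3 * e2 phi K)" by (rule sum.cong[OF refl]) (use vK vertsT(2) in simp)
 finally show ?thesis by (simp add: sum_distrib_left[symmetric])
qed

text \<open>A seminorm on H^1 that sees only the oscillation of the gradient within triangles. All
  error bounds are stated in terms of it, so that the dependence on s reduces to estimating this one
  quantity.\<close>

definition sE :: "(plane => real) => real" where "sE v = sqrt (SUM K:T. e2 v K)"

lemma sE_nonneg: "sE v >= 0" by (simp add: sE_def sum_nonneg e2_nonneg)

lemma NW_h_sq:
 assumes "v : H1 Om" shows "(NW h v)^2 <= 3 * (SUM K:T. loc v K)"
proof -
 define x where "x = l2 MOm v"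
 define y where "y = h * l2 MOm (weak_partial Om 1 v)"
 define z where "z = h * l2 MOm (weak_partial Om 2 v)"
 have "NW h v = x + y + z" by (simp add: NW_def UNIV_2_eq x_def y_def z_def distrib_left)
 moreover have "(SUM K:T. loc v K) = x^2 + y^2 + z^2"
  unfolding loc_sum[OF assms] by (simp add: UNIV_2_eq x_def y_def z_def power_mult_distrib distrib_left)
 moreover have "(x + y + z)^2 <= 3 * (x^2 + y^2 + z^2)"
  using zero_le_power2[of "x - y"] zero_le_power2[of "y - z"] zero_le_power2[of "x - z"] by (simp add: power2_eq_square algebra_simps)
 ultimately show ?thesis by simp
qed

lemma szn_smooth_estimate:
 assumes phi: "smooth phi" and s: "!!z. z : mesh_vertices T ==> (z, s z) : EP"
 shows "NW h (%x. phi x - szn s phi x) <= c5 * h * sE phi"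
proof -
 have H: "(%x. phi x - szn s phi x) : H1 Om"
  unfolding szn_def by (intro pws_H1(1) pws_diff pwsI_smooth phi pws_nodal)
 have "(NW h (%x. phi x - szn s phi x))^2 <= 3 * (SUM K:T. loc (%x. phi x - szn s phi x) K)" by (rule NW_h_sq[OF H])
 also have "... <= 3 * (SUM K:T. c3 * h^2 * (MM phi K)^2)" by (intro mult_left_mono sum_mono local_estimate phi s) auto
 also have "... = 3 * (c3 * h^2) * (SUM K:T. (MM phi K)^2)" by (simp add: sum_distrib_left mult_ac)
 also have "... <= 3 * (c3 * h^2) * (9 * Nb^2 * (SUM K:T. e2 phi K))" using c_pos(3) by (intro mult_left_mono sum_MM) auto
 also have "... = (c5 * h * sE phi)^2"
  using c_pos(4) by (simp add: c5_def sE_def c4_def power_mult_distrib sum_nonneg e2_nonneg)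
 finally show ?thesis by (rule power2_le_imp_le) (use c_pos(5) h0 sE_nonneg in simp)
qed

lemma l2_MK_le: "K : T ==> sqint MOm f ==> l2 (MK K) f <= l2 MOm f"
 by (rule power2_le_imp_le[OF _ l2_nonneg]) (simp add: l2_mesh member_le_sum[where f="%K. (l2 (MK K) f)^2"] finT)

lemma sE_L2_set: "sE v = L2_set (%(K, i). osc (interior K) (weak_partial Om i v)) (T \<times> UNIV)"
 unfolding sE_def e2_def L2_set_def by (simp add: sum.cartesian_product case_prod_unfold)

text \<open>\<open>sE\<close> is the Euclidean norm of the finite family of oscillations, so
  Minkowski's inequality passes the seminorm property of \<open>osc\<close> on.\<close>

lemma sE_lin:
 assumes v: "v : H1 Om" and w: "w : H1 Om"
 shows "sE (%x. alpha * v x + beta * w x) <= \<bar>alpha\<bar> * sE v + \<bar>beta\<bar> * sE w"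
proof -
 let ?o = "%v (K, i). osc (interior K) (weak_partial Om i v)"
 have "sE (%x. alpha * v x + beta * w x) <= L2_set (%Ki. \<bar>alpha\<bar> * ?o v Ki + \<bar>beta\<bar> * ?o w Ki) (T \<times> UNIV)"
  unfolding sE_L2_set
 proof (rule L2_set_mono)
  fix Ki :: "plane set \<times> 2" assume "Ki : T \<times> UNIV"
  then obtain K i where K: "Ki = (K, i)" "K : T" by auto
  have "osc (interior K) (weak_partial Om i (%x. alpha * v x + beta * w x)) <=
   \<bar>alpha\<bar> * osc (interior K) (weak_partial Om i v) + \<bar>beta\<bar> * osc (interior K) (weak_partial Om i w)"
   by (rule osc_lin[OF factsT(6)[OF K(2)] open_interior factsT(4)[OF K(2)]])
    (intro sqint_measurable sqint_restrict[OF K(2)] H1D(2) l2_lin(1) v w AE_restrict[OF K(2)] l2_lin(3))+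
  then show "?o (%x. alpha * v x + beta * w x) Ki <= \<bar>alpha\<bar> * ?o v Ki + \<bar>beta\<bar> * ?o w Ki" by (simp add: K)
 qed (auto simp: osc_nonneg)
 also have "... <= L2_set (%Ki. \<bar>alpha\<bar> * ?o v Ki) (T \<times> UNIV) + L2_set (%Ki. \<bar>beta\<bar> * ?o w Ki) (T \<times> UNIV)"
  by (rule L2_set_triangle_ineq)
 also have "... = \<bar>alpha\<bar> * sE v + \<bar>beta\<bar> * sE w" unfolding sE_L2_set by (simp add: L2_set_right_distrib)
 finally show ?thesis .
qed

lemma sE_le_NN: assumes "v : H1 Om" shows "sE v <= real (card T) * NN v"
proof -
 have "sE v <= (SUM Ki:T \<times> UNIV. (%(K, i). osc (interior K) (weak_partial Om i v)) Ki)"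
  unfolding sE_L2_set by (rule L2_set_le_sum) (auto simp: osc_nonneg)
 also have "... = (SUM K:T. SUM i:UNIV. osc (interior K) (weak_partial Om i v))" by (simp add: sum.cartesian_product)
 also have "... <= (SUM K:T. SUM i:UNIV. l2 MOm (weak_partial Om i v))"
 proof (intro sum_mono)
  fix K i assume K: "K : T"
  have "osc (interior K) (weak_partial Om i v) <= l2 (MK K) (%x. weak_partial Om i v x - 0)"
   by (rule osc_facts(4)[OF factsT(6)[OF K] open_interior factsT(4)[OF K] sqint_restrict[OF K H1D(2)[OF assms]]])
  also have "... <= l2 MOm (weak_partial Om i v)" using l2_MK_le[OF K H1D(2)[OF assms]] by simp
  finally show "osc (interior K) (weak_partial Om i v) <= l2 MOm (weak_partial Om i v)" .
 qed
 also have "... <= (SUM K:T. NN v)" by (intro sum_mono) (simp add: NN_def l2_nonneg)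
 finally show ?thesis by simp
qed

lemma NW_nonneg: "k >= 0 ==> NW k v >= 0" by (simp add: NW_def l2_nonneg sum_nonneg)

lemma NW_zero: "NW k (%x. 0) = 0"
proof -
 have "l2 MOm (weak_partial Om i (%x. 0)) = 0" for i
  using l2_weak_partial_cong[OF sqint_zero sqint_zero has_weak_partial_zero, of i] by simp
 then show ?thesis by (simp add: NW_def)
qed

lemma NW_sum:
 assumes "finite I" "!!i. i : I ==> f i : H1 Om" "k >= 0"
 shows "(%x. SUM i:I. c i * f i x) : H1 Om & NW k (%x. SUM i:I. c i * f i x) <= (SUM i:I. \<bar>c i\<bar> * NW k (f i))"
 using assms(1,2)
proof (induction I rule: finite_induct)
 case empty
 have "pws (%x. 0)" by (rule pwsI_smooth[OF smooth_const])
 then show ?case using pws_H1(1) NW_zero by simp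
next
 case (insert i I)
 then have IH: "(%x. SUM i:I. c i * f i x) : H1 Om" "NW k (%x. SUM i:I. c i * f i x) <= (SUM i:I. \<bar>c i\<bar> * NW k (f i))" and i: "f i : H1 Om"
  by auto
 show ?case using l2_lin(1)[OF i IH(1), of "c i" 1] NW_lin[OF assms(3) i IH(1), of "c i" 1] IH(2) insert.hyps by simp
qed

lemma NW_diff3:
 assumes "u : H1 Om" "v : H1 Om" "w : H1 Om" "k >= 0"
 shows "NW k (%x. u x - w x) <= NW k (%x. u x - v x) + NW k (%x. v x - w x)"
 using NW_lin[OF assms(4) H1_diff(1)[OF assms(1,2)] H1_diff(1)[OF assms(2,3)], of 1 1] by simp

definition sznH :: "(plane => plane) => (plane => real) => plane => real" where
 "sznH s v = nodal_function T (%z. szf (%t. trace_on Om z (s z) v (linepath z (s z) t)))"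

text \<open>For a fixed mesh both sides are continuous in the H^1 norm, so the estimate extends from
  smooth functions without loss in the constant.\<close>

theorem sznH_estimate:
 assumes v: "v : H1 Om" and s: "!!z. z : mesh_vertices T ==> (z, s z) : EP"
 shows "NW h (%x. v x - sznH s v x) <= c5 * h * sE v"
proof -
 let ?V = "mesh_vertices T"
 have "ALL z:?V. EX C. tr_ok z (s z) C" using tr_ok_edge[OF s] by blast
 from bchoice[OF this] obtain C where C: "ALL z:?V. tr_ok z (s z) (C z)" ..
 have bas: "nodal_basis T z : H1 Om" for z unfolding nodal_basis_def by (intro pws_H1(1) pws_nodal)
 have nod: "nodal_function T c : H1 Om" for c by (intro pws_H1(1) pws_nodal)
 \<comment> \<open>Collects everything that depends on the mesh: the norm comparison, the number of
   triangles, the trace constants and the norms of the basis functions. It multiplies only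
   e.\<close>
 define A where "A = (1 + h) + c5 * h * real (card T) + (SUM z:?V. 2 * C z * NW h (nodal_basis T z))"
 have A0: "A >= 0" unfolding A_def using h0 c_pos(5) C
  by (intro add_nonneg_nonneg sum_nonneg mult_nonneg_nonneg NW_nonneg) (auto simp: tr_ok_def)
 have bound: "NW h (%x. v x - sznH s v x) <= c5 * h * sE v + A * e" if "e > 0" for e
 proof -
  obtain phi where phi: "smooth phi" "NN (%x. phi x - v x) <= e" using dense[OF v \<open>e > 0\<close>] by blast
  have phiH: "phi : H1 Om" by (rule smooth_H1(1)[OF phi(1)])
  have N: "NN (%x. v x - phi x) <= e" using NN_minus_commute[OF v phiH] phi(2) by simp
  have dH: "(%x. phi x - v x) : H1 Om" "(%x. v x - phi x) : H1 Om" by (intro H1_diff(1) v phiH)+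
  have uH: "szn s phi : H1 Om" "sznH s v : H1 Om" unfolding szn_def sznH_def by (rule nod)+
  have 1: "NW h (%x. v x - phi x) <= (1 + h) * e"
  proof -
   have "NW h (%x. v x - phi x) <= (1 + h) * NN (%x. v x - phi x)"
    unfolding NW_def NN_def using h0 by (simp add: distrib_left distrib_right l2_nonneg sum_nonneg)
   also have "... <= (1 + h) * e" using h0 N by (intro mult_left_mono) auto
   finally show ?thesis .
  qed
  have "sE phi <= sE v + sE (%x. phi x - v x)" using sE_lin[OF v dH(1), of 1 1] by simp
  also have "sE (%x. phi x - v x) <= real (card T) * e"
   using sE_le_NN[OF dH(1)] phi(2) by (meson mult_left_mono of_nat_0_le_iff order_trans)
  finally have "c5 * h * sE phi <= c5 * h * (sE v + real (card T) * e)" using c_pos(5) h0 by (intro mult_left_mono) auto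
  then have 2: "NW h (%x. phi x - szn s phi x) <= c5 * h * (sE v + real (card T) * e)"
   using szn_smooth_estimate[OF phi(1) s] by linarith
  define dz where "dz z = szf (%t. phi (linepath z (s z) t)) - szf (%t. trace_on Om z (s z) v (linepath z (s z) t))" for z
  have dz: "\<bar>dz z\<bar> <= 2 * C z * e" if z: "z : ?V" for z
  proof -
   have ok: "tr_ok z (s z) (C z)" using C z by blast
   have sq: "sqint II (%t. phi (linepath z (s z) t))" "sqint II (%t. trace_on Om z (s z) v (linepath z (s z) t))"
    by (intro pws_line pwsI_smooth phi EP_closure s z, rule trace_close(1)[OF ok v])
   have "\<bar>dz z\<bar> <= 2 * l2 II (%t. phi (linepath z (s z) t) - trace_on Om z (s z) v (linepath z (s z) t))"
    unfolding dz_def szf_diff[OF sq, symmetric] by (rule szf_bound[OF sqint_diff[OF sq]])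
   also have "l2 II (%t. phi (linepath z (s z) t) - trace_on Om z (s z) v (linepath z (s z) t)) <= C z * NN (%x. v x - phi x)"
    using trace_close(2)[OF ok v pwsI_smooth[OF phi(1)]] by (simp add: l2_minus_commute)
   also have "C z * NN (%x. v x - phi x) <= C z * e" using ok N by (intro mult_left_mono) (auto simp: tr_ok_def)
   finally show ?thesis by simp
  qed
  have "(%x. szn s phi x - sznH s v x) = (%x. SUM z:?V. dz z * nodal_basis T z x)"
   unfolding szn_def sznH_def nodal_diff[symmetric] dz_def by (rule nodal_sum)
  then have "NW h (%x. szn s phi x - sznH s v x) <= (SUM z:?V. \<bar>dz z\<bar> * NW h (nodal_basis T z))"
   using NW_sum[OF finV bas, of h dz] h0 by simp
  also have "... <= (SUM z:?V. 2 * C z * e * NW h (nodal_basis T z))"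
   using h0 by (intro sum_mono mult_right_mono dz NW_nonneg) auto
  finally have 3: "NW h (%x. szn s phi x - sznH s v x) <= (SUM z:?V. 2 * C z * NW h (nodal_basis T z)) * e"
   by (simp only: sum_distrib_right sum_distrib_left mult_ac)
  have "NW h (%x. v x - sznH s v x) <= NW h (%x. v x - phi x) + (NW h (%x. phi x - szn s phi x) + NW h (%x. szn s phi x - sznH s v x))"
   using NW_diff3[OF v phiH uH(2), of h] NW_diff3[OF phiH uH, of h] h0 by linarith
  also have "... <= (1 + h) * e + (c5 * h * (sE v + real (card T) * e) + (SUM z:?V. 2 * C z * NW h (nodal_basis T z)) * e)"
   by (intro add_mono 1 2 3)
  also have "... = c5 * h * sE v + A * e" by (simp add: A_def algebra_simps)
  finally show ?thesis .
 qed
 show ?thesis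
 proof (rule field_le_epsilon)
  fix e :: real assume "e > 0"
  define e' where "e' = e / (A + 1)"
  have e': "e' > 0" using \<open>e > 0\<close> A0 by (simp add: e'_def)
  have "A * e' <= (A + 1) * e'" using e' by (intro mult_right_mono) auto
  also have "... = e" unfolding e'_def using A0 by (subst mult.commute) (intro divide_mult_cancel_real, simp)
  finally show "NW h (%x. v x - sznH s v x) <= c5 * h * sE v + e" using bound[OF e'] by linarith
 qed
qed

end

section \<open>The boundary segment and its correction\<close>

lemma AE_II_finite:
 fixes p q :: plane
 assumes "p ~= q" "finite V" shows "AE t in II. t : {0<..<1} & linepath p q t ~: V"
proof -
 define N where "N = {0, 1} \<union> {t. linepath p q t : V}"
 have "finite {t. linepath p q t : V}"
  by (rule inj_on_finite[OF _ _ assms(2), of "linepath p q"]) (auto intro!: inj_onI dest: linepath_inj[OF assms(1)])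
 then have "finite N" by (simp add: N_def)
 then have "N : null_sets lebesgue" using negligible_finite negligible_iff_null_sets by blast
 then have "AE t in lebesgue. t ~: N" by (rule AE_not_in)
 then have "AE t in II. t ~: N" by (subst AE_restrict_space_iff) (auto elim: eventually_mono)
 then show ?thesis by (rule AE_mp) (rule AE_I2, auto simp: N_def space_restrict_space)
qed

lemma szf_zero_AE: assumes "AE t in II. u t = 0" shows "szf u = 0"
 unfolding szf_def by (rule integral_eq_zero_AE) (use assms in \<open>auto elim: eventually_mono\<close>)

lemma linepath_open_segment: "p ~= q ==> t : {0<..<1} ==> linepath p q t : open_segment p q"
 by (auto simp: in_segment linepath_def)

locale fmesh = rmesh +
 fixes \<Gamma>D \<Gamma>T :: "plane set" and a b :: plane and \<sigma> :: "plane => plane"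
 assumes fr: "frontier Om = closure (\<Gamma>D \<union> \<Gamma>T)" and disj: "\<Gamma>D \<inter> \<Gamma>T = {}"
  and openT: "openin (top_of_set (frontier Om)) \<Gamma>T" and ab: "a ~= b" and \<Gamma>T: "\<Gamma>T = open_segment a b"
  and conf: "!!E. E : mesh_edges T ==> E <= frontier Om ==> rel_interior E <= \<Gamma>D | rel_interior E <= \<Gamma>T"
  and sz: "sz_choice Om \<Gamma>D T \<sigma>"
begin

abbreviation "V \<equiv> mesh_vertices T"
abbreviation "l \<equiv> linepath a b"

lemma frD: "closure \<Gamma>D <= frontier Om" "\<Gamma>T <= frontier Om"
 unfolding fr using closure_mono[of \<Gamma>D "\<Gamma>D \<union> \<Gamma>T"] closure_subset[of "\<Gamma>D \<union> \<Gamma>T"] by auto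

text \<open>By openness of \<Gamma>T in the frontier. This is why nodal corrections at vertices in
  \<Gamma>T leave the condition on \<Gamma>D intact.\<close>

lemma closure_disj: "closure \<Gamma>D \<inter> \<Gamma>T = {}"
proof -
 obtain U where U: "open U" "\<Gamma>T = frontier Om \<inter> U" using openT by (auto simp: openin_open)
 have "U \<inter> \<Gamma>D = {}" using U(2) frD(1) closure_subset[of \<Gamma>D] disj by blast
 then have "U \<inter> closure \<Gamma>D = {}" using open_Int_closure_eq_empty[OF U(1)] by blast
 then show ?thesis using U(2) by blast
qed

lemma ab_frontier: "closed_segment a b <= frontier Om"
proof -
 have "closure \<Gamma>T <= frontier Om" using frD(2) frontier_closed closure_minimal by blast
 then show ?thesis using ab by (simp add: \<Gamma>T)
qed

lemma ab_closure: "closed_segment a b <= closure Om"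
 using ab_frontier by (auto simp: frontier_def)

lemma notin_Om: "x : frontier Om ==> x ~: Om" using opn by (auto simp: frontier_def interior_open)

lemma boundary_edge:
 assumes "(z, y) : EP" "closed_segment z y <= frontier Om"
 shows "open_segment z y <= \<Gamma>D & closed_segment z y <= closure \<Gamma>D | open_segment z y <= \<Gamma>T & closed_segment z y <= closed_segment a b"
proof -
 have zy: "z ~= y" using assms(1) by (auto simp: EP_def)
 have "open_segment z y <= \<Gamma>D | open_segment z y <= \<Gamma>T"
  using conf[OF _ assms(2)] assms(1) zy by (simp add: EP_iff rel_interior_closed_segment)
 moreover have "closed_segment z y <= closure S" if "open_segment z y <= S" for S
  using closure_mono[OF that] zy by simp
 ultimately show ?thesis using ab unfolding \<Gamma>T by (metis closure_open_segment)
qed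

text \<open>The point lies on some edge of the mesh, and by \<open>edge_dichotomy\<close> an open
  edge that is not contained in \<open>Om\<close> misses it entirely.\<close>

lemma frontier_point:
 assumes "x : frontier Om" "x ~: V"
 shows "EX z y. (z, y) : EP & x : open_segment z y & closed_segment z y <= frontier Om"
proof -
 obtain E where "E : mesh_edges T" "x : E" using frontier_domain_edge[OF assms(1)] by blast
 then obtain K z y where K: "K : T" "z : verts K" "y : verts K" "z ~= y" and x: "x : closed_segment z y"
  by (auto simp: edge_iff)
 have "z : V" "y : V" using K by (auto simp: mesh_vertices_eq)
 then have xo: "x : open_segment z y" using x assms(2) by (auto simp: open_segment_def)
 have "open_segment z y \<inter> Om = {}" using edge_dichotomy[OF K] xo notin_Om[OF assms(1)] by blast
 moreover have ep: "(z, y) : EP" using K by (auto simp: EP_def)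
 ultimately have "open_segment z y <= frontier Om"
  using EP_closure[OF ep] opn segment_open_subset_closed[of z y] by (auto simp: frontier_def interior_open)
 then have "closure (open_segment z y) <= frontier Om" using frontier_closed closure_minimal by blast
 then show ?thesis using ep xo K(4) by auto
qed

lemma \<Gamma>T_point:
 assumes "x : \<Gamma>T" "x ~: V"
 shows "EX z y. (z, y) : EP & x : open_segment z y & closed_segment z y <= closed_segment a b"
 using frontier_point[of x] assms frD(2) boundary_edge disj by blast

text \<open>\<open>H1_D\<close> tests all segments in the frontier. Off the vertices, a point of
  \<Gamma>D is interior to a boundary edge, which lies in the closure of \<Gamma>D because the mesh
  resolves the two boundary parts; both end values are then 0.\<close>

lemma nodal_H1D:
 assumes "!!z. z : V ==> z : closure \<Gamma>D ==> c z = 0"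
 shows "nodal_function T c : P1 T \<inter> H1_D Om \<Gamma>D"
proof
 show "nodal_function T c : P1 T"
  using nodal(1) interior_subset by (fastforce simp: P1_def affine_fun_on_def)
 have "AE t in II. linepath p q t : \<Gamma>D --> trace_on Om p q (nodal_function T c) (linepath p q t) = 0"
  if pq: "p ~= q" "closed_segment p q <= frontier Om" for p q
 proof -
  obtain C where C: "tr_ok p q C" using tr_ok_frontier[OF pq] by blast
  show ?thesis using trace_pws[OF C pws_nodal[of c]] AE_II_finite[OF pq(1) finV]
  proof eventually_elim
   case (elim t)
   let ?x = "linepath p q t"
   have "nodal_function T c ?x = 0" if x: "?x : \<Gamma>D"
   proof -
    have xf: "?x : frontier Om" using x frD(1) closure_subset by blast
    obtain z y where zy: "(z, y) : EP" "?x : open_segment z y" "closed_segment z y <= frontier Om"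
     using frontier_point[OF xf] elim(2) by blast
    then have "closed_segment z y <= closure \<Gamma>D" using boundary_edge[OF zy(1,3)] x disj by blast
    then have "z : closure \<Gamma>D" "y : closure \<Gamma>D" by auto
    moreover have "z : V" "y : V" using zy(1) by (auto simp: EP_def mesh_vertices_eq)
    ultimately have "c z = 0" "c y = 0" using assms by blast+
    moreover obtain s where "s : {0..1}" "?x = linepath z y s"
     using segment_open_subset_closed[of z y] zy(2) by (force simp: in_segment linepath_def)
    ultimately show ?thesis using nodal_line[OF zy(1)] by simp
   qed
   then show ?case using elim(1) by simp
  qed
 qed
 then show "nodal_function T c : H1_D Om \<Gamma>D" using pws_H1(1)[OF pws_nodal] by (simp add: H1_D_def)
qed

lemma H1_D_H1: "v : H1_D Om \<Gamma>D ==> v : H1 Om" by (simp add: H1_D_def)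

lemma H1_D_lin:
 assumes v: "v : H1_D Om \<Gamma>D" and w: "w : H1_D Om \<Gamma>D"
 shows "(%x. alpha * v x + beta * w x) : H1_D Om \<Gamma>D"
proof -
 have "AE t in II. linepath p q t : \<Gamma>D --> trace_on Om p q (%x. alpha * v x + beta * w x) (linepath p q t) = 0"
  if pq: "p ~= q" "closed_segment p q <= frontier Om" for p q
 proof -
  obtain C where C: "tr_ok p q C" using tr_ok_frontier[OF pq] by blast
  have "AE t in II. linepath p q t : \<Gamma>D --> trace_on Om p q u (linepath p q t) = 0" if "u : H1_D Om \<Gamma>D" for u
   using that pq by (simp add: H1_D_def)
  from this[OF v] this[OF w] trace_lin[OF C H1_D_H1[OF v] H1_D_H1[OF w], of alpha beta]
  show ?thesis by eventually_elim simp
 qed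
 then show ?thesis using l2_lin(1)[OF H1_D_H1[OF v] H1_D_H1[OF w]] by (simp add: H1_D_def)
qed

lemma P1_lin: "u : P1 T ==> w : P1 T ==> (%x. alpha * u x + beta * w x) : P1 T"
 unfolding P1_def by (intro CollectI ballI affine_fun_on_add affine_fun_on_cmult) auto

lemma \<sigma>_EP: "z : V ==> (z, \<sigma> z) : EP" using sz by (simp add: sz_choice_def EP_iff)

text \<open>Replaces the dual basis functions by \<open>szf\<close> in the parameter of the edge,
  the form in which the estimates are proved.\<close>

lemma scott_zhang_eq: "scott_zhang Om T \<sigma> v = sznH \<sigma> v"
 unfolding scott_zhang_def
proof (rule nodal_eq)
 show "sznH \<sigma> v z = seg_integral z (\<sigma> z) (%x. sz_dual T z (\<sigma> z) x * trace_on Om z (\<sigma> z) v x)" if "z : V" for z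
  unfolding scott_zhang_value[OF \<sigma>_EP[OF that]] sznH_def by (rule nodal(2)[OF that])
qed (simp_all add: sznH_def nodal)

text \<open>For a vertex in the closure of \<Gamma>D the chosen edge lies there too, and its open
  part lies in \<Gamma>D. The trace vanishes almost everywhere on it, and with it the nodal
  value.\<close>

lemma sznH_H1D:
 assumes v: "v : H1_D Om \<Gamma>D" shows "sznH \<sigma> v : P1 T \<inter> H1_D Om \<Gamma>D"
 unfolding sznH_def
proof (rule nodal_H1D)
 fix z assume z: "z : V" "z : closure \<Gamma>D"
 have zy: "z ~= \<sigma> z" using \<sigma>_EP[OF z(1)] by (auto simp: EP_def)
 have c: "closed_segment z (\<sigma> z) <= closure \<Gamma>D" using sz z by (simp add: sz_choice_def)
 then have f: "closed_segment z (\<sigma> z) <= frontier Om" using frD(1) by blast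
 have ne: "open_segment z (\<sigma> z) ~= {}" using zy by simp
 have op: "open_segment z (\<sigma> z) <= \<Gamma>D"
  using boundary_edge[OF \<sigma>_EP[OF z(1)] f] c closure_disj segment_open_subset_closed[of z "\<sigma> z"] ne by blast
 have "AE t in II. linepath z (\<sigma> z) t : \<Gamma>D --> trace_on Om z (\<sigma> z) v (linepath z (\<sigma> z) t) = 0"
  using v zy f by (simp add: H1_D_def)
 then have "AE t in II. trace_on Om z (\<sigma> z) v (linepath z (\<sigma> z) t) = 0"
  using AE_II_finite[OF zy finV] by eventually_elim (use op linepath_open_segment[OF zy] in blast)
 then show "szf (%t. trace_on Om z (\<sigma> z) v (linepath z (\<sigma> z) t)) = 0" by (rule szf_zero_AE)
qed

text \<open>The end points of the segment are left out: members of \<open>W_h\<close> vanish there,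
  and a correction at an end point could violate the condition on \<Gamma>D.\<close>

definition Z :: "plane set" where "Z = V \<inter> \<Gamma>T"

lemma finZ: "finite Z" using finV by (simp add: Z_def)

lemma Z_edge: assumes "z : Z" shows "(z, \<sigma> z) : EP" "closed_segment z (\<sigma> z) <= closed_segment a b"
proof -
 have z: "z : V" "z : \<Gamma>T" using assms by (auto simp: Z_def)
 show ep: "(z, \<sigma> z) : EP" by (rule \<sigma>_EP[OF z(1)])
 have "closed_segment z (\<sigma> z) <= frontier Om" using sz z frD(2) by (auto simp: sz_choice_def)
 then show "closed_segment z (\<sigma> z) <= closed_segment a b"
  using boundary_edge[OF ep] z(2) closure_disj ends_in_segment(1)[of z "\<sigma> z"] by blast
qed

text \<open>Reduces testing against all of \<open>W_h\<close> to testing against the finitely many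
  hat functions of \<open>Z\<close>. Off the vertices a point lies in an open edge on which both
  sides are affine with equal end values.\<close>

lemma W_h_nodal:
 assumes w: "w : W_h a b T"
 shows "AE t in II. w (l t) = nodal_function T (%z. if z : Z then w z else 0) (l t)"
 using AE_II_finite[OF ab finV]
proof eventually_elim
 case (elim t)
 let ?c = "%z. if z : Z then w z else 0"
 have "l t : \<Gamma>T" using linepath_open_segment[OF ab] elim by (simp add: \<Gamma>T)
 then obtain z y where zy: "(z, y) : EP" "l t : open_segment z y" "closed_segment z y <= closed_segment a b"
  using \<Gamma>T_point elim by blast
 have c: "?c u = w u" if "u : V" "u : closed_segment a b" for u
 proof -
  have "u : \<Gamma>T | u = a | u = b" using that(2) unfolding \<Gamma>T open_segment_def by auto
  then show ?thesis using w that(1) by (auto simp: Z_def W_h_def)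
 qed
 have V: "z : V" "y : V" using zy(1) by (auto simp: EP_def mesh_vertices_eq)
 have zc: "?c z = w z" "?c y = w y" using zy(3) by (intro c V; force)+
 obtain s where s: "s : {0..1}" "l t = linepath z y s"
  using segment_open_subset_closed[of z y] zy(2) by (force simp: in_segment linepath_def)
 have "affine_fun_on (closed_segment z y) w" using w zy(1,3) by (auto simp: W_h_def EP_iff)
 then obtain alpha beta where aff: "ALL x:closed_segment z y. w x = alpha + beta \<bullet> x" by (auto simp: affine_fun_on_def)
 have "w (linepath z y s) = alpha + beta \<bullet> linepath z y s"
  using aff s(1) by (simp add: linepath_in_path)
 also have "... = (alpha + beta \<bullet> z) + (beta \<bullet> (y - z)) * s" using fun_cong[OF affine_line] by blast
 also have "... = w z + (w y - w z) * s" using aff by (simp add: inner_diff_right)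
 finally show ?case using nodal_line[OF zy(1) s(1), of ?c] s(2) zc by simp
qed

end

section \<open>Orthogonal projection onto finitely many functions\<close>

lemma integral_mult_lin:
 assumes "sqint M f" "sqint M g" "sqint M k"
 shows "(LINT x|M. (f x - t * g x) * k x) = (LINT x|M. f x * k x) - t * (LINT x|M. g x * k x)"
proof -
 have "(%x. (f x - t * g x) * k x) = (%x. f x * k x - t * (g x * k x))" by (simp add: algebra_simps)
 then show ?thesis using sqint_mult_integrable[OF assms(1,3)] sqint_mult_integrable[OF assms(2,3)] by simp
qed

lemma integral_mult_sum:
 assumes "sqint M f" "!!z. z : S ==> sqint M (g z)"
 shows "(LINT x|M. f x * (SUM z:S. c z * g z x)) = (SUM z:S. c z * (LINT x|M. f x * g z x))"
proof -
 have "(%x. f x * (SUM z:S. c z * g z x)) = (%x. SUM z:S. c z * (f x * g z x))" by (simp add: sum_distrib_left mult_ac)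
 then show ?thesis using sqint_mult_integrable[OF assms(1) assms(2)] by simp
qed

text \<open>Gram-Schmidt by induction for possibly dependent functions: the new function is replaced
  by its residual \<open>e\<close>, which is orthogonal to the previous ones.\<close>

lemma projection_ex:
 assumes "finite S" "ALL z:S. sqint M (f z)"
 shows "ALL r. sqint M r --> (EX c. ALL z:S. (LINT x|M. (r x - (SUM y:S. c y * f y x)) * f z x) = 0)"
 using assms
proof (induction S rule: finite_induct)
 case (insert u S)
 have fu: "sqint M (f u)" and fS: "!!z. z : S ==> sqint M (f z)" using insert.prems by auto
 have sS: "sqint M (%x. SUM y:S. c y * f y x)" for c by (intro sqint_sum sqint_cmult fS)
 show ?case
 proof (intro allI impI)
  fix r assume r: "sqint M r"
  obtain c where c: "ALL z:S. (LINT x|M. (r x - (SUM y:S. c y * f y x)) * f z x) = 0" using insert.IH insert.prems r by auto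
  obtain d where d: "ALL z:S. (LINT x|M. (f u x - (SUM y:S. d y * f y x)) * f z x) = 0" using insert.IH insert.prems fu by auto
  define r' where "r' x = r x - (SUM y:S. c y * f y x)" for x
  define e where "e x = f u x - (SUM y:S. d y * f y x)" for x
  have sr: "sqint M r'" unfolding r'_def by (intro sqint_diff r sS)
  have se: "sqint M e" unfolding e_def by (intro sqint_diff fu sS)
  \<comment> \<open>If \<open>e\<close> has norm 0, the quotient is 0 by convention. This is the
    right coefficient, because Cauchy-Schwarz then makes all inner products with \<open>e\<close>
    vanish.\<close>
  define t where "t = (LINT x|M. r' x * e x) / (l2 M e)^2"
  define k where "k x = r' x - t * e x" for x
  have sk: "sqint M k" unfolding k_def by (intro sqint_diff sqint_cmult sr se)
  have kS: "(LINT x|M. k x * f z x) = 0" if "z : S" for z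
   unfolding k_def integral_mult_lin[OF sr se fS[OF that]] using c d that by (simp add: r'_def e_def)
  have "(LINT x|M. k x * e x) = (LINT x|M. r' x * e x) - t * (l2 M e)^2"
   unfolding k_def integral_mult_lin[OF sr se se] l2_sq by (simp add: power2_eq_square)
  also have "... = 0"
   using l2_Cauchy_Schwarz[OF sr se] by (cases "l2 M e = 0") (auto simp: t_def)
  finally have ke: "(LINT x|M. k x * e x) = 0" .
  have "(LINT x|M. k x * f u x) = (LINT x|M. k x * e x + k x * (SUM y:S. d y * f y x))"
   by (simp add: e_def algebra_simps)
  also have "... = (SUM z:S. d z * (LINT x|M. k x * f z x))"
   using sqint_mult_integrable[OF sk se] sqint_mult_integrable[OF sk sS[of d]] ke
   by (subst integral_mult_sum[OF sk fS, symmetric]) simp_all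
  also have "... = 0" using kS by simp
  finally have ku: "(LINT x|M. k x * f u x) = 0" .
  define c' where "c' y = (if y = u then t else c y - t * d y)" for y
  have "(SUM y:S. c' y * f y x) = (SUM y:S. c y * f y x) - t * (SUM y:S. d y * f y x)" for x
   unfolding sum_distrib_left sum_subtractf[symmetric]
   by (rule sum.cong) (use insert.hyps(2) in \<open>auto simp: c'_def algebra_simps\<close>)
  then have "r x - (SUM y:insert u S. c' y * f y x) = k x" for x
   using insert.hyps by (simp add: k_def r'_def e_def c'_def algebra_simps)
  then show "EX c. ALL z:insert u S. (LINT x|M. (r x - (SUM y:insert u S. c y * f y x)) * f z x) = 0"
   using kS ku by (intro exI[of _ c']) auto
 qed
qed simp

text \<open>Since the residual is orthogonal to the span, the inner product of r with its projection
  s is the squared norm of s; Cauchy-Schwarz gives the bound.\<close>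

lemma projection:
 assumes "finite S" "ALL z:S. sqint M (f z)" "sqint M r"
 shows "EX c. (ALL z:S. (LINT x|M. (r x - (SUM y:S. c y * f y x)) * f z x) = 0) & l2 M (%x. SUM y:S. c y * f y x) <= l2 M r"
proof -
 obtain c where c: "ALL z:S. (LINT x|M. (r x - (SUM y:S. c y * f y x)) * f z x) = 0" using projection_ex[OF assms(1,2)] assms(3) by blast
 define s where "s x = (SUM y:S. c y * f y x)" for x
 have ss: "sqint M s" unfolding s_def using assms(2) by (intro sqint_sum sqint_cmult) auto
 have "(LINT x|M. (r x - s x) * s x) = (SUM z:S. c z * (LINT x|M. (r x - s x) * f z x))"
  using integral_mult_sum[OF sqint_diff[OF assms(3) ss], of S f c] assms(2) by (simp add: s_def)
 also have "... = 0" using c by (simp add: s_def)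
 finally have "(LINT x|M. r x * s x) = (l2 M s)^2"
  using integral_mult_lin[OF assms(3) ss ss, of 1] l2_sq[of M s] by (simp add: power2_eq_square)
 then have "l2 M s * l2 M s <= l2 M r * l2 M s" using l2_Cauchy_Schwarz[OF assms(3) ss] by (simp add: power2_eq_square)
 then have "l2 M s <= l2 M r" using l2_nonneg[of M s] l2_nonneg[of M r] by (cases "l2 M s = 0") (auto simp: mult_le_cancel_right)
 then show ?thesis using c unfolding s_def by blast
qed

lemma sum_UN_le:
 fixes g :: "'a => real"
 assumes "finite I" "!!i. i : I ==> finite (A i)" "!!x. g x >= 0"
 shows "(SUM x:(UN i:I. A i). g x) <= (SUM i:I. SUM x:A i. g x)"
 using assms(1,2)
proof (induction I rule: finite_induct)
 case (insert i I)
 have "(SUM x:A i \<union> (UN i:I. A i). g x) <= (SUM x:A i. g x) + (SUM x:(UN i:I. A i). g x)"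
  using insert by (subst sum.union_inter[symmetric]) (auto intro!: sum_nonneg assms(3))
 then show ?case using insert by force
qed simp

section \<open>Trace and inverse estimates on the boundary segment\<close>

context fmesh
begin

lemma sqint_l: "pws f ==> sqint II (%t. f (l t))" by (rule pws_line[OF _ ab_closure])

lemma NW_sq: "v : H1 Om ==> (SUM K:T. loc v K) <= (NW h v)^2"
 unfolding loc_sum NW_def using h0
 by (simp add: UNIV_2_eq power2_eq_square algebra_simps l2_nonneg add_nonneg_nonneg)

text \<open>Up to finitely many parameters the segment is covered by mesh edges, whose traces are
  bounded within a triangle. The 9 bounds the number of ordered vertex pairs of a triangle, and the
  length at most h of an edge turns \<open>Ct / h^2\<close> into \<open>Ct / h\<close>.\<close>

lemma boundary_trace:
 assumes f: "pws f"
 shows "dist a b * (l2 II (%t. f (l t)))^2 <= 9 * Ct / h * (NW h f)^2"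
proof -
 define G where "G K = {zy : verts K \<times> verts K. fst zy ~= snd zy}" for K
 let ?g = "%zy. dist (fst zy) (snd zy) * (l2 II (%t. f (linepath (fst zy) (snd zy) t)))^2"
 have G: "finite (G K)" "real (card (G K)) <= 9" if "K : T" for K
 proof -
  have s: "G K <= verts K \<times> verts K" "finite (verts K \<times> verts K)" using vertsT(1)[OF that] by (auto simp: G_def)
  show "finite (G K)" by (rule finite_subset[OF s])
  show "real (card (G K)) <= 9" using card_mono[OF s(2,1)] vertsT(2)[OF that] by (simp add: card_cartesian_product)
 qed
 have EP: "EP = (UN K:T. G K)" by (auto simp: EP_def G_def)
 have "dist a b * (l2 II (%t. f (l t)))^2 <= (SUM zy:EP. ?g zy)"
 proof (rule seg_bound[OF f ab ab_closure order_refl, of "{t. l t : V} \<union> {0, 1}"])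
  show "finite ({t. l t : V} \<union> {0, 1})"
   using inj_on_finite[OF _ _ finV, of l "{t. l t : V}"] linepath_inj[OF ab] by (auto simp: inj_on_def)
  fix t :: real assume t: "t : {0..1}" "t ~: {t. l t : V} \<union> {0, 1}"
  then have "l t : \<Gamma>T" "l t ~: V" unfolding \<Gamma>T by (auto intro!: linepath_open_segment ab)
  then obtain z y where "(z, y) : EP" "l t : open_segment z y" using \<Gamma>T_point by blast
  then show "EX zy:EP. l t : closed_segment (fst zy) (snd zy)" using segment_open_subset_closed by force
 qed
 also have "... <= (SUM K:T. SUM zy:G K. ?g zy)" unfolding EP by (rule sum_UN_le[OF finT G(1)]) auto
 also have "... <= (SUM K:T. 9 * (Ct / h * loc f K))"
 proof (rule sum_mono)
  fix K assume K: "K : T"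
  have "?g zy <= Ct / h * loc f K" if zy: "zy : G K" for zy
  proof -
   obtain z y where zy: "zy = (z, y)" "z : verts K" "y : verts K" "z ~= y" using zy by (auto simp: G_def)
   have "dist z y * (l2 II (%t. f (linepath z y t)))^2 <= h * (Ct / h^2 * loc f K)"
    using zy K verts_sub[OF K] h0 by (intro mult_mono diam[OF K] edge_trace[OF f K]) auto
   then show ?thesis using h0 by (simp add: zy power2_eq_square)
  qed
  then have "(SUM zy:G K. ?g zy) <= real (card (G K)) * (Ct / h * loc f K)" by (rule sum_bounded_above)
  also have "... <= 9 * (Ct / h * loc f K)" using G(2)[OF K] Ct_pos h0 loc_nonneg by (intro mult_right_mono) auto
  finally show "(SUM zy:G K. ?g zy) <= 9 * (Ct / h * loc f K)" .
 qed
 also have "... = 9 * Ct / h * (SUM K:T. loc f K)" unfolding sum_distrib_left by (rule sum.cong) auto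
 also have "... <= 9 * Ct / h * (NW h f)^2" using Ct_pos h0 by (intro mult_left_mono NW_sq pws_H1(1) f) auto
 finally show ?thesis .
qed

text \<open>The length of the segment appears because \<open>l2\<close> over the unit interval is
  not weighted by arc length.\<close>

definition kt :: real where "kt = sqrt (9 * Ct / (h * dist a b))"

lemma kt: "kt >= 0" "dist a b * (kt * x)^2 = 9 * Ct / h * x^2"
proof -
 show "kt >= 0" using Ct_pos h0 by (simp add: kt_def)
 have "kt^2 * dist a b = 9 * Ct / h" using Ct_pos h0 ab by (simp add: kt_def)
 then show "dist a b * (kt * x)^2 = 9 * Ct / h * x^2" by (metis mult.assoc mult.commute power_mult_distrib)
qed

lemma boundary_trace_l2: assumes "pws f" shows "l2 II (%t. f (l t)) <= kt * NW h f"
proof (rule power2_le_imp_le)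
 have "dist a b * (l2 II (%t. f (l t)))^2 <= dist a b * (kt * NW h f)^2"
  using boundary_trace[OF assms] unfolding kt(2) .
 then show "(l2 II (%t. f (l t)))^2 <= (kt * NW h f)^2" using ab by simp
qed (use kt(1) NW_nonneg h0 in simp)

lemma ab_tr: obtains C where "tr_ok a b C" using tr_ok_frontier[OF ab ab_frontier] by blast

text \<open>Extends the quantitative trace bound from piecewise smooth functions to v - u; the
  mesh-dependent constant \<open>C\<close> multiplies only the density error e.\<close>

lemma trace_sub_pws:
 assumes v: "v : H1 Om" and u: "pws u"
 shows "sqint II (%t. trace_on Om a b v (l t) - u (l t))"
  and "l2 II (%t. trace_on Om a b v (l t) - u (l t)) <= kt * NW h (%x. v x - u x)"
proof -
 obtain C where C: "tr_ok a b C" by (rule ab_tr)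
 have C0: "C >= 0" using C by (simp add: tr_ok_def)
 have st: "sqint II (%t. trace_on Om a b v (l t))" by (rule trace_close(1)[OF C v])
 show "sqint II (%t. trace_on Om a b v (l t) - u (l t))" by (intro sqint_diff st sqint_l u)
 have uH: "u : H1 Om" by (rule pws_H1(1)[OF u])
 define A where "A = C + kt * (1 + h)"
 have A0: "A >= 0" using C0 kt(1) h0 by (simp add: A_def)
 have bound: "l2 II (%t. trace_on Om a b v (l t) - u (l t)) <= kt * NW h (%x. v x - u x) + A * e" if "e > 0" for e
 proof -
  obtain phi where phi: "smooth phi" "NN (%x. phi x - v x) <= e" using dense[OF v \<open>e > 0\<close>] by blast
  have phiH: "phi : H1 Om" by (rule smooth_H1(1)[OF phi(1)])
  have N: "NN (%x. v x - phi x) <= e" using NN_minus_commute[OF v phiH] phi(2) by simp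
  have "l2 II (%t. trace_on Om a b v (l t) - u (l t)) <= l2 II (%t. trace_on Om a b v (l t) - phi (l t)) + l2 II (%t. phi (l t) - u (l t))"
   by (intro l2_triangle3 st sqint_l u pwsI_smooth phi)
  also have "... <= C * NN (%x. v x - phi x) + kt * NW h (%x. phi x - u x)"
   by (intro add_mono trace_close(2)[OF C v] boundary_trace_l2 pws_diff pwsI_smooth phi u)
  also have "... <= C * e + kt * ((1 + h) * e + NW h (%x. v x - u x))"
  proof (intro add_mono mult_left_mono N C0 kt(1))
   have "NW h (%x. phi x - v x) <= (1 + h) * NN (%x. phi x - v x)"
    unfolding NW_def NN_def using h0 by (simp add: distrib_left distrib_right l2_nonneg sum_nonneg)
   also have "... <= (1 + h) * e" using h0 phi(2) by (intro mult_left_mono) auto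
   finally show "NW h (%x. phi x - u x) <= (1 + h) * e + NW h (%x. v x - u x)"
    using NW_diff3[OF phiH v uH, of h] h0 by linarith
  qed
  also have "... = kt * NW h (%x. v x - u x) + A * e" by (simp add: A_def algebra_simps)
  finally show ?thesis .
 qed
 show "l2 II (%t. trace_on Om a b v (l t) - u (l t)) <= kt * NW h (%x. v x - u x)"
 proof (rule field_le_epsilon)
  fix e :: real assume "e > 0"
  define e' where "e' = e / (A + 1)"
  have e': "e' > 0" using \<open>e > 0\<close> A0 by (simp add: e'_def)
  have "A * e' <= (A + 1) * e'" using e' by (intro mult_right_mono) auto
  also have "... = e" unfolding e'_def using A0 by (subst mult.commute) (intro divide_mult_cancel_real, simp)
  finally show "l2 II (%t. trace_on Om a b v (l t) - u (l t)) <= kt * NW h (%x. v x - u x) + e" using bound[OF e'] by linarith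
 qed
qed

text \<open>Off the vertices, a point of the boundary segment lies on chosen edges of the vertices of a
 single triangle only, hence the constant 3.\<close>

lemma chosen_edges_overlap:
 assumes f: "pws f"
 shows "(SUM z:Z. dist z (\<sigma> z) * (l2 II (%t. f (linepath z (\<sigma> z) t)))^2) <= 3 * (dist a b * (l2 II (%t. f (l t)))^2)"
proof -
 define F where "F x = ennreal ((indicator (closure Om) x *\<^sub>R f x)^2)" for x
 have F: "F : borel_measurable borel" unfolding F_def by (rule pws_borel[OF f])
 have lm: "l : borel_measurable borel" unfolding linepath_def by (intro borel_measurable_continuous_onI continuous_intros)
 have Fl: "(%t. F (l t)) : borel_measurable borel" using measurable_compose[OF lm F] .
 have cl: "closed_segment z y : sets borel" for z y :: plane by (intro borel_closed closed_segment)
 have il: "(%t. indicator (closed_segment z y) (l t) :: ennreal) : borel_measurable borel" for z y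
  by (rule measurable_compose[OF lm]) (use cl in measurable)
 have e: "ennreal (dist z (\<sigma> z) * (l2 II (%t. f (linepath z (\<sigma> z) t)))^2) =
  ennreal (dist a b) * (\<integral>\<^sup>+t. F (l t) * indicator (closed_segment z (\<sigma> z)) (l t) \<partial>lborel)" if z: "z : Z" for z
 proof -
  have "z : closed_segment a b" "\<sigma> z : closed_segment a b" using Z_edge(2)[OF z] by auto
  then obtain alpha beta where ab': "z = l alpha" "\<sigma> z = l beta" by (auto simp: in_segment linepath_def)
  moreover have "z ~= \<sigma> z" using Z_edge(1)[OF z] by (auto simp: EP_def)
  ultimately have "alpha ~= beta" by auto
  note seg_transfer[OF ab ab' this F]
  moreover have "ennreal ((l2 II (%t. f (linepath z (\<sigma> z) t)))^2) = (\<integral>\<^sup>+t. F (linepath z (\<sigma> z) t) * indicator {0..1} t \<partial>lborel)"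
   unfolding F_def by (rule l2_line_nn[OF f EP_closure[OF Z_edge(1)[OF z]]])
  ultimately show ?thesis by (simp add: ennreal_mult)
 qed
 have "ennreal (SUM z:Z. dist z (\<sigma> z) * (l2 II (%t. f (linepath z (\<sigma> z) t)))^2) =
  (SUM z:Z. ennreal (dist a b) * (\<integral>\<^sup>+t. F (l t) * indicator (closed_segment z (\<sigma> z)) (l t) \<partial>lborel))"
  unfolding sum_ennreal[symmetric, OF mult_nonneg_nonneg[OF zero_le_dist zero_le_power2]] by (rule sum.cong[OF refl e])
 also have "... = ennreal (dist a b) * (\<integral>\<^sup>+t. (SUM z:Z. F (l t) * indicator (closed_segment z (\<sigma> z)) (l t)) \<partial>lborel)"
  by (subst nn_integral_sum) (auto intro!: borel_measurable_times_ennreal Fl il simp: sum_distrib_left)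
 also have "... <= ennreal (dist a b) * (\<integral>\<^sup>+t. 3 * (F (l t) * indicator {0..1} t) \<partial>lborel)"
 proof (intro mult_left_mono nn_integral_mono_AE)
  have "finite {t. l t : V}" using inj_on_finite[OF _ _ finV, of l "{t. l t : V}"] linepath_inj[OF ab] by (auto simp: inj_on_def)
  then have "AE t in lborel. t ~: {t. l t : V}" by (intro AE_not_in finite_imp_null_set_lborel)
  then show "AE t in lborel. (SUM z:Z. F (l t) * indicator (closed_segment z (\<sigma> z)) (l t)) <= 3 * (F (l t) * indicator {0..1} t)"
  proof eventually_elim
   case (elim t)
   define S where "S = {z : Z. l t : closed_segment z (\<sigma> z)}"
   have fS: "finite S" using finZ by (simp add: S_def)
   have "(SUM z:Z. F (l t) * indicator (closed_segment z (\<sigma> z)) (l t)) = (SUM z:S. F (l t))"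
    unfolding S_def by (subst sum.inter_filter[OF finZ]) (auto intro!: sum.cong simp: indicator_def)
   also have "... = of_nat (card S) * F (l t)" by simp
   also have "... <= 3 * (F (l t) * indicator {0..1} t)"
   proof (cases "S = {}")
    case False
    then obtain u where u: "u : S" by blast
    have t: "t : {0..1}" using u Z_edge(2)[of u] linepath_in_segment_iff[OF ab, of t] by (auto simp: S_def)
    have "l t : closure Om" using ab_closure linepath_in_segment_iff[OF ab, of t] t by blast
    then obtain K where K: "K : T" "l t : K" using cover by blast
    have "S <= verts K"
    proof
     fix z assume z: "z : S"
     then have zZ: "z : Z" "l t : closed_segment z (\<sigma> z)" by (auto simp: S_def)
     obtain L where L: "L : T" "z : verts L" "\<sigma> z : verts L" "z ~= \<sigma> z" using Z_edge(1)[OF zZ(1)] by (auto simp: EP_def)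
     have V: "z : V" "\<sigma> z : V" using L by (auto simp: mesh_vertices_eq)
     have "l t : open_segment z (\<sigma> z)" using zZ(2) V elim by (auto simp: open_segment_def)
     then have "closed_segment z (\<sigma> z) <= K" by (rule edge_sub_of_meet[OF L _ K])
     then show "z : verts K" using vertex_in[OF K(1) V(1)] by auto
    qed
    then have "card S <= 3" using card_mono[OF vertsT(1)[OF K(1)]] vertsT(2)[OF K(1)] by metis
    then have "(of_nat (card S) :: ennreal) <= of_nat 3" by (simp only: of_nat_le_iff)
    then show ?thesis using t by (simp add: mult_right_mono)
   qed simp
   finally show ?case .
  qed
 qed simp
 also have "... = 3 * (ennreal (dist a b) * (\<integral>\<^sup>+t. F (l t) * indicator {0..1} t \<partial>lborel))"
  by (subst nn_integral_cmult) (auto intro!: borel_measurable_times_ennreal Fl simp: mult_ac)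
 also have "(\<integral>\<^sup>+t. F (l t) * indicator {0..1} t \<partial>lborel) = ennreal ((l2 II (%t. f (l t)))^2)"
  unfolding F_def by (rule l2_line_nn[OF f ab_closure, symmetric])
 also have "3 * (ennreal (dist a b) * ennreal ((l2 II (%t. f (l t)))^2)) = ennreal (3 * (dist a b * (l2 II (%t. f (l t)))^2))"
  by (simp add: ennreal_mult)
 finally show ?thesis by (subst (asm) ennreal_le_iff) auto
qed

text \<open>Along the edge the hat function of z drops from 1 to 0, while its gradient is at most 2
  / (gamma h) by the inverse estimate.\<close>

lemma edge_length: assumes "(z, y) : EP" shows "gamma * h / 2 <= dist z y"
proof -
 obtain K where K: "K : T" "z : verts K" "y : verts K" "z ~= y" using assms by (auto simp: EP_def)
 obtain c d where cd: "ALL x:K. nodal_basis T z x = c + d \<bullet> x"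
  using nodal(1)[OF K(1)] unfolding nodal_basis_def affine_fun_on_def by blast
 have val: "c + d \<bullet> x = (if x = z then 1 else 0)" if "x : verts K" for x
 proof -
  have "x : V" "x : K" using that K(1) verts_sub by (auto simp: mesh_vertices_eq)
  then show ?thesis using cd nodal(2)[of x "%y. if y = z then 1 else 0"] by (simp add: nodal_basis_def)
 qed
 have n: "norm d * (gamma * h) <= 2 * 1" by (rule affine_local(1)[OF K(1), where a=c]) (use val in auto)
 have "1 = d \<bullet> (z - y)" using val[OF K(2)] val[OF K(3)] K(4) by (simp add: inner_diff_right)
 also have "... <= norm d * dist z y" unfolding dist_norm by (rule norm_cauchy_schwarz)
 finally have 1: "1 <= norm d * dist z y" .
 have "gamma * h * 1 <= gamma * h * (norm d * dist z y)" using 1 gamma0 h0 by (intro mult_left_mono) auto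
 also have "... = norm d * (gamma * h) * dist z y" by simp
 also have "... <= 2 * 1 * dist z y" by (intro mult_right_mono n) simp
 finally show ?thesis by simp
qed

text \<open>\<open>szf\<close> on the chosen edge of z, which lies on the segment, recovers the
  coefficient at z; its square is at most 4 times the squared L^2 norm there. The lower bound for
  edge lengths contributes a factor 2, the overlap of chosen edges a factor 3.\<close>

lemma coefficient_bound:
 assumes c: "!!z. z ~: Z ==> c z = 0"
 shows "gamma * h * (SUM z:Z. (c z)^2) <= 24 * (dist a b * (l2 II (%t. nodal_function T c (l t)))^2)"
proof -
 let ?u = "nodal_function T c"
 have "gamma * h / 2 * (c z)^2 <= 4 * (dist z (\<sigma> z) * (l2 II (%t. ?u (linepath z (\<sigma> z) t)))^2)" if z: "z : Z" for z
 proof -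
  note ep = Z_edge(1)[OF z]
  have sq: "sqint II (%t. ?u (linepath z (\<sigma> z) t))" by (rule pws_line[OF pws_nodal EP_closure[OF ep]])
  have "szf (%t. ?u (linepath z (\<sigma> z) t)) = szf (%t. c z + (c (\<sigma> z) - c z) * t)"
   unfolding szf_def by (rule Bochner_Integration.integral_cong) (auto simp: nodal_line[OF ep] space_restrict_space)
  then have "\<bar>c z\<bar> <= 2 * l2 II (%t. ?u (linepath z (\<sigma> z) t))" using szf_bound[OF sq] by (simp add: szf_affine)
  then have "\<bar>c z\<bar>^2 <= (2 * l2 II (%t. ?u (linepath z (\<sigma> z) t)))^2" by (intro power_mono) auto
  then have 1: "(c z)^2 <= 4 * (l2 II (%t. ?u (linepath z (\<sigma> z) t)))^2" by (simp add: power_mult_distrib)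
  have "gamma * h / 2 * (c z)^2 <= dist z (\<sigma> z) * (4 * (l2 II (%t. ?u (linepath z (\<sigma> z) t)))^2)"
   by (intro mult_mono edge_length[OF ep] 1) auto
  then show ?thesis by simp
 qed
 then have "(SUM z:Z. gamma * h / 2 * (c z)^2) <= (SUM z:Z. 4 * (dist z (\<sigma> z) * (l2 II (%t. ?u (linepath z (\<sigma> z) t)))^2))"
  by (rule sum_mono)
 also have "... <= 4 * (3 * (dist a b * (l2 II (%t. ?u (l t)))^2))"
  unfolding sum_distrib_left[symmetric] by (intro mult_left_mono chosen_edges_overlap pws_nodal) simp
 finally show ?thesis unfolding sum_distrib_left[symmetric] by (simp add: field_simps)
qed

text \<open>On each triangle the nodal function is affine, and its vertex values are bounded by the
  root of the sum of squared coefficients. Each coefficient is counted once per triangle at its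
  vertex, hence \<open>Nb\<close>.\<close>

lemma nodal_NW:
 assumes c: "!!z. z ~: Z ==> c z = 0"
 shows "(NW h (nodal_function T c))^2 <= 3 * ((1 + 4 / gamma^2) * (pi * h^2)) * Nb * (SUM z:Z. (c z)^2)"
proof -
 let ?u = "nodal_function T c"
 define P where "P = (1 + 4 / gamma^2) * (pi * h^2)"
 have P0: "P >= 0" unfolding P_def by (intro mult_nonneg_nonneg add_nonneg_nonneg) auto
 have vK: "{z : V. z : verts K} = verts K" if "K : T" for K using that by (auto simp: mesh_vertices_eq)
 have "loc ?u K <= (SUM z:verts K. (c z)^2) * P" if K: "K : T" for K
 proof -
  obtain alpha beta where u: "ALL x:K. ?u x = alpha + beta \<bullet> x" using nodal(1)[OF K] unfolding affine_fun_on_def by blast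
  define B where "B = sqrt (SUM z:verts K. (c z)^2)"
  have "\<bar>alpha + beta \<bullet> z\<bar> <= B" if z: "z : verts K" for z
  proof -
   have "z : V" "z : K" using z K verts_sub by (auto simp: mesh_vertices_eq)
   then have "alpha + beta \<bullet> z = c z" using u nodal(2)[of z c] by simp
   moreover have "(c z)^2 <= (SUM z:verts K. (c z)^2)" by (rule member_le_sum[OF z]) (auto simp: vertsT(1)[OF K])
   ultimately show ?thesis unfolding B_def by (metis real_sqrt_abs real_sqrt_le_mono)
  qed
  then have "(l2 (MK K) (%x. alpha + beta \<bullet> x))^2 + h^2 * (SUM i:UNIV. (l2 (MK K) (partial i (%x. alpha + beta \<bullet> x)))^2) <= B^2 * (1 + 4 / gamma^2) * (pi * h^2)"
   by (intro affine_local(2)[OF K]) blast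
  then show ?thesis using loc_pws[OF pws_nodal K smooth_affine u] by (simp add: B_def P_def sum_nonneg mult.assoc)
 qed
 then have "(SUM K:T. loc ?u K) <= (SUM K:T. SUM z:{z : V. z : verts K}. (c z)^2 * P)"
  by (intro sum_mono) (simp add: vK sum_distrib_right)
 also have "... = (SUM z:V. SUM K:{K : T. z : verts K}. (c z)^2 * P)" by (rule sum.swap_restrict[OF finT finV])
 also have "... = (SUM z:V. real (card (star z)) * ((c z)^2 * P))" by (simp add: star_def)
 also have "... <= (SUM z:V. Nb * ((c z)^2 * P))" using P0 by (intro sum_mono mult_right_mono card_star) auto
 also have "... = P * Nb * (SUM z:V. (c z)^2)" unfolding sum_distrib_left by (rule sum.cong) auto
 also have "(SUM z:V. (c z)^2) = (SUM z:Z. (c z)^2)" by (rule sum.mono_neutral_right[OF finV]) (auto simp: Z_def c)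
 finally have "3 * (SUM K:T. loc ?u K) <= 3 * (P * Nb * (SUM z:Z. (c z)^2))" by simp
 moreover have "(NW h ?u)^2 <= 3 * (SUM K:T. loc ?u K)" by (rule NW_h_sq[OF pws_H1(1)[OF pws_nodal]])
 ultimately show ?thesis unfolding P_def[symmetric] by (simp only: mult.assoc)
qed

end

context rmesh begin
text \<open>216 = 24 * 9 combines \<open>coefficient_bound\<close> and
  \<open>boundary_trace\<close>; the other factors are those of \<open>nodal_NW\<close> without
  h^2.\<close>

definition c6 :: real where "c6 = sqrt (3 * ((1 + 4 / gamma^2) * pi) * Nb * (216 * Ct / gamma))"
lemma c6_nonneg: "c6 >= 0" unfolding c6_def using Nb0 Ct_pos gamma0
 by (intro real_sqrt_ge_zero mult_nonneg_nonneg add_nonneg_nonneg) auto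
end

section \<open>The corrected interpolant\<close>

context fmesh
begin

definition res :: "(plane => real) => real => real" where "res v t = trace_on Om a b v (l t) - sznH \<sigma> v (l t)"

text \<open>Describes the coefficients of the L^2 projection of the trace error onto the span of the
  hat functions of \<open>Z\<close>. The predicate sees v only through \<open>res\<close>, that is
  through traces, so the choice \<open>cf\<close> does not depend on the representative of
  v.\<close>

definition admissible :: "(plane => real) => (plane => real) => bool" where
 "admissible v c \<longleftrightarrow> (ALL z. z ~: Z --> c z = 0) & l2 II (%t. nodal_function T c (l t)) <= l2 II (res v) &
  (ALL z:Z. (LINT t|II. (res v t - nodal_function T c (l t)) * nodal_basis T z (l t)) = 0)"

lemma pws_basis: "pws (nodal_basis T z)" unfolding nodal_basis_def by (rule pws_nodal)

lemma pws_szn: "pws (sznH \<sigma> v)" unfolding sznH_def by (rule pws_nodal)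

lemma nodal_Z:
 assumes "!!z. z ~: Z ==> c z = 0" shows "nodal_function T c x = (SUM z:Z. c z * nodal_basis T z x)"
 unfolding fun_cong[OF nodal_sum[of c]] by (rule sum.mono_neutral_right[OF finV]) (auto simp: Z_def assms)

lemma sqint_res: "v : H1 Om ==> sqint II (res v)"
 unfolding res_def by (rule trace_sub_pws(1)[OF _ pws_szn])

lemma admissible_ex: assumes v: "v : H1 Om" shows "EX c. admissible v c"
proof -
 have "ALL z:Z. sqint II (%t. nodal_basis T z (l t))" using sqint_l[OF pws_basis] by blast
 from projection[OF finZ this sqint_res[OF v]] obtain c where
  c: "ALL z:Z. (LINT t|II. (res v t - (SUM y:Z. c y * nodal_basis T y (l t))) * nodal_basis T z (l t)) = 0"
   "l2 II (%t. SUM y:Z. c y * nodal_basis T y (l t)) <= l2 II (res v)" by blast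
 define c' where "c' z = (if z : Z then c z else 0)" for z
 have c0: "z ~: Z ==> c' z = 0" for z by (simp add: c'_def)
 have "nodal_function T c' x = (SUM y:Z. c y * nodal_basis T y x)" for x
  by (subst nodal_Z) (auto simp: c'_def intro!: sum.cong)
 then have "admissible v c'" using c c0 by (simp add: admissible_def)
 then show ?thesis by blast
qed

definition cf :: "(plane => real) => plane => real" where "cf v = (SOME c. admissible v c)"

text \<open>The factors 1 put the sum into the form of the lemmas on linear combinations.\<close>

definition Pt :: "(plane => real) => plane => real" where
 "Pt v = (%x. 1 * sznH \<sigma> v x + 1 * nodal_function T (cf v) x)"

lemma cf: assumes "v : H1 Om" shows "admissible v (cf v)"
 unfolding cf_def by (rule someI_ex[OF admissible_ex[OF assms]])

text \<open>\<open>Pt\<close> depends on v through \<open>trace_on\<close> alone, whose chosen value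
  is the same for both representatives; hence equality as functions.\<close>

lemma Pt_AE:
 assumes "v : H1 Om" "v' : H1 Om" "AE x in MOm. v x = v' x" shows "Pt v = Pt v'"
proof -
 have t: "trace_on Om p q v = trace_on Om p q v'" for p q by (rule trace_on_AE[OF assms])
 have "sznH \<sigma> v = sznH \<sigma> v'" by (simp add: sznH_def t)
 moreover from this have "res v = res v'" by (intro ext) (simp add: res_def t)
 ultimately show ?thesis by (simp add: Pt_def cf_def admissible_def)
qed

lemma Pt_H1D: assumes "v : H1_D Om \<Gamma>D" shows "Pt v : P1 T \<inter> H1_D Om \<Gamma>D"
proof -
 have "cf v z = 0" if "z : closure \<Gamma>D" for z
  using cf[OF H1_D_H1[OF assms]] that closure_disj by (auto simp: admissible_def Z_def)
 then have "nodal_function T (cf v) : P1 T \<inter> H1_D Om \<Gamma>D" by (intro nodal_H1D)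
 then show ?thesis using sznH_H1D[OF assms] unfolding Pt_def by (blast intro: P1_lin H1_D_lin)
qed

lemma pws_Pt: "pws (Pt v)"
 unfolding Pt_def by (intro pws_affine affine_fun_on_add affine_fun_on_cmult) (simp_all add: sznH_def nodal(1))

lemma Pt_orthogonal:
 assumes v: "v : H1 Om" and w: "w : W_h a b T"
 shows "(LINT t|II. (trace_on Om a b v (l t) - Pt v (l t)) * w (l t)) = 0"
  and "sqint II (%t. w (l t))"
proof -
 let ?c = "%z. if z : Z then w z else 0"
 have "continuous_on {0..1} (%t. w (l t))"
 proof (rule continuous_on_compose2[of "closed_segment a b" w])
  show "continuous_on (closed_segment a b) w" using w by (simp add: W_h_def)
  show "continuous_on {0..1} l" by (rule continuous_on_linepath)
  show "l ` {0..1} <= closed_segment a b" using linepath_in_path by blast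
 qed
 then have wm: "(%t. w (l t)) : borel_measurable II" by (intro continuous_imp_measurable_on_sets_lebesgue) auto
 have nw: "sqint II (%t. nodal_function T ?c (l t))" by (rule sqint_l[OF pws_nodal])
 show sw: "sqint II (%t. w (l t))"
  by (rule sqint_cong_AE[OF nw wm]) (use W_h_nodal[OF w] in \<open>auto elim: eventually_mono\<close>)
 have e: "trace_on Om a b v (l t) - Pt v (l t) = res v t - nodal_function T (cf v) (l t)" for t by (simp add: Pt_def res_def)
 have sr: "sqint II (%t. res v t - nodal_function T (cf v) (l t))" by (intro sqint_diff sqint_res v sqint_l pws_nodal)
 have "(LINT t|II. (trace_on Om a b v (l t) - Pt v (l t)) * w (l t)) =
  (LINT t|II. (res v t - nodal_function T (cf v) (l t)) * nodal_function T ?c (l t))"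
  unfolding e
  by (rule integral_cong_AE)
   (use W_h_nodal[OF w] in \<open>auto intro!: borel_measurable_times sqint_measurable[OF sr] sqint_measurable[OF nw] wm elim: eventually_mono\<close>)
 also have "... = (LINT t|II. (res v t - nodal_function T (cf v) (l t)) * (SUM z:Z. ?c z * nodal_basis T z (l t)))"
  by (subst nodal_Z[of ?c]) auto
 also have "... = (SUM z:Z. ?c z * (LINT t|II. (res v t - nodal_function T (cf v) (l t)) * nodal_basis T z (l t)))"
  by (rule integral_mult_sum[OF sr sqint_l[OF pws_basis]])
 also have "... = 0" using cf[OF v] by (simp add: admissible_def)
 finally show "(LINT t|II. (trace_on Om a b v (l t) - Pt v (l t)) * w (l t)) = 0" .
qed

text \<open>Projection, trace and coefficient bounds give a sum of squared coefficients of order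
  \<open>?W^2 / h^2\<close>, and the squared norm of the nodal function is of order h^2 times this
  sum. The powers of h cancel, so the correction is at most \<open>c6\<close> times the Scott-Zhang
  error.\<close>

lemma Pt_estimate:
 assumes v: "v : H1 Om" shows "NW h (%x. v x - Pt v x) <= (1 + c6) * (c5 * h * sE v)"
proof -
 let ?c = "cf v" and ?W = "NW h (%x. v x - sznH \<sigma> v x)"
 let ?u = "nodal_function T ?c"
 have adm: "z ~: Z ==> ?c z = 0" "l2 II (%t. ?u (l t)) <= l2 II (res v)" for z
  using cf[OF v] by (auto simp: admissible_def)
 have W0: "?W >= 0" using NW_nonneg h0 by simp
 have "l2 II (%t. ?u (l t)) <= kt * ?W" using adm(2) trace_sub_pws(2)[OF v pws_szn[of v]] unfolding res_def by linarith
 then have "dist a b * (l2 II (%t. ?u (l t)))^2 <= dist a b * (kt * ?W)^2" by (intro mult_left_mono power_mono l2_nonneg) auto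
 also have "... = 9 * Ct / h * ?W^2" by (rule kt(2))
 finally have "gamma * h * (SUM z:Z. (?c z)^2) <= 24 * (9 * Ct / h * ?W^2)" using coefficient_bound[of ?c, OF adm(1)] by linarith
 then have "(SUM z:Z. (?c z)^2) <= 24 * (9 * Ct / h * ?W^2) / (gamma * h)" using gamma0 h0 by (simp add: pos_le_divide_eq mult.commute)
 also have "... = 216 * Ct / gamma * ?W^2 / h^2" by (simp add: power2_eq_square mult_ac)
 finally have S: "(SUM z:Z. (?c z)^2) <= 216 * Ct / gamma * ?W^2 / h^2" .
 have "(NW h ?u)^2 <= 3 * ((1 + 4 / gamma^2) * (pi * h^2)) * Nb * (SUM z:Z. (?c z)^2)" by (rule nodal_NW[of ?c, OF adm(1)])
 also have "... <= 3 * ((1 + 4 / gamma^2) * (pi * h^2)) * Nb * (216 * Ct / gamma * ?W^2 / h^2)"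
  using Nb0 by (intro mult_left_mono S mult_nonneg_nonneg add_nonneg_nonneg) auto
 also have "... = 3 * ((1 + 4 / gamma^2) * pi) * Nb * (216 * Ct / gamma) * ?W^2" using h0 by simp
 also have "... = (c6 * ?W)^2" unfolding power_mult_distrib c6_def using Nb0 Ct_pos gamma0
  by (subst real_sqrt_pow2) (auto intro!: mult_nonneg_nonneg add_nonneg_nonneg)
 finally have u: "NW h ?u <= c6 * ?W" by (rule power2_le_imp_le) (use c6_nonneg W0 in simp)
 have H: "(%x. v x - sznH \<sigma> v x) : H1 Om" "?u : H1 Om"
  using v pws_H1(1)[OF pws_nodal] pws_H1(1)[OF pws_szn] by (auto intro: H1_diff(1))
 have "(%x. v x - Pt v x) = (%x. 1 * (v x - sznH \<sigma> v x) + (-1) * ?u x)" by (simp add: Pt_def algebra_simps)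
 then have "NW h (%x. v x - Pt v x) <= ?W + NW h ?u" using NW_lin[OF _ H, of h 1 "-1"] h0 by simp
 also have "... <= (1 + c6) * ?W" using u by (simp add: algebra_simps)
 also have "... <= (1 + c6) * (c5 * h * sE v)" using c6_nonneg by (intro mult_left_mono sznH_estimate v \<sigma>_EP) auto
 finally show ?thesis .
qed

end

section \<open>Gradient oscillation bounded by seminorms of order s\<close>

context rmesh
begin

text \<open>Its square dominates the constants of the three ranges: 1 for s = 0, 2 for s = 1, and 1
  / (2 pi gamma^2) in between.\<close>

definition c7 :: real where "c7 = sqrt (3 + 1 / (2 * pi * gamma^2))"

lemma c7: "c7 >= 0" "1 <= c7^2" "2 <= c7^2" "1 / (2 * pi * gamma^2) <= c7^2"
 by (auto simp: c7_def add_nonneg_nonneg)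

lemma osc_le_l2: "K : T ==> sqint MOm g ==> osc (interior K) g <= l2 (MK K) g"
 using osc_facts(4)[OF factsT(6) open_interior factsT(4) sqint_restrict, of K g 0] by simp

text \<open>For s = 1 the inequality is applied to a weak partial derivative of v, which is merely
  in H^1; it follows from the smooth case by density.\<close>

lemma poincare_H1:
 assumes K: "K : T" and g: "g : H1 Om"
 shows "(osc (interior K) g)^2 <= 2 * h^2 * (SUM i:UNIV. (l2 (MK K) (weak_partial Om i g))^2)"
proof -
 let ?S = "%g. L2_set (%i. l2 (MK K) (weak_partial Om i g)) UNIV"
 note U = factsT(6)[OF K] open_interior[of K] factsT(4)[OF K]
 have bound: "osc (interior K) g <= sqrt 2 * h * ?S g + (1 + sqrt 2 * h) * e" if "e > 0" for e
 proof -
  obtain phi where phi: "smooth phi" "NN (%x. phi x - g x) <= e" using dense[OF g \<open>e > 0\<close>] by blast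
  have phiH: "phi : H1 Om" by (rule smooth_H1(1)[OF phi(1)])
  have N: "NN (%x. g x - phi x) <= e" using NN_minus_commute[OF g phiH] phi(2) by simp
  have d: "(%x. g x - phi x) : H1 Om" "(%x. phi x - g x) : H1 Om" by (intro H1_diff(1) g phiH)+
  have "osc (interior K) g <= \<bar>1\<bar> * osc (interior K) phi + \<bar>1\<bar> * osc (interior K) (%x. g x - phi x)"
   by (rule osc_lin[OF U]) (auto intro!: sqint_measurable sqint_restrict[OF K] H1D(1) phiH g d)
  moreover have "osc (interior K) (%x. g x - phi x) <= e"
  proof -
   have "osc (interior K) (%x. g x - phi x) <= l2 MOm (%x. g x - phi x)"
    using osc_le_l2[OF K H1D(1)[OF d(1)]] l2_MK_le[OF K H1D(1)[OF d(1)]] by linarith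
   also have "... <= NN (%x. g x - phi x)" by (simp add: NN_def sum_nonneg l2_nonneg)
   finally show ?thesis using N by linarith
  qed
  moreover have "osc (interior K) phi <= sqrt 2 * h * ?S phi"
  proof (rule power2_le_imp_le)
   have "(osc (interior K) phi)^2 <= 2 * h^2 * (SUM i:UNIV. (l2 (MK K) (partial i phi))^2)"
    by (rule poincare_smooth[OF factsT(7)[OF K] open_interior factsT(6,4)[OF K] _ phi(1)])
     (use diam[OF K] interior_subset[of K] in blast)
   also have "(SUM i:UNIV. (l2 (MK K) (partial i phi))^2) = (SUM i:UNIV. (l2 (MK K) (weak_partial Om i phi))^2)"
   proof (rule sum.cong[OF refl])
    fix i
    have "l2 (MK K) (partial i phi) = l2 (MK K) (weak_partial Om i phi)"
     by (rule l2_cong_AE[OF _ _ AE_symmetric[OF AE_restrict[OF K smooth_H1(2)[OF phi(1)]]]])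
      (intro sqint_measurable sqint_restrict[OF K] smooth_sq smooth_partial phi(1) H1D(2) phiH)+
    then show "(l2 (MK K) (partial i phi))^2 = (l2 (MK K) (weak_partial Om i phi))^2" by simp
   qed
   finally show "(osc (interior K) phi)^2 <= (sqrt 2 * h * ?S phi)^2" by (simp add: power_mult_distrib L2_set_def sum_nonneg)
  qed (use h0 in simp)
  moreover have "?S phi <= ?S g + e"
  proof -
   have "?S phi <= L2_set (%i. l2 (MK K) (weak_partial Om i g) + l2 (MK K) (weak_partial Om i (%x. phi x - g x))) UNIV"
   proof (rule L2_set_mono)
    fix i
    have s: "sqint (MK K) (weak_partial Om i f)" if "f : H1 Om" for f by (intro sqint_restrict[OF K] H1D(2) that)
    have "l2 (MK K) (weak_partial Om i phi) = l2 (MK K) (%x. weak_partial Om i g x + weak_partial Om i (%x. phi x - g x) x)"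
    proof (rule l2_cong_AE)
     show "AE x in MK K. weak_partial Om i phi x = weak_partial Om i g x + weak_partial Om i (%x. phi x - g x) x"
      using AE_restrict[OF K H1_diff(2)[OF phiH g, of i]] by eventually_elim simp
    qed (intro sqint_measurable sqint_add s phiH g d)+
    also have "... <= l2 (MK K) (weak_partial Om i g) + l2 (MK K) (weak_partial Om i (%x. phi x - g x))"
     by (intro l2_triangle s g d)
    finally show "l2 (MK K) (weak_partial Om i phi) <= l2 (MK K) (weak_partial Om i g) + l2 (MK K) (weak_partial Om i (%x. phi x - g x))" .
   qed (simp add: l2_nonneg)
   also have "... <= ?S g + ?S (%x. phi x - g x)" by (rule L2_set_triangle_ineq)
   also have "?S (%x. phi x - g x) <= (SUM i:UNIV. l2 (MK K) (weak_partial Om i (%x. phi x - g x)))"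
    by (rule L2_set_le_sum) (simp add: l2_nonneg)
   also have "... <= (SUM i:UNIV. l2 MOm (weak_partial Om i (%x. phi x - g x)))" by (intro sum_mono l2_MK_le[OF K] H1D(2) d)
   also have "... <= NN (%x. phi x - g x)" by (simp add: NN_def l2_nonneg)
   finally show ?thesis using phi(2) by linarith
  qed
  then have "sqrt 2 * h * ?S phi <= sqrt 2 * h * (?S g + e)" using h0 by (intro mult_left_mono) auto
  ultimately have "osc (interior K) g <= sqrt 2 * h * (?S g + e) + e" by (simp only: abs_one mult_1)
  then show ?thesis by (simp add: algebra_simps)
 qed
 have "osc (interior K) g <= sqrt 2 * h * ?S g"
 proof (rule field_le_epsilon)
  fix e :: real assume "e > 0"
  define A where "A = 1 + sqrt 2 * h"
  have A: "A > 0" using h0 by (simp add: A_def add_pos_pos)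
  then show "osc (interior K) g <= sqrt 2 * h * ?S g + e" using bound[of "e / A"] \<open>e > 0\<close> by (simp add: A_def[symmetric])
 qed
 then have "(osc (interior K) g)^2 <= (sqrt 2 * h * ?S g)^2" by (intro power_mono osc_nonneg)
 then show ?thesis by (simp add: power_mult_distrib L2_set_def sum_nonneg)
qed

text \<open>Within a triangle |x - y| is at most h, so the kernel is at least h^(-2-2s); on the
  diagonal both sides are 0.\<close>

lemma slobodeckij_bound:
 assumes "K : T" "x : K" "y : K" "0 < s"
 shows "(g x - g y)^2 <= h powr (2 + 2 * s) * slobodeckij_integrand s g (x, y)"
proof (cases "x = y")
 case False
 then have n: "norm (x - y) > 0" "norm (x - y) <= h" using diam[OF assms(1-3)] by (auto simp: dist_norm)
 then have "norm (x - y) powr (2 + 2 * s) <= h powr (2 + 2 * s)" using assms(4) by (intro powr_mono2) auto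
 then have "(g x - g y)^2 * norm (x - y) powr (2 + 2 * s) <= (g x - g y)^2 * h powr (2 + 2 * s)" by (intro mult_left_mono) auto
 then show ?thesis using n by (simp add: slobodeckij_integrand_def pos_le_divide_eq mult.commute)
qed (simp add: slobodeckij_integrand_def)

text \<open>The variance on K is a double integral of squared differences over pairs in K. The
  kernel bound costs h^(2+2s), and division by the area returns h^(-2). After enlarging the second
  variable to all of \<open>Om\<close>, the first runs over disjoint sets, so the sum is at most the
  full double integral.\<close>

lemma osc_slobodeckij:
 assumes g: "sqint MOm g" and s: "0 < s" and I: "integrable (MOm \<Otimes>\<^sub>M MOm) (slobodeckij_integrand s g)"
 shows "(SUM K:T. (osc (interior K) g)^2) <= 1 / (2 * pi * gamma^2) * (h powr s)^2 * integral\<^sup>L (MOm \<Otimes>\<^sub>M MOm) (slobodeckij_integrand s g)"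
proof -
 let ?F = "slobodeckij_integrand s g"
 interpret fm: finite_measure MOm by (rule finite_measure_lebesgue_on[OF bounded opn])
 interpret pm: pair_sigma_finite MOm MOm by unfold_locales
 have F0: "?F p >= 0" for p by (simp add: slobodeckij_integrand_def case_prod_unfold)
 define J where "J x = (LINT y|MOm. ?F (x, y))" for x
 have J: "integrable MOm J" "(LINT x|MOm. J x) = integral\<^sup>L (MOm \<Otimes>\<^sub>M MOm) ?F" "AE x in MOm. integrable MOm (%y. ?F (x, y))"
  unfolding J_def using pm.integrable_fst'[OF I] pm.integral_fst'[OF I] pm.AE_integrable_fst'[OF I] by auto
 have k: "2 * (pi * (gamma * h)^2) * (osc (interior K) g)^2 <= h powr (2 + 2 * s) * (LINT x|MK K. J x)" if K: "K : T" for K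
 proof -
  note U = factsT(6)[OF K] open_interior[of K] factsT(4)[OF K]
  note o = osc_facts[OF U sqint_restrict[OF K g]]
  have "2 * (pi * (gamma * h)^2) * (osc (interior K) g)^2 <= 2 * measure lebesgue (interior K) * (osc (interior K) g)^2"
   using area_low[OF K] by (intro mult_right_mono) auto
  also have "... = (LINT x|MK K. LINT y|MK K. (g x - g y)^2)" by (rule o(1)[symmetric])
  also have "... <= (LINT x|MK K. h powr (2 + 2 * s) * J x)"
  proof (rule integral_mono_AE[OF o(2)])
   show "integrable (MK K) (%x. h powr (2 + 2 * s) * J x)" using integrable_restrict[OF K J(1)] by simp
   have "AE x in MK K. x : interior K" by (rule AE_I2) (simp add: space_restrict_space)
   with AE_restrict[OF K J(3)]
   show "AE x in MK K. (LINT y|MK K. (g x - g y)^2) <= h powr (2 + 2 * s) * J x"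
   proof eventually_elim
    case (elim x)
    have i: "integrable (MK K) (%y. ?F (x, y))" by (rule integrable_restrict[OF K elim(1)])
    have "(LINT y|MK K. (g x - g y)^2) <= (LINT y|MK K. h powr (2 + 2 * s) * ?F (x, y))"
     using elim(2) interior_subset[of K]
     by (intro integral_mono o(3) integrable_mult_right i slobodeckij_bound[OF K _ _ s]) (auto simp: space_restrict_space)
    also have "... = h powr (2 + 2 * s) * (LINT y|MK K. ?F (x, y))" by simp
    also have "(LINT y|MK K. ?F (x, y)) <= J x"
     unfolding J_def integral_mesh[OF elim(1)] by (rule member_le_sum[OF K]) (auto simp: finT intro!: integral_nonneg_AE F0)
    finally show ?case by (simp add: mult_left_mono)
   qed
  qed
  finally show ?thesis by simp
 qed
 have "2 * (pi * (gamma * h)^2) * (SUM K:T. (osc (interior K) g)^2) <= (SUM K:T. h powr (2 + 2 * s) * (LINT x|MK K. J x))"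
  unfolding sum_distrib_left by (intro sum_mono k)
 also have "... = h powr (2 + 2 * s) * integral\<^sup>L (MOm \<Otimes>\<^sub>M MOm) ?F"
  unfolding sum_distrib_left[symmetric] integral_mesh[OF J(1), symmetric] J(2) ..
 also have "h powr (2 + 2 * s) = h^2 * (h powr s)^2" unfolding mult_2[of s] powr_add power2_eq_square[of "h powr s"] using h0 by simp
 finally have "(2 * pi * gamma^2) * (SUM K:T. (osc (interior K) g)^2) <= (h powr s)^2 * integral\<^sup>L (MOm \<Otimes>\<^sub>M MOm) ?F"
  using h0 by (simp add: power_mult_distrib mult_ac)
 then show ?thesis using gamma0 by (simp add: field_simps)
qed

lemma osc_Hs:
 assumes g: "g : Hs Om s" and s: "s : {0..1}"
 shows "(SUM K:T. (osc (interior K) g)^2) <= (c7 * h powr s * Hs_seminorm Om s g)^2"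
proof -
 have gL: "sqint MOm g" using g by (auto simp: Hs_def L2_iff H1_def split: if_splits)
 consider "s = 0" | "s = 1" | "s ~= 0" "s ~= 1" by blast
 then show ?thesis
 proof cases
  case 1
  have "(SUM K:T. (osc (interior K) g)^2) <= (SUM K:T. (l2 (MK K) g)^2)"
   by (intro sum_mono power_mono osc_le_l2 gL osc_nonneg)
  also have "... = 1 * (l2 MOm g)^2" using l2_mesh[OF gL] by simp
  also have "... <= c7^2 * (l2 MOm g)^2" by (intro mult_right_mono c7) simp
  finally show ?thesis using 1 h0 by (simp add: Hs_seminorm_def L2_norm_eq_l2 power_mult_distrib)
 next
  case 2
  then have gH: "g : H1 Om" using g by (simp add: Hs_def)
  have "(SUM K:T. (osc (interior K) g)^2) <= (SUM K:T. 2 * h^2 * (SUM i:UNIV. (l2 (MK K) (weak_partial Om i g))^2))"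
   by (intro sum_mono poincare_H1 gH)
  also have "... = 2 * h^2 * (SUM i:UNIV. SUM K:T. (l2 (MK K) (weak_partial Om i g))^2)"
   unfolding sum_distrib_left[symmetric] by (subst sum.swap) simp
  also have "... = 2 * h^2 * (L2_norm Om (weak_grad Om g))^2"
   unfolding L2_norm_weak_grad_sq[OF gH] l2_mesh[OF H1D(2)[OF gH]] ..
  also have "... <= c7^2 * h^2 * (L2_norm Om (weak_grad Om g))^2" by (intro mult_right_mono c7) auto
  finally show ?thesis using 2 h0 by (simp add: Hs_seminorm_def power_mult_distrib)
 next
  case 3
  then have I: "integrable (MOm \<Otimes>\<^sub>M MOm) (slobodeckij_integrand s g)" using g by (simp add: Hs_def)
  have i0: "integral\<^sup>L (MOm \<Otimes>\<^sub>M MOm) (slobodeckij_integrand s g) >= 0"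
   by (intro integral_nonneg_AE AE_I2) (simp add: slobodeckij_integrand_def case_prod_unfold)
  have "(SUM K:T. (osc (interior K) g)^2) <= 1 / (2 * pi * gamma^2) * (h powr s)^2 * integral\<^sup>L (MOm \<Otimes>\<^sub>M MOm) (slobodeckij_integrand s g)"
   using 3 s by (intro osc_slobodeckij gL I) auto
  also have "... <= c7^2 * (h powr s)^2 * integral\<^sup>L (MOm \<Otimes>\<^sub>M MOm) (slobodeckij_integrand s g)"
   by (intro mult_right_mono c7 i0) auto
  finally show ?thesis using 3 i0 by (simp add: Hs_seminorm_def power_mult_distrib)
 qed
qed

lemma sE_Hs:
 assumes "ALL i. weak_partial Om i v : Hs Om s" "s : {0..1}"
 shows "sE v <= c7 * h powr s * sqrt (SUM i:UNIV. (Hs_seminorm Om s (weak_partial Om i v))^2)"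
proof -
 have "(SUM K:T. e2 v K) = (SUM i:UNIV. SUM K:T. (osc (interior K) (weak_partial Om i v))^2)"
  unfolding e2_def by (rule sum.swap)
 also have "... <= (SUM i:UNIV. (c7 * h powr s * Hs_seminorm Om s (weak_partial Om i v))^2)"
  using assms by (intro sum_mono osc_Hs) auto
 also have "... = (c7 * h powr s)^2 * (SUM i:UNIV. (Hs_seminorm Om s (weak_partial Om i v))^2)"
  by (simp add: power_mult_distrib sum_distrib_left)
 finally have "sE v <= sqrt ((c7 * h powr s)^2 * (SUM i:UNIV. (Hs_seminorm Om s (weak_partial Om i v))^2))"
  unfolding sE_def by (rule real_sqrt_le_mono)
 then show ?thesis using c7(1) by (simp add: real_sqrt_mult)
qed

end

section \<open>The vector-valued operator and its estimates\<close>

lemma norm_vec_sq: "(norm x)^2 = (SUM j:UNIV. (norm (x $ j))^2)" for x :: "'b::real_normed_vector^'n"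
 by (simp add: norm_vec_def L2_set_def sum_nonneg)

lemma L2_norm_sq: "(L2_norm U f)^2 = (LINT x|lebesgue_on U. (norm (f x))^2)"
 by (simp add: L2_norm_def)

lemma L2_norm_vec_sq:
 fixes f :: "plane => 'b::real_normed_vector^2"
 assumes "!!j. integrable (lebesgue_on U) (%x. (norm (f x $ j))^2)"
 shows "(L2_norm U f)^2 = (SUM j:UNIV. (L2_norm U (%x. f x $ j))^2)"
 unfolding L2_norm_sq norm_vec_sq[of "f _"] by (rule Bochner_Integration.integral_sum) (rule assms)

lemma orthonormal_expansion:
 fixes x n t :: plane
 assumes "norm n = 1" "norm t = 1" "n \<bullet> t = 0"
 shows "(x \<bullet> n) * n $ j + (x \<bullet> t) * t $ j = x $ j"
proof -
 define n1 n2 t1 t2 where d: "n1 = n $ 1" "n2 = n $ 2" "t1 = t $ 1" "t2 = t $ 2"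
 have e: "n1^2 + n2^2 = 1" "t1^2 + t2^2 = 1" "n1 * t1 + n2 * t2 = 0"
  using assms norm_vec_sq[of n] norm_vec_sq[of t] by (simp_all add: d UNIV_2_eq inner_vec_def)
 \<comment> \<open>The determinant of the orthonormal pair, 1 or -1: the second vector is k times
   the first one turned by a right angle, which makes the columns orthonormal as well.\<close>
 define k where "k = n1 * t2 - n2 * t1"
 have t: "t1 = - n2 * k" "t2 = n1 * k" using e(1,3) unfolding k_def by algebra+
 have "k^2 = 1" using e unfolding k_def by algebra
 then have "n1^2 + t1^2 = 1" "n2^2 + t2^2 = 1" "n1 * n2 + t1 * t2 = 0" using e t by algebra+
 then have "(x $ 1 * n1 + x $ 2 * n2) * n1 + (x $ 1 * t1 + x $ 2 * t2) * t1 = x $ 1"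
  "(x $ 1 * n1 + x $ 2 * n2) * n2 + (x $ 1 * t1 + x $ 2 * t2) * t2 = x $ 2" by algebra+
 then show ?thesis using exhaust_2[of j] by (auto simp: d inner_vec_def UNIV_2_eq)
qed

context rmesh
begin

text \<open>2 + \<open>c6\<close> adds the normal part 1 + \<open>c6\<close> and the tangential part
  1; the 4 counts the two components of the error and the two components of w that enter each
  \<open>sE\<close>.\<close>

definition c8 :: real where "c8 = 4 * (2 + c6) * c5 * c7"

lemma c8_nonneg: "c8 >= 0" unfolding c8_def using c6_nonneg c_pos c7(1) by (intro mult_nonneg_nonneg) auto

text \<open>Sums of component norms, equivalent to the norm of the field (and, for
  \<open>ND\<close>, of its Jacobian), so that componentwise estimates simply add up.\<close>

definition NA :: "(plane => real^2) => real" where "NA u = (SUM j:UNIV. l2 MOm (%x. u x $ j))"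

definition ND :: "(plane => real^2) => real" where
 "ND u = (SUM j:UNIV. SUM i:UNIV. l2 MOm (weak_partial Om i (%x. u x $ j)))"

lemma NA_bounds:
 assumes "!!j. (%x. u x $ j) : H1 Om"
 shows "L2_norm Om u <= NA u" "NA u <= 2 * L2_norm Om u"
proof -
 have sq: "(L2_norm Om u)^2 = (SUM j:UNIV. (l2 MOm (%x. u x $ j))^2)"
  using L2_norm_vec_sq[of Om u] sqint_integrable[OF H1D(1)[OF assms]] by (simp add: L2_norm_eq_l2)
 then have e: "L2_norm Om u = L2_set (%j. l2 MOm (%x. u x $ j)) UNIV"
  by (simp add: L2_set_def L2_norm_def real_sqrt_unique)
 show "L2_norm Om u <= NA u" unfolding e NA_def by (rule L2_set_le_sum) (simp add: l2_nonneg)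
 have "NA u <= (SUM j:(UNIV::2 set). L2_norm Om u)"
  unfolding NA_def e by (intro sum_mono member_le_L2_set) auto
 then show "NA u <= 2 * L2_norm Om u" by simp
qed

lemma jacobian_norm:
 assumes "!!j. (%x. u x $ j) : H1 Om"
 shows "L2_norm Om (weak_jacobian Om u) = sqrt (SUM j:UNIV. SUM i:UNIV. (l2 MOm (weak_partial Om i (%x. u x $ j)))^2)"
proof -
 have i: "integrable MOm (%x. (norm (weak_grad Om (%x. u x $ j) x))^2)" for j
  unfolding norm_vec_sq using sqint_integrable[OF H1D(2)[OF assms]] by (simp add: weak_grad_def)
 have "(L2_norm Om (weak_jacobian Om u))^2 = (SUM j:UNIV. (L2_norm Om (weak_grad Om (%x. u x $ j)))^2)"
  by (subst L2_norm_vec_sq) (simp_all add: weak_jacobian_def i)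
 also have "... = (SUM j:UNIV. SUM i:UNIV. (l2 MOm (weak_partial Om i (%x. u x $ j)))^2)"
  using L2_norm_weak_grad_sq[OF assms] by simp
 finally show ?thesis by (metis L2_norm_def abs_of_nonneg integral_nonneg_AE AE_I2 real_sqrt_abs real_sqrt_ge_zero zero_le_power2)
qed

lemma ND_bounds:
 assumes "!!j. (%x. u x $ j) : H1 Om"
 shows "L2_norm Om (weak_jacobian Om u) <= ND u" "ND u <= 4 * L2_norm Om (weak_jacobian Om u)"
proof -
 have e: "L2_norm Om (weak_jacobian Om u) = L2_set (%(j, i). l2 MOm (weak_partial Om i (%x. u x $ j))) (UNIV \<times> UNIV)"
  unfolding jacobian_norm[OF assms] L2_set_def by (simp add: sum.cartesian_product case_prod_unfold del: UNIV_Times_UNIV)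
 have s: "ND u = (SUM (j, i):UNIV \<times> UNIV. l2 MOm (weak_partial Om i (%x. u x $ j)))"
  unfolding ND_def by (rule sum.cartesian_product)
 show "L2_norm Om (weak_jacobian Om u) <= ND u" unfolding e s by (rule L2_set_le_sum) (auto simp: l2_nonneg)
 have "ND u <= (SUM ji:(UNIV::2 set) \<times> (UNIV::2 set). L2_norm Om (weak_jacobian Om u))"
  unfolding e s by (rule sum_mono) (rule member_le_L2_set[of _ _ "%(j, i). l2 MOm (weak_partial Om i (%x. u x $ j))"], auto)
 then show "ND u <= 4 * L2_norm Om (weak_jacobian Om u)" by (simp add: card_cartesian_product del: UNIV_Times_UNIV)
qed

end

context fmesh
begin

text \<open>Orthogonality was obtained for the values of \<open>Pt v\<close>, whereas the claim
  concerns its chosen trace; the two agree almost everywhere on the segment.\<close>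

lemma fortin_scalar:
 assumes v: "v : H1 Om" and w: "w : W_h a b T"
 shows "(LINT t|II. (trace_on Om a b v (l t) - trace_on Om a b (Pt v) (l t)) * w (l t)) = 0"
  and "seg_integral a b (%x. trace_on Om a b (Pt v) x * w x) = seg_integral a b (%x. trace_on Om a b v x * w x)"
proof -
 obtain C where C: "tr_ok a b C" by (rule ab_tr)
 have st: "sqint II (%t. trace_on Om a b u (l t))" if "u : H1 Om" for u by (rule trace_close(1)[OF C that])
 have PH: "Pt v : H1 Om" by (rule pws_H1(1)[OF pws_Pt])
 note sw = Pt_orthogonal(2)[OF v w]
 have "(LINT t|II. (trace_on Om a b v (l t) - trace_on Om a b (Pt v) (l t)) * w (l t)) =
  (LINT t|II. (trace_on Om a b v (l t) - Pt v (l t)) * w (l t))"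
 proof (rule integral_cong_AE)
  show "AE t in II. (trace_on Om a b v (l t) - trace_on Om a b (Pt v) (l t)) * w (l t) = (trace_on Om a b v (l t) - Pt v (l t)) * w (l t)"
   using trace_pws[OF C pws_Pt[of v]] by eventually_elim simp
 qed (intro borel_measurable_times sqint_measurable sqint_diff st v PH sw sqint_l pws_Pt)+
 then show 0: "(LINT t|II. (trace_on Om a b v (l t) - trace_on Om a b (Pt v) (l t)) * w (l t)) = 0"
  using Pt_orthogonal(1)[OF v w] by simp
 show "seg_integral a b (%x. trace_on Om a b (Pt v) x * w x) = seg_integral a b (%x. trace_on Om a b v x * w x)"
  using 0 integral_mult_lin[OF st[OF v] st[OF PH] sw, of 1] by (simp add: seg_integral_eq)
qed

context
 fixes n \<tau> :: plane
 assumes nn: "norm n = 1" and tt: "norm \<tau> = 1" and nt: "n \<bullet> \<tau> = 0"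
begin

abbreviation "Ph \<equiv> fortin_op Om T \<sigma> n \<tau> Pt"

lemma inner_components: "(%y. w y \<bullet> m) = (%y. m $ 1 * w y $ 1 + m $ 2 * w y $ 2)" for m :: plane
 by (auto simp: inner_vec_def UNIV_2_eq mult.commute)

lemma inner_H1_D: "w : H1_D_vec Om \<Gamma>D ==> (%y. w y \<bullet> m) : H1_D Om \<Gamma>D"
 unfolding inner_components by (intro H1_D_lin) (auto simp: H1_D_vec_def)

lemma H1_D_vec_H1: "w : H1_D_vec Om \<Gamma>D ==> (%y. w y $ j) : H1 Om"
 by (auto simp: H1_D_vec_def H1_D_def)

lemma sE_inner:
 assumes "w : H1_D_vec Om \<Gamma>D" "norm m = 1"
 shows "sE (%y. w y \<bullet> m) <= sE (%y. w y $ 1) + sE (%y. w y $ 2)"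
proof -
 have m: "\<bar>m $ j\<bar> <= 1" for j using component_le_norm_cart[of m j] assms(2) by simp
 have "sE (%y. w y \<bullet> m) <= \<bar>m $ 1\<bar> * sE (%y. w y $ 1) + \<bar>m $ 2\<bar> * sE (%y. w y $ 2)"
  unfolding inner_components by (intro sE_lin H1_D_vec_H1 assms)
 also have "... <= 1 * sE (%y. w y $ 1) + 1 * sE (%y. w y $ 2)" by (intro add_mono mult_right_mono m sE_nonneg)
 finally show ?thesis by simp
qed

lemma Ph_component: "Ph w x $ j = n $ j * Pt (%y. w y \<bullet> n) x + \<tau> $ j * sznH \<sigma> (%y. w y \<bullet> \<tau>) x"
 by (simp add: fortin_op_def scott_zhang_eq)

lemma Ph_V_h: "w : H1_D_vec Om \<Gamma>D ==> Ph w : V_h Om \<Gamma>D T"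
proof -
 assume w: "w : H1_D_vec Om \<Gamma>D"
 have "(%x. Ph w x $ j) = (%x. n $ j * Pt (%y. w y \<bullet> n) x + \<tau> $ j * sznH \<sigma> (%y. w y \<bullet> \<tau>) x)" for j
  by (rule ext) (rule Ph_component)
 then show ?thesis
  using Pt_H1D[OF inner_H1_D[OF w, of n]] sznH_H1D[OF inner_H1_D[OF w, of \<tau>]] by (simp add: V_h_def P1_lin H1_D_lin)
qed

lemma Ph_H1: "w : H1_D_vec Om \<Gamma>D ==> (%x. Ph w x $ j) : H1 Om"
 using Ph_V_h by (auto simp: V_h_def H1_D_def)

lemma Ph_error_component:
 "(w x - Ph w x) $ j = n $ j * (w x \<bullet> n - Pt (%y. w y \<bullet> n) x) + \<tau> $ j * (w x \<bullet> \<tau> - sznH \<sigma> (%y. w y \<bullet> \<tau>) x)"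
 using orthonormal_expansion[OF nn tt nt, of "w x" j] by (simp add: Ph_component algebra_simps)

lemma Ph_error_H1: "w : H1_D_vec Om \<Gamma>D ==> (%x. (w x - Ph w x) $ j) : H1 Om"
 using H1_diff(1)[OF H1_D_vec_H1 Ph_H1] by simp

lemma Ph_error:
 assumes w: "w : H1_D_vec Om \<Gamma>D" "w : H1s_vec Om s" and s: "s : {0..1}"
 shows "NA (%x. w x - Ph w x) + h * ND (%x. w x - Ph w x) <= c8 * (h powr (1 + s) * H1s_vec_seminorm Om s w)"
proof -
 let ?S = "sE (%y. w y $ 1) + sE (%y. w y $ 2)"
 have S0: "?S >= 0" using sE_nonneg by (simp add: add_nonneg_nonneg)
 have H: "(%y. w y \<bullet> m) : H1 Om" for m by (rule H1_D_H1[OF inner_H1_D[OF w(1)]])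
 have e: "(%x. w x \<bullet> n - Pt (%y. w y \<bullet> n) x) : H1 Om" "(%x. w x \<bullet> \<tau> - sznH \<sigma> (%y. w y \<bullet> \<tau>) x) : H1 Om"
  by (intro H1_diff(1) H pws_H1(1) pws_Pt pws_szn)+
 have c5h: "c5 * h >= 0" using c_pos(5) h0 by simp
 have "NW h (%x. (w x - Ph w x) $ j) <= (2 + c6) * (c5 * h * ?S)" for j
 proof -
  have m: "\<bar>n $ j\<bar> <= 1" "\<bar>\<tau> $ j\<bar> <= 1" using component_le_norm_cart[of n j] component_le_norm_cart[of \<tau> j] nn tt by auto
  have "NW h (%x. (w x - Ph w x) $ j) <= \<bar>n $ j\<bar> * NW h (%x. w x \<bullet> n - Pt (%y. w y \<bullet> n) x) + \<bar>\<tau> $ j\<bar> * NW h (%x. w x \<bullet> \<tau> - sznH \<sigma> (%y. w y \<bullet> \<tau>) x)"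
   unfolding Ph_error_component using h0 by (intro NW_lin e) simp
  also have "... <= 1 * ((1 + c6) * (c5 * h * sE (%y. w y \<bullet> n))) + 1 * (c5 * h * sE (%y. w y \<bullet> \<tau>))"
   using h0 by (intro add_mono mult_mono m Pt_estimate sznH_estimate H \<sigma>_EP NW_nonneg) auto
  also have "... <= 1 * ((1 + c6) * (c5 * h * ?S)) + 1 * (c5 * h * ?S)"
   using c6_nonneg c5h by (intro add_mono mult_left_mono sE_inner w nn tt) auto
  finally show ?thesis by (simp add: algebra_simps)
 qed
 then have "(SUM j:UNIV. NW h (%x. (w x - Ph w x) $ j)) <= (SUM j:(UNIV::2 set). (2 + c6) * (c5 * h * ?S))" by (intro sum_mono)
 moreover have "(SUM j:UNIV. NW h (%x. (w x - Ph w x) $ j)) = NA (%x. w x - Ph w x) + h * ND (%x. w x - Ph w x)"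
  unfolding NW_def NA_def ND_def by (simp add: sum.distrib sum_distrib_left)
 ultimately have 1: "NA (%x. w x - Ph w x) + h * ND (%x. w x - Ph w x) <= 2 * ((2 + c6) * (c5 * h * ?S))" by simp
 have "sE (%y. w y $ j) <= c7 * h powr s * H1s_vec_seminorm Om s w" for j
 proof -
  have "sE (%y. w y $ j) <= c7 * h powr s * sqrt (SUM i:UNIV. (Hs_seminorm Om s (weak_partial Om i (%x. w x $ j)))^2)"
   using w(2) by (intro sE_Hs s) (simp add: H1s_vec_def)
  also have "... <= c7 * h powr s * H1s_vec_seminorm Om s w"
   unfolding H1s_vec_seminorm_def using c7(1)
   by (intro mult_left_mono real_sqrt_le_mono member_le_sum[of j UNIV "%j. SUM i:UNIV. (Hs_seminorm Om s (weak_partial Om i (%x. w x $ j)))^2"])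
    (auto intro!: sum_nonneg)
  finally show ?thesis .
 qed
 from add_mono[OF this[of 1] this[of 2]] have "?S <= 2 * (c7 * h powr s * H1s_vec_seminorm Om s w)" by simp
 then have "2 * ((2 + c6) * (c5 * h * ?S)) <= 2 * ((2 + c6) * (c5 * h * (2 * (c7 * h powr s * H1s_vec_seminorm Om s w))))"
  using c6_nonneg c5h by (intro mult_left_mono) auto
 also have "... = c8 * (h powr (1 + s) * H1s_vec_seminorm Om s w)" using h0 by (simp add: c8_def powr_add mult_ac)
 finally show ?thesis using 1 by linarith
qed

text \<open>For s = 0 the right-hand side of the error estimate becomes h times the norm of the
  Jacobian, the form from which stability follows.\<close>

lemma H1s_vec_0:
 assumes "w : H1_D_vec Om \<Gamma>D"
 shows "w : H1s_vec Om 0" "H1s_vec_seminorm Om 0 w = L2_norm Om (weak_jacobian Om w)"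
 using H1_D_vec_H1[OF assms] H1D(2)[OF H1_D_vec_H1[OF assms]]
 by (simp_all add: H1s_vec_def Hs_def L2_iff H1s_vec_seminorm_def Hs_seminorm_def L2_norm_eq_l2 jacobian_norm)

text \<open>The triangle inequality with the error estimate for s = 0; dividing by h gives the
  gradient bound. The 4 compares the sum over the four entries of the Jacobian with its
  norm.\<close>

lemma Ph_stability:
 assumes w: "w : H1_D_vec Om \<Gamma>D"
 shows "L2_norm Om (Ph w) <= (4 + c8) * (L2_norm Om w + h * L2_norm Om (weak_jacobian Om w))"
  and "L2_norm Om (weak_jacobian Om (Ph w)) <= (4 + c8) * L2_norm Om (weak_jacobian Om w)"
proof -
 let ?e = "%x. w x - Ph w x" and ?J = "L2_norm Om (weak_jacobian Om w)"
 have E: "NA ?e + h * ND ?e <= c8 * (h * ?J)" using Ph_error[OF w H1s_vec_0(1)[OF w]] H1s_vec_0(2)[OF w] h0 by simp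
 have nn: "NA u >= 0" "ND u >= 0" for u unfolding NA_def ND_def by (intro sum_nonneg l2_nonneg)+
 have hD: "h * ND ?e >= 0" using nn h0 by simp
 have J0: "?J >= 0" "L2_norm Om w >= 0" by (simp_all add: L2_norm_def)
 have c: "(%x. Ph w x $ j) = (%x. 1 * w x $ j + (-1) * ?e x $ j)" for j by simp
 note H = H1_D_vec_H1[OF w] Ph_error_H1[OF w]
 have "l2 MOm (%x. Ph w x $ j) <= l2 MOm (%x. w x $ j) + l2 MOm (%x. ?e x $ j)" for j
  using l2_lin(2)[OF H(1)[of j] H(2)[of j], of 1 "-1"] unfolding c[symmetric] by (simp only: abs_minus_cancel abs_one mult_1)
 then have "NA (Ph w) <= NA w + NA ?e" unfolding NA_def sum.distrib[symmetric] by (intro sum_mono)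
 then have "L2_norm Om (Ph w) <= 2 * L2_norm Om w + NA ?e"
  using NA_bounds(1)[OF Ph_H1[OF w]] NA_bounds(2)[OF H(1)] by linarith
 also have "NA ?e <= c8 * (h * ?J)" using E hD by linarith
 also have "2 * L2_norm Om w + c8 * (h * ?J) <= (4 + c8) * (L2_norm Om w + h * ?J)"
  using J0 h0 c8_nonneg by (simp add: algebra_simps)
 finally show "L2_norm Om (Ph w) <= (4 + c8) * (L2_norm Om w + h * ?J)" by simp
 have "l2 MOm (weak_partial Om i (%x. Ph w x $ j)) <= l2 MOm (weak_partial Om i (%x. w x $ j)) + l2 MOm (weak_partial Om i (%x. ?e x $ j))" for i j
  using l2_lin(4)[OF H(1)[of j] H(2)[of j], of i 1 "-1"] unfolding c[symmetric] by (simp only: abs_minus_cancel abs_one mult_1)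
 then have "ND (Ph w) <= ND w + ND ?e" unfolding ND_def sum.distrib[symmetric] by (intro sum_mono)
 then have "L2_norm Om (weak_jacobian Om (Ph w)) <= 4 * ?J + ND ?e"
  using ND_bounds(1)[OF Ph_H1[OF w]] ND_bounds(2)[OF H(1)] by linarith
 also have "ND ?e <= c8 * ?J"
 proof -
  have "h * ND ?e <= h * (c8 * ?J)" using E nn(1)[of ?e] by (simp add: mult_ac)
  then show ?thesis using h0 by simp
 qed
 finally show "L2_norm Om (weak_jacobian Om (Ph w)) <= (4 + c8) * ?J" by (simp add: algebra_simps)
qed

text \<open>The inner product with n removes the tangential summand and leaves the scalar error of
  \<open>Pt\<close> for the normal component.\<close>

lemma Ph_fortin:
 assumes v: "v : H1_D_vec Om \<Gamma>D" and w: "w : W_h a b T"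
 shows "seg_integral a b (%x. trace_on Om a b (%y. (v y - Ph v y) \<bullet> n) x * w x) = 0"
proof -
 let ?v = "%y. v y \<bullet> n"
 obtain C where C: "tr_ok a b C" by (rule ab_tr)
 have H: "?v : H1 Om" "Pt ?v : H1 Om" by (intro H1_D_H1[OF inner_H1_D[OF v]] pws_H1(1)[OF pws_Pt])+
 have e: "(%y. (v y - Ph v y) \<bullet> n) = (%y. 1 * ?v y + (-1) * Pt ?v y)"
  using nn nt by (auto simp: fortin_op_def inner_diff_left inner_add_left inner_commute[of \<tau>] norm_eq_1)
 note sw = Pt_orthogonal(2)[OF H(1) w]
 have "(LINT t|II. trace_on Om a b (%y. 1 * ?v y + (-1) * Pt ?v y) (l t) * w (l t)) =
  (LINT t|II. (trace_on Om a b ?v (l t) - trace_on Om a b (Pt ?v) (l t)) * w (l t))"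
 proof (rule integral_cong_AE)
  show "AE t in II. trace_on Om a b (%y. 1 * ?v y + (-1) * Pt ?v y) (l t) * w (l t) =
   (trace_on Om a b ?v (l t) - trace_on Om a b (Pt ?v) (l t)) * w (l t)"
   using trace_lin[OF C H, of 1 "-1"] by eventually_elim simp
 qed (intro borel_measurable_times sqint_measurable sqint_diff trace_close(1)[OF C] H sw l2_lin(1))+
 then show ?thesis unfolding e seg_integral_eq using fortin_scalar(1)[OF H(1) w] by simp
qed

end

end

section \<open>From regular mesh families to uniform constants\<close>

lemma diameter_pos:
 fixes K :: "plane set" assumes "2 simplex K" shows "diameter K > 0"
proof -
 obtain x where x: "x : interior K" using two_simplex_facts(4)[OF assms] by blast
 then obtain e where e: "e > 0" "cball x e <= K" by (auto simp: mem_interior_cball)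
 have "x : K" "x + e *\<^sub>R axis 1 1 : K" using e by (auto simp: dist_norm subset_iff)
 then have "dist x (x + e *\<^sub>R axis 1 1) <= diameter K"
  by (intro diameter_bounded_bound compact_imp_bounded two_simplex_facts(1)[OF assms])
 then show ?thesis using e(1) by (simp add: dist_norm)
qed

text \<open>Quasi-uniformity and shape regularity chain to: mesh size at most q \<kappa> times the
  inradius. The inradius is a supremum, so a disc is guaranteed only for radii strictly below it,
  hence the factor 2; the absolute value and the summand 1 keep the denominator positive for all q
  and \<kappa>.\<close>

lemma regular_mesh:
 assumes "conforming_mesh Om \<Gamma>D \<Gamma>T T" "Om ~= {}"
  and \<kappa>: "ALL K:T. diameter K <= \<kappa> * inradius K" and q: "ALL K:T. mesh_size T <= q * diameter K"
 shows "mesh_size T > 0" "K : T ==> x : K ==> y : K ==> dist x y <= mesh_size T"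
  "K : T ==> EX x. cball x (1 / (2 * (\<bar>q * \<kappa>\<bar> + 1)) * mesh_size T) <= K"
proof -
 have fT: "finite T" and s2: "!!K. K : T ==> 2 simplex K" and cov: "\<Union>T = closure Om"
  using assms(1) by (auto simp: conforming_mesh_def triangulation_def)
 have le: "diameter K <= mesh_size T" if "K : T" for K unfolding mesh_size_def using fT that by (intro Max_ge) auto
 obtain K0 where "K0 : T" using cov assms(2) closure_subset[of Om] by blast
 then show h: "mesh_size T > 0" using le[of K0] diameter_pos[OF s2] by fastforce
 show "dist x y <= mesh_size T" if "K : T" "x : K" "y : K"
  using diameter_bounded_bound[OF compact_imp_bounded[OF two_simplex_facts(1)[OF s2[OF that(1)]]] that(2,3)] le[OF that(1)] by linarith
 show "EX x. cball x (1 / (2 * (\<bar>q * \<kappa>\<bar> + 1)) * mesh_size T) <= K" if K: "K : T"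
 proof -
  define i where "i = inradius K"
  have d: "diameter K > 0" by (rule diameter_pos[OF s2[OF K]])
  have k: "diameter K <= \<kappa> * i" using \<kappa> K by (simp add: i_def)
  have q0: "q > 0" using q K h d by (smt (verit) mult_nonpos_nonneg)
  have "q * diameter K <= q * (\<kappa> * i)" using k q0 by (intro mult_left_mono) auto
  then have A: "mesh_size T <= q * \<kappa> * i" using bspec[OF q K] by (simp add: mult.assoc)
  define S where "S = {r. 0 <= r & (EX x. cball x r <= K)}"
  have bS: "r <= mesh_size T" if rS: "r : S" for r
  proof -
   obtain x where x: "cball x r <= K" "0 <= r" using rS by (auto simp: S_def)
   have "x : cball x r" "x + r *\<^sub>R axis 1 1 : cball x r" using x(2) by (auto simp: dist_norm)
   then have "x : K" "x + r *\<^sub>R axis 1 1 : K" using x(1) by blast+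
   from diameter_bounded_bound[OF compact_imp_bounded[OF two_simplex_facts(1)[OF s2[OF K]]] this]
   show ?thesis using le[OF K] x(2) by (simp add: dist_norm)
  qed
  obtain x0 where "x0 : K" using two_simplex_facts(4)[OF s2[OF K]] interior_subset by blast
  then have S0: "0 : S" by (auto simp: S_def)
  have i0: "i >= 0" unfolding i_def inradius_def S_def[symmetric] by (rule cSup_upper[OF S0]) (use bS in \<open>auto simp: bdd_above_def\<close>)
  have "q * \<kappa> * i <= \<bar>q * \<kappa>\<bar> * i" using i0 by (intro mult_right_mono) auto
  then have B: "mesh_size T <= \<bar>q * \<kappa>\<bar> * i" using A by linarith
  then have ip: "i > 0" using h i0 by (cases "i = 0") auto
  have "mesh_size T < 2 * (\<bar>q * \<kappa>\<bar> + 1) * i"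
  proof -
   have "2 * (\<bar>q * \<kappa>\<bar> + 1) * i = \<bar>q * \<kappa>\<bar> * i + (\<bar>q * \<kappa>\<bar> * i + 2 * i)" by (simp add: algebra_simps)
   moreover have "\<bar>q * \<kappa>\<bar> * i >= 0" using ip by simp
   ultimately show ?thesis using B ip by linarith
  qed
  then have "1 / (2 * (\<bar>q * \<kappa>\<bar> + 1)) * mesh_size T < Sup S"
   unfolding i_def inradius_def S_def[symmetric] by (simp add: pos_divide_less_eq mult.commute)
  then obtain r where "r : S" "1 / (2 * (\<bar>q * \<kappa>\<bar> + 1)) * mesh_size T < r" using less_cSupD S0 by blast
  then obtain x where "cball x r <= K" "1 / (2 * (\<bar>q * \<kappa>\<bar> + 1)) * mesh_size T < r" by (auto simp: S_def)
  then show ?thesis using subset_cball[of "1 / (2 * (\<bar>q * \<kappa>\<bar> + 1)) * mesh_size T" r x] by (meson less_imp_le order_trans)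
 qed
qed

theorem lemma5p1:
  fixes \<Omega> \<Gamma>D \<Gamma>T :: "(real^2) set" and a b n \<tau> :: "real^2"
    and \<M> :: "(real^2) set set set"
  assumes "polygonal_domain \<Omega>"
    and "frontier \<Omega> = closure (\<Gamma>D \<union> \<Gamma>T)"
    and "\<Gamma>D \<inter> \<Gamma>T = {}"
    and "openin (top_of_set (frontier \<Omega>)) \<Gamma>D"
    and "openin (top_of_set (frontier \<Omega>)) \<Gamma>T"
    and "positive_length \<Gamma>D" and "positive_length \<Gamma>T"
    and "a \<noteq> b" and "\<Gamma>T = open_segment a b"
    and "outward_unit_normal \<Omega> a b n"
    and "unit_tangent a b \<tau>"
    and "\<And>T. T \<in> \<M> \<Longrightarrow> conforming_mesh \<Omega> \<Gamma>D \<Gamma>T T"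
    and "shape_regular \<M>"
    and "quasi_uniform \<M>"
  shows "\<exists>c::real. \<forall>T\<in>\<M>. \<forall>\<sigma>. sz_choice \<Omega> \<Gamma>D T \<sigma> \<longrightarrow>
    (\<exists>\<Pi>t :: (real^2 \<Rightarrow> real) \<Rightarrow> real^2 \<Rightarrow> real.
       (\<forall>v\<in>H1_D \<Omega> \<Gamma>D. \<Pi>t v \<in> P1 T \<inter> H1_D \<Omega> \<Gamma>D) \<and>
       (\<forall>v\<in>H1_D \<Omega> \<Gamma>D. \<forall>v'\<in>H1_D \<Omega> \<Gamma>D.
          (AE x in lebesgue_on \<Omega>. v x = v' x) \<longrightarrow> (AE x in lebesgue_on \<Omega>. \<Pi>t v x = \<Pi>t v' x)) \<and>
       (\<forall>v\<in>H1_D \<Omega> \<Gamma>D. \<forall>w\<in>W_h a b T.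
          seg_integral a b (\<lambda>x. trace_on \<Omega> a b (\<Pi>t v) x * w x) =
          seg_integral a b (\<lambda>x. trace_on \<Omega> a b v x * w x)) \<and>
       (let \<Pi>h = fortin_op \<Omega> T \<sigma> n \<tau> \<Pi>t; h = mesh_size T in
          (\<forall>v\<in>H1_D_vec \<Omega> \<Gamma>D. \<Pi>h v \<in> V_h \<Omega> \<Gamma>D T) \<and>
          (\<forall>v\<in>H1_D_vec \<Omega> \<Gamma>D. \<forall>w\<in>W_h a b T.
             seg_integral a b (\<lambda>x. trace_on \<Omega> a b (\<lambda>y. (v y - \<Pi>h v y) \<bullet> n) x * w x) = 0) \<and>
          (\<forall>v\<in>H1_D_vec \<Omega> \<Gamma>D.
             L2_norm \<Omega> (\<Pi>h v) \<le> c * (L2_norm \<Omega> v + h * L2_norm \<Omega> (weak_jacobian \<Omega> v)) \<and>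
             L2_norm \<Omega> (weak_jacobian \<Omega> (\<Pi>h v)) \<le> c * L2_norm \<Omega> (weak_jacobian \<Omega> v)) \<and>
          (\<forall>s\<in>{0..1}. \<forall>w\<in>H1s_vec \<Omega> s \<inter> H1_D_vec \<Omega> \<Gamma>D.
             L2_norm \<Omega> (\<lambda>x. w x - \<Pi>h w x) + h * L2_norm \<Omega> (weak_jacobian \<Omega> (\<lambda>x. w x - \<Pi>h w x))
               \<le> c * (h powr (1 + s) * H1s_vec_seminorm \<Omega> s w))))"
proof -
 obtain \<kappa> where \<kappa>: "ALL T:\<M>. ALL K:T. diameter K <= \<kappa> * inradius K" using assms(13) by (auto simp: shape_regular_def)
 obtain q where q: "ALL T:\<M>. ALL K:T. mesh_size T <= q * diameter K" using assms(14) by (auto simp: quasi_uniform_def)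
 define \<gamma> where "\<gamma> = 1 / (2 * (\<bar>q * \<kappa>\<bar> + 1))"
 have dom: "open \<Omega>" "bounded \<Omega>" "\<Omega> ~= {}" "lipschitz_boundary \<Omega>" using assms(1) by (auto simp: polygonal_domain_def)
 have n: "norm n = 1" "n \<bullet> (b - a) = 0" using assms(10) by (auto simp: outward_unit_normal_def)
 obtain k where \<tau>: "norm \<tau> = 1" "b - a = k *\<^sub>R \<tau>" using assms(11) by (auto simp: unit_tangent_def)
 have n\<tau>: "n \<bullet> \<tau> = 0" using n(2) \<tau>(2) assms(8) by auto
 \<comment> \<open>\<open>rmesh.c8 \<gamma>\<close> does not mention the mesh, so the witness can be
   given before \<open>T\<close> and \<open>\<sigma>\<close> are fixed; the summand 4 comes from the
   stability bound.\<close>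
 show ?thesis
 proof (intro exI[of _ "4 + rmesh.c8 \<gamma>"] ballI allI impI)
  fix T \<sigma> assume T: "T : \<M>" and \<sigma>: "sz_choice \<Omega> \<Gamma>D T \<sigma>"
  note cm = assms(12)[OF T]
  note reg = regular_mesh[OF cm dom(3) bspec[OF \<kappa> T] bspec[OF q T], folded \<gamma>_def]
  interpret fmesh \<Omega> T "mesh_size T" \<gamma> \<Gamma>D \<Gamma>T a b \<sigma>
  proof unfold_locales
   show "\<gamma> > 0" by (simp add: \<gamma>_def add_nonneg_pos)
   show "triangulation T" "K : T ==> 2 simplex K" "\<Union>T = closure \<Omega>" for K using cm by (auto simp: conforming_mesh_def)
   show "rel_interior E <= \<Gamma>D | rel_interior E <= \<Gamma>T" if "E : mesh_edges T" "E <= frontier \<Omega>" for E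
    using cm that by (auto simp: conforming_mesh_def)
  qed (use dom reg assms \<sigma> in blast)+
  note on = n(1) \<tau>(1) n\<tau>
  have err: "L2_norm \<Omega> (%x. w x - Ph n \<tau> w x) + mesh_size T * L2_norm \<Omega> (weak_jacobian \<Omega> (%x. w x - Ph n \<tau> w x))
    <= (4 + c8) * (mesh_size T powr (1 + s) * H1s_vec_seminorm \<Omega> s w)"
   if w: "w : H1s_vec \<Omega> s" "w : H1_D_vec \<Omega> \<Gamma>D" and s: "s : {0..1}" for s w
  proof -
   have "L2_norm \<Omega> (%x. w x - Ph n \<tau> w x) + mesh_size T * L2_norm \<Omega> (weak_jacobian \<Omega> (%x. w x - Ph n \<tau> w x))
    <= NA (%x. w x - Ph n \<tau> w x) + mesh_size T * ND (%x. w x - Ph n \<tau> w x)"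
    using h0 by (intro add_mono mult_left_mono NA_bounds(1) ND_bounds(1) Ph_error_H1[OF on w(2)]) auto
   also have "... <= c8 * (mesh_size T powr (1 + s) * H1s_vec_seminorm \<Omega> s w)" by (rule Ph_error[OF on w(2,1) s])
   also have "... <= (4 + c8) * (mesh_size T powr (1 + s) * H1s_vec_seminorm \<Omega> s w)"
    by (intro mult_right_mono) (auto simp: H1s_vec_seminorm_def sum_nonneg)
   finally show ?thesis .
  qed
  show "EX \<Pi>t. (ALL v:H1_D \<Omega> \<Gamma>D. \<Pi>t v : P1 T \<inter> H1_D \<Omega> \<Gamma>D) &
   (ALL v:H1_D \<Omega> \<Gamma>D. ALL v':H1_D \<Omega> \<Gamma>D.
     (AE x in lebesgue_on \<Omega>. v x = v' x) --> (AE x in lebesgue_on \<Omega>. \<Pi>t v x = \<Pi>t v' x)) &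
   (ALL v:H1_D \<Omega> \<Gamma>D. ALL w:W_h a b T.
     seg_integral a b (%x. trace_on \<Omega> a b (\<Pi>t v) x * w x) =
     seg_integral a b (%x. trace_on \<Omega> a b v x * w x)) &
   (let \<Pi>h = fortin_op \<Omega> T \<sigma> n \<tau> \<Pi>t; h = mesh_size T in
     (ALL v:H1_D_vec \<Omega> \<Gamma>D. \<Pi>h v : V_h \<Omega> \<Gamma>D T) &
     (ALL v:H1_D_vec \<Omega> \<Gamma>D. ALL w:W_h a b T.
      seg_integral a b (%x. trace_on \<Omega> a b (%y. (v y - \<Pi>h v y) \<bullet> n) x * w x) = 0) &
     (ALL v:H1_D_vec \<Omega> \<Gamma>D.
      L2_norm \<Omega> (\<Pi>h v) <= (4 + c8) * (L2_norm \<Omega> v + h * L2_norm \<Omega> (weak_jacobian \<Omega> v)) &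
      L2_norm \<Omega> (weak_jacobian \<Omega> (\<Pi>h v)) <= (4 + c8) * L2_norm \<Omega> (weak_jacobian \<Omega> v)) &
     (ALL s:{0..1}. ALL w:H1s_vec \<Omega> s \<inter> H1_D_vec \<Omega> \<Gamma>D.
      L2_norm \<Omega> (%x. w x - \<Pi>h w x) + h * L2_norm \<Omega> (weak_jacobian \<Omega> (%x. w x - \<Pi>h w x))
       <= (4 + c8) * (h powr (1 + s) * H1s_vec_seminorm \<Omega> s w)))"
   unfolding Let_def
  proof (intro exI[of _ Pt] conjI ballI impI)
   show "AE x in lebesgue_on \<Omega>. Pt v x = Pt v' x"
    if "v : H1_D \<Omega> \<Gamma>D" "v' : H1_D \<Omega> \<Gamma>D" "AE x in lebesgue_on \<Omega>. v x = v' x" for v v'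
    using Pt_AE[OF H1_D_H1[OF that(1)] H1_D_H1[OF that(2)] that(3)] by simp
  qed (rule Pt_H1D fortin_scalar(2) H1_D_H1 Ph_V_h[OF on] Ph_fortin[OF on] Ph_stability[OF on] err | assumption | elim IntE)+
 qed
qed

end
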